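(* Let $\Gamma$ be a finitely generated non-amenable group. Then there exist $n\in\mathbb{N}$ and real numbers $0\le p_1<p_2\le 1$ such that for every $p\in(p_1,p_2)$ there is a measure-preserving, ergodic, essentially free action of $\mathbf{F}_2$ on the product space $\prod_{1}^{n}(\{0,1\}^{\Gamma},\mu_p)$ such that almost every orbit of the diagonal Bernoulli shift action of $\Gamma$ on this space decomposes into $\mathbf{F}_2$-orbits (i.e., for almost every $x$, the $\mathbf{F}_2$-orbit of $x$ is contained in the $\Gamma$-orbit of $x$).
   Context: For a finite or countable set $M$ and $p\in[0,1]$, $\mu_p$ denotes the product over $M$ of the measures $(1-p)\delta_{0}+p\delta_{1}$ on $\{0,1\}^M$. The Bernoulli shift of $\Gamma$ on $\{0,1\}^{\Gamma}$ is $(\gamma\cdot x)(g)=x(\gamma^{-1}g)$; the diagonal action on $\prod_1^n\{0,1\}^{\Gamma}$ applies it in each factor, and preserves $\mu_p^{\otimes n}$. An action is essentially free if almost every point has trivial stabilizer. *)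

theory Defs
  imports "HOL-Probability.Probability"
begin

section \<open>Groups (written additively, via the type class group_add; not assumed commutative)\<close>

definition finitely_generated_group :: "'g::group_add itself \<Rightarrow> bool" where
  "finitely_generated_group _ \<longleftrightarrow>
     (\<exists>S::'g set. finite S \<and>
        (\<forall>H. 0 \<in> H \<and> S \<subseteq> H \<and> (\<forall>a\<in>H. \<forall>b\<in>H. a + b \<in> H) \<and> (\<forall>a\<in>H. - a \<in> H)
              \<longrightarrow> H = UNIV))"

definition amenable_group :: "'g::group_add itself \<Rightarrow> bool" where
  "amenable_group _ \<longleftrightarrow>
     (\<exists>m :: 'g set \<Rightarrow> real.
        m UNIV = 1 \<and> (\<forall>A. 0 \<le> m A) \<and>
        (\<forall>A B. A \<inter> B = {} \<longrightarrow> m (A \<union> B) = m A + m B) \<and>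
        (\<forall>g A. m ((\<lambda>x. g + x) ` A) = m A))"

text \<open>$\{0,1\}$ is represented by bool (True = 1).\<close>
definition bern :: "real \<Rightarrow> bool measure" where
  "bern p = measure_pmf (bernoulli_pmf p)"

definition bernoulli_space :: "real \<Rightarrow> 'g set \<Rightarrow> ('g \<Rightarrow> bool) measure" where
  "bernoulli_space p G = PiM G (\<lambda>_. bern p)"

definition prod_bernoulli :: "nat \<Rightarrow> real \<Rightarrow> (nat \<Rightarrow> 'g \<Rightarrow> bool) measure" where
  "prod_bernoulli n p = PiM {..<n} (\<lambda>_. bernoulli_space p (UNIV :: 'g set))"

definition diag_shift :: "nat \<Rightarrow> 'g::group_add \<Rightarrow> (nat \<Rightarrow> 'g \<Rightarrow> bool) \<Rightarrow> (nat \<Rightarrow> 'g \<Rightarrow> bool)" where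
  "diag_shift n \<gamma> x = restrict (\<lambda>k g. x k (- \<gamma> + g)) {..<n}"

text \<open>Elements of F_2 are reduced words in the letters $a^{\pm1}, b^{\pm1}$;
  a letter is (generator, is_inverse), the generators being False (= a) and True (= b).\<close>
type_synonym f2_word = "(bool \<times> bool) list"

definition reduced_word :: "f2_word \<Rightarrow> bool" where
  "reduced_word w \<longleftrightarrow>
     (\<forall>i. Suc i < length w \<longrightarrow> \<not> (fst (w!i) = fst (w!Suc i) \<and> snd (w!i) \<noteq> snd (w!Suc i)))"

text \<open>An F_2 action on X is given by the images T False, T True of the two generators
  (bijections of X); letters act by T i or its inverse; a word acts as the composition.\<close>
definition letter_act :: "'x set \<Rightarrow> (bool \<Rightarrow> 'x \<Rightarrow> 'x) \<Rightarrow> bool \<times> bool \<Rightarrow> 'x \<Rightarrow> 'x" where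
  "letter_act X T l = (if snd l then inv_into X (T (fst l)) else T (fst l))"

definition word_act :: "'x set \<Rightarrow> (bool \<Rightarrow> 'x \<Rightarrow> 'x) \<Rightarrow> f2_word \<Rightarrow> 'x \<Rightarrow> 'x" where
  "word_act X T w = foldr (\<lambda>l f. letter_act X T l \<circ> f) w id"

definition mp_F2_action :: "'x measure \<Rightarrow> (bool \<Rightarrow> 'x \<Rightarrow> 'x) \<Rightarrow> bool" where
  "mp_F2_action M T \<longleftrightarrow>
     (\<forall>i. bij_betw (T i) (space M) (space M) \<and>
          T i \<in> M \<rightarrow>\<^sub>M M \<and> inv_into (space M) (T i) \<in> M \<rightarrow>\<^sub>M M \<and>
          distr M M (T i) = M)"

definition ergodic_F2_action :: "'x measure \<Rightarrow> (bool \<Rightarrow> 'x \<Rightarrow> 'x) \<Rightarrow> bool" where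
  "ergodic_F2_action M T \<longleftrightarrow>
     (\<forall>A \<in> sets M. (\<forall>i. T i -` A \<inter> space M = A) \<longrightarrow> measure M A = 0 \<or> measure M A = 1)"

definition ess_free_F2_action :: "'x measure \<Rightarrow> (bool \<Rightarrow> 'x \<Rightarrow> 'x) \<Rightarrow> bool" where
  "ess_free_F2_action M T \<longleftrightarrow>
     (AE x in M. \<forall>w. reduced_word w \<and> w \<noteq> [] \<longrightarrow> word_act (space M) T w x \<noteq> x)"

end

theory Submission
  imports Defs
begin

text \<open>
  Random walks contract on a non-amenable group, so convolution powers yield a Cayley multigraph with so
  large a spectral gap that, in percolation with parameter \<open>p\<close>, an edge rarely has its endpoints joined by
  an open path avoiding it, although the mean open degree is large. The \<open>n\<close> factors of a configuration
  are the open edges for \<open>n\<close> generators, split into three groups \<open>I1\<close>, \<open>I2\<close>, \<open>I3\<close>.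

  Most open edges of \<open>I1\<close> are bridges, and a finite cluster has at most as many bridges as vertices, so
  mass transport leaves a positive density of vertices in infinite \<open>I1\<close>-clusters. Edges of \<open>I2\<close> connect
  any two group elements and glue the infinite clusters into an ergodic equivalence relation \<open>R\<close>: an event
  which is invariant along infinite clusters is determined by the coordinates in \<open>I1\<close>, of which the
  coordinates in \<open>I2\<close> are independent. The open edges of \<open>I3\<close> which are bridges of the whole open graph and
  join vertices in infinite clusters have total measure at least one, and they form a treeing over \<open>R\<close>.

  By ergodicity the full group of \<open>R\<close> contains an ergodic transformation \<open>a\<close> (a dyadic odometer), and the
  \<open>I3\<close>-bridges can be assembled, up to elements of the full groupoid of \<open>R\<close>, into one automorphism \<open>b\<close>
  each of whose steps crosses one bridge. A reduced word in \<open>a\<close> and \<open>b\<close> follows a path without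
  backtracking over bridges, so it fixes almost no point.
\<close>

section \<open>Random walk contraction in non-amenable groups\<close>

text \<open>The obstacle is to obtain infinite clusters, one ergodic relation and bridges that are
  free over it from the same random graph; a single percolation would raise the question whether
  invariant events can tell infinite clusters apart. With split labels each task meets fresh
  randomness: an invariant event read off \<open>I1\<close> is tested by untouched
  \<open>I2\<close>-edges, and the state of an \<open>I3\<close>-edge is independent of all that
  decides whether its ends are joined without it.

  All labels, however, count towards the walk operator, so its norm must stay small compared with
  \<open>N * N\<close>, the number of labels in \<open>I1\<close>. Labels of the form
  \<open>- v a + v b\<close> serve two ends: their operator is a product of two contracted ones, and
  summing over \<open>a\<close> and \<open>b\<close> gives a second moment, bounded below by the
  squared density of infinite clusters however these are correlated. The density is at least 1/20
  and \<open>p * (N * N)\<close> at least 3, so 1000 copies yield 1000 * 3 / 400 = 7.5 expected open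
  \<open>I3\<close>-edges between infinite clusters, and non-bridges cost at most 1. The contraction
  1/1000 is chosen to outweigh the 1001 copies.\<close>

definition fsupp :: "('g \<Rightarrow> real) \<Rightarrow> bool" where
  "fsupp f \<longleftrightarrow> finite {h. f h \<noteq> 0}"

text \<open>The l2 norm, taken over the support so that only finite sums occur. Finitely supported
  functions suffice, because walks are counted length by length.\<close>

definition nrm :: "('g \<Rightarrow> real) \<Rightarrow> real" where
  "nrm f = L2_set f {h. f h \<noteq> 0}"

text \<open>The left regular representation.\<close>

definition lam :: "'g::group_add \<Rightarrow> ('g \<Rightarrow> real) \<Rightarrow> 'g \<Rightarrow> real" where
  "lam g f = (\<lambda>h. f (- g + h))"

lemma nrm_eq: "finite F \<Longrightarrow> {h. f h \<noteq> 0} \<subseteq> F \<Longrightarrow> nrm f = L2_set f F"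
  unfolding nrm_def L2_set_def
  by (intro arg_cong[where f = sqrt] sum.mono_neutral_left) auto

lemma nrm_nonneg [simp]: "0 \<le> nrm f"
  by (simp add: nrm_def)

lemma nrm_sq: "finite F \<Longrightarrow> {h. f h \<noteq> 0} \<subseteq> F \<Longrightarrow> (nrm f)\<^sup>2 = (\<Sum>h\<in>F. (f h)\<^sup>2)"
  by (simp add: nrm_eq L2_set_def sum_nonneg)

lemma nrm_uminus: "nrm (\<lambda>h. - f h) = nrm f"
  by (simp add: nrm_def L2_set_def)

lemma abs_le_nrm: "fsupp f \<Longrightarrow> \<bar>f h\<bar> \<le> nrm f"
  using nrm_eq[of "insert h {h. f h \<noteq> 0}" f] member_le_L2_set[of "insert h {h. f h \<noteq> 0}" h "\<lambda>x. \<bar>f x\<bar>"]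
  by (simp add: fsupp_def L2_set_def subset_insertI)

lemma supp_lam: "{h. lam g f h \<noteq> 0} = (\<lambda>h. g + h) ` {h. f h \<noteq> 0}"
proof -
  have "h = g + (- g + h)" for h by (simp add: add.assoc[symmetric])
  then show ?thesis unfolding lam_def by (auto simp: add.assoc[symmetric] intro: rev_image_eqI)
qed

lemma fsupp_lam [simp]: "fsupp f \<Longrightarrow> fsupp (lam g f)"
  by (simp add: fsupp_def supp_lam)

lemma fsupp_add [simp]: "fsupp f \<Longrightarrow> fsupp f' \<Longrightarrow> fsupp (\<lambda>h. f h + f' h)"
  unfolding fsupp_def by (rule finite_subset[of _ "{h. f h \<noteq> 0} \<union> {h. f' h \<noteq> 0}"]) auto

lemma fsupp_zero [simp]: "fsupp (\<lambda>h. 0)"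
  by (simp add: fsupp_def)

lemma fsupp_sum: "(\<And>i. i \<in> I \<Longrightarrow> fsupp (f i)) \<Longrightarrow> fsupp (\<lambda>h. \<Sum>i\<in>I. f i h)"
  by (induction I rule: infinite_finite_induct) auto

lemma nrm_lam [simp]: "nrm (lam g f) = nrm f"
proof -
  have "(\<Sum>h\<in>{h. lam g f h \<noteq> 0}. (lam g f h)\<^sup>2) = (\<Sum>h\<in>{h. f h \<noteq> 0}. (f h)\<^sup>2)"
    unfolding supp_lam by (subst sum.reindex) (auto simp: inj_on_def lam_def add.assoc[symmetric])
  then show ?thesis by (simp add: nrm_def L2_set_def)
qed

lemma nrm_add: "fsupp f \<Longrightarrow> fsupp f' \<Longrightarrow> nrm (\<lambda>h. f h + f' h) \<le> nrm f + nrm f'"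
proof -
  assume "fsupp f" "fsupp f'"
  define F where "F = {h. f h \<noteq> 0} \<union> {h. f' h \<noteq> 0}"
  have F: "finite F" using \<open>fsupp f\<close> \<open>fsupp f'\<close> by (simp add: F_def fsupp_def)
  have "nrm f = L2_set f F" "nrm f' = L2_set f' F" "nrm (\<lambda>h. f h + f' h) = L2_set (\<lambda>h. f h + f' h) F"
    by (rule nrm_eq[OF F]; auto simp: F_def)+
  then show ?thesis by (simp add: L2_set_triangle_ineq)
qed

lemma nrm_sum: "(\<And>i. i \<in> I \<Longrightarrow> fsupp (f i)) \<Longrightarrow> nrm (\<lambda>h. \<Sum>i\<in>I. f i h) \<le> (\<Sum>i\<in>I. nrm (f i))"
proof (induction I rule: infinite_finite_induct)
  case (insert i I)
  then show ?case using nrm_add[of "f i" "\<lambda>h. \<Sum>i\<in>I. f i h"] fsupp_sum[of I f] by auto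
qed (auto simp: nrm_def)

text \<open>Cauchy-Schwarz with a remainder: measured from \<open>v 0\<close>, one of the
  differences vanishes, so Cauchy-Schwarz costs a factor \<open>k - 1\<close> instead of
  \<open>k\<close>, and the missing multiple is the deficit.\<close>

lemma sum_square_deficit:
  fixes v :: "nat \<Rightarrow> real"
  shows "(\<Sum>i<k. v i)\<^sup>2 \<le> k * (\<Sum>i<k. (v i)\<^sup>2) - (\<Sum>i<k. (v i - v 0)\<^sup>2)"
proof (cases k)
  case (Suc m)
  define u where "u i = v i - v 0" for i
  have u0: "u 0 = 0" by (simp add: u_def)
  have "(\<Sum>i<k. u i) = (\<Sum>i\<in>{1..<k}. u i)" "(\<Sum>i<k. (u i)\<^sup>2) = (\<Sum>i\<in>{1..<k}. (u i)\<^sup>2)"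
    using u0 by (auto intro!: sum.mono_neutral_right) (metis not_less_eq_eq One_nat_def less_Suc0 not_le)+
  moreover have "(\<Sum>i\<in>{1..<k}. u i)\<^sup>2 \<le> (\<Sum>i\<in>{1..<k}. (u i)\<^sup>2) * card {1..<k}"
    by (rule sum_squared_le_sum_of_squares)
  ultimately have "(\<Sum>i<k. u i)\<^sup>2 \<le> m * (\<Sum>i<k. (u i)\<^sup>2)"
    using Suc by (simp add: mult.commute)
  moreover have "(\<Sum>i<k. v i) = (\<Sum>i<k. u i) + k * v 0"
    by (simp add: u_def sum_subtractf)
  moreover have "(\<Sum>i<k. (v i)\<^sup>2) = (\<Sum>i<k. (u i)\<^sup>2) + 2 * v 0 * (\<Sum>i<k. u i) + k * (v 0)\<^sup>2"
  proof -
    have "(v i)\<^sup>2 = (u i)\<^sup>2 + 2 * v 0 * u i + (v 0)\<^sup>2" for i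
      by (simp add: u_def power2_eq_square algebra_simps)
    then have "(\<Sum>i<k. (v i)\<^sup>2) = (\<Sum>i<k. (u i)\<^sup>2 + 2 * v 0 * u i + (v 0)\<^sup>2)"
      by (intro sum.cong refl)
    then show ?thesis by (simp add: sum.distrib sum_distrib_left)
  qed
  moreover have "(A + k * c)\<^sup>2 \<le> k * (Q + 2 * c * A + k * c\<^sup>2) - Q" if "A\<^sup>2 \<le> m * Q" for A Q c :: real
    using that by (simp add: Suc power2_eq_square algebra_simps)
  ultimately show ?thesis
    unfolding u_def[symmetric] by simp
qed simp

text \<open>Tychonoff; an invariant mean will be found in this cube by compactness.\<close>

lemma compact_cube: "compact {m :: 'a \<Rightarrow> real. \<forall>A. 0 \<le> m A \<and> m A \<le> 1}"
proof -
  have "compactin (product_topology (\<lambda>_. euclideanreal) UNIV) (PiE UNIV (\<lambda>_::'a. {0..1::real}))"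
    unfolding compactin_PiE by auto
  moreover have "PiE UNIV (\<lambda>_::'a. {0..1::real}) = {m. \<forall>A. 0 \<le> m A \<and> m A \<le> 1}"
    by (auto simp: PiE_def extensional_def Pi_def)
  ultimately show ?thesis by (simp add: euclidean_product_topology)
qed

text \<open>Reiter's argument by contradiction: almost invariant vectors \<open>f\<close> give
  probability weights proportional to the square of \<open>f\<close>, whose means are almost
  invariant under finitely many translations. Compactness of the cube turns these approximate means
  into an exactly invariant one.\<close>

lemma nonamenable_spectral_gap:
  assumes "\<not> amenable_group TYPE('g::group_add)"
  shows "\<exists>(S::'g set) \<epsilon>. finite S \<and> \<epsilon> > 0 \<and>
    (\<forall>f. fsupp f \<longrightarrow> \<epsilon> * (nrm f)\<^sup>2 \<le> (\<Sum>s\<in>S. (nrm (\<lambda>h. lam s f h - f h))\<^sup>2))"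
proof (rule ccontr)
  assume "\<not> ?thesis"
  then have neg: "\<And>(S::'g set) \<epsilon>. finite S \<Longrightarrow> \<epsilon> > 0 \<Longrightarrow>
     \<exists>f. fsupp f \<and> (\<Sum>s\<in>S. (nrm (\<lambda>h. lam s f h - f h))\<^sup>2) < \<epsilon> * (nrm f)\<^sup>2"
    by (force simp: not_le)
  define K :: "('g set \<Rightarrow> real) set" where "K = {m. \<forall>A. 0 \<le> m A \<and> m A \<le> 1}"
  define K0 where "K0 = {m. m UNIV = 1} \<inter> {m::'g set \<Rightarrow> real. \<forall>A B. A \<inter> B = {} \<longrightarrow> m (A \<union> B) = m A + m B}"
  define C where "C = (\<lambda>(s, \<epsilon>). {m::'g set \<Rightarrow> real. \<forall>A. \<bar>m ((\<lambda>x. s + x) ` A) - m A\<bar> \<le> \<epsilon>})"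
  have cK0: "closed K0" unfolding K0_def
    by (intro closed_Int closed_Collect_all closed_Collect_imp closed_Collect_eq continuous_intros
        continuous_on_product_coordinates) auto
  have cC: "closed (C q)" for q unfolding C_def case_prod_beta
    by (intro closed_Collect_all closed_Collect_le continuous_intros continuous_on_product_coordinates)
  have cKK: "compact (K \<inter> K0)" using compact_cube cK0 unfolding K_def by (rule compact_Int_closed)
  have "(K \<inter> K0) \<inter> \<Inter>(C ` (UNIV \<times> {0<..})) \<noteq> {}"
  proof (rule compact_imp_fip[OF cKK])
    fix F' assume F': "finite F'" "F' \<subseteq> C ` (UNIV \<times> {0<..})"
    then obtain P where P: "finite P" "P \<subseteq> UNIV \<times> {0<..}" "F' = C ` P"
      by (meson finite_subset_image)
    \<comment> \<open>The smallest tolerance serves all constraints at once; the \<open>1\<close>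
      keeps the minimum defined when there are none.\<close>
    define \<epsilon> where "\<epsilon> = Min (insert 1 (snd ` P))"
    have eps: "\<epsilon> > 0" "\<And>s e. (s,e) \<in> P \<Longrightarrow> \<epsilon> \<le> e"
      unfolding \<epsilon>_def using P by (auto simp: Min_gr_iff intro!: Min_le rev_image_eqI)
    \<comment> \<open>Half of \<open>\<epsilon>\<close>, because the difference of squares below
      picks up a factor \<open>f' + f\<close> of norm up to \<open>2 * nrm f\<close>.\<close>
    obtain f where f: "fsupp f" "(\<Sum>s\<in>fst ` P. (nrm (\<lambda>h. lam s f h - f h))\<^sup>2) < (\<epsilon>/2)\<^sup>2 * (nrm f)\<^sup>2"
      using neg[of "fst ` P" "(\<epsilon>/2)\<^sup>2"] P eps by auto
    have n0: "nrm f > 0"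
    proof (rule ccontr)
      assume "\<not> nrm f > 0"
      then have "nrm f = 0" by (simp add: less_le)
      then have "(\<Sum>s\<in>fst ` P. (nrm (\<lambda>h. lam s f h - f h))\<^sup>2) < 0" using f by simp
      then show False by (meson not_le sum_nonneg zero_le_power2)
    qed
    have gap: "nrm (\<lambda>h. lam s f h - f h) \<le> (\<epsilon>/2) * nrm f" if "s \<in> fst ` P" for s
    proof -
      have "(nrm (\<lambda>h. lam s f h - f h))\<^sup>2 \<le> (\<Sum>s\<in>fst ` P. (nrm (\<lambda>h. lam s f h - f h))\<^sup>2)"
        using that P by (intro member_le_sum) auto
      then have "(nrm (\<lambda>h. lam s f h - f h))\<^sup>2 \<le> ((\<epsilon>/2) * nrm f)\<^sup>2"
        using f unfolding power_mult_distrib by linarith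
      then show ?thesis by (rule power2_le_imp_le) (use eps n0 in simp)
    qed
    define F where "F = {h. f h \<noteq> 0}"
    have fF: "finite F" using f by (simp add: F_def fsupp_def)
    define m where "m A = (\<Sum>h\<in>A \<inter> F. (f h)\<^sup>2) / (nrm f)\<^sup>2" for A
    have nsq: "(nrm f)\<^sup>2 = (\<Sum>h\<in>F. (f h)\<^sup>2)" by (rule nrm_sq[OF fF]) (simp add: F_def)
    have "m \<in> K"
    proof -
      have "m A \<le> 1" for A
      proof -
        have "(\<Sum>h\<in>A \<inter> F. (f h)\<^sup>2) \<le> (nrm f)\<^sup>2"
          unfolding nsq by (rule sum_mono2) (use fF in auto)
        then show ?thesis using n0 by (simp add: m_def)
      qed
      moreover have "0 \<le> m A" for A unfolding m_def by (intro divide_nonneg_nonneg sum_nonneg) auto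
      ultimately show ?thesis by (simp add: K_def)
    qed
    moreover have "m \<in> K0"
    proof -
      have "m (A \<union> B) = m A + m B" if "A \<inter> B = {}" for A B
        unfolding m_def add_divide_distrib[symmetric] Int_Un_distrib2
        by (subst sum.union_disjoint) (use fF that in auto)
      moreover have "m UNIV = 1" using n0 by (simp add: m_def nsq[symmetric])
      ultimately show ?thesis by (auto simp: K0_def)
    qed
    moreover have "m \<in> C q" if "q \<in> P" for q
    proof -
      obtain s e where q: "q = (s,e)" by force
      then have s: "s \<in> fst ` P" using that by force
      have "\<bar>m ((\<lambda>x. s + x) ` A) - m A\<bar> \<le> e" for A
      proof -
        \<comment> \<open>The translation is moved from the set to the function: \<open>m\<close> of
          the translate of \<open>A\<close> is the mass of \<open>lam (- s) f\<close> on
          \<open>A\<close>, so both masses become sums over \<open>A \<inter> G\<close>.\<close>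
        define G where "G = F \<union> (\<lambda>h. - s + h) ` F"
        have G: "finite G" using fF by (simp add: G_def)
        define f' where "f' = lam (- s) f"
        have f': "f' h = f (s + h)" for h by (simp add: f'_def lam_def)
        have s1: "(\<Sum>h\<in>A \<inter> F. (f h)\<^sup>2) = (\<Sum>h\<in>A \<inter> G. (f h)\<^sup>2)"
          by (rule sum.mono_neutral_left) (use G in \<open>auto simp: G_def F_def\<close>)
        have "(\<Sum>h\<in>(\<lambda>x. s + x) ` A \<inter> F. (f h)\<^sup>2) = (\<Sum>h\<in>(\<lambda>x. s + x) ` (A \<inter> (\<lambda>h. - s + h) ` F). (f h)\<^sup>2)"
          by (rule sum.cong) (auto simp: add.assoc[symmetric] intro!: rev_image_eqI)
        also have "\<dots> = (\<Sum>h\<in>A \<inter> (\<lambda>h. - s + h) ` F. (f' h)\<^sup>2)"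
          by (subst sum.reindex) (auto simp: f' inj_on_def)
        also have "\<dots> = (\<Sum>h\<in>A \<inter> G. (f' h)\<^sup>2)"
        proof (rule sum.mono_neutral_left)
          show "\<forall>i\<in>A \<inter> G - A \<inter> (\<lambda>h. - s + h) ` F. (f' i)\<^sup>2 = 0"
          proof
            fix i assume i: "i \<in> A \<inter> G - A \<inter> (\<lambda>h. - s + h) ` F"
            have "i = - s + (s + i)" by (simp add: add.assoc[symmetric])
            then have "s + i \<notin> F" using i by (metis DiffD1 DiffD2 IntD1 IntI imageI)
            then show "(f' i)\<^sup>2 = 0" by (simp add: f' F_def)
          qed
        qed (use G in \<open>auto simp: G_def\<close>)
        finally have s2: "(\<Sum>h\<in>(\<lambda>x. s + x) ` A \<inter> F. (f h)\<^sup>2) = (\<Sum>h\<in>A \<inter> G. (f' h)\<^sup>2)" .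
        have sup': "{h. f' h \<noteq> 0} \<subseteq> G"
        proof
          fix i assume "i \<in> {h. f' h \<noteq> 0}"
          then have "s + i \<in> F" by (simp add: f' F_def)
          moreover have "i = - s + (s + i)" by (simp add: add.assoc[symmetric])
          ultimately show "i \<in> G" unfolding G_def by blast
        qed
        have sup: "{h. f h \<noteq> 0} \<subseteq> G" by (auto simp: G_def F_def)
        have "\<bar>(\<Sum>h\<in>A \<inter> G. (f' h)\<^sup>2) - (\<Sum>h\<in>A \<inter> G. (f h)\<^sup>2)\<bar> \<le> (\<Sum>h\<in>A \<inter> G. \<bar>f' h - f h\<bar> * \<bar>f' h + f h\<bar>)"
          unfolding sum_subtractf[symmetric]
          by (rule order_trans[OF sum_abs]) (auto intro!: sum_mono simp: power2_eq_square abs_mult[symmetric] algebra_simps)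
        also have "\<dots> \<le> (\<Sum>h\<in>G. \<bar>f' h - f h\<bar> * \<bar>f' h + f h\<bar>)"
          by (rule sum_mono2) (use G in auto)
        also have "\<dots> \<le> L2_set (\<lambda>h. f' h - f h) G * L2_set (\<lambda>h. f' h + f h) G"
          by (rule L2_set_mult_ineq)
        also have "L2_set (\<lambda>h. f' h - f h) G = nrm (\<lambda>h. f' h - f h)"
        proof (rule nrm_eq[symmetric, OF G], rule subsetI)
          fix h assume "h \<in> {h. f' h - f h \<noteq> 0}"
          then have "h \<in> {h. f' h \<noteq> 0} \<union> {h. f h \<noteq> 0}" by (cases "f h = 0") auto
          then show "h \<in> G" using sup sup' by blast
        qed
        also have "\<dots> = nrm (lam s (\<lambda>h. f' h - f h))" by simp
        also have "\<dots> = nrm (\<lambda>h. lam s f h - f h)"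
        proof -
          have "lam s (\<lambda>h. f' h - f h) = (\<lambda>h. - (lam s f h - f h))"
            by (auto simp: f' lam_def add.assoc[symmetric])
          then show ?thesis by (simp only: nrm_uminus)
        qed
        also have "L2_set (\<lambda>h. f' h + f h) G = nrm (\<lambda>h. f' h + f h)"
        proof (rule nrm_eq[symmetric, OF G], rule subsetI)
          fix h assume "h \<in> {h. f' h + f h \<noteq> 0}"
          then have "h \<in> {h. f' h \<noteq> 0} \<union> {h. f h \<noteq> 0}" by (cases "f h = 0") auto
          then show "h \<in> G" using sup sup' by blast
        qed
        also have "nrm (\<lambda>h. lam s f h - f h) * nrm (\<lambda>h. f' h + f h) \<le> ((\<epsilon>/2) * nrm f) * (2 * nrm f)"
        proof (rule mult_mono)
          have "nrm (\<lambda>h. f' h + f h) \<le> nrm f' + nrm f" by (rule nrm_add) (use f in \<open>auto simp: f'_def\<close>)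
          then show "nrm (\<lambda>h. f' h + f h) \<le> 2 * nrm f" by (simp add: f'_def)
        qed (use gap s n0 eps in auto)
        finally have "\<bar>(\<Sum>h\<in>A \<inter> G. (f' h)\<^sup>2) - (\<Sum>h\<in>A \<inter> G. (f h)\<^sup>2)\<bar> \<le> \<epsilon> * (nrm f)\<^sup>2"
          by (simp add: power2_eq_square)
        then have "\<bar>m ((\<lambda>x. s + x) ` A) - m A\<bar> \<le> \<epsilon>"
          unfolding m_def s1 s2 using n0
          by (simp add: diff_divide_distrib[symmetric] abs_divide divide_le_eq)
        also have "\<epsilon> \<le> e" using eps q that by simp
        finally show ?thesis .
      qed
      then show ?thesis by (simp add: C_def q)
    qed
    ultimately show "(K \<inter> K0) \<inter> \<Inter>F' \<noteq> {}" using P by blast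
  qed (use cC in auto)
  then obtain m where m: "m \<in> K" "m \<in> K0" "\<And>s \<epsilon>. \<epsilon> > 0 \<Longrightarrow> m \<in> C (s, \<epsilon>)" by auto
  have "m ((\<lambda>x. g + x) ` A) = m A" for g A
  proof -
    have "\<bar>m ((\<lambda>x. g + x) ` A) - m A\<bar> \<le> 0"
      by (rule field_le_epsilon) (use m(3) in \<open>auto simp: C_def\<close>)
    then show ?thesis by simp
  qed
  then have "amenable_group TYPE('g)"
    unfolding amenable_group_def using m by (intro exI[of _ m]) (auto simp: K_def K0_def)
  then show False using assms by simp
qed

section \<open>Powers of the walk operator and the choice of labels\<close>

fun word_val :: "(nat \<Rightarrow> 'g::group_add) \<Rightarrow> (nat \<times> bool) list \<Rightarrow> 'g" where
  "word_val s [] = 0"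
| "word_val s ((i, d) # l) = (if d then s i else - s i) + word_val s l"

text \<open>\<open>sum_square_deficit\<close> at every point \<open>h\<close>, summed. The identity
  at index \<open>0\<close> makes \<open>f h\<close> the reference value, so the deficit is the
  displacement of \<open>f\<close> under the generators.\<close>

lemma nrm_square_sum_lam:
  fixes g :: "nat \<Rightarrow> 'g::group_add"
  assumes f: "fsupp f" and g0: "g 0 = 0"
  shows "(nrm (\<lambda>h. \<Sum>i<k. lam (g i) f h))\<^sup>2 \<le>
    (real k)\<^sup>2 * (nrm f)\<^sup>2 - (\<Sum>i<k. (nrm (\<lambda>h. lam (g i) f h - f h))\<^sup>2)"
proof -
  define F where "F = {h. f h \<noteq> 0} \<union> (\<Union>i<k. {h. lam (g i) f h \<noteq> 0})"
  have "finite {h. lam (g i) f h \<noteq> 0}" for i using fsupp_lam[OF f] by (simp add: fsupp_def)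
  then have F: "finite F" using f by (simp add: F_def fsupp_def)
  have lam0: "lam (g 0) f = f" by (simp add: g0 lam_def)
  have "(nrm (\<lambda>h. \<Sum>i<k. lam (g i) f h))\<^sup>2 = (\<Sum>h\<in>F. (\<Sum>i<k. lam (g i) f h)\<^sup>2)"
  proof (rule nrm_sq[OF F], rule subsetI)
    fix h assume "h \<in> {h. (\<Sum>i<k. lam (g i) f h) \<noteq> 0}"
    then obtain i where "i < k" "lam (g i) f h \<noteq> 0" by (metis (mono_tags, lifting) lessThan_iff mem_Collect_eq sum.neutral)
    then show "h \<in> F" by (auto simp: F_def)
  qed
  also have "\<dots> \<le> (\<Sum>h\<in>F. k * (\<Sum>i<k. (lam (g i) f h)\<^sup>2) - (\<Sum>i<k. (lam (g i) f h - f h)\<^sup>2))"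
    using sum_square_deficit[of "\<lambda>i. lam (g i) f _" k] by (intro sum_mono) (simp add: lam0)
  also have "\<dots> = k * (\<Sum>i<k. \<Sum>h\<in>F. (lam (g i) f h)\<^sup>2) - (\<Sum>i<k. \<Sum>h\<in>F. (lam (g i) f h - f h)\<^sup>2)"
    by (simp add: sum_subtractf sum_distrib_left[symmetric] sum.swap[of _ F "{..<k}"])
  also have "(\<Sum>i<k. \<Sum>h\<in>F. (lam (g i) f h)\<^sup>2) = (\<Sum>i<k. (nrm (lam (g i) f))\<^sup>2)"
    by (intro sum.cong refl nrm_sq[symmetric, OF F]) (auto simp: F_def)
  also have "(\<Sum>i<k. \<Sum>h\<in>F. (lam (g i) f h - f h)\<^sup>2) = (\<Sum>i<k. (nrm (\<lambda>h. lam (g i) f h - f h))\<^sup>2)"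
    by (intro sum.cong refl nrm_sq[symmetric, OF F]) (auto simp: F_def)
  finally show ?thesis by (simp add: power2_eq_square[of "real k"] mult.assoc)
qed

lemma nrm_diff_lam_minus: "nrm (\<lambda>h. lam (- s) f h - f h) = nrm (\<lambda>h. lam s f h - f h)"
proof -
  have "lam s (\<lambda>h. lam (- s) f h - f h) = (\<lambda>h. - (lam s f h - f h))"
    by (auto simp: lam_def add.assoc[symmetric])
  then have "nrm (lam s (\<lambda>h. lam (- s) f h - f h)) = nrm (\<lambda>h. - (lam s f h - f h))" by simp
  then show ?thesis by (simp only: nrm_lam nrm_uminus)
qed

text \<open>The spectral gap read as a norm bound for the walk operator. It serves the steps and
  their inverses alike, since a translation and its inverse displace \<open>f\<close> by the same
  amount.\<close>

lemma nonamenable_contraction: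
  assumes "\<not> amenable_group TYPE('g::group_add)"
  shows "\<exists>k q (s :: nat \<Rightarrow> 'g). k \<ge> 2 \<and> 0 \<le> q \<and> q < 1 \<and> (\<forall>f. fsupp f \<longrightarrow>
     nrm (\<lambda>h. \<Sum>i<k. lam (s i) f h) \<le> q * real k * nrm f \<and>
     nrm (\<lambda>h. \<Sum>i<k. lam (- s i) f h) \<le> q * real k * nrm f)"
proof -
  obtain S :: "'g set" and \<epsilon>0 where S: "finite S" "\<epsilon>0 > 0"
    "\<And>f. fsupp f \<Longrightarrow> \<epsilon>0 * (nrm f)\<^sup>2 \<le> (\<Sum>s\<in>S. (nrm (\<lambda>h. lam s f h - f h))\<^sup>2)"
    using nonamenable_spectral_gap[OF assms] by blast
  \<comment> \<open>Capped at one so that the square root in \<open>q\<close> is taken of a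
    nonnegative number.\<close>
  define \<epsilon> where "\<epsilon> = min \<epsilon>0 1"
  have \<epsilon>: "0 < \<epsilon>" "\<epsilon> \<le> 1" using S by (auto simp: \<epsilon>_def)
  have gap: "\<epsilon> * (nrm f)\<^sup>2 \<le> (\<Sum>s\<in>S. (nrm (\<lambda>h. lam s f h - f h))\<^sup>2)" if "fsupp f" for f
    using S(3)[OF that] mult_right_mono[of \<epsilon> \<epsilon>0 "(nrm f)\<^sup>2"] by (simp add: \<epsilon>_def)
  obtain e where e: "bij_betw e {0..<card S} S" using S ex_bij_betw_nat_finite by blast
  \<comment> \<open>Two extra steps by \<open>0\<close>: index \<open>0\<close> is the reference,
    and the last one ensures \<open>k \<ge> 2\<close> even when \<open>S\<close> is empty, which
    later makes \<open>k ^ t\<close> grow.\<close>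
  define k where "k = card S + 2"
  define s where "s i = (if i = 0 \<or> i = Suc (card S) then 0 else e (i - 1))" for i
  define q where "q = sqrt (1 - \<epsilon> / (real k)\<^sup>2)"
  have k: "k \<ge> 2" by (simp add: k_def)
  have kk: "(real k)\<^sup>2 \<ge> 1" using k by (simp add: one_le_power)
  have in1: "\<epsilon> / (real k)\<^sup>2 \<le> 1" using order_trans[OF \<epsilon>(2) kk] k by (simp add: divide_le_eq)
  have q: "0 \<le> q" "q < 1" unfolding q_def using in1 \<epsilon> k by auto
  have qk: "(q * real k)\<^sup>2 = (real k)\<^sup>2 - \<epsilon>"
    using in1 k by (simp add: q_def power_mult_distrib field_simps)
  have reidx: "(\<Sum>i\<in>Suc ` {0..<card S}. F (s i)) = (\<Sum>t\<in>S. F t)" for F :: "'g \<Rightarrow> real"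
  proof -
    have "(\<Sum>i\<in>Suc ` {0..<card S}. F (s i)) = (\<Sum>i\<in>{0..<card S}. F (e i))"
      by (subst sum.reindex) (auto simp: s_def intro!: sum.cong)
    also have "\<dots> = (\<Sum>t\<in>S. F t)" by (rule sum.reindex_bij_betw[OF e])
    finally show ?thesis .
  qed
  have main: "nrm (\<lambda>h. \<Sum>i<k. lam (g i) f h) \<le> q * real k * nrm f"
    if f: "fsupp f" and g: "g 0 = 0" and
      g': "\<And>i. nrm (\<lambda>h. lam (g i) f h - f h) = nrm (\<lambda>h. lam (s i) f h - f h)" for f and g :: "nat \<Rightarrow> 'g"
  proof -
    have "\<epsilon> * (nrm f)\<^sup>2 \<le> (\<Sum>i\<in>Suc ` {0..<card S}. (nrm (\<lambda>h. lam (s i) f h - f h))\<^sup>2)"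
      using gap[OF f] by (subst reidx)
    also have "\<dots> \<le> (\<Sum>i<k. (nrm (\<lambda>h. lam (s i) f h - f h))\<^sup>2)"
      by (rule sum_mono2) (auto simp: k_def)
    finally have "(nrm (\<lambda>h. \<Sum>i<k. lam (g i) f h))\<^sup>2 \<le> (real k)\<^sup>2 * (nrm f)\<^sup>2 - \<epsilon> * (nrm f)\<^sup>2"
      using nrm_square_sum_lam[where g = g and k = k, OF f g] by (simp add: g')
    also have "\<dots> = (q * real k * nrm f)\<^sup>2"
      unfolding power_mult_distrib[of "q * real k"] qk by (simp add: algebra_simps)
    finally show ?thesis by (rule power2_le_imp_le) (use q in simp)
  qed
  have "s 0 = 0" by (simp add: s_def)
  then show ?thesis
    using k q main[of _ s] main[of _ "\<lambda>i. - s i"]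
    by (intro exI[of _ k] exI[of _ q] exI[of _ s]) (auto simp: nrm_diff_lam_minus)
qed

lemma sum_nat_div_mod:
  fixes F :: "nat \<Rightarrow> nat \<Rightarrow> 'a::comm_monoid_add"
  shows "(\<Sum>a<m * k. F (a mod k) (a div k)) = (\<Sum>i<k. \<Sum>j<m. F i j)"
proof -
  have "(\<Sum>a<m * k. F (a mod k) (a div k)) = (\<Sum>j<m. \<Sum>a\<in>{j*k..<j*k+k}. F (a mod k) (a div k))"
    by (rule sum.nat_group[symmetric])
  also have "\<dots> = (\<Sum>j<m. \<Sum>i<k. F i j)"
  proof (rule sum.cong[OF refl])
    fix j
    have "(\<Sum>a\<in>{j*k..<j*k+k}. F (a mod k) (a div k)) = (\<Sum>a\<in>{0..<k}. F ((a + j*k) mod k) ((a + j*k) div k))"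
      using sum.shift_bounds_nat_ivl[of "\<lambda>a. F (a mod k) (a div k)" 0 "j*k" k] by (simp add: add.commute)
    also have "\<dots> = (\<Sum>i<k. F i j)" by (rule sum.cong) auto
    finally show "(\<Sum>a\<in>{j*k..<j*k+k}. F (a mod k) (a div k)) = (\<Sum>i<k. F i j)" .
  qed
  finally show ?thesis by (simp add: sum.swap[of _ "{..<m}"])
qed

text \<open>\<open>v\<close> lists, with repetition, the products of \<open>t\<close> steps, indexed
  by base-\<open>k\<close> digits. Its walk operator is the \<open>t\<close>-th power of the given
  one; for the inverses the factors appear in reverse order.\<close>

lemma contraction_power:
  fixes s :: "nat \<Rightarrow> 'g::group_add"
  assumes q: "0 \<le> q" and s: "\<And>f. fsupp f \<Longrightarrow> nrm (\<lambda>h. \<Sum>i<k. lam (s i) f h) \<le> q * real k * nrm f"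
    "\<And>f. fsupp f \<Longrightarrow> nrm (\<lambda>h. \<Sum>i<k. lam (- s i) f h) \<le> q * real k * nrm f"
  shows "\<exists>v :: nat \<Rightarrow> 'g. \<forall>f. fsupp f \<longrightarrow>
     nrm (\<lambda>h. \<Sum>i<k^t. lam (v i) f h) \<le> (q * real k) ^ t * nrm f \<and>
     nrm (\<lambda>h. \<Sum>i<k^t. lam (- v i) f h) \<le> (q * real k) ^ t * nrm f"
proof (induction t)
  case 0
  show ?case by (intro exI[of _ "\<lambda>_. 0"]) (simp add: lam_def)
next
  case (Suc t)
  then obtain v :: "nat \<Rightarrow> 'g" where v:
    "\<And>f. fsupp f \<Longrightarrow> nrm (\<lambda>h. \<Sum>i<k^t. lam (v i) f h) \<le> (q * real k) ^ t * nrm f"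
    "\<And>f. fsupp f \<Longrightarrow> nrm (\<lambda>h. \<Sum>i<k^t. lam (- v i) f h) \<le> (q * real k) ^ t * nrm f" by blast
  define v' where "v' a = s (a mod k) + v (a div k)" for a
  have qk: "0 \<le> q * real k" using q by simp
  have kS: "k ^ Suc t = k ^ t * k" by simp
  have "nrm (\<lambda>h. \<Sum>i<k^Suc t. lam (v' i) f h) \<le> (q * real k) ^ Suc t * nrm f" if f: "fsupp f" for f
  proof -
    define f' where "f' = (\<lambda>h. \<Sum>j<k^t. lam (v j) f h)"
    have f': "fsupp f'" unfolding f'_def by (rule fsupp_sum) (use f in simp)
    have "(\<Sum>i<k^Suc t. lam (v' i) f h) = (\<Sum>i<k. lam (s i) f' h)" for h
      using sum_nat_div_mod[of "\<lambda>i j. lam (s i + v j) f h" k "k^t"]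
      unfolding kS by (simp add: v'_def f'_def lam_def minus_add add.assoc del: add_uminus_conv_diff)
    then have "nrm (\<lambda>h. \<Sum>i<k^Suc t. lam (v' i) f h) \<le> q * real k * nrm f'" using s(1)[OF f'] by simp
    also have "\<dots> \<le> q * real k * ((q * real k) ^ t * nrm f)"
      using v(1)[OF f] by (intro mult_left_mono[OF _ qk]) (simp add: f'_def)
    finally show ?thesis by (simp add: mult.assoc)
  qed
  moreover have "nrm (\<lambda>h. \<Sum>i<k^Suc t. lam (- v' i) f h) \<le> (q * real k) ^ Suc t * nrm f" if f: "fsupp f" for f
  proof -
    define f' where "f' = (\<lambda>h. \<Sum>j<k. lam (- s j) f h)"
    have f': "fsupp f'" unfolding f'_def by (rule fsupp_sum) (use f in simp)
    have "(\<Sum>i<k^Suc t. lam (- v' i) f h) = (\<Sum>i<k^t. lam (- v i) f' h)" for h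
      using sum_nat_div_mod[of "\<lambda>i j. lam (- (s i + v j)) f h" k "k^t"]
      unfolding kS by (simp add: v'_def f'_def lam_def add.assoc sum.swap[of _ "{..<k}"] del: add_uminus_conv_diff)
    then have "nrm (\<lambda>h. \<Sum>i<k^Suc t. lam (- v' i) f h) \<le> (q * real k) ^ t * nrm f'" using v(2)[OF f'] by simp
    also have "\<dots> \<le> (q * real k) ^ t * (q * real k * nrm f)"
      using s(2)[OF f] qk by (intro mult_left_mono) (simp_all add: f'_def)
    finally show ?thesis by (simp add: mult.assoc mult.left_commute)
  qed
  ultimately show ?case by blast
qed

lemma generated_by_words:
  assumes "finitely_generated_group TYPE('g::group_add)"
  shows "\<exists>S::'g set. finite S \<and> (\<forall>g. \<exists>l :: ('g \<times> bool) list. fst ` set l \<subseteq> S \<and>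
     g = foldr (\<lambda>(t, d) h. (if d then t else - t) + h) l 0)"
proof -
  obtain S :: "'g set" where S: "finite S"
    "\<And>H. 0 \<in> H \<and> S \<subseteq> H \<and> (\<forall>a\<in>H. \<forall>b\<in>H. a + b \<in> H) \<and> (\<forall>a\<in>H. - a \<in> H) \<Longrightarrow> H = UNIV"
    using assms unfolding finitely_generated_group_def by blast
  define ev :: "('g \<times> bool) list \<Rightarrow> 'g" where "ev l = foldr (\<lambda>(t, d) h. (if d then t else - t) + h) l 0" for l
  have ev: "ev [] = 0" "ev ((t,d) # l) = (if d then t else - t) + ev l" for t d l
    by (simp_all add: ev_def)
  have app: "ev (l @ l') = ev l + ev l'" for l l'
    by (induction l) (auto simp: ev add.assoc)
  have neg: "ev (rev (map (\<lambda>(t,d). (t, \<not> d)) l)) = - ev l" for l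
    by (induction l) (auto simp: ev app minus_add)
  define H where "H = {ev l | l. fst ` set l \<subseteq> S}"
  have "H = UNIV"
  proof (rule S(2), intro conjI ballI subsetI)
    show "0 \<in> H" unfolding H_def using ev(1) by (auto intro!: exI[of _ "[]"])
  next
    fix t assume "t \<in> S"
    then show "t \<in> H" unfolding H_def by (auto simp: ev intro!: exI[of _ "[(t,True)]"])
  next
    fix a b assume "a \<in> H" "b \<in> H"
    then obtain l l' where "a = ev l" "fst ` set l \<subseteq> S" "b = ev l'" "fst ` set l' \<subseteq> S" by (auto simp: H_def)
    then show "a + b \<in> H" unfolding H_def
      by (intro CollectI exI[of _ "l @ l'"]) (simp add: app image_Un)
  next
    fix a assume "a \<in> H"
    then obtain l where "a = ev l" "fst ` set l \<subseteq> S" by (auto simp: H_def)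
    then show "- a \<in> H" unfolding H_def
      by (intro CollectI exI[of _ "rev (map (\<lambda>(t,d). (t, \<not> d)) l)"]) (auto simp: neg)
  qed
  have "\<exists>l. fst ` set l \<subseteq> S \<and> g = ev l" for g
  proof -
    have "g \<in> H" using \<open>H = UNIV\<close> by simp
    then show ?thesis unfolding H_def by blast
  qed
  then show ?thesis using S(1) unfolding ev_def by (intro exI[of _ S]) simp
qed

text \<open>The labels are 1001 copies of the \<open>N * N\<close> differences
  \<open>- v a + v b\<close>, one copy for \<open>I1\<close> and 1000 for \<open>I3\<close>, and a
  generating set for \<open>I2\<close>. The translations by the differences sum to the product of
  the operator of the \<open>- v a\<close> with that of the \<open>v b\<close>, hence to an operator
  of norm at most \<open>N * N / 1000000\<close>. The difference form is also what
  \<open>sum_both\<close> asks for.\<close>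

lemma percolation_parameters:
  assumes fg: "finitely_generated_group TYPE('g::group_add)" and na: "\<not> amenable_group TYPE('g)"
  shows "\<exists>n (s :: nat \<Rightarrow> 'g) I1 I2 I3 N (v :: nat \<Rightarrow> 'g) \<Lambda>.
    N \<ge> 2 \<and> {..<n} = I1 \<union> I2 \<union> I3 \<and> I1 \<inter> I2 = {} \<and> I1 \<inter> I3 = {} \<and> I2 \<inter> I3 = {} \<and>
    card I1 = N * N \<and>
    (\<forall>g. \<exists>l. fst ` set l \<subseteq> I2 \<and> word_val s l = g) \<and>
    (\<forall>F :: 'g \<Rightarrow> real. (\<Sum>i\<in>I3. F (s i)) = 1000 * (\<Sum>a<N. \<Sum>b<N. F (- v a + v b))) \<and>
    8 * \<Lambda> \<le> real N * real N \<and> 0 \<le> \<Lambda> \<and>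
    (\<forall>f. fsupp f \<longrightarrow> nrm (\<lambda>h. \<Sum>i<n. lam (s i) f h + lam (- s i) f h) \<le> \<Lambda> * nrm f)"
proof -
  obtain S :: "'g set" where S: "finite S" "\<And>g. \<exists>l :: ('g \<times> bool) list. fst ` set l \<subseteq> S \<and>
     g = foldr (\<lambda>(t, d) h. (if d then t else - t) + h) l 0"
    using generated_by_words[OF fg] by blast
  obtain k q and s0 :: "nat \<Rightarrow> 'g" where k: "k \<ge> 2" and q: "0 \<le> q" "q < 1" and
    s0: "\<And>f. fsupp f \<Longrightarrow> nrm (\<lambda>h. \<Sum>i<k. lam (s0 i) f h) \<le> q * real k * nrm f"
      "\<And>f. fsupp f \<Longrightarrow> nrm (\<lambda>h. \<Sum>i<k. lam (- s0 i) f h) \<le> q * real k * nrm f"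
    using nonamenable_contraction[OF na] by blast
  \<comment> \<open>The rate \<open>1/1000\<close> is squared in the operator of the differences and
    then outweighs 1001 copies and their inverses; the lower bound on \<open>t\<close> makes
    \<open>N\<close> so large that the generators in \<open>S\<close> contribute little to
    \<open>\<Lambda>\<close>.\<close>
  have "(\<lambda>t. q ^ t) \<longlonglongrightarrow> 0" using q by (simp add: LIMSEQ_realpow_zero)
  then have "\<forall>\<^sub>F t in sequentially. q ^ t < 1/1000" by (rule order_tendstoD) simp
  moreover have "\<forall>\<^sub>F t in sequentially. t \<ge> 32 * card S + 2" by (rule eventually_ge_at_top)
  ultimately obtain t where t: "q ^ t < 1/1000" "t \<ge> 32 * card S + 2"
    using eventually_happens[OF eventually_conj] trivial_limit_sequentially by (metis (no_types, lifting))
  define N where "N = k ^ t"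
  have N: "N > 0" using k by (simp add: N_def)
  have "t < 2 ^ t" by (rule less_exp)
  also have "(2::nat) ^ t \<le> N" unfolding N_def using k by (rule power_mono) simp
  finally have tN: "t < N" .
  then have N2: "N \<ge> 2" using t by simp
  obtain v :: "nat \<Rightarrow> 'g" where
    v: "\<And>f. fsupp f \<Longrightarrow> nrm (\<lambda>h. \<Sum>i<k^t. lam (v i) f h) \<le> (q * real k) ^ t * nrm f"
    "\<And>f. fsupp f \<Longrightarrow> nrm (\<lambda>h. \<Sum>i<k^t. lam (- v i) f h) \<le> (q * real k) ^ t * nrm f"
    using contraction_power[OF q(1) s0] by blast
  have qN: "(q * real k) ^ t \<le> real N / 1000"
    using mult_right_mono[OF less_imp_le[OF t(1)], of "real N"] by (simp add: N_def power_mult_distrib)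
  define L where "L f = (\<lambda>h. \<Sum>b<N. lam (v b) f h)" for f
  have L: "fsupp (L f)" if "fsupp f" for f unfolding L_def by (rule fsupp_sum) (use that in simp)
  define L2 where "L2 f = (\<lambda>h. \<Sum>a<N. lam (- v a) (L f) h)" for f
  have L2: "fsupp (L2 f)" if "fsupp f" for f unfolding L2_def by (rule fsupp_sum) (use L that in simp)
  have nL2: "nrm (L2 f) \<le> real N * real N / 1000000 * nrm f" if f: "fsupp f" for f
  proof -
    have "nrm (L2 f) \<le> (q * real k) ^ t * nrm (L f)"
      unfolding L2_def using v(2)[OF L[OF f]] by (simp add: N_def)
    also have "\<dots> \<le> real N / 1000 * ((q * real k) ^ t * nrm f)"
      using v(1)[OF f] q by (intro mult_mono qN) (auto simp: N_def L_def)
    also have "\<dots> \<le> real N / 1000 * (real N / 1000 * nrm f)"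
      by (intro mult_left_mono mult_right_mono qN) auto
    finally show ?thesis by simp
  qed
  define J where "J = {..<1001::nat} \<times> {..<N} \<times> {..<N}"
  define Idx :: "((nat \<times> nat \<times> nat) + 'g) set" where "Idx = Inl ` J \<union> Inr ` S"
  define el :: "(nat \<times> nat \<times> nat) + 'g \<Rightarrow> 'g" where
    "el = case_sum (\<lambda>(c,a,b). - v a + v b) (\<lambda>t. t)"
  define n where "n = card Idx"
  have fJ: "finite J" by (simp add: J_def)
  have fIdx: "finite Idx" using S fJ by (simp add: Idx_def)
  obtain e where e: "bij_betw e {..<n} Idx"
    using ex_bij_betw_nat_finite[OF fIdx] by (auto simp: n_def atLeast0LessThan)
  define s where "s i = el (e i)" for i
  define pre where "pre B = {i \<in> {..<n}. e i \<in> B}" for B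
  have pre: "bij_betw e (pre B) B" if "B \<subseteq> Idx" for B
    using e that unfolding bij_betw_def pre_def inj_on_def by auto
  have sumpre: "(\<Sum>i\<in>pre B. F (s i)) = (\<Sum>x\<in>B. F (el x))" if "B \<subseteq> Idx" for B and F :: "'g \<Rightarrow> real"
    unfolding s_def by (rule sum.reindex_bij_betw[OF pre[OF that], of "\<lambda>x. F (el x)"])
  define B1 :: "((nat \<times> nat \<times> nat) + 'g) set" where "B1 = Inl ` ({0} \<times> {..<N} \<times> {..<N})"
  define B3 :: "((nat \<times> nat \<times> nat) + 'g) set" where "B3 = Inl ` ({1..<1001} \<times> {..<N} \<times> {..<N})"
  define B2 :: "((nat \<times> nat \<times> nat) + 'g) set" where "B2 = Inr ` S"
  have B: "B1 \<subseteq> Idx" "B2 \<subseteq> Idx" "B3 \<subseteq> Idx" "Idx = B1 \<union> B2 \<union> B3"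
    by (auto simp: B1_def B2_def B3_def Idx_def J_def image_iff)
  have part: "{..<n} = pre B1 \<union> pre B2 \<union> pre B3" "pre B1 \<inter> pre B2 = {}" "pre B1 \<inter> pre B3 = {}" "pre B2 \<inter> pre B3 = {}"
  proof -
    show "{..<n} = pre B1 \<union> pre B2 \<union> pre B3"
      using bij_betwE[OF e] B(4) unfolding pre_def by auto
  qed (auto simp: pre_def B1_def B2_def B3_def)
  have card1: "card (pre B1) = N * N"
    using bij_betw_same_card[OF pre[OF B(1)]] by (simp add: B1_def card_image card_cartesian_product)
  have gen: "\<exists>l. fst ` set l \<subseteq> pre B2 \<and> word_val s l = g" for g
  proof -
    have "\<exists>l'. fst ` set l' \<subseteq> pre B2 \<and> word_val s l' = foldr (\<lambda>(t, d) h. (if d then t else - t) + h) l 0"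
      if "fst ` set l \<subseteq> S" for l :: "('g \<times> bool) list" using that
    proof (induction l)
      case Nil
      show ?case by (intro exI[of _ "[]"]) simp
    next
      case (Cons td l)
      obtain t d where td: "td = (t, d)" by force
      from Cons obtain l' where l': "fst ` set l' \<subseteq> pre B2"
        "word_val s l' = foldr (\<lambda>(t, d) h. (if d then t else - t) + h) l 0" by auto
      have "Inr t \<in> e ` pre B2" using Cons.prems pre[OF B(2)] by (auto simp: td B2_def bij_betw_def)
      then obtain i where i: "i \<in> pre B2" "e i = Inr t" by (metis imageE)
      have "s i = t" using i by (simp add: s_def el_def)
      then show ?case
        by (intro exI[of _ "(i,d) # l'"]) (use i l' in \<open>auto simp: td\<close>)
    qed
    then show ?thesis using S(2)[of g] by metis
  qed
  have prodsum: "(\<Sum>x\<in>Inl ` (C \<times> {..<N} \<times> {..<N}). F (el x)) = card C * (\<Sum>a<N. \<Sum>b<N. F (- v a + v b))"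
    for F :: "'g \<Rightarrow> real" and C
  proof -
    have "(\<Sum>x\<in>Inl ` (C \<times> {..<N} \<times> {..<N}). F (el x)) =
       (\<Sum>(c,a,b)\<in>C \<times> {..<N} \<times> {..<N}. F (- v a + v b))"
      by (subst sum.reindex) (auto simp: inj_on_def el_def intro!: sum.cong)
    also have "\<dots> = (\<Sum>c\<in>C. \<Sum>a<N. \<Sum>b<N. F (- v a + v b))"
      by (simp only: sum.cartesian_product case_prod_unfold)
    finally show ?thesis by simp
  qed
  have sum3: "(\<Sum>i\<in>pre B3. F (s i)) = 1000 * (\<Sum>a<N. \<Sum>b<N. F (- v a + v b))" for F :: "'g \<Rightarrow> real"
    unfolding sumpre[OF B(3)] unfolding B3_def prodsum by simp
  \<comment> \<open>Each of the 1001 copies counts twice, since the list of differences is closed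
    under inverses; each element of \<open>S\<close> counts for two translations of norm
    one.\<close>
  define \<Lambda> where "\<Lambda> = 2002 * (real N * real N / 1000000) + 2 * card S"
  have "16 * real (card S) \<le> real N * real N / 2"
  proof -
    have "32 * card S \<le> N" using t tN by simp
    then have "32 * real (card S) \<le> real N" by (metis of_nat_le_iff of_nat_mult of_nat_numeral)
    also have "real N \<le> real N * real N" using N by simp
    finally show ?thesis by simp
  qed
  then have \<Lambda>: "8 * \<Lambda> \<le> real N * real N" by (simp add: \<Lambda>_def field_simps)
  have op: "nrm (\<lambda>h. \<Sum>i<n. lam (s i) f h + lam (- s i) f h) \<le> \<Lambda> * nrm f" if f: "fsupp f" for f
  proof -
    have "(\<Sum>i<n. lam (s i) f h + lam (- s i) f h) = 2002 * L2 f h + (\<Sum>t\<in>S. lam t f h + lam (- t) f h)" for h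
    proof -
      define F where "F g = lam g f h + lam (- g) f h" for g
      have "(\<Sum>i<n. F (s i)) = (\<Sum>x\<in>Idx. F (el x))"
        unfolding s_def by (rule sum.reindex_bij_betw[OF e, of "\<lambda>x. F (el x)"])
      also have "\<dots> = (\<Sum>x\<in>Inl ` J. F (el x)) + (\<Sum>x\<in>Inr ` S. F (el x))"
        unfolding Idx_def by (rule sum.union_disjoint) (use fJ S in auto)
      also have "(\<Sum>x\<in>Inr ` S. F (el x)) = (\<Sum>t\<in>S. F t)"
        by (subst sum.reindex) (auto simp: inj_on_def el_def)
      also have "(\<Sum>x\<in>Inl ` J. F (el x)) = 1001 * (\<Sum>a<N. \<Sum>b<N. F (- v a + v b))"
        unfolding J_def prodsum by simp
      also have "(\<Sum>a<N. \<Sum>b<N. F (- v a + v b)) = 2 * L2 f h"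
      proof -
        have "(\<Sum>a<N. \<Sum>b<N. lam (- v a + v b) f h) = L2 f h"
          by (simp add: L2_def L_def lam_def minus_add add.assoc del: add_uminus_conv_diff)
        moreover have "(\<Sum>a<N. \<Sum>b<N. lam (- (- v a + v b)) f h) = L2 f h"
          by (subst sum.swap) (simp add: L2_def L_def lam_def minus_add add.assoc del: add_uminus_conv_diff)
        ultimately show ?thesis unfolding F_def sum.distrib by simp
      qed
      finally show ?thesis by (simp add: F_def)
    qed
    then have "nrm (\<lambda>h. \<Sum>i<n. lam (s i) f h + lam (- s i) f h) =
       nrm (\<lambda>h. 2002 * L2 f h + (\<Sum>t\<in>S. lam t f h + lam (- t) f h))" by simp
    also have "\<dots> \<le> nrm (\<lambda>h. 2002 * L2 f h) + nrm (\<lambda>h. \<Sum>t\<in>S. lam t f h + lam (- t) f h)"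
    proof (rule nrm_add)
      show "fsupp (\<lambda>h. 2002 * L2 f h)" using L2[OF f] by (simp add: fsupp_def)
      show "fsupp (\<lambda>h. \<Sum>t\<in>S. lam t f h + lam (- t) f h)" by (rule fsupp_sum) (use f in simp)
    qed
    also have "nrm (\<lambda>h. 2002 * L2 f h) = 2002 * nrm (L2 f)"
      by (simp add: nrm_def L2_set_right_distrib)
    also have "nrm (\<lambda>h. \<Sum>t\<in>S. lam t f h + lam (- t) f h) \<le> (\<Sum>t\<in>S. nrm (\<lambda>h. lam t f h + lam (- t) f h))"
      by (rule nrm_sum) (use f in simp)
    also have "\<dots> \<le> (\<Sum>t\<in>S. 2 * nrm f)"
    proof (rule sum_mono)
      fix t
      show "nrm (\<lambda>h. lam t f h + lam (- t) f h) \<le> 2 * nrm f"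
        using nrm_add[of "lam t f" "lam (- t) f"] f by simp
    qed
    finally have "nrm (\<lambda>h. \<Sum>i<n. lam (s i) f h + lam (- s i) f h) \<le> 2002 * nrm (L2 f) + card S * (2 * nrm f)"
      by simp
    then show ?thesis using nL2[OF f] by (simp add: \<Lambda>_def algebra_simps)
  qed
  have \<Lambda>0: "0 \<le> \<Lambda>" by (simp add: \<Lambda>_def)
  show ?thesis
    by (rule exI[of _ n], rule exI[of _ s], rule exI[of _ "pre B1"], rule exI[of _ "pre B2"], rule exI[of _ "pre B3"],
        rule exI[of _ N], rule exI[of _ v], rule exI[of _ \<Lambda>], intro conjI allI impI)
      (fact N2 part card1 gen sum3 \<Lambda> \<Lambda>0 op)+
qed

section \<open>Bridges in edge-labelled Cayley graphs\<close>

text \<open>An edge is its source together with a label, so parallel edges arising from repeated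
  group elements stay distinct. A letter \<open>(i, False)\<close> runs backwards over the edge
  whose target is the current vertex.\<close>

fun walk_edges :: "(nat \<Rightarrow> 'g::group_add) \<Rightarrow> 'g \<Rightarrow> (nat \<times> bool) list \<Rightarrow> ('g \<times> nat) list" where
  "walk_edges s u [] = []"
| "walk_edges s u ((i, d) # l) =
     ((if d then u else u - s i), i) # walk_edges s (u + (if d then s i else - s i)) l"

definition conn :: "(nat \<Rightarrow> 'g::group_add) \<Rightarrow> ('g \<times> nat) set \<Rightarrow> 'g \<Rightarrow> 'g \<Rightarrow> bool" where
  "conn s E u v \<longleftrightarrow> (\<exists>l. v = u + word_val s l \<and> set (walk_edges s u l) \<subseteq> E)"

definition tgt :: "(nat \<Rightarrow> 'g::group_add) \<Rightarrow> 'g \<times> nat \<Rightarrow> 'g" where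
  "tgt s e = fst e + s (snd e)"

definition bridge :: "(nat \<Rightarrow> 'g::group_add) \<Rightarrow> ('g \<times> nat) set \<Rightarrow> 'g \<times> nat \<Rightarrow> bool" where
  "bridge s E e \<longleftrightarrow> \<not> conn s (E - {e}) (fst e) (tgt s e)"

lemma word_val_append: "word_val s (l @ l') = word_val s l + word_val s l'"
  by (induction s l rule: word_val.induct) (auto simp: add.assoc)

lemma walk_edges_append:
  "walk_edges s u (l @ l') = walk_edges s u l @ walk_edges s (u + word_val s l) l'"
  by (induction s u l rule: walk_edges.induct) (auto simp: add.assoc)

lemma length_walk_edges [simp]: "length (walk_edges s u l) = length l"
  by (induction s u l rule: walk_edges.induct) auto

lemma snd_walk_edges: "snd ` set (walk_edges s u l) = fst ` set l"
  by (induction s u l rule: walk_edges.induct) auto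

lemma walk_edges_shift: "walk_edges s (h + u) l = map (\<lambda>(g, i). (h + g, i)) (walk_edges s u l)"
  by (induction s u l rule: walk_edges.induct) (auto simp: add.assoc add_diff_eq)

lemma conn_refl [simp]: "conn s E u u"
  unfolding conn_def by (rule exI[of _ "[]"]) simp

lemma conn_trans: "conn s E u v \<Longrightarrow> conn s E v w \<Longrightarrow> conn s E u w"
  unfolding conn_def
proof safe
  fix l l' assume "set (walk_edges s u l) \<subseteq> E" "set (walk_edges s (u + word_val s l) l') \<subseteq> E"
  then show "\<exists>k. u + word_val s l + word_val s l' = u + word_val s k \<and> set (walk_edges s u k) \<subseteq> E"
    by (intro exI[of _ "l @ l'"]) (auto simp: word_val_append walk_edges_append add.assoc)
qed

lemma conn_mono: "conn s E u v \<Longrightarrow> E \<subseteq> E' \<Longrightarrow> conn s E' u v"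
  unfolding conn_def by blast

lemma conn_edge: "e \<in> E \<Longrightarrow> conn s E (fst e) (tgt s e)"
  unfolding conn_def tgt_def by (rule exI[of _ "[(snd e, True)]"]) (cases e, simp)

lemma conn_edge': "e \<in> E \<Longrightarrow> conn s E (tgt s e) (fst e)"
  unfolding conn_def tgt_def
  by (rule exI[of _ "[(snd e, False)]"]) (cases e, simp add: add.assoc)

lemma conn_Cons_cases:
  assumes "set (walk_edges s u ((i, d) # l)) \<subseteq> E"
  shows "\<exists>e\<in>E. u = (if d then fst e else tgt s e) \<and>
     u + (if d then s i else - s i) = (if d then tgt s e else fst e)"
  using assms by (intro bexI[of _ "((if d then u else u - s i), i)"]) (auto simp: tgt_def add.assoc)

lemma conn_sym: "conn s E u v \<Longrightarrow> conn s E v u"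
proof -
  have "set (walk_edges s u l) \<subseteq> E \<Longrightarrow> conn s E (u + word_val s l) u" for l
  proof (induction s u l rule: walk_edges.induct)
    case (2 s u i d l)
    let ?u = "u + (if d then s i else - s i)"
    from conn_Cons_cases[OF 2(2)] obtain e where "e \<in> E"
      "u = (if d then fst e else tgt s e)" "?u = (if d then tgt s e else fst e)" by blast
    then have "conn s E ?u u" using conn_edge conn_edge' by (metis (full_types))
    moreover have "conn s E (?u + word_val s l) ?u" using 2 by simp
    ultimately show ?case using conn_trans by (auto simp: add.assoc)
  qed simp
  then show "conn s E u v \<Longrightarrow> conn s E v u" unfolding conn_def[of s E u v] by blast
qed

lemma conn_shift:
  assumes "\<And>g i. (g, i) \<in> E' \<longleftrightarrow> (h + g, i) \<in> E"
  shows "conn s E' u v \<longleftrightarrow> conn s E (h + u) (h + v)"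
proof -
  have "set (walk_edges s (h + u) l) \<subseteq> E \<longleftrightarrow> set (walk_edges s u l) \<subseteq> E'" for l
    using assms unfolding walk_edges_shift by auto
  then show ?thesis by (simp add: conn_def add.assoc)
qed

text \<open>The exact account of how one edge can help; the bridge arguments delete one or two edges
  and restore them through it.\<close>

lemma conn_insert:
  assumes "conn s (insert e E) t a"
  shows "conn s E t a \<or> (conn s E t (fst e) \<and> conn s E (tgt s e) a) \<or> (conn s E t (tgt s e) \<and> conn s E (fst e) a)"
proof -
  have "set (walk_edges s t l) \<subseteq> insert e E \<Longrightarrow> a = t + word_val s l \<Longrightarrow> ?thesis" for l
  proof (induction s t l rule: walk_edges.induct)
    case (2 s u i d l)
    let ?u = "u + (if d then s i else - s i)"
    from conn_Cons_cases[OF 2(2)] obtain e' where e': "e' \<in> insert e E"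
      "u = (if d then fst e' else tgt s e')" "?u = (if d then tgt s e' else fst e')" by blast
    have IH: "conn s E ?u a \<or> (conn s E ?u (fst e) \<and> conn s E (tgt s e) a) \<or> (conn s E ?u (tgt s e) \<and> conn s E (fst e) a)"
      using 2 by (simp add: add.assoc)
    show ?case
    proof (cases "e' \<in> E")
      case True
      then have "conn s E u ?u" using e' conn_edge conn_edge' by (metis (full_types))
      then show ?thesis using IH conn_trans by metis
    next
      case False
      then have "(u = fst e \<and> ?u = tgt s e) \<or> (u = tgt s e \<and> ?u = fst e)" using e' by (cases d) auto
      then show ?thesis using IH conn_refl by metis
    qed
  qed simp
  then show ?thesis using assms unfolding conn_def[of s "insert e E"] by blast
qed

lemma walk_edges_split:
  "walk_edges s u l = ys @ e # zs \<Longrightarrow>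
   \<exists>l1 d l2. l = l1 @ (snd e, d) # l2 \<and> (if d then fst e else tgt s e) = u + word_val s l1 \<and>
     walk_edges s u l1 = ys \<and> walk_edges s (if d then tgt s e else fst e) l2 = zs"
proof (induction ys arbitrary: u l)
  case Nil
  then obtain i d l2 where l: "l = (i, d) # l2" by (cases l) auto
  show ?case using Nil unfolding l
    by (intro exI[of _ "[]"] exI[of _ d] exI[of _ l2]) (auto simp: tgt_def)
next
  case (Cons y ys)
  then obtain i d l' where l: "l = (i, d) # l'" by (cases l) auto
  let ?u = "u + (if d then s i else - s i)"
  have "walk_edges s ?u l' = ys @ e # zs" using Cons.prems by (simp add: l)
  from Cons.IH[OF this] obtain l1 d' l2 where *: "l' = l1 @ (snd e, d') # l2"
    "(if d' then fst e else tgt s e) = ?u + word_val s l1"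
    "walk_edges s ?u l1 = ys" "walk_edges s (if d' then tgt s e else fst e) l2 = zs" by blast
  show ?case
    by (rule exI[of _ "(i,d) # l1"], rule exI[of _ d'], rule exI[of _ l2])
      (use * Cons.prems in \<open>auto simp: l add.assoc\<close>)
qed

text \<open>Loop erasure for edges. It is needed because an open walk has probability
  \<open>p\<close> to the power of its length only when its edges are distinct.\<close>

lemma conn_distinct:
  assumes "conn s E u v"
  shows "\<exists>l. v = u + word_val s l \<and> set (walk_edges s u l) \<subseteq> E \<and> distinct (walk_edges s u l)"
proof -
  have "set (walk_edges s u l) \<subseteq> E \<Longrightarrow> \<exists>l'. u + word_val s l = u + word_val s l' \<and>
    set (walk_edges s u l') \<subseteq> E \<and> distinct (walk_edges s u l')" for l
  proof (induction s u l rule: walk_edges.induct)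
    case (1 s u)
    show ?case by (intro exI[of _ "[]"]) simp
  next
    case (2 s u i d l)
    let ?u = "u + (if d then s i else - s i)"
    let ?e = "((if d then u else u - s i), i)"
    obtain l' where l': "?u + word_val s l = ?u + word_val s l'"
      "set (walk_edges s ?u l') \<subseteq> E" "distinct (walk_edges s ?u l')"
      using 2 by (auto simp del: add_left_cancel)
    show ?case
    proof (cases "?e \<in> set (walk_edges s ?u l')")
      case False
      then show ?thesis using 2(2) l'
        by (intro exI[of _ "(i,d) # l'"]) (auto simp: add.assoc[symmetric])
    next
      case True
      then obtain ys zs where yz: "walk_edges s ?u l' = ys @ ?e # zs"
        by (meson split_list)
      from walk_edges_split[OF this] obtain l1 d' l2 where *: "l' = l1 @ (i, d') # l2"
        "(if d' then fst ?e else tgt s ?e) = ?u + word_val s l1"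
        "walk_edges s (if d' then tgt s ?e else fst ?e) l2 = zs" by auto
      have te: "tgt s ?e = (if d then ?u else u)" "fst ?e = (if d then u else ?u)"
        by (auto simp: tgt_def add.assoc)
      have tot: "?u + word_val s l' = (if d' then tgt s ?e else fst ?e) + word_val s l2"
      proof -
        have "?u + word_val s l' = (?u + word_val s l1) + ((if d' then s i else - s i) + word_val s l2)"
          by (simp add: * word_val_append add.assoc)
        also have "\<dots> = (if d' then tgt s ?e else fst ?e) + word_val s l2"
          unfolding *(2)[symmetric] by (auto simp: tgt_def add.assoc[symmetric])
        finally show ?thesis .
      qed
      show ?thesis
      \<comment> \<open>The first edge recurs. If it recurs in the same direction, it is kept once
        and everything up to the recurrence is dropped; in the opposite direction the walk is back
        at \<open>u\<close>, and both passages disappear.\<close>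
      proof (cases "d = d'")
        case True
        have "walk_edges s u ((i,d) # l2) = ?e # zs"
          using *(3) te True by (cases d) (auto simp: tgt_def)
        moreover have "u + word_val s ((i,d) # l) = u + word_val s ((i,d) # l2)"
          using tot te True l'(1) by (cases d) (auto simp: add.assoc diff_conv_add_uminus simp del: add_uminus_conv_diff)
        ultimately show ?thesis using l' yz
          by (intro exI[of _ "(i,d) # l2"]) (auto simp del: walk_edges.simps word_val.simps)
      next
        case False
        have "walk_edges s u l2 = zs"
          using *(3) te False by (cases d) auto
        moreover have "u + word_val s ((i,d) # l) = u + word_val s l2"
          using tot te False l'(1) by (cases d) (auto simp: add.assoc diff_conv_add_uminus simp del: add_uminus_conv_diff)
        ultimately show ?thesis using l' yz
          by (intro exI[of _ l2]) (auto simp del: walk_edges.simps word_val.simps)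
      qed
    qed
  qed
  then show ?thesis using assms unfolding conn_def by metis
qed

text \<open>A bridge is charged to its endpoint on the far side of the root; distinct bridges have
  distinct far endpoints.\<close>
lemma card_bridges_le:
  assumes fin: "finite {v. conn s E r v}"
  shows "finite {e \<in> E. bridge s E e \<and> conn s E r (fst e)}"
    and "card {e \<in> E. bridge s E e \<and> conn s E r (fst e)} \<le> card {v. conn s E r v}"
proof -
  define far where "far e = (if conn s (E - {e}) r (fst e) then tgt s e else fst e)" for e
  define near where "near e = (if conn s (E - {e}) r (fst e) then fst e else tgt s e)" for e
  let ?B = "{e \<in> E. bridge s E e \<and> conn s E r (fst e)}"
  have ins: "insert e (E - {e}) = E" if "e \<in> E" for e using that by auto
  have fn: "conn s (E - {e}) r (near e) \<and> \<not> conn s (E - {e}) r (far e) \<and> conn s E r (far e)"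
    if e: "e \<in> ?B" for e
  proof -
    have c: "conn s (insert e (E - {e})) r (fst e)" using e ins by auto
    have b: "\<not> conn s (E - {e}) (fst e) (tgt s e)" using e by (simp add: bridge_def)
    have "conn s (E - {e}) r (fst e) \<or> conn s (E - {e}) r (tgt s e)" using conn_insert[OF c] by auto
    moreover have "conn s E r (tgt s e)" using e conn_edge[of e E s] conn_trans by blast
    moreover have "\<not> (conn s (E - {e}) r (fst e) \<and> conn s (E - {e}) r (tgt s e))"
      using b conn_sym conn_trans by metis
    ultimately show ?thesis using e unfolding near_def far_def by auto
  qed
  have inj: "inj_on far ?B"
  proof (rule inj_onI, rule ccontr)
    fix e e' assume e: "e \<in> ?B" and e': "e' \<in> ?B" and eq: "far e = far e'" and ne: "e \<noteq> e'"
    \<comment> \<open>Suppose two bridges share the far end. The root reaches \<open>near e\<close>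
      without \<open>e\<close>, hence without both edges it reaches \<open>near e\<close>,
      \<open>near e'\<close> or \<open>far e'\<close>. In the first two cases crossing one bridge
      from its near end would reach the common far end without the other; the third contradicts the
      choice of the far end.\<close>
    let ?U = "E - {e, e'}"
    have i1: "insert e' ?U = E - {e}" and i2: "insert e ?U = E - {e'}" using e e' ne by auto
    have ends: "{near x, far x} = {fst x, tgt s x}" for x unfolding near_def far_def by auto
    have join: "conn s (insert x ?U) (near x) (far x)" for x
      using ends[of x] conn_edge[of x "insert x ?U" s] conn_edge'[of x "insert x ?U" s]
      by (auto simp: doubleton_eq_iff)
    have "conn s (insert e' ?U) r (near e)" using fn[OF e] by (simp add: i1)
    then have "conn s ?U r (near e) \<or> conn s ?U r (fst e') \<or> conn s ?U r (tgt s e')"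
      using conn_insert by blast
    then have "conn s ?U r (near e) \<or> conn s ?U r (near e') \<or> conn s ?U r (far e')"
      using ends[of e'] by (auto simp: doubleton_eq_iff)
    moreover have "\<not> conn s ?U r (near e)"
    proof
      assume "conn s ?U r (near e)"
      then have "conn s (insert e ?U) r (far e)"
        using join[of e] conn_trans conn_mono[of s ?U r "near e" "insert e ?U"] by blast
      then show False using fn[OF e'] by (simp add: i2 eq)
    qed
    moreover have "\<not> conn s ?U r (near e')"
    proof
      assume "conn s ?U r (near e')"
      then have "conn s (insert e' ?U) r (far e')"
        using join[of e'] conn_trans conn_mono[of s ?U r "near e'" "insert e' ?U"] by blast
      then show False using fn[OF e] by (simp add: i1 eq)
    qed
    moreover have "\<not> conn s ?U r (far e')"
      using fn[OF e'] conn_mono[of s ?U r "far e'" "E - {e'}"] by auto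
    ultimately show False by blast
  qed
  have sub: "far ` ?B \<subseteq> {v. conn s E r v}" using fn by auto
  show "finite ?B" using inj_on_finite[OF inj sub fin] .
  show "card ?B \<le> card {v. conn s E r v}" using card_inj_on_le[OF inj sub fin] .
qed

section \<open>Paths without backtracking over bridges\<close>

definition dtail :: "(nat \<Rightarrow> 'g::group_add) \<Rightarrow> ('g \<times> nat) \<times> bool \<Rightarrow> 'g" where
  "dtail s e = (if snd e then fst (fst e) else tgt s (fst e))"

definition dhead :: "(nat \<Rightarrow> 'g::group_add) \<Rightarrow> ('g \<times> nat) \<times> bool \<Rightarrow> 'g" where
  "dhead s e = (if snd e then tgt s (fst e) else fst (fst e))"

text \<open>Paths without backtracking in the graph obtained by contracting the
  \<open>E0\<close>-components, of which only the first and last directed edge are recorded. Only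
  bridges of the whole graph \<open>E\<close> are crossed, so such a path behaves like a path in a
  forest.\<close>

inductive bridge_chain :: "(nat \<Rightarrow> 'g::group_add) \<Rightarrow> ('g \<times> nat) set \<Rightarrow> ('g \<times> nat) set \<Rightarrow>
    ('g \<times> nat) \<times> bool \<Rightarrow> ('g \<times> nat) \<times> bool \<Rightarrow> bool"
  for s E E0 where
  single: "fst e \<in> E - E0 \<Longrightarrow> bridge s E (fst e) \<Longrightarrow> bridge_chain s E E0 e e"
| extend: "bridge_chain s E E0 e0 e \<Longrightarrow> fst e' \<in> E - E0 \<Longrightarrow> bridge s E (fst e') \<Longrightarrow>
    conn s E0 (dhead s e) (dtail s e') \<Longrightarrow> e' \<noteq> (fst e, \<not> snd e) \<Longrightarrow> bridge_chain s E E0 e0 e'"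

lemma bridge_dir:
  assumes "bridge s E (fst e)" shows "\<not> conn s (E - {fst e}) (dtail s e) (dhead s e)"
  using assms conn_sym[of s "E - {fst e}"] unfolding bridge_def dtail_def dhead_def by auto

text \<open>The invariant that survives extension: the last bridge can be approached from the start
  without crossing it, so whatever lies beyond is cut off from the start.\<close>

lemma bridge_chain_conn:
  assumes "bridge_chain s E E0 e0 e" and "E0 \<subseteq> E"
  shows "fst e \<in> E - E0 \<and> bridge s E (fst e) \<and> conn s (E - {fst e}) (dtail s e0) (dtail s e)"
  using assms(1)
proof induction
  case (extend e0 e e')
  define U where "U = E - {fst e, fst e'}"
  have E0U: "E0 \<subseteq> U" using extend assms(2) by (auto simp: U_def)
  have he: "conn s U (dhead s e) (dtail s e')" using extend(4) E0U conn_mono by blast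
  \<comment> \<open>Crossing the same edge again in the same direction would need an
    \<open>E0\<close>-path from its head back to its tail, and the edge would not be a
    bridge.\<close>
  have ne: "fst e \<noteq> fst e'"
  proof
    assume eq: "fst e = fst e'"
    then have "snd e' = snd e" using extend by (cases e, cases e') auto
    then have "dtail s e' = dtail s e" using eq by (simp add: dtail_def)
    then have "conn s U (dhead s e) (dtail s e)" using he by simp
    then have "conn s (E - {fst e}) (dtail s e) (dhead s e)"
      using conn_sym conn_mono[of s U "dtail s e" "dhead s e" "E - {fst e}"] by (auto simp: U_def)
    then show False using bridge_dir extend by blast
  qed
  have i1: "insert (fst e') U = E - {fst e}" "insert (fst e) U = E - {fst e'}"
    using ne extend by (auto simp: U_def)
  have cross: "conn s (insert (fst e) U) (dtail s e) (dhead s e)"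
    using conn_edge[of "fst e" "insert (fst e) U" s] conn_edge'[of "fst e" "insert (fst e) U" s]
    by (simp add: dtail_def dhead_def)
  have sub: "conn s U a b \<Longrightarrow> conn s (insert x U) a b" for a b x using conn_mono[of s U a b "insert x U"] by auto
  have "conn s (insert (fst e') U) (dtail s e0) (dtail s e)" using extend by (simp add: i1)
  from conn_insert[OF this]
  have "conn s U (dtail s e0) (dtail s e) \<or> (conn s U (dtail s e0) (dtail s e'))
      \<or> (conn s U (dtail s e0) (dhead s e') \<and> conn s U (dtail s e') (dtail s e))"
    unfolding dtail_def[of s e'] dhead_def[of s e'] by auto
  \<comment> \<open>Approaching \<open>e\<close> by running backwards over \<open>e'\<close> is
    excluded: the tail of \<open>e'\<close> is joined to the head of \<open>e\<close>, so
    \<open>e\<close> would be bypassed.\<close>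
  moreover have "\<not> conn s U (dtail s e') (dtail s e)"
  proof
    assume "conn s U (dtail s e') (dtail s e)"
    then have "conn s (E - {fst e}) (dtail s e) (dhead s e)"
      using he sub[of _ _ "fst e'"] conn_sym conn_trans unfolding i1 by metis
    then show False using bridge_dir extend by blast
  qed
  ultimately have "conn s U (dtail s e0) (dtail s e) \<or> conn s U (dtail s e0) (dtail s e')" by blast
  then have "conn s (insert (fst e) U) (dtail s e0) (dtail s e')"
    using cross sub[of _ _ "fst e"] he conn_trans by metis
  then show ?case using extend by (simp add: i1)
qed auto

text \<open>Were the last head joined to the start inside \<open>E0\<close>, the approach given by
  \<open>bridge_chain_conn\<close> would close up to a detour around the last bridge.\<close>

lemma bridge_chain_open:
  assumes "bridge_chain s E E0 e0 e" and "E0 \<subseteq> E"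
  shows "\<not> conn s E0 (dtail s e0) (dhead s e)"
proof
  assume c: "conn s E0 (dtail s e0) (dhead s e)"
  note b = bridge_chain_conn[OF assms]
  have "conn s (E - {fst e}) (dtail s e0) (dhead s e)"
    using c b assms(2) conn_mono[of s E0 _ _ "E - {fst e}"] by blast
  then have "conn s (E - {fst e}) (dtail s e) (dhead s e)" using b conn_sym conn_trans by metis
  then show False using bridge_dir b by blast
qed

section \<open>Words tracing paths without backtracking\<close>

lemma reduced_word_Cons:
  "reduced_word (l # l' # w) \<longleftrightarrow> \<not> (fst l = fst l' \<and> snd l \<noteq> snd l') \<and> reduced_word (l' # w)"
  unfolding reduced_word_def by (auto simp: nth_Cons split: nat.splits)

lemma reduced_word_tl: "reduced_word (l # w) \<Longrightarrow> reduced_word w"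
  by (cases w) (auto simp: reduced_word_Cons reduced_word_def)

text \<open>Called with \<open>src\<close> and \<open>dst\<close> exchanged, it gives the head of
  the directed edge.\<close>

definition etail :: "('e \<Rightarrow> 'x) \<Rightarrow> ('e \<Rightarrow> 'x) \<Rightarrow> 'e \<times> bool \<Rightarrow> 'x" where
  "etail src dst f = (if snd f then src (fst f) else dst (fst f))"

text \<open>The counterpart of \<open>bridge_chain\<close> for points of the space, with
  \<open>R\<close>-classes in place of components. It separates the combinatorics of words from
  percolation.\<close>

inductive edge_chain :: "('x \<Rightarrow> 'x \<Rightarrow> bool) \<Rightarrow> ('e \<Rightarrow> 'x) \<Rightarrow> ('e \<Rightarrow> 'x) \<Rightarrow> 'e set \<Rightarrow> 'e \<times> bool \<Rightarrow> 'e \<times> bool \<Rightarrow> bool"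
  for R src dst E where
  single: "fst f \<in> E \<Longrightarrow> edge_chain R src dst E f f"
| extend: "edge_chain R src dst E f0 f \<Longrightarrow> fst f' \<in> E \<Longrightarrow> R (etail dst src f) (etail src dst f') \<Longrightarrow>
    f' \<noteq> (fst f, \<not> snd f) \<Longrightarrow> edge_chain R src dst E f0 f'"

text \<open>The orbits of \<open>T False\<close> stay inside \<open>R\<close>-classes, and \<open>T True\<close> crosses exactly one edge
  between \<open>R\<close>-classes, which determines the point. A reduced word therefore traces a path without
  backtracking in the graph of \<open>R\<close>-classes.\<close>
lemma free_word_act:
  fixes T :: "bool \<Rightarrow> 'x \<Rightarrow> 'x"
  assumes bij: "\<And>i. bij_betw (T i) \<Omega> \<Omega>" "\<And>i. bij_betw (T i) X X" and sub: "\<Omega> \<subseteq> X"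
    and Rrefl: "\<And>x. x \<in> \<Omega> \<Longrightarrow> R x x" and Rsym: "\<And>x y. R x y \<Longrightarrow> R y x"
    and Rtrans: "\<And>x y z. R x y \<Longrightarrow> R y z \<Longrightarrow> R x z"
    and a: "\<And>x. x \<in> \<Omega> \<Longrightarrow> R x (T False x)"
    and aper: "\<And>x k. x \<in> \<Omega> \<Longrightarrow> k > 0 \<Longrightarrow> (T False ^^ k) x \<noteq> x"
    and ed: "\<And>x. x \<in> \<Omega> \<Longrightarrow> ed x \<in> E" "inj_on ed \<Omega>"
      "\<And>x. x \<in> \<Omega> \<Longrightarrow> R x (src (ed x))" "\<And>x. x \<in> \<Omega> \<Longrightarrow> R (dst (ed x)) (T True x)"
    and open_chain: "\<And>f0 f. edge_chain R src dst E f0 f \<Longrightarrow> \<not> R (etail src dst f0) (etail dst src f)"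
    and w: "reduced_word w" "w \<noteq> []" and x: "x \<in> \<Omega>"
  shows "word_act X T w x \<noteq> x"
proof -
  define la where "la s = letter_act X T (False, s)" for s
  define lb where "lb s = letter_act X T (True, s)" for s
  have inv: "inv_into X (T i) (T i y) = y" "T i (inv_into X (T i) y) = y" "inv_into X (T i) y \<in> \<Omega>"
    if "y \<in> \<Omega>" for i y
  proof -
    show "inv_into X (T i) (T i y) = y"
      using bij(2)[of i] that sub by (auto simp: bij_betw_def intro: inv_into_f_f)
    have "y \<in> T i ` \<Omega>" using bij_betw_imp_surj_on[OF bij(1)] that by simp
    then obtain z where z: "z \<in> \<Omega>" "y = T i z" by blast
    have "inv_into X (T i) y = z"
      unfolding z(2) using bij(2)[of i] z sub by (auto simp: bij_betw_def intro: inv_into_f_f)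
    then show "T i (inv_into X (T i) y) = y" "inv_into X (T i) y \<in> \<Omega>" using z by auto
  qed
  have T: "T i y \<in> \<Omega>" if "y \<in> \<Omega>" for i y using bij(1)[of i] that by (auto simp: bij_betw_def)
  have la: "la s y \<in> \<Omega>" "R y (la s y)" if "y \<in> \<Omega>" for s y
  proof -
    show "la s y \<in> \<Omega>" using inv T that by (auto simp: la_def letter_act_def)
    have "R (inv_into X (T False) y) y" using a[OF inv(3)[OF that, of False]] inv(2)[OF that] by simp
    then show "R y (la s y)" using a[OF that] Rsym by (auto simp: la_def letter_act_def)
  qed
  have lan: "(la s ^^ n) y \<in> \<Omega> \<and> R y ((la s ^^ n) y)" if "y \<in> \<Omega>" for s n y
  proof (induction n)
    case (Suc n)
    then show ?case using la[of "(la s ^^ n) y" s] Rtrans[of y "(la s ^^ n) y"] by simp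
  qed (use that Rrefl in simp)
  have an: "(T False ^^ n) y \<in> \<Omega>" if "y \<in> \<Omega>" for n y
    by (induction n) (use that T in auto)
  have cancel: "(T False ^^ n) ((la True ^^ n) y) = y" if "y \<in> \<Omega>" for n y
    using that
  proof (induction n arbitrary: y)
    case (Suc n)
    have "(T False ^^ Suc n) ((la True ^^ Suc n) y) = (T False ^^ n) (T False (la True ((la True ^^ n) y)))"
      by (simp add: funpow_swap1)
    also have "\<dots> = (T False ^^ n) ((la True ^^ n) y)"
      using inv(2)[of "(la True ^^ n) y" False] lan[OF Suc.prems, where s = True and n = n] by (simp add: la_def letter_act_def)
    finally show ?case using Suc by simp
  qed simp
  have laper: "(la s ^^ n) y \<noteq> y" if "y \<in> \<Omega>" "n > 0" for s n y
  proof (cases s)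
    case True
    show ?thesis
    proof
      assume "(la s ^^ n) y = y"
      then have "(T False ^^ n) y = y" using cancel[OF that(1), of n] True by simp
      then show False using aper that by blast
    qed
  next
    case False
    then have "la s = T False" by (simp add: la_def letter_act_def)
    then show ?thesis using aper that by simp
  qed
  have lb: "lb s y \<in> \<Omega>" "lb True (lb False y) = y" "lb False (lb True y) = y" if "y \<in> \<Omega>" for s y
    using inv T that by (auto simp: lb_def letter_act_def)
  have lbinj: "lb True y = lb True z \<Longrightarrow> y = z" if "y \<in> \<Omega>" "z \<in> \<Omega>" for y z
    using lb(3) that by metis
  \<comment> \<open>The directed edge crossed by a \<open>b\<close>-letter that arrives at
    \<open>z\<close>: the inverse of \<open>b\<close> runs backwards over \<open>ed z\<close>, while
    \<open>b\<close> runs forwards over the edge of the point it started from.\<close>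
  define fe where "fe s z = (if s then (ed z, False) else (ed (lb True z), True))" for s z
  have fe: "fst (fe s (lb s y)) \<in> E" "R y (etail src dst (fe s (lb s y)))"
      "R (etail dst src (fe s (lb s y))) (lb s y)" if y: "y \<in> \<Omega>" for s y
  proof -
    have 1: "R (dst (ed (lb True y))) y"
      using ed(4)[OF inv(3)[OF y, of True]] inv(2)[OF y, of True] by (simp add: lb_def letter_act_def)
    have 2: "R (dst (ed y)) (lb False y)" using ed(4)[OF y] by (simp add: lb_def letter_act_def)
    show "fst (fe s (lb s y)) \<in> E" using ed(1) lb y by (auto simp: fe_def)
    show "R y (etail src dst (fe s (lb s y)))"
      using ed(3)[OF y] Rsym[OF 1] lb(2)[OF y] by (auto simp: fe_def etail_def)
    show "R (etail dst src (fe s (lb s y))) (lb s y)"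
      using 2 Rsym[OF ed(3)[OF lb(1)[OF y, of True]]] lb(2)[OF y] by (auto simp: fe_def etail_def)
  qed
  \<comment> \<open>The rightmost letter acts first, so \<open>Cons\<close> adds the next step of
    the path. The state is either a pure power of \<open>a\<close>, or the point \<open>z\<close>
    reached by the latest \<open>b\<close>-letter, the chain up to that crossing, and the power of
    \<open>a\<close> applied since.\<close>
  have main: "reduced_word w \<Longrightarrow>
    (\<exists>n s. w = replicate n (False, s) \<and> word_act X T w x = (la s ^^ n) x) \<or>
    (\<exists>n s s' w' z f0. w = replicate n (False, s) @ (True, s') # w' \<and> word_act X T w x = (la s ^^ n) z \<and>
       z \<in> \<Omega> \<and> edge_chain R src dst E f0 (fe s' z) \<and> R x (etail src dst f0) \<and> R (etail dst src (fe s' z)) z)"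
  proof (induction w)
    case Nil
    show ?case by (rule disjI1, rule exI[of _ 0]) (simp add: word_act_def)
  next
    case (Cons l w)
    obtain i s1 where l: "l = (i, s1)" by force
    have red: "reduced_word w" using Cons.prems reduced_word_tl by blast
    have step: "word_act X T (l # w) x = letter_act X T l (word_act X T w x)" by (simp add: word_act_def)
    consider (pure) n s where "w = replicate n (False, s)" "word_act X T w x = (la s ^^ n) x"
      | (mixed) n s s' w' z f0 where "w = replicate n (False, s) @ (True, s') # w'"
        "word_act X T w x = (la s ^^ n) z" "z \<in> \<Omega>" "edge_chain R src dst E f0 (fe s' z)"
        "R x (etail src dst f0)" "R (etail dst src (fe s' z)) z"
      using Cons.IH[OF red] by blast
    then show ?case
    proof cases
      case pure
      show ?thesis
      proof (cases i)
        case False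
        have "n > 0 \<Longrightarrow> s = s1"
          using Cons.prems pure by (cases n) (auto simp: l False reduced_word_Cons)
        then have "l # w = replicate (Suc n) (False, s1)" "(la s ^^ n) x = (la s1 ^^ n) x"
          using pure False by (cases "n > 0"; simp add: l)+
        moreover have "word_act X T (l # w) x = la s1 (word_act X T w x)"
          unfolding step by (simp add: l False la_def)
        ultimately have "l # w = replicate (Suc n) (False, s1)" "word_act X T (l # w) x = (la s1 ^^ Suc n) x"
          using pure(2) by auto
        then show ?thesis by blast
      next
        case True
        let ?y = "(la s ^^ n) x"
        have y: "?y \<in> \<Omega>" "R x ?y" using lan[OF x] by auto
        have "edge_chain R src dst E (fe s1 (lb s1 ?y)) (fe s1 (lb s1 ?y))"
          by (rule edge_chain.single) (use fe y in auto)
        moreover have "word_act X T (l # w) x = (la s1 ^^ 0) (lb s1 ?y)"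
          unfolding step pure(2) by (simp add: l True lb_def)
        moreover have "l # w = replicate 0 (False, s1) @ (True, s1) # w" by (simp add: l True)
        moreover have "R x (etail src dst (fe s1 (lb s1 ?y)))" using y(2) fe(2)[OF y(1)] Rtrans by blast
        ultimately show ?thesis using fe(3)[OF y(1), of s1] lb(1)[OF y(1), of s1] by blast
      qed
    next
      case mixed
      let ?y = "(la s ^^ n) z"
      have y: "?y \<in> \<Omega>" "R z ?y" using lan[OF mixed(3)] by auto
      show ?thesis
      proof (cases i)
        case False
        have "n > 0 \<Longrightarrow> s = s1"
          using Cons.prems mixed by (cases n) (auto simp: l False reduced_word_Cons)
        then have "l # w = replicate (Suc n) (False, s1) @ (True, s') # w'" "(la s ^^ n) z = (la s1 ^^ n) z"
          using mixed False by (cases "n > 0"; simp add: l)+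
        moreover have "word_act X T (l # w) x = la s1 (word_act X T w x)"
          unfolding step by (simp add: l False la_def)
        ultimately have "l # w = replicate (Suc n) (False, s1) @ (True, s') # w'"
          "word_act X T (l # w) x = (la s1 ^^ Suc n) z"
          using mixed(2) by auto
        then show ?thesis using mixed(3-6) by blast
      next
        case True
        let ?f = "fe s1 (lb s1 ?y)"
        \<comment> \<open>Backtracking means opposite letters over one edge. Since the edge
          determines the point, the power of \<open>a\<close> in between fixes \<open>z\<close>, so
          it is trivial and the two letters were adjacent, against reducedness.\<close>
        have "?f \<noteq> (fst (fe s' z), \<not> snd (fe s' z))"
        proof
          assume eq: "?f = (fst (fe s' z), \<not> snd (fe s' z))"
          then have s': "s' = (\<not> s1)" by (auto simp: fe_def split: if_splits)
          have "?y = z"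
          proof (cases s1)
            case True
            then have "ed (lb True ?y) = ed (lb True z)" using eq s' by (simp add: fe_def)
            then have "lb True ?y = lb True z" using ed(2) lb(1) y(1) mixed(3) by (meson inj_onD)
            then show ?thesis using lbinj y(1) mixed(3) by blast
          next
            case False
            then have "ed ?y = ed z" using eq s' lb(2)[OF y(1)] by (simp add: fe_def)
            then show ?thesis using ed(2) y(1) mixed(3) by (meson inj_onD)
          qed
          then have "n = 0" using laper mixed(3) by blast
          then have "w = (True, \<not> s1) # w'" using mixed s' by simp
          then show False using Cons.prems True by (simp add: l reduced_word_Cons)
        qed
        then have "edge_chain R src dst E f0 ?f"
          using mixed(4,6) y fe[OF y(1), of s1] Rtrans by (blast intro: edge_chain.extend)
        moreover have "word_act X T (l # w) x = (la s1 ^^ 0) (lb s1 ?y)"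
          unfolding step mixed(2) by (simp add: l True lb_def)
        moreover have "l # w = replicate 0 (False, s1) @ (True, s1) # w" by (simp add: l True)
        ultimately show ?thesis using fe(3)[OF y(1), of s1] lb(1)[OF y(1), of s1] mixed(5) by blast
      qed
    qed
  qed
  from main[OF w(1)] show ?thesis
  proof (elim disjE exE conjE)
    fix n s assume "w = replicate n (False, s)" "word_act X T w x = (la s ^^ n) x"
    then show ?thesis using laper[OF x, of n s] w(2) by auto
  next
    fix n s s' w' z f0
    assume z: "word_act X T w x = (la s ^^ n) z" "z \<in> \<Omega>" "edge_chain R src dst E f0 (fe s' z)"
      "R x (etail src dst f0)" "R (etail dst src (fe s' z)) z"
    have "R z ((la s ^^ n) z)" using lan[OF z(2)] by auto
    then show ?thesis using z open_chain[OF z(3)] Rsym Rtrans by metis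
  qed
qed

section \<open>Full groupoids and matchings\<close>

locale pmp_action = prob_space M for M :: "'x measure" +
  fixes act :: "'g::group_add \<Rightarrow> 'x \<Rightarrow> 'x"
  assumes countable_group: "countable (UNIV :: 'g set)"
    and act_measurable [measurable]: "act g \<in> M \<rightarrow>\<^sub>M M"
    and distr_act: "distr M M (act g) = M"
    and act_0: "x \<in> space M \<Longrightarrow> act 0 x = x"
    and act_add: "x \<in> space M \<Longrightarrow> act (g + h) x = act g (act h x)"
begin

lemma act_space [simp]: "x \<in> space M \<Longrightarrow> act g x \<in> space M"
  using act_measurable[of g] by (rule measurable_space)

lemma act_minus [simp]: "x \<in> space M \<Longrightarrow> act (- g) (act g x) = x"
  "x \<in> space M \<Longrightarrow> act g (act (- g) x) = x"
  using act_add[of x "- g" g] act_add[of x g "- g"] act_0 by auto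

lemma act_image:
  assumes "A \<in> sets M"
  shows "act g ` A = act (- g) -` A \<inter> space M" "act g ` A \<in> sets M" "prob (act g ` A) = prob A"
    "emeasure M (act g ` A) = emeasure M A"
proof -
  have A: "A \<subseteq> space M" using assms sets.sets_into_space by blast
  show e: "act g ` A = act (- g) -` A \<inter> space M"
  proof safe
    fix x assume "act (- g) x \<in> A" "x \<in> space M"
    then show "x \<in> act g ` A" by (metis act_minus(2) imageI)
  qed (use A in auto)
  show "act g ` A \<in> sets M" unfolding e by (rule measurable_sets[OF act_measurable assms])
  show "emeasure M (act g ` A) = emeasure M A"
    unfolding e using emeasure_distr[OF act_measurable[of "- g"] assms] by (simp add: distr_act)
  then show "prob (act g ` A) = prob A" by (simp add: measure_def)
qed

text \<open>Piecewise translations by group elements. Partial isomorphisms of the orbit relation are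
  treated as total maps of this kind that are injective on the set of interest, so composition and
  countable gluing need no domains.\<close>

definition pw :: "('x \<Rightarrow> 'x) \<Rightarrow> bool" where
  "pw f \<longleftrightarrow> (\<exists>c \<in> M \<rightarrow>\<^sub>M count_space UNIV. \<forall>x\<in>space M. f x = act (c x) x)"

lemma pw_act: "pw (act g)"
  unfolding pw_def by (intro bexI[of _ "\<lambda>_. g"]) auto

lemma pw_id: "pw (\<lambda>x. x)"
  unfolding pw_def by (intro bexI[of _ "\<lambda>_. 0"]) (auto simp: act_0)

lemma pw_space: "pw f \<Longrightarrow> x \<in> space M \<Longrightarrow> f x \<in> space M"
  by (auto simp: pw_def)

lemma pw_orbit: "pw f \<Longrightarrow> x \<in> space M \<Longrightarrow> \<exists>g. f x = act g x"
  by (auto simp: pw_def)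

lemma measurable_count_space_group:
  assumes "\<And>g. d -` {g :: 'g} \<inter> space M \<in> sets M"
  shows "d \<in> M \<rightarrow>\<^sub>M count_space UNIV"
proof (rule measurableI)
  fix A :: "'g set"
  have "d -` A \<inter> space M = (\<Union>g\<in>A. d -` {g} \<inter> space M)" by auto
  also have "\<dots> \<in> sets M"
    by (rule sets.countable_UN'[OF countable_subset[OF subset_UNIV countable_group]]) (use assms in auto)
  finally show "d -` A \<inter> space M \<in> sets M" .
qed simp

lemma measurable_count_compose:
  assumes "\<And>i. f i \<in> M \<rightarrow>\<^sub>M count_space UNIV" "c \<in> M \<rightarrow>\<^sub>M count_space UNIV" "countable (UNIV :: 'i set)"
  shows "(\<lambda>x. f (c x :: 'i) x) \<in> M \<rightarrow>\<^sub>M count_space UNIV"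
  by (rule measurable_compose_countable'[OF _ _ assms(3)]) (use assms in auto)

lemma pw_measurable: "pw f \<Longrightarrow> f \<in> M \<rightarrow>\<^sub>M M"
proof -
  assume "pw f"
  then obtain c where c: "c \<in> M \<rightarrow>\<^sub>M count_space UNIV" "\<And>x. x \<in> space M \<Longrightarrow> f x = act (c x) x"
    by (auto simp: pw_def)
  have "(\<lambda>x. act (c x) x) \<in> M \<rightarrow>\<^sub>M M"
    by (rule measurable_compose_countable'[OF _ c(1) countable_group]) simp
  then show ?thesis using c(2) by (simp cong: measurable_cong)
qed

lemma pw_countable:
  assumes f: "\<And>i::'i. pw (f i)" and m: "m \<in> M \<rightarrow>\<^sub>M count_space UNIV" and "countable (UNIV :: 'i set)"
  shows "pw (\<lambda>x. f (m x) x)"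
proof -
  have "\<forall>i. \<exists>c \<in> M \<rightarrow>\<^sub>M count_space UNIV. \<forall>x\<in>space M. f i x = act (c x) x"
    using f by (simp add: pw_def)
  then obtain c where c: "\<And>i. c i \<in> M \<rightarrow>\<^sub>M count_space UNIV" "\<And>i x. x \<in> space M \<Longrightarrow> f i x = act (c i x) x"
    by metis
  show ?thesis unfolding pw_def
    by (intro bexI[of _ "\<lambda>x. c (m x) x"]) (use c measurable_count_compose[OF c(1) m assms(3)] in auto)
qed

lemma pw_if:
  assumes "pw f" "pw g" "A \<in> sets M"
  shows "pw (\<lambda>x. if x \<in> A then f x else g x)"
proof -
  have "pw (\<lambda>x. (\<lambda>b. if b then f else g) (x \<in> A) x)"
    by (rule pw_countable) (use assms in auto)
  moreover have "(\<lambda>x. (if x \<in> A then f else g) x) = (\<lambda>x. if x \<in> A then f x else g x)" by auto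
  ultimately show ?thesis by simp
qed

lemma pw_comp:
  assumes "pw f" "pw g"
  shows "pw (\<lambda>x. f (g x))"
proof -
  obtain c where c: "c \<in> M \<rightarrow>\<^sub>M count_space UNIV" "\<And>x. x \<in> space M \<Longrightarrow> f x = act (c x) x"
    using assms by (auto simp: pw_def)
  obtain d where d: "d \<in> M \<rightarrow>\<^sub>M count_space UNIV" "\<And>x. x \<in> space M \<Longrightarrow> g x = act (d x) x"
    using assms by (auto simp: pw_def)
  have cg: "(\<lambda>x. c (g x)) \<in> M \<rightarrow>\<^sub>M count_space UNIV"
    using measurable_compose[OF pw_measurable[OF assms(2)] c(1)] by simp
  have "(\<lambda>x. c (g x) + d x) \<in> M \<rightarrow>\<^sub>M count_space UNIV"
    by (rule measurable_count_compose[where c = d, OF _ d(1) countable_group])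
      (rule measurable_compose[OF cg], simp)
  moreover have "f (g x) = act (c (g x) + d x) x" if "x \<in> space M" for x
    using c(2)[OF pw_space[OF assms(2) that]] d(2)[OF that] act_add[OF that, of "c (g x)" "d x"] by metis
  ultimately show ?thesis
    unfolding pw_def by (intro bexI[of _ "\<lambda>x. c (g x) + d x"] ballI)
qed

text \<open>Cut \<open>A\<close> along the countably many values of the translating element: on each
  piece \<open>f\<close> is one group element, and injectivity keeps the images disjoint.\<close>

lemma pw_image_emeasure:
  assumes f: "pw f" and A: "A \<in> sets M" and inj: "inj_on f A"
  shows "f ` A \<in> sets M" "emeasure M (f ` A) = emeasure M A"
proof -
  have As: "A \<subseteq> space M" using A sets.sets_into_space by blast
  obtain c where c: "c \<in> M \<rightarrow>\<^sub>M count_space UNIV" "\<And>x. x \<in> space M \<Longrightarrow> f x = act (c x) x"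
    using f by (auto simp: pw_def)
  define Ag where "Ag g = A \<inter> (c -` {g} \<inter> space M)" for g
  have Ag: "Ag g \<in> sets M" for g unfolding Ag_def using A measurable_sets[OF c(1), of "{g}"] by auto
  have AU: "A = (\<Union>g\<in>UNIV. Ag g)" using As by (auto simp: Ag_def)
  have img: "f ` Ag g = act g ` Ag g" for g
    by (rule image_cong) (use c(2) in \<open>auto simp: Ag_def\<close>)
  have fA: "f ` A = (\<Union>g\<in>UNIV. act g ` Ag g)" by (subst AU) (auto simp: image_UN img)
  show "f ` A \<in> sets M" unfolding fA by (rule sets.countable_UN'[OF countable_group]) (use act_image Ag in auto)
  have d1: "disjoint_family_on Ag UNIV" by (auto simp: disjoint_family_on_def Ag_def)
  have d2: "disjoint_family_on (\<lambda>g. act g ` Ag g) UNIV"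
    unfolding disjoint_family_on_def
  proof (intro ballI impI)
    fix g h :: 'g assume "g \<noteq> h"
    then have "Ag g \<inter> Ag h = {}" "Ag g \<subseteq> A" "Ag h \<subseteq> A" by (auto simp: Ag_def)
    then show "act g ` Ag g \<inter> act h ` Ag h = {}"
      unfolding img[symmetric] using inj by (metis image_empty inj_on_image_Int)
  qed
  have "emeasure M (f ` A) = (\<integral>\<^sup>+g. emeasure M (act g ` Ag g) \<partial>count_space UNIV)"
    unfolding fA by (rule emeasure_UN_countable[OF _ countable_group d2]) (use act_image Ag in auto)
  also have "\<dots> = (\<integral>\<^sup>+g. emeasure M (Ag g) \<partial>count_space UNIV)"
    by (rule nn_integral_cong) (use act_image Ag in auto)
  also have "\<dots> = emeasure M (\<Union>g\<in>UNIV. Ag g)"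
    by (rule emeasure_UN_countable[symmetric, OF _ countable_group d1]) (use Ag in auto)
  also have "\<dots> = emeasure M A" by (rule arg_cong[OF AU[symmetric]])
  finally show "emeasure M (f ` A) = emeasure M A" .
qed

lemma pw_image_prob:
  assumes "pw f" "A \<in> sets M" "inj_on f A"
  shows "prob (f ` A) = prob A"
  using pw_image_emeasure[OF assms] by (simp add: measure_def)

text \<open>Translate by the inverse element on the image, and by \<open>0\<close> elsewhere to stay
  total.\<close>

lemma pw_inverse:
  assumes f: "pw f" and A: "A \<in> sets M" and inj: "inj_on f A"
  shows "\<exists>h. pw h \<and> (\<forall>x\<in>A. h (f x) = x)"
proof -
  have As: "A \<subseteq> space M" using A sets.sets_into_space by blast
  obtain c where c: "c \<in> M \<rightarrow>\<^sub>M count_space UNIV" "\<And>x. x \<in> space M \<Longrightarrow> f x = act (c x) x"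
    using f by (auto simp: pw_def)
  define h where "h y = (if y \<in> f ` A then inv_into A f y else y)" for y
  define d where "d y = (if y \<in> f ` A then - c (inv_into A f y) else 0)" for y
  have hf: "h (f x) = x" if "x \<in> A" for x using that inj by (simp add: h_def)
  have "d -` {g} \<inter> space M \<in> sets M" for g
  proof -
    define Ag where "Ag = A \<inter> (c -` {- g} \<inter> space M)"
    have Ag: "Ag \<in> sets M" unfolding Ag_def using A measurable_sets[OF c(1), of "{- g}"] by auto
    have "inj_on f Ag" using inj by (auto simp: Ag_def inj_on_def)
    then have m: "f ` Ag \<in> sets M" using pw_image_emeasure[OF f Ag] by blast
    have "d -` {g} \<inter> space M = f ` Ag \<union> (if g = 0 then space M - f ` A else {})"
    proof (rule set_eqI)
      fix y
      show "y \<in> d -` {g} \<inter> space M \<longleftrightarrow> y \<in> f ` Ag \<union> (if g = 0 then space M - f ` A else {})"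
      proof (cases "y \<in> f ` A")
        case True
        then obtain x where x: "x \<in> A" "y = f x" by blast
        then have iv: "inv_into A f y = x" using inj by simp
        have "y \<in> space M" using x As pw_space[OF f] by auto
        then have "y \<in> d -` {g} \<inter> space M \<longleftrightarrow> c x = - g" using True iv by (auto simp: d_def)
        also have "\<dots> \<longleftrightarrow> x \<in> Ag" using x As by (auto simp: Ag_def)
        also have "\<dots> \<longleftrightarrow> y \<in> f ` Ag"
          using x inj by (auto simp: Ag_def inj_on_def)
        finally show ?thesis using True by auto
      next
        case False
        then show ?thesis by (auto simp: d_def Ag_def)
      qed
    qed
    then show ?thesis using m pw_image_emeasure(1)[OF f A inj] by auto
  qed
  then have d: "d \<in> M \<rightarrow>\<^sub>M count_space UNIV"
    by (intro measurable_count_space_group) auto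
  have "h y = act (d y) y" if y: "y \<in> space M" for y
  proof (cases "y \<in> f ` A")
    case True
    then obtain x where x: "x \<in> A" "y = f x" by blast
    then have "inv_into A f y = x" using inj by simp
    then have "h y = x" "d y = - c x" using True by (auto simp: h_def d_def)
    moreover have "x \<in> space M" "y = act (c x) x" using x c(2)[of x] As by auto
    ultimately show ?thesis by simp
  next
    case False
    then show ?thesis using y by (simp add: h_def d_def act_0)
  qed
  then have "pw h" using d unfolding pw_def by (intro bexI[of _ d] ballI)
  then show ?thesis using hf by blast
qed

lemma pw_nn_integral:
  assumes f: "pw f" and A: "A \<in> sets M" and inj: "inj_on f A" and G: "G \<in> borel_measurable M"
  shows "(\<integral>\<^sup>+y. G y * indicator (f ` A) y \<partial>M) = (\<integral>\<^sup>+x. G (f x) * indicator A x \<partial>M)"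
proof -
  have fm: "f \<in> M \<rightarrow>\<^sub>M M" by (rule pw_measurable[OF f])
  have fA: "f ` A \<in> sets M" using pw_image_emeasure[OF f A inj] by blast
  have "density M (indicator (f ` A)) = distr (density M (indicator A)) M f"
  proof (rule measure_eqI)
    fix B assume "B \<in> sets (density M (indicator (f ` A)))"
    then have B: "B \<in> sets M" by simp
    define C where "C = A \<inter> (f -` B \<inter> space M)"
    have C: "C \<in> sets M" unfolding C_def using A measurable_sets[OF fm B] by auto
    have "inj_on f C" using inj by (auto simp: C_def inj_on_def)
    then have e: "emeasure M (f ` C) = emeasure M C" using pw_image_emeasure[OF f C] by blast
    have "A \<subseteq> space M" using A sets.sets_into_space by blast
    then have fC: "f ` C = f ` A \<inter> B" by (auto simp: C_def)
    have "emeasure (density M (indicator (f ` A))) B = emeasure M (f ` A \<inter> B)"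
    proof -
      have "emeasure (density M (indicator (f ` A))) B = (\<integral>\<^sup>+x. indicator (f ` A) x * indicator B x \<partial>M)"
        using fA B by (subst emeasure_density) auto
      also have "\<dots> = emeasure M (f ` A \<inter> B)"
        using fA B by (simp add: indicator_inter_arith[symmetric])
      finally show ?thesis .
    qed
    also have "\<dots> = emeasure M C" using e fC by simp
    also have "\<dots> = emeasure (distr (density M (indicator A)) M f) B"
    proof -
      have "emeasure (distr (density M (indicator A)) M f) B = emeasure (density M (indicator A)) (f -` B \<inter> space M)"
        using fm B by (subst emeasure_distr) auto
      also have "\<dots> = (\<integral>\<^sup>+x. indicator A x * indicator (f -` B \<inter> space M) x \<partial>M)"
        using A measurable_sets[OF fm B] by (subst emeasure_density) auto
      also have "\<dots> = emeasure M C"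
        using C unfolding C_def by (simp add: indicator_inter_arith[symmetric])
      finally show ?thesis by simp
    qed
    finally show "emeasure (density M (indicator (f ` A))) B = emeasure (distr (density M (indicator A)) M f) B" .
  qed simp
  then have "(\<integral>\<^sup>+y. G y \<partial>density M (indicator (f ` A))) = (\<integral>\<^sup>+y. G y \<partial>distr (density M (indicator A)) M f)" by simp
  also have "\<dots> = (\<integral>\<^sup>+x. G (f x) \<partial>density M (indicator A))"
    using fm G by (subst nn_integral_distr) auto
  finally show ?thesis
    using fA A G fm by (simp add: nn_integral_density mult.commute)
qed

text \<open>Invariance is what makes these sets disposable: every piecewise translation preserves
  them, so bijections stay bijections when more of them are removed.\<close>

definition null_inv :: "'x set \<Rightarrow> bool" where
  "null_inv N \<longleftrightarrow> N \<in> null_sets M \<and> (\<forall>x\<in>N. \<forall>g. act g x \<in> N)"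

lemma null_inv_saturate:
  assumes "Z \<in> null_sets M"
  shows "\<exists>N. null_inv N \<and> Z \<subseteq> N"
proof -
  have Z: "Z \<in> sets M" "Z \<subseteq> space M" "prob Z = 0"
    using assms sets.sets_into_space by (auto simp: null_sets_def measure_def)
  let ?N = "\<Union>g\<in>UNIV. act g ` Z"
  have "act g ` Z \<in> null_sets M" for g
    using act_image[OF Z(1), of g] assms by (simp add: null_sets_def)
  then have "?N \<in> null_sets M" by (intro null_sets_UN'[OF countable_group]) auto
  moreover have "\<forall>x\<in>?N. \<forall>g. act g x \<in> ?N"
  proof safe
    fix h g x assume "x \<in> Z"
    then have "act g (act h x) = act (g + h) x" using Z act_add by auto
    then show "act g (act h x) \<in> ?N" using \<open>x \<in> Z\<close> by auto
  qed
  moreover have "Z \<subseteq> ?N"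
  proof
    fix x assume "x \<in> Z"
    then have "x = act 0 x" using Z act_0 by auto
    then show "x \<in> ?N" using \<open>x \<in> Z\<close> by auto
  qed
  ultimately show ?thesis unfolding null_inv_def by blast
qed

lemma null_inv_UN:
  assumes "countable I" "\<And>i. i \<in> I \<Longrightarrow> null_inv (N i)"
  shows "null_inv (\<Union>i\<in>I. N i)"
  using assms unfolding null_inv_def by (auto intro!: null_sets_UN')

lemma null_inv_Un: "null_inv N \<Longrightarrow> null_inv N' \<Longrightarrow> null_inv (N \<union> N')"
  unfolding null_inv_def by auto

lemma null_inv_pw:
  assumes "null_inv N" "pw f" "x \<in> space M"
  shows "f x \<in> N \<longleftrightarrow> x \<in> N"
proof -
  obtain g where g: "f x = act g x" using pw_orbit[OF assms(2,3)] by blast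
  then have "x = act (- g) (f x)" using assms(3) by simp
  then show ?thesis using assms(1) g unfolding null_inv_def by metis
qed

lemma null_inv_bij_mono:
  assumes "null_inv N'" "N \<subseteq> N'" "pw f" "bij_betw f (A - N) (B - N)" "A \<subseteq> space M" "B \<subseteq> space M"
  shows "bij_betw f (A - N') (B - N')"
proof -
  have nn: "f x \<in> N' \<longleftrightarrow> x \<in> N'" if "x \<in> A" for x using null_inv_pw assms that by blast
  have "inj_on f (A - N')" using assms(2,4) unfolding bij_betw_def by (auto intro: inj_on_subset)
  moreover have "f ` (A - N') = B - N'"
  proof safe
    fix x assume "x \<in> A" "x \<notin> N'"
    then show "f x \<in> B" using assms(2,4) by (auto simp: bij_betw_def)
  next
    fix y assume y: "y \<in> B" "y \<notin> N'"
    then have "y \<in> f ` (A - N)" using assms(2,4) by (auto simp: bij_betw_def)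
    then show "y \<in> f ` (A - N')" using y nn by auto
  qed (use nn in auto)
  ultimately show ?thesis by (simp add: bij_betw_def)
qed

end

text \<open>A measurable ergodic subrelation of the orbit relation with three aids: \<open>U\<close>
  splits sets into parts of any size, \<open>N0\<close> contains the points with non-trivial
  stabilizer, and the countable pi-system \<open>Es\<close> reduces ergodicity of a transformation
  to countably many tests.\<close>

locale ergodic_relation = pmp_action M act for M :: "'x measure" and act :: "'g::group_add \<Rightarrow> 'x \<Rightarrow> 'x" +
  fixes R :: "'x \<Rightarrow> 'x \<Rightarrow> bool" and U :: "'x \<Rightarrow> real" and N0 :: "'x set" and Es :: "nat \<Rightarrow> 'x set"
  assumes R_refl: "x \<in> space M \<Longrightarrow> R x x" and R_sym: "R x y \<Longrightarrow> R y x"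
    and R_trans: "R x y \<Longrightarrow> R y z \<Longrightarrow> R x z"
    and R_orbit: "R x y \<Longrightarrow> x \<in> space M \<and> (\<exists>g. y = act g x)"
    and R_measurable: "{x \<in> space M. R x (act g x)} \<in> sets M"
    and R_ergodic: "\<And>D. D \<in> sets M \<Longrightarrow> (\<And>x y. x \<in> D \<Longrightarrow> R x y \<Longrightarrow> y \<in> D) \<Longrightarrow> prob D = 0 \<or> prob D = 1"
    and U_measurable [measurable]: "U \<in> borel_measurable M"
    and U_atomless: "prob {x \<in> space M. U x = u} = 0"
    and N0: "null_inv N0" "\<And>x g. x \<in> space M \<Longrightarrow> x \<notin> N0 \<Longrightarrow> act g x = x \<Longrightarrow> g = 0"
    and Es: "sets M = sigma_sets (space M) (range Es)" "Int_stable (range Es)" "range Es \<subseteq> Pow (space M)"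
begin

text \<open>Greedy matching: at stage \<open>n\<close>, every remaining point of \<open>A\<close>
  which the \<open>n\<close>-th group element takes to a remaining point of \<open>B\<close> in the
  same class is matched. The unmatched parts have equal measure; if it were positive, ergodicity
  would provide a related pair of unmatched points, and this pair would have been matched at its
  stage.\<close>

lemma matching:
  assumes A: "A \<in> sets M" and B: "B \<in> sets M" and eq: "prob A = prob B"
  shows "\<exists>f N. pw f \<and> null_inv N \<and> bij_betw f (A - N) (B - N) \<and> (\<forall>x\<in>A - N. R x (f x))"
proof -
  define e :: "nat \<Rightarrow> 'g" where "e = from_nat_into UNIV"
  have e: "\<exists>n. e n = g" for g
    unfolding e_def using from_nat_into_surj[OF countable_group UNIV_I] by metis
  define D where "D n P = {x \<in> fst P. act (e n) x \<in> snd P \<and> R x (act (e n) x)}" for n and P :: "'x set \<times> 'x set"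
  define AB where "AB = rec_nat (A, B) (\<lambda>n P. (fst P - D n P, snd P - act (e n) ` D n P))"
  define An where "An n = fst (AB n)" for n
  define Bn where "Bn n = snd (AB n)" for n
  define Dn where "Dn n = D n (AB n)" for n
  have A0: "An 0 = A" "Bn 0 = B" by (simp_all add: An_def Bn_def AB_def)
  have AS: "An (Suc n) = An n - Dn n" "Bn (Suc n) = Bn n - act (e n) ` Dn n" for n
    by (simp_all add: An_def Bn_def AB_def Dn_def)
  have Dn: "Dn n = {x \<in> An n. act (e n) x \<in> Bn n \<and> R x (act (e n) x)}" for n
    by (simp add: Dn_def D_def An_def Bn_def)
  have sp: "A \<subseteq> space M" "B \<subseteq> space M" using A B sets.sets_into_space by auto
  have meas: "An n \<in> sets M \<and> Bn n \<in> sets M \<and> Dn n \<in> sets M" for n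
  proof (induction n)
    have *: "Dn n \<in> sets M" if "An n \<in> sets M" "Bn n \<in> sets M" for n
    proof -
      have "An n \<subseteq> space M" using that sets.sets_into_space by auto
      then have "Dn n = An n \<inter> (act (e n) -` Bn n \<inter> space M) \<inter> {x \<in> space M. R x (act (e n) x)}"
        unfolding Dn by auto
      then show ?thesis using that R_measurable measurable_sets[OF act_measurable that(2)] by auto
    qed
    { case 0 show ?case using * A B A0 by auto }
    { case (Suc n)
      then have "An (Suc n) \<in> sets M" "Bn (Suc n) \<in> sets M" using act_image by (auto simp: AS)
      then show ?case using * by auto }
  qed
  have mono: "An n \<subseteq> An m" "Bn n \<subseteq> Bn m" if "m \<le> n" for m n
    using lift_Suc_antimono_le[of An m n] lift_Suc_antimono_le[of Bn m n] that AS by auto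
  have AnA: "An n \<subseteq> A" "Bn n \<subseteq> B" for n using mono[of 0 n] A0 by auto
  have Ddisj: "Dn m \<inter> Dn n = {}" if "m < n" for m n
  proof -
    have "Dn n \<subseteq> An n" using Dn by blast
    also have "\<dots> \<subseteq> An m - Dn m" using mono(1)[of "Suc m" n] that AS(1)[of m] by simp
    finally show ?thesis by blast
  qed
  have Edisj: "act (e m) ` Dn m \<inter> act (e n) ` Dn n = {}" if "m < n" for m n
  proof -
    have "act (e n) ` Dn n \<subseteq> Bn n" using Dn by blast
    also have "\<dots> \<subseteq> Bn m - act (e m) ` Dn m" using mono(2)[of "Suc m" n] that AS(2)[of m] by simp
    finally show ?thesis by blast
  qed
  define idx where "idx x = (LEAST n. x \<in> Dn n)" for x
  define DD where "DD = (\<Union>n. Dn n)"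
  have DDm: "DD \<in> sets M" using meas by (auto simp: DD_def)
  have idx: "idx x = n" if "x \<in> Dn n" for x n
    unfolding idx_def
  proof (rule Least_equality)
    fix m assume "x \<in> Dn m"
    then show "n \<le> m" using Ddisj[of m n] that by (meson disjoint_iff not_le)
  qed fact
  have idxm: "idx \<in> M \<rightarrow>\<^sub>M count_space UNIV"
  proof -
    have [measurable]: "Dn n \<in> sets M" for n using meas by blast
    show ?thesis unfolding idx_def by measurable
  qed
  define f where "f x = act (e (idx x)) x" for x
  have pwf: "pw f" unfolding f_def
    by (rule pw_countable[where f = "\<lambda>i. act (e i)"]) (use pw_act idxm in auto)
  have fD: "f x = act (e n) x" if "x \<in> Dn n" for x n using idx[OF that] by (simp add: f_def)
  have Dsp: "Dn n \<subseteq> space M" for n using meas sets.sets_into_space by auto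
  have inj: "inj_on f DD"
  proof (rule inj_onI)
    fix x y assume "x \<in> DD" "y \<in> DD" and fxy: "f x = f y"
    then obtain m n where mn: "x \<in> Dn m" "y \<in> Dn n" by (auto simp: DD_def)
    have xy: "act (e m) x = act (e n) y" using fxy mn fD by simp
    have "m = n"
      using Edisj[of m n] Edisj[of n m] mn xy by (metis disjoint_iff imageI linorder_neqE_nat)
    then have "act (- e n) (act (e n) x) = act (- e n) (act (e n) y)" using xy by simp
    then show "x = y" using mn \<open>m = n\<close> Dsp by (simp add: subset_iff)
  qed
  have DDA: "DD \<subseteq> A" using AnA Dn by (auto simp: DD_def)
  have fDB: "f ` DD \<subseteq> B" using AnA Dn fD by (auto simp: DD_def subset_iff)
  have fDm: "f ` DD \<in> sets M" "prob (f ` DD) = prob DD"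
    using pw_image_emeasure(1)[OF pwf DDm inj] pw_image_prob[OF pwf DDm inj] by auto
  have inA: "x \<in> An n" if "x \<in> A" "x \<notin> DD" for x n
    by (induction n) (use that A0 AS in \<open>auto simp: DD_def\<close>)
  have inB: "y \<in> Bn n" if "y \<in> B" "y \<notin> f ` DD" for y n
  proof (induction n)
    case (Suc n)
    have "y \<notin> act (e n) ` Dn n"
    proof
      assume "y \<in> act (e n) ` Dn n"
      then obtain x where "x \<in> Dn n" "y = f x" using fD by auto
      then show False using that by (auto simp: DD_def)
    qed
    then show ?case using Suc AS by auto
  qed (use that A0 in auto)
  have pe: "prob (A - DD) = prob (B - f ` DD)"
    using finite_measure_Diff[OF A DDm DDA] finite_measure_Diff[OF B fDm(1) fDB] fDm(2) eq by simp
  have "prob (A - DD) = 0"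
  proof (rule ccontr)
    assume pos: "prob (A - DD) \<noteq> 0"
    \<comment> \<open>The \<open>R\<close>-saturation of the unmatched part of \<open>A\<close>,
      written as a countable union for measurability.\<close>
    define S where "S = (\<Union>g\<in>UNIV. {x \<in> space M. R x (act g x)} \<inter> (act g -` (A - DD) \<inter> space M))"
    have Sm: "S \<in> sets M" unfolding S_def
      by (rule sets.countable_UN'[OF countable_group]) (use A DDm R_measurable measurable_sets[OF act_measurable] in auto)
    have S: "x \<in> S \<longleftrightarrow> (\<exists>y\<in>A - DD. R x y)" for x
      using R_orbit unfolding S_def by auto
    have "A - DD \<subseteq> S" using S R_refl sp by blast
    then have "prob (A - DD) \<le> prob S" by (rule finite_measure_mono[OF _ Sm])
    moreover have "prob S = 0 \<or> prob S = 1" by (rule R_ergodic[OF Sm]) (use S R_sym R_trans in blast)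
    ultimately have "prob S = 1" using pos by (metis measure_nonneg antisym)
    then have "prob (space M - S) = 0" using prob_compl[OF Sm] by simp
    moreover have "prob (B - f ` DD) \<noteq> 0" using pos pe by simp
    ultimately have "\<not> B - f ` DD \<subseteq> space M - S"
      using finite_measure_mono[of "B - f ` DD" "space M - S"] Sm by (metis measure_nonneg antisym sets.compl_sets)
    then obtain y where y: "y \<in> B" "y \<notin> f ` DD" "y \<in> S" using sp by auto
    then obtain x where x: "x \<in> A" "x \<notin> DD" "R y x" using S by auto
    obtain g where g: "y = act g x" using R_orbit R_sym[OF x(3)] by auto
    obtain n where n: "e n = g" using e by blast
    have "x \<in> Dn n" unfolding Dn using inA[OF x(1,2), of n] inB[OF y(1,2), of n] g n R_sym[OF x(3)] by simp
    then show False using x by (auto simp: DD_def)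
  qed
  then have "A - DD \<in> null_sets M" "B - f ` DD \<in> null_sets M"
    using pe A B DDm fDm by (auto simp: null_sets_def emeasure_eq_measure)
  then have "(A - DD) \<union> (B - f ` DD) \<in> null_sets M" by auto
  then obtain N where N: "null_inv N" "(A - DD) \<union> (B - f ` DD) \<subseteq> N" using null_inv_saturate by blast
  have "bij_betw f (DD - N) (f ` DD - N)"
    by (rule null_inv_bij_mono[OF N(1) empty_subsetI pwf])
       (use inj Dsp sets.sets_into_space[OF fDm(1)] in \<open>auto simp: bij_betw_def DD_def\<close>)
  moreover have "DD - N = A - N" "f ` DD - N = B - N" using DDA fDB N(2) by blast+
  ultimately have "bij_betw f (A - N) (B - N)" by simp
  moreover have "R x (f x)" if "x \<in> A - N" for x
  proof -
    have "x \<in> DD" using that N by auto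
    then obtain n where "x \<in> Dn n" by (auto simp: DD_def)
    then show ?thesis using fD Dn by auto
  qed
  ultimately show ?thesis using pwf N(1) by blast
qed

end

section \<open>Ergodic single transformations\<close>

context ergodic_relation begin

lemma distribution_function:
  assumes A: "A \<in> sets M" and F: "F \<in> borel_measurable M"
  defines "N \<equiv> distr (restrict_space M A) borel F"
  shows "finite_borel_measure N" "cdf N s = prob {x \<in> A. F x \<le> s}" "measure N {..<s} = prob {x \<in> A. F x < s}"
    "measure N {s} = prob {x \<in> A. F x = s}" "measure N (space N) = prob A"
proof -
  have As: "A \<subseteq> space M" using A sets.sets_into_space by blast
  have Fr: "F \<in> borel_measurable (restrict_space M A)" using F by (rule measurable_restrict_space1)
  have sp: "space (restrict_space M A) = A" using As by (auto simp: space_restrict_space)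
  interpret fin: finite_measure "restrict_space M A"
    by (rule finite_measure_restrict_space) (use A in \<open>auto intro: finite_measure_axioms\<close>)
  show "finite_borel_measure N" unfolding N_def
    by (intro finite_borel_measure.intro fin.finite_measure_distr Fr finite_borel_measure_axioms.intro) simp
  have m: "measure N B = prob {x \<in> A. F x \<in> B}" if "B \<in> sets borel" for B
  proof -
    have "measure N B = measure (restrict_space M A) (F -` B \<inter> A)"
      unfolding N_def using measure_distr[OF Fr that] sp by simp
    also have "F -` B \<inter> A = {x \<in> A. F x \<in> B}" by auto
    also have "measure (restrict_space M A) {x \<in> A. F x \<in> B} = prob {x \<in> A. F x \<in> B}"
      by (rule measure_restrict_space) (use A As in \<open>auto simp: Int_absorb2\<close>)
    finally show ?thesis .
  qed
  show "cdf N s = prob {x \<in> A. F x \<le> s}" using m[of "{..s}"] by (simp add: cdf_def)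
  show "measure N {..<s} = prob {x \<in> A. F x < s}" using m[of "{..<s}"] by simp
  show "measure N {s} = prob {x \<in> A. F x = s}" using m[of "{s}"] by simp
  show "measure N (space N) = prob A" using m[of UNIV] by (simp add: N_def)
qed

text \<open>The distribution function of \<open>U\<close> on \<open>A\<close> is continuous, so the
  intermediate value theorem applies.\<close>

lemma subset_of_prob:
  assumes A: "A \<in> sets M" and r: "0 \<le> r" "r \<le> prob A"
  shows "\<exists>B\<in>sets M. B \<subseteq> A \<and> prob B = r"
proof -
  consider "r = 0" | "r = prob A" | "0 < r" "r < prob A" using r by linarith
  then show ?thesis
  proof cases
    case 3
    define N where "N = distr (restrict_space M A) borel U"
    note N = distribution_function[OF A U_measurable, folded N_def]
    interpret N: finite_borel_measure N by (rule N)
    have As: "A \<subseteq> space M" using A sets.sets_into_space by blast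
    have "prob {x \<in> A. U x = s} \<le> prob {x \<in> space M. U x = s}" for s
      by (rule finite_measure_mono) (use As in auto)
    then have "measure N {s} = 0" for s using U_atomless[of s] N(4)[of s] by (metis antisym measure_nonneg)
    then have cont: "isCont (cdf N) s" for s by (simp add: N.isCont_cdf)
    obtain a where a: "cdf N a < r"
      using order_tendstoD(2)[OF N.cdf_lim_at_bot 3(1)] by (metis eventually_at_bot_linorder order_refl)
    obtain b where b: "r < cdf N b"
      using order_tendstoD(1)[OF N.cdf_lim_at_top, of r] 3(2) N(5) by (metis eventually_at_top_linorder order_refl)
    have "a \<le> b" using a b N.cdf_nondecreasing[of b a] by linarith
    then obtain s where "cdf N s = r"
      using IVT[of "cdf N" a r b] a b cont by auto
    moreover have "{x \<in> A. U x \<le> s} = A \<inter> {x \<in> space M. U x \<le> s}" using As by auto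
    then have "{x \<in> A. U x \<le> s} \<in> sets M" using A by simp
    ultimately show ?thesis using N(2)[of s] by (intro bexI[of _ "{x \<in> A. U x \<le> s}"]) auto
  qed (use A in auto)
qed

text \<open>\<open>F\<close> may have atoms, so a threshold alone need not halve \<open>A\<close>:
  at the median level \<open>t\<close> the set where \<open>F\<close> equals \<open>t\<close> is
  itself divided, by \<open>subset_of_prob\<close>.\<close>

lemma median_split:
  fixes F :: "'x \<Rightarrow> real"
  assumes A: "A \<in> sets M" and F: "F \<in> borel_measurable M"
    and b: "\<And>x. x \<in> A \<Longrightarrow> l \<le> F x \<and> F x \<le> h" and lh: "l \<le> h"
  shows "\<exists>B t. B \<in> sets M \<and> B \<subseteq> A \<and> prob B = prob A / 2 \<and> l \<le> t \<and> t \<le> h \<and>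
    (\<forall>x\<in>B. F x \<le> t) \<and> (\<forall>x\<in>A - B. t \<le> F x)"
proof (cases "prob A = 0")
  case True
  then show ?thesis by (intro exI[of _ A] exI[of _ h]) (use A b lh in simp)
next
  case False
  then have pos: "prob A > 0" by (simp add: less_le)
  define N where "N = distr (restrict_space M A) borel F"
  note N = distribution_function[OF A F, folded N_def]
  interpret N: finite_borel_measure N by (rule N)
  have As: "A \<subseteq> space M" using A sets.sets_into_space by blast
  define S where "S = {s. prob A / 2 \<le> cdf N s}"
  have hS: "h \<in> S"
  proof -
    have "{x \<in> A. F x \<le> h} = A" using b by auto
    then show ?thesis using pos by (simp add: S_def N(2))
  qed
  have Sl: "l \<le> s" if "s \<in> S" for s
  proof (rule ccontr)
    assume "\<not> l \<le> s"
    then have "{x \<in> A. F x \<le> s} = {}" using b by force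
    then have "cdf N s = 0" unfolding N(2) by (simp only: measure_empty)
    then show False using that pos by (simp add: S_def)
  qed
  have bdd: "bdd_below S" using Sl by (meson bdd_below.I)
  define t where "t = Inf S"
  have tl: "l \<le> t" unfolding t_def by (rule cInf_greatest) (use hS Sl in auto)
  have th: "t \<le> h" unfolding t_def by (rule cInf_lower[OF hS bdd])
  have up: "s \<in> S" if st: "t < s" for s
  proof -
    obtain s' where "s' \<in> S" "s' < s" using cInf_lessD[of S s] hS st unfolding t_def by auto
    then show ?thesis using N.cdf_nondecreasing[of s' s] by (auto simp: S_def)
  qed
  have le: "prob A / 2 \<le> cdf N t"
  proof (rule tendsto_lowerbound)
    show "(cdf N \<longlongrightarrow> cdf N t) (at_right t)" using N.cdf_is_right_cont[of t] by (simp add: continuous_within)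
    show "\<forall>\<^sub>F s in at_right t. prob A / 2 \<le> cdf N s"
      using up by (auto simp: eventually_at_filter S_def)
  qed simp
  have ge: "measure N {..<t} \<le> prob A / 2"
  proof (rule tendsto_upperbound)
    show "(cdf N \<longlongrightarrow> measure N {..<t}) (at_left t)" by (rule N.cdf_at_left)
    have "cdf N s \<le> prob A / 2" if "s < t" for s
      using cInf_lower[OF _ bdd, of s] that unfolding t_def S_def by force
    then show "\<forall>\<^sub>F s in at_left t. cdf N s \<le> prob A / 2"
      by (auto simp: eventually_at_filter)
  qed simp
  have sets: "{x \<in> A. F x < t} \<in> sets M" "{x \<in> A. F x = t} \<in> sets M"
  proof -
    have "{x \<in> A. F x < t} = A \<inter> {x \<in> space M. F x < t}" "{x \<in> A. F x = t} = A \<inter> {x \<in> space M. F x = t}"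
      using As by auto
    then show "{x \<in> A. F x < t} \<in> sets M" "{x \<in> A. F x = t} \<in> sets M" using A F by simp_all
  qed
  have "{x \<in> A. F x \<le> t} = {x \<in> A. F x < t} \<union> {x \<in> A. F x = t}" by auto
  then have sum: "prob {x \<in> A. F x \<le> t} = prob {x \<in> A. F x < t} + prob {x \<in> A. F x = t}"
    using finite_measure_Union[OF sets] by auto
  obtain C where C: "C \<in> sets M" "C \<subseteq> {x \<in> A. F x = t}" "prob C = prob A / 2 - prob {x \<in> A. F x < t}"
    using subset_of_prob[OF sets(2), of "prob A / 2 - prob {x \<in> A. F x < t}"] ge le sum N(2,3) by auto
  define B where "B = {x \<in> A. F x < t} \<union> C"
  have "{x \<in> A. F x < t} \<inter> C = {}" using C by auto
  then have "prob B = prob A / 2" unfolding B_def using finite_measure_Union[OF sets(1) C(1)] C(3) by simp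
  then show ?thesis using sets C tl th
    by (intro exI[of _ B] exI[of _ t]) (auto simp: B_def)
qed

text \<open>Pair each point of the lower half for \<open>F k0\<close> with one of the upper half and
  average over the pairs. A value between \<open>l\<close> and \<open>t\<close> and one between
  \<open>t\<close> and \<open>h\<close> average into an interval of half the length, while the
  averages for other indices stay within their old bounds.\<close>

lemma odometer_step:
  fixes F :: "nat \<Rightarrow> 'x \<Rightarrow> real"
  assumes A: "A \<in> sets M" and F: "\<And>k::nat. F k \<in> borel_measurable M"
    and b: "\<And>k x. x \<in> A \<Longrightarrow> l k \<le> F k x \<and> F k x \<le> h k" and lh: "\<And>k. l k \<le> h k"
  shows "\<exists>A' F' l' h' \<tau> N. A' \<in> sets M \<and> A' \<subseteq> A \<and> prob A' = prob A / 2 \<and>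
     (\<forall>k. F' k \<in> borel_measurable M) \<and> (\<forall>k. \<forall>x\<in>A'. l' k \<le> F' k x \<and> F' k x \<le> h' k) \<and>
     pw \<tau> \<and> null_inv N \<and> bij_betw \<tau> (A' - N) (A - A' - N) \<and> (\<forall>x\<in>A' - N. R x (\<tau> x)) \<and>
     (\<forall>k. \<forall>x\<in>A' - N. 2 * F' k x = F k x + F k (\<tau> x)) \<and>
     (\<forall>k. l k \<le> l' k \<and> l' k \<le> h' k \<and> h' k \<le> h k) \<and> 2 * (h' k0 - l' k0) \<le> h k0 - l k0"
proof -
  obtain B t where B: "B \<in> sets M" "B \<subseteq> A" "prob B = prob A / 2" "l k0 \<le> t" "t \<le> h k0"
    "\<And>x. x \<in> B \<Longrightarrow> F k0 x \<le> t" "\<And>x. x \<in> A - B \<Longrightarrow> t \<le> F k0 x"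
    using median_split[OF A F[of k0] b lh] by blast
  have "prob B = prob (A - B)" using finite_measure_Diff[OF A B(1,2)] B(3) by simp
  then obtain \<tau> N where \<tau>: "pw \<tau>" "null_inv N" "bij_betw \<tau> (B - N) (A - B - N)" "\<And>x. x \<in> B - N \<Longrightarrow> R x (\<tau> x)"
    using matching[OF B(1) sets.Diff[OF A B(1)]] by blast
  define l' where "l' k = (if k = k0 then (l k + t) / 2 else l k)" for k
  define h' where "h' k = (if k = k0 then (t + h k) / 2 else h k)" for k
  \<comment> \<open>On the exceptional set the average is replaced by a value within the bounds, so
    that these hold on all of \<open>B\<close>.\<close>
  define F' where "F' k x = (if x \<in> B - N then (F k x + F k (\<tau> x)) / 2 else l' k)" for k x
  have N: "N \<in> sets M" using \<tau>(2) by (auto simp: null_inv_def)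
  have l'h': "l k \<le> l' k \<and> l' k \<le> h' k \<and> h' k \<le> h k" for k
    using B(4,5) lh[of k] by (auto simp: l'_def h'_def)
  have F': "F' k \<in> borel_measurable M" for k
  proof -
    have [measurable]: "\<tau> \<in> M \<rightarrow>\<^sub>M M" "F k \<in> borel_measurable M" "B - N \<in> sets M"
      using pw_measurable[OF \<tau>(1)] F B N by auto
    show ?thesis unfolding F'_def by measurable
  qed
  have bnd: "l' k \<le> F' k x \<and> F' k x \<le> h' k" if "x \<in> B" for k x
  proof (cases "x \<in> N")
    case True then show ?thesis using l'h' by (simp add: F'_def)
  next
    case False
    have x: "x \<in> A" using that B by auto
    have tx: "\<tau> x \<in> A - B" using \<tau>(3) that False by (auto simp: bij_betw_def)
    have 1: "l k \<le> F k x" "F k x \<le> h k" "l k \<le> F k (\<tau> x)" "F k (\<tau> x) \<le> h k" using b x tx by auto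
    show ?thesis
    proof (cases "k = k0")
      case True
      then show ?thesis using 1 B(6)[OF that] B(7)[OF tx] that False by (simp add: F'_def l'_def h'_def)
    next
      case neq: False
      then show ?thesis using 1 that False by (simp add: F'_def l'_def h'_def)
    qed
  qed
  have avg: "2 * F' k x = F k x + F k (\<tau> x)" if "x \<in> B - N" for k x using that by (simp add: F'_def)
  have half: "2 * (h' k0 - l' k0) \<le> h k0 - l k0" by (simp add: h'_def l'_def add_divide_distrib)
  show ?thesis
    by (rule exI[of _ B], rule exI[of _ F'], rule exI[of _ l'], rule exI[of _ h'], rule exI[of _ \<tau>], rule exI[of _ N])
      (use B(1-3) F' bnd \<tau> avg l'h' half in simp)
qed

end

text \<open>\<open>A m\<close> is the base of a tower with \<open>2 ^ m\<close> levels, and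
  \<open>\<tau> m\<close> carries \<open>A (Suc m)\<close> onto the rest of \<open>A m\<close>.
  Unfolding \<open>F_avg\<close>, \<open>F m k x\<close> is, off \<open>N\<close>, the proportion of
  the tower over \<open>x\<close> that lies in \<open>Es k\<close>; by \<open>osc\<close> this
  proportion becomes nearly the same over the whole base.\<close>

locale odometer = ergodic_relation M act R U N0 Es
  for M :: "'x measure" and act :: "'g::group_add \<Rightarrow> 'x \<Rightarrow> 'x" and R U N0 Es +
  fixes A :: "nat \<Rightarrow> 'x set" and F :: "nat \<Rightarrow> nat \<Rightarrow> 'x \<Rightarrow> real" and l h :: "nat \<Rightarrow> nat \<Rightarrow> real"
    and \<tau> :: "nat \<Rightarrow> 'x \<Rightarrow> 'x" and N :: "'x set"
  assumes A_sets: "A m \<in> sets M" and A0: "A 0 = space M" and A_sub: "A (Suc m) \<subseteq> A m"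
    and A_prob: "prob (A m) = 1 / 2 ^ m" and \<tau>: "pw (\<tau> m)" and N: "null_inv N"
    and \<tau>_bij: "bij_betw (\<tau> m) (A (Suc m) - N) (A m - A (Suc m) - N)"
    and \<tau>_R: "x \<in> A (Suc m) - N \<Longrightarrow> R x (\<tau> m x)"
    and F0: "F 0 k = indicator (Es k)" and F_measurable: "F m k \<in> borel_measurable M"
    and F_avg: "x \<in> A (Suc m) - N \<Longrightarrow> 2 * F (Suc m) k x = F m k x + F m k (\<tau> m x)"
    and F_bounds: "x \<in> A m \<Longrightarrow> l m k \<le> F m k x \<and> F m k x \<le> h m k" and l_nonneg: "0 \<le> l m k"
    and osc: "(\<lambda>m. h m k - l m k) \<longlonglongrightarrow> 0"

text \<open>The first component of \<open>prod_decode m\<close> takes each value \<open>k\<close>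
  infinitely often, so every oscillation is halved infinitely often, and none ever grows.\<close>

lemma (in ergodic_relation) odometer_exists:
  "\<exists>A F l h \<tau> N. odometer M act R U N0 Es A F l h \<tau> N"
proof -
  define P where "P m st = (case st of (A, F, l, h, \<tau>, N) \<Rightarrow>
    A \<in> sets M \<and> prob A = 1 / 2 ^ m \<and> (\<forall>k. F k \<in> borel_measurable M) \<and>
    (\<forall>k. \<forall>x\<in>A. l k \<le> F k x \<and> F k x \<le> h k) \<and> (\<forall>k. 0 \<le> l k \<and> l k \<le> h k) \<and>
    (m = 0 \<longrightarrow> A = space M \<and> F = (\<lambda>k. indicator (Es k)) \<and> l = (\<lambda>_. 0) \<and> h = (\<lambda>_. 1)))"
    for m :: nat and st :: "'x set \<times> (nat \<Rightarrow> 'x \<Rightarrow> real) \<times> (nat \<Rightarrow> real) \<times> (nat \<Rightarrow> real) \<times> ('x \<Rightarrow> 'x) \<times> 'x set"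
  define Q where "Q m st st' = (case st of (A, F, l, h, _, _) \<Rightarrow> case st' of (A', F', l', h', \<tau>, N) \<Rightarrow>
     A' \<subseteq> A \<and> pw \<tau> \<and> null_inv N \<and> bij_betw \<tau> (A' - N) (A - A' - N) \<and> (\<forall>x\<in>A' - N. R x (\<tau> x)) \<and>
     (\<forall>k. \<forall>x\<in>A' - N. 2 * F' k x = F k x + F k (\<tau> x)) \<and>
     (\<forall>k. l k \<le> l' k \<and> l' k \<le> h' k \<and> h' k \<le> h k) \<and>
     2 * (h' (fst (prod_decode m)) - l' (fst (prod_decode m))) \<le> h (fst (prod_decode m)) - l (fst (prod_decode m)))"
    for m :: nat and st st' :: "'x set \<times> (nat \<Rightarrow> 'x \<Rightarrow> real) \<times> (nat \<Rightarrow> real) \<times> (nat \<Rightarrow> real) \<times> ('x \<Rightarrow> 'x) \<times> 'x set"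
  have Es_sets: "Es k \<in> sets M" for k using Es(1) by (auto intro: sigma_sets.Basic)
  have "\<exists>f. \<forall>n. P n (f n) \<and> Q n (f n) (f (Suc n))"
  proof (rule dependent_nat_choice)
    show "\<exists>x. P 0 x"
      by (rule exI[of _ "(space M, (\<lambda>k. indicator (Es k)), (\<lambda>_. 0), (\<lambda>_. 1), id, {})"])
        (use Es_sets prob_space in \<open>auto simp: P_def indicator_def\<close>)
  next
    fix st m assume "P m st"
    obtain A F l h \<tau>0 N1 where st: "st = (A, F, l, h, \<tau>0, N1)" by (cases st) auto
    have p: "A \<in> sets M" "prob A = 1 / 2 ^ m" "\<And>k. F k \<in> borel_measurable M"
      "\<And>k x. x \<in> A \<Longrightarrow> l k \<le> F k x \<and> F k x \<le> h k" "\<And>k. 0 \<le> l k" "\<And>k. l k \<le> h k"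
      using \<open>P m st\<close> by (auto simp: st P_def)
    obtain A' F' l' h' \<tau> N where q: "A' \<in> sets M" "A' \<subseteq> A" "prob A' = prob A / 2"
     "\<forall>k. F' k \<in> borel_measurable M" "\<forall>k. \<forall>x\<in>A'. l' k \<le> F' k x \<and> F' k x \<le> h' k"
     "pw \<tau>" "null_inv N" "bij_betw \<tau> (A' - N) (A - A' - N)" "\<forall>x\<in>A' - N. R x (\<tau> x)"
     "\<forall>k. \<forall>x\<in>A' - N. 2 * F' k x = F k x + F k (\<tau> x)"
     "\<forall>k. l k \<le> l' k \<and> l' k \<le> h' k \<and> h' k \<le> h k"
     "2 * (h' (fst (prod_decode m)) - l' (fst (prod_decode m))) \<le> h (fst (prod_decode m)) - l (fst (prod_decode m))"
      using odometer_step[where A = A and F = F and l = l and h = h and ?k0.0 = "fst (prod_decode m)", OF p(1,3,4,6)] by blast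
    have "0 \<le> l' k" for k using p(5)[of k] q(11) order_trans by blast
    then show "\<exists>y. P (Suc m) y \<and> Q m st y"
      using q p(2) by (intro exI[of _ "(A', F', l', h', \<tau>, N)"]) (simp add: P_def Q_def st)
  qed
  then obtain f where f: "\<And>n. P n (f n)" "\<And>n. Q n (f n) (f (Suc n))" by blast
  define A where "A m = fst (f m)" for m
  define F where "F m = fst (snd (f m))" for m
  define l where "l m = fst (snd (snd (f m)))" for m
  define h where "h m = fst (snd (snd (snd (f m))))" for m
  define \<tau> where "\<tau> m = fst (snd (snd (snd (snd (f (Suc m))))))" for m
  define Nm where "Nm m = snd (snd (snd (snd (snd (f (Suc m))))))" for m
  have ff: "f m = (A m, F m, l m, h m, fst (snd (snd (snd (snd (f m))))), snd (snd (snd (snd (snd (f m))))))" for m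
    by (simp add: A_def F_def l_def h_def)
  have fS: "f (Suc m) = (A (Suc m), F (Suc m), l (Suc m), h (Suc m), \<tau> m, Nm m)" for m
    by (simp add: A_def F_def l_def h_def \<tau>_def Nm_def)
  have p: "A m \<in> sets M" "prob (A m) = 1 / 2 ^ m" "F m k \<in> borel_measurable M"
      "x \<in> A m \<Longrightarrow> l m k \<le> F m k x \<and> F m k x \<le> h m k" "0 \<le> l m k" "l m k \<le> h m k"
      "A 0 = space M" "F 0 k = indicator (Es k)" "l 0 k = 0" "h 0 k = 1" for m k x
    using f(1)[of m] f(1)[of 0] unfolding P_def by (subst (asm) ff; subst (asm) (2) ff; simp)+
  have q: "A (Suc m) \<subseteq> A m" "pw (\<tau> m)" "null_inv (Nm m)"
     "bij_betw (\<tau> m) (A (Suc m) - Nm m) (A m - A (Suc m) - Nm m)" "\<And>x. x \<in> A (Suc m) - Nm m \<Longrightarrow> R x (\<tau> m x)"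
     "\<And>k x. x \<in> A (Suc m) - Nm m \<Longrightarrow> 2 * F (Suc m) k x = F m k x + F m k (\<tau> m x)"
     "\<And>k. l m k \<le> l (Suc m) k" "\<And>k. h (Suc m) k \<le> h m k"
     "2 * (h (Suc m) (fst (prod_decode m)) - l (Suc m) (fst (prod_decode m))) \<le>
         h m (fst (prod_decode m)) - l m (fst (prod_decode m))" for m
    using f(2)[of m] unfolding Q_def fS by (subst (asm) ff; simp)+
  define N where "N = (\<Union>m. Nm m)"
  have N: "null_inv N" unfolding N_def by (rule null_inv_UN) (use q in auto)
  have NmN: "Nm m \<subseteq> N" for m by (auto simp: N_def)
  define os where "os k m = h m k - l m k" for k m
  have os0: "0 \<le> os k m" for k m using p(6) by (simp add: os_def)
  have osdec: "os k n \<le> os k m" if "m \<le> n" for k m n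
    using lift_Suc_antimono_le[of "os k" m n] that q(7,8) by (simp add: os_def diff_mono)
  have oshalf: "\<exists>m. os k m \<le> 1 / 2 ^ j" for k j
  proof (induction j)
    case 0
    show ?case by (intro exI[of _ 0]) (simp add: os_def p(9,10))
  next
    case (Suc j)
    then obtain m where m: "os k m \<le> 1 / 2 ^ j" by blast
    define m' where "m' = prod_encode (k, m)"
    have "m \<le> m'" unfolding m'_def by (rule le_prod_encode_2)
    then have "os k m' \<le> 1 / 2 ^ j" using osdec m order_trans by blast
    moreover have "2 * os k (Suc m') \<le> os k m'"
      using q(9)[of m'] by (simp add: os_def m'_def)
    ultimately show ?case by (intro exI[of _ "Suc m'"]) simp
  qed
  have osl: "(\<lambda>m. h m k - l m k) \<longlonglongrightarrow> 0" for k
  proof (rule LIMSEQ_I)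
    fix r :: real assume "r > 0"
    then obtain j where j: "(1/2::real) ^ j < r" using real_arch_pow_inv[of r "1/2"] by auto
    obtain m where m: "os k m \<le> 1 / 2 ^ j" using oshalf by blast
    have "\<bar>os k n\<bar> < r" if "n \<ge> m" for n
      using osdec[OF that, of k] m j os0[of k n] by (simp add: power_one_over)
    then show "\<exists>m. \<forall>n\<ge>m. norm (h n k - l n k - 0) < r" by (auto simp: os_def)
  qed
  have sp: "A m \<subseteq> space M" for m using p(1) sets.sets_into_space by blast
  have "odometer M act R U N0 Es A F l h \<tau> N"
  proof (intro odometer.intro odometer_axioms.intro)
    show "ergodic_relation M act R U N0 Es" by (rule ergodic_relation_axioms)
    show "bij_betw (\<tau> m) (A (Suc m) - N) (A m - A (Suc m) - N)" for m
      by (rule null_inv_bij_mono[OF N NmN q(2,4)]) (use sp in auto)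
    show "R x (\<tau> m x)" if "x \<in> A (Suc m) - N" for x m using q(5)[of x m] that NmN[of m] by auto
    show "2 * F (Suc m) k x = F m k x + F m k (\<tau> m x)" if "x \<in> A (Suc m) - N" for x m k
      using q(6)[of x m k] that NmN[of m] by auto
  qed (use p q N osl in auto)
  then show ?thesis by blast
qed

section \<open>The odometer: addition of one with carry, and its ergodicity\<close>

context odometer begin

definition sig :: "nat \<Rightarrow> 'x \<Rightarrow> 'x" where
  "sig m = (SOME s. pw s \<and> (\<forall>x\<in>A (Suc m) - N. s (\<tau> m x) = x))"

lemma N_sets: "N \<in> sets M"
  using N by (auto simp: null_inv_def)

lemma A_space: "A m \<subseteq> space M"
  using A_sets sets.sets_into_space by blast

lemma sig: "pw (sig m)" "x \<in> A (Suc m) - N \<Longrightarrow> sig m (\<tau> m x) = x"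
proof -
  have "\<exists>s. pw s \<and> (\<forall>x\<in>A (Suc m) - N. s (\<tau> m x) = x)"
    using pw_inverse[OF \<tau>, of "A (Suc m) - N" m] \<tau>_bij[of m] A_sets N_sets by (auto simp: bij_betw_def)
  then have "pw (sig m) \<and> (\<forall>x\<in>A (Suc m) - N. sig m (\<tau> m x) = x)" unfolding sig_def by (rule someI_ex)
  then show "pw (sig m)" "x \<in> A (Suc m) - N \<Longrightarrow> sig m (\<tau> m x) = x" by auto
qed

lemma sig_bij: "bij_betw (sig m) (A m - A (Suc m) - N) (A (Suc m) - N)"
proof (rule bij_betwI[where g = "\<tau> m"])
  show "\<tau> m \<in> A (Suc m) - N \<rightarrow> A m - A (Suc m) - N" using \<tau>_bij by (auto simp: bij_betw_def)
  have *: "\<exists>x\<in>A (Suc m) - N. y = \<tau> m x" if "y \<in> A m - A (Suc m) - N" for y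
    using \<tau>_bij[of m] that by (metis bij_betw_imp_surj_on imageE)
  show "sig m \<in> A m - A (Suc m) - N \<rightarrow> A (Suc m) - N" using * sig(2)[of _ m] by fastforce
  show "\<tau> m (sig m y) = y" if "y \<in> A m - A (Suc m) - N" for y using *[OF that] sig(2)[of _ m] by fastforce
qed (use sig(2) in auto)

lemma \<tau>_sig: "y \<in> A m - A (Suc m) - N \<Longrightarrow> \<tau> m (sig m y) = y"
  using \<tau>_bij[of m] sig(2)[of _ m] by (metis bij_betw_imp_surj_on imageE)

text \<open>Points carry binary digits: digit \<open>m\<close> is \<open>0\<close> on
  \<open>A (Suc m)\<close> and \<open>1\<close> on the rest of \<open>A m\<close>. As long as all
  digits below \<open>m\<close> are \<open>1\<close>, \<open>p m\<close> resets them and lands in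
  \<open>A m\<close>, where the next digit can be read.\<close>

primrec p :: "nat \<Rightarrow> 'x \<Rightarrow> 'x" where
  "p 0 = (\<lambda>x. x)"
| "p (Suc m) = (\<lambda>x. sig m (p m x))"

lemma pw_p: "pw (p m)"
  by (induction m) (simp_all add: pw_id pw_comp[OF sig(1)])

text \<open>Off \<open>N\<close>, the points whose first \<open>m\<close> digits are all
  \<open>1\<close>: those on which a carry reaches position \<open>m\<close>.\<close>

definition top_level :: "nat \<Rightarrow> 'x set" where
  "top_level m = {x \<in> space M - N. \<forall>i<m. p i x \<in> A i - A (Suc i)}"

lemma top_level_Suc: "top_level (Suc m) = {x \<in> top_level m. p m x \<in> A m - A (Suc m)}"
  by (auto simp: top_level_def less_Suc_eq)

lemma top_level_bij: "bij_betw (p m) (top_level m) (A m - N)"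
proof (induction m)
  case 0
  have "top_level 0 = space M - N" by (auto simp: top_level_def)
  then show ?case by (simp add: A0 bij_betw_def inj_on_def)
next
  case (Suc m)
  have "bij_betw (p m) (top_level (Suc m)) (A m - A (Suc m) - N)"
  proof (rule bij_betw_imageI)
    show "inj_on (p m) (top_level (Suc m))"
      using Suc unfolding top_level_Suc bij_betw_def by (auto intro: inj_on_subset)
    have "p m ` top_level m = A m - N" using Suc by (simp add: bij_betw_def)
    moreover have "p m ` top_level (Suc m) = p m ` top_level m \<inter> (A m - A (Suc m))"
      unfolding top_level_Suc by auto
    ultimately show "p m ` top_level (Suc m) = A m - A (Suc m) - N" by auto
  qed
  from bij_betw_trans[OF this sig_bij] show ?case by (simp add: comp_def)
qed

lemma top_level_sets: "top_level m \<in> sets M"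
proof (induction m)
  case 0
  have "top_level 0 = space M - N" by (auto simp: top_level_def)
  then show ?case using N_sets by auto
next
  case (Suc m)
  have "top_level m \<subseteq> space M" using Suc sets.sets_into_space by blast
  then have "top_level (Suc m) = top_level m \<inter> (p m -` (A m - A (Suc m)) \<inter> space M)"
    unfolding top_level_Suc by auto
  then show ?case
    using Suc measurable_sets[OF pw_measurable[OF pw_p], of "A m - A (Suc m)" m] A_sets by auto
qed

lemma top_level_prob: "prob (top_level m) \<le> 1 / 2 ^ m"
proof -
  have "prob (top_level m) = prob (p m ` top_level m)"
    by (rule pw_image_prob[symmetric, OF pw_p top_level_sets]) (use top_level_bij[of m] in \<open>simp add: bij_betw_def\<close>)
  also have "\<dots> = prob (A m - N)" using top_level_bij by (simp add: bij_betw_def)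
  also have "\<dots> \<le> prob (A m)" by (rule finite_measure_mono) (use A_sets in auto)
  finally show ?thesis by (simp add: A_prob)
qed

lemma null_of_geometric:
  assumes "B \<in> sets M" "\<And>m::nat. prob B \<le> 1 / 2 ^ m"
  shows "B \<in> null_sets M"
proof -
  have "(\<lambda>m. (1/2::real) ^ m) \<longlonglongrightarrow> 0" by (rule LIMSEQ_realpow_zero) auto
  then have "prob B \<le> 0"
    by (rule LIMSEQ_le_const) (use assms(2) in \<open>auto simp: power_one_over\<close>)
  then have "prob B = 0" using measure_nonneg[of M B] by linarith
  then show ?thesis using assms(1) by (simp add: null_sets_def emeasure_eq_measure)
qed

text \<open>Addition of one: \<open>p m\<close> resets the initial run of ones, and
  \<open>\<tau> m\<close> turns the first \<open>0\<close> into \<open>1\<close>.\<close>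

definition odo :: "'x \<Rightarrow> 'x" where
  "odo x = (\<lambda>m. \<tau> m (p m x)) (LEAST m. p m x \<in> A (Suc m))"

lemma pw_odo: "pw odo"
proof -
  have [measurable]: "p m \<in> M \<rightarrow>\<^sub>M M" "A m \<in> sets M" for m using pw_measurable[OF pw_p] A_sets by auto
  have "(\<lambda>x. LEAST m. p m x \<in> A (Suc m)) \<in> M \<rightarrow>\<^sub>M count_space UNIV" by measurable
  then have "pw (\<lambda>x. (\<lambda>m x. \<tau> m (p m x)) (LEAST m. p m x \<in> A (Suc m)) x)"
    by (rule pw_countable[where f = "\<lambda>m x. \<tau> m (p m x)", rotated]) (auto intro: pw_comp[OF \<tau> pw_p])
  then show ?thesis by (simp add: odo_def[abs_def])
qed

lemma odo_eq:
  assumes x: "x \<in> top_level m" "p m x \<in> A (Suc m)" shows "odo x = \<tau> m (p m x)"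
proof -
  have "(LEAST m. p m x \<in> A (Suc m)) = m"
    by (rule Least_equality) (use x in \<open>auto simp: top_level_def not_less[symmetric]\<close>)
  then show ?thesis by (simp add: odo_def)
qed

text \<open>Points all of whose digits are \<open>1\<close> have no successor, and points in every
  \<open>A m\<close> have no predecessor. Both sets are null, because fixing \<open>m\<close> digits
  leaves measure at most \<open>1 / 2 ^ m\<close>.\<close>

lemma exceptional_set: "\<exists>N'. null_inv N' \<and> N \<subseteq> N' \<and> (\<forall>x\<in>space M - N'. \<exists>m. x \<in> top_level m \<and> p m x \<in> A (Suc m)) \<and>
    (\<forall>y\<in>space M - N'. \<exists>m. y \<in> A m - A (Suc m))"
proof -
  have 1: "(\<Inter>m. top_level m) \<in> null_sets M"
  proof (rule null_of_geometric)
    show "(\<Inter>m. top_level m) \<in> sets M" using top_level_sets by auto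
    show "prob (\<Inter>m. top_level m) \<le> 1 / 2 ^ m" for m
      by (rule order_trans[OF finite_measure_mono top_level_prob]) (use top_level_sets in auto)
  qed
  have 2: "(\<Inter>m. A m) \<in> null_sets M"
  proof (rule null_of_geometric)
    show "(\<Inter>m. A m) \<in> sets M" using A_sets by auto
    show "prob (\<Inter>m. A m) \<le> 1 / 2 ^ m" for m
      unfolding A_prob[symmetric] by (rule finite_measure_mono) (use A_sets in auto)
  qed
  have "(\<Inter>m. top_level m) \<union> (\<Inter>m. A m) \<in> null_sets M" using 1 2 by auto
  then obtain N1 where N1: "null_inv N1" "(\<Inter>m. top_level m) \<union> (\<Inter>m. A m) \<subseteq> N1"
    using null_inv_saturate by blast
  have "\<exists>m. x \<in> top_level m \<and> p m x \<in> A (Suc m)" if x: "x \<in> space M - (N \<union> N1)" for x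
  proof -
    have "\<exists>m. x \<notin> top_level m" using N1(2) x by auto
    then have nt: "x \<notin> top_level (LEAST m. x \<notin> top_level m)" by (rule LeastI_ex)
    moreover have "x \<in> top_level 0" using x by (simp add: top_level_def)
    ultimately obtain m where m: "(LEAST m. x \<notin> top_level m) = Suc m" by (metis not0_implies_Suc)
    then have xm: "x \<in> top_level m" using not_less_Least[of m "\<lambda>m. x \<notin> top_level m"] by auto
    then have "p m x \<in> A m" using top_level_bij[of m] by (auto simp: bij_betw_def)
    then show ?thesis using nt xm m by (auto simp: top_level_Suc)
  qed
  moreover have "\<exists>m. y \<in> A m - A (Suc m)" if y: "y \<in> space M - (N \<union> N1)" for y
  proof -
    have "\<exists>m. y \<notin> A m" using N1(2) y by auto
    then have nt: "y \<notin> A (LEAST m. y \<notin> A m)" by (rule LeastI_ex)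
    moreover have "y \<in> A 0" using y by (simp add: A0)
    ultimately obtain m where m: "(LEAST m. y \<notin> A m) = Suc m" by (metis not0_implies_Suc)
    then have "y \<in> A m" using not_less_Least[of m "\<lambda>m. y \<notin> A m"] by auto
    then show ?thesis using nt m by auto
  qed
  ultimately show ?thesis using null_inv_Un[OF N N1(1)] by (intro exI[of _ "N \<union> N1"]) auto
qed

lemma p_R: "x \<in> top_level m \<Longrightarrow> R x (p m x)"
proof (induction m)
  case 0
  then show ?case by (simp add: top_level_def R_refl)
next
  case (Suc m)
  then have x: "x \<in> top_level m" "p m x \<in> A m - A (Suc m)" by (auto simp: top_level_Suc)
  then have y: "p m x \<in> A m - A (Suc m) - N" using top_level_bij[of m] by (auto simp: bij_betw_def)
  then have "sig m (p m x) \<in> A (Suc m) - N" using sig_bij[of m] by (auto simp: bij_betw_def)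
  then have "R (sig m (p m x)) (p m x)" using \<tau>_R[of "sig m (p m x)" m] \<tau>_sig[OF y] by simp
  then show ?case using Suc.IH[OF x(1)] R_sym R_trans by (metis p.simps(2))
qed

lemma odo_properties:
  "\<exists>N'. null_inv N' \<and> N \<subseteq> N' \<and> bij_betw odo (space M - N') (space M - N') \<and>
    (\<forall>x\<in>space M - N'. R x (odo x)) \<and>
    (\<forall>D. (\<forall>x\<in>space M - N'. odo x \<in> D \<longleftrightarrow> x \<in> D) \<longrightarrow>
       (\<forall>m. \<forall>x\<in>A (Suc m) - N'. \<tau> m x \<in> D \<longleftrightarrow> x \<in> D))"
proof -
  obtain N' where N': "null_inv N'" "N \<subseteq> N'"
    "\<And>x. x \<in> space M - N' \<Longrightarrow> \<exists>m. x \<in> top_level m \<and> p m x \<in> A (Suc m)"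
    "\<And>y. y \<in> space M - N' \<Longrightarrow> \<exists>m. y \<in> A m - A (Suc m)"
    using exceptional_set by blast
  have nn: "f x \<notin> N'" if "pw f" "x \<in> space M" "x \<notin> N'" for f x
    using null_inv_pw[OF N'(1) that(1,2)] that(3) by simp
  have pA: "p m x \<in> A m - N" if "x \<in> top_level m" for m x using top_level_bij[of m] that by (auto simp: bij_betw_def)
  have Ad: "i < j \<Longrightarrow> A j \<subseteq> A (Suc i)" for i j using lift_Suc_antimono_le[of A "Suc i" j] A_sub by auto
  have lvl: "odo x \<in> A m - A (Suc m) - N" if "x \<in> top_level m" "p m x \<in> A (Suc m)" for m x
    using odo_eq[OF that] \<tau>_bij[of m] pA[OF that(1)] that(2) by (auto simp: bij_betw_def)
  have inj: "inj_on odo (space M - N')"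
  proof (rule inj_onI)
    fix x y assume x: "x \<in> space M - N'" and y: "y \<in> space M - N'" and eq: "odo x = odo y"
    obtain m where m: "x \<in> top_level m" "p m x \<in> A (Suc m)" using N'(3) x by blast
    obtain n where n: "y \<in> top_level n" "p n y \<in> A (Suc n)" using N'(3) y by blast
    \<comment> \<open>Carries of different lengths end in different sets
      \<open>A m - A (Suc m)\<close>, and these are disjoint.\<close>
    have "m = n"
      using lvl[OF m] lvl[OF n] eq Ad[of m n] Ad[of n m] by (cases m n rule: linorder_cases) auto
    then have "\<tau> m (p m x) = \<tau> m (p m y)" using eq odo_eq[OF m] odo_eq[OF n] by simp
    then have "p m x = p m y"
      using \<tau>_bij[of m] pA[OF m(1)] pA[OF n(1)] m n \<open>m = n\<close> by (auto simp: bij_betw_def dest: inj_onD)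
    then show "x = y" using top_level_bij[of m] m n \<open>m = n\<close> by (auto simp: bij_betw_def dest: inj_onD)
  qed
  have surj: "odo ` (space M - N') = space M - N'"
  proof safe
    fix y assume y: "y \<in> space M" "y \<notin> N'"
    then obtain m where m: "y \<in> A m - A (Suc m)" using N'(4) by blast
    then have "y \<in> \<tau> m ` (A (Suc m) - N)" using \<tau>_bij[of m] y N'(2) by (auto simp: bij_betw_def)
    then obtain z where z: "z \<in> A (Suc m) - N" "y = \<tau> m z" by blast
    then have "z \<in> p m ` top_level m" using top_level_bij[of m] A_sub[of m] by (auto simp: bij_betw_def)
    then obtain x where x: "x \<in> top_level m" "z = p m x" by blast
    then have "odo x = y" using odo_eq[of x m] z by simp
    moreover have "x \<in> space M" using x by (simp add: top_level_def)
    moreover have "x \<notin> N'" using null_inv_pw[OF N'(1) pw_odo \<open>x \<in> space M\<close>] y \<open>odo x = y\<close> by simp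
    ultimately show "y \<in> odo ` (space M - N')" by blast
  qed (use nn[OF pw_odo] pw_space[OF pw_odo] in auto)
  have Ro: "R x (odo x)" if x: "x \<in> space M - N'" for x
  proof -
    obtain m where m: "x \<in> top_level m" "p m x \<in> A (Suc m)" using N'(3) x by blast
    then have "R (p m x) (odo x)" using \<tau>_R[of "p m x" m] pA[OF m(1)] odo_eq[OF m] by simp
    then show ?thesis using p_R[OF m(1)] R_trans by blast
  qed
  \<comment> \<open>If \<open>z = p m x\<close>, then \<open>\<tau> m z = odo x\<close>; and passing
    from \<open>x\<close> to \<open>p m x\<close> uses only maps of smaller index, under which
    \<open>D\<close> is invariant by induction.\<close>
  have inv: "\<tau> m z \<in> D \<longleftrightarrow> z \<in> D"
    if D: "\<And>x. x \<in> space M - N' \<Longrightarrow> odo x \<in> D \<longleftrightarrow> x \<in> D" and z: "z \<in> A (Suc m) - N'" for D m z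
  proof -
    have step: "\<tau> m z \<in> D \<longleftrightarrow> z \<in> D"
      if pD: "\<And>x. x \<in> top_level m - N' \<Longrightarrow> p m x \<in> D \<longleftrightarrow> x \<in> D" and z: "z \<in> A (Suc m) - N'" for m z
    proof -
      have "z \<in> p m ` top_level m" using top_level_bij[of m] z N'(2) A_sub[of m] by (auto simp: bij_betw_def)
      then obtain x where x: "x \<in> top_level m" "z = p m x" by blast
      have xs: "x \<in> space M" using x by (simp add: top_level_def)
      have xN: "x \<notin> N'" using null_inv_pw[OF N'(1) pw_p xs] z x by simp
      have "odo x = \<tau> m z" using odo_eq[of x m] x z by simp
      then show ?thesis using D[of x] pD[of x] x xs xN by simp
    qed
    have "p m x \<in> D \<longleftrightarrow> x \<in> D" if "x \<in> top_level m - N'" for x m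
      using that
    proof (induction m arbitrary: x)
      case (Suc m)
      then have x: "x \<in> top_level m - N'" "p m x \<in> A m - A (Suc m)" by (auto simp: top_level_Suc)
      have xs: "x \<in> space M" using x by (simp add: top_level_def)
      have pm: "p m x \<in> A m - A (Suc m) - N" using pA x by auto
      have s: "sig m (p m x) \<in> A (Suc m)" using sig_bij[of m] pm by (auto simp: bij_betw_def)
      have "sig m (p m x) \<notin> N'" using nn[OF pw_p[of "Suc m"] xs] x by simp
      then have "\<tau> m (sig m (p m x)) \<in> D \<longleftrightarrow> sig m (p m x) \<in> D"
        using step[OF Suc.IH, of "sig m (p m x)"] s by simp
      then show ?case using \<tau>_sig[OF pm] Suc.IH[OF x(1)] by simp
    qed simp
    then show ?thesis using step z by blast
  qed
  show ?thesis
    by (rule exI[of _ N']) (use N'(1,2) inj surj Ro inv in \<open>auto simp: bij_betw_def\<close>)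
qed

text \<open>Up to the exceptional set, \<open>A m\<close> consists of \<open>A (Suc m)\<close> and
  its image under \<open>\<tau> m\<close>; the integral over the image is transported back.\<close>

lemma invariant_integral:
  assumes N': "null_inv N'" "N \<subseteq> N'" and D: "D \<in> sets M" "D \<inter> N' = {}"
    and inv: "\<And>m x. x \<in> A (Suc m) - N' \<Longrightarrow> \<tau> m x \<in> D \<longleftrightarrow> x \<in> D"
    and G: "G \<in> borel_measurable M"
  shows "(\<integral>\<^sup>+x. G x * indicator (D \<inter> A m) x \<partial>M) = (\<integral>\<^sup>+x. (G x + G (\<tau> m x)) * indicator (D \<inter> A (Suc m)) x \<partial>M)"
proof -
  let ?B = "D \<inter> A (Suc m)"
  have B: "?B \<in> sets M" using D A_sets by auto
  have Bs: "?B \<subseteq> A (Suc m) - N" using D N' by auto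
  have inj: "inj_on (\<tau> m) ?B" using \<tau>_bij[of m] Bs by (auto simp: bij_betw_def intro: inj_on_subset)
  have im: "\<tau> m ` ?B = D \<inter> (A m - A (Suc m))"
  proof (rule set_eqI, rule iffI)
    fix y assume "y \<in> \<tau> m ` ?B"
    then obtain x where x: "x \<in> ?B" "y = \<tau> m x" by blast
    then have "y \<in> A m - A (Suc m) - N" using \<tau>_bij[of m] Bs by (auto simp: bij_betw_def)
    moreover have "y \<in> D" using inv[of x m] x D(2) by auto
    ultimately show "y \<in> D \<inter> (A m - A (Suc m))" by auto
  next
    fix y assume y: "y \<in> D \<inter> (A m - A (Suc m))"
    then have "y \<in> \<tau> m ` (A (Suc m) - N)" using \<tau>_bij[of m] D(2) N'(2) by (auto simp: bij_betw_def)
    then obtain x where x: "x \<in> A (Suc m) - N" "y = \<tau> m x" by blast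
    have xs: "x \<in> space M" using x A_space by blast
    have "x \<notin> N'" using null_inv_pw[OF N'(1) \<tau> xs, of m] x(2) y D(2) by auto
    then show "y \<in> \<tau> m ` ?B" using inv[of x m] x y by auto
  qed
  have [measurable]: "\<tau> m \<in> M \<rightarrow>\<^sub>M M" "G \<in> borel_measurable M" "?B \<in> sets M" "D \<inter> (A m - A (Suc m)) \<in> sets M"
    using pw_measurable[OF \<tau>] G B D A_sets by auto
  have "(\<integral>\<^sup>+x. G x * indicator (D \<inter> A m) x \<partial>M)
      = (\<integral>\<^sup>+x. G x * indicator ?B x + G x * indicator (D \<inter> (A m - A (Suc m))) x \<partial>M)"
    by (rule nn_integral_cong) (use A_sub[of m] in \<open>auto simp: indicator_def split: if_splits\<close>)
  also have "\<dots> = (\<integral>\<^sup>+x. G x * indicator ?B x \<partial>M) + (\<integral>\<^sup>+x. G x * indicator (D \<inter> (A m - A (Suc m))) x \<partial>M)"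
    by (rule nn_integral_add) measurable
  also have "(\<integral>\<^sup>+x. G x * indicator (D \<inter> (A m - A (Suc m))) x \<partial>M) = (\<integral>\<^sup>+x. G (\<tau> m x) * indicator ?B x \<partial>M)"
    using pw_nn_integral[OF \<tau> B inj G] by (simp add: im)
  also have "(\<integral>\<^sup>+x. G x * indicator ?B x \<partial>M) + (\<integral>\<^sup>+x. G (\<tau> m x) * indicator ?B x \<partial>M)
      = (\<integral>\<^sup>+x. G x * indicator ?B x + G (\<tau> m x) * indicator ?B x \<partial>M)"
    by (rule nn_integral_add[symmetric]) measurable
  finally show ?thesis by (simp add: distrib_right)
qed

text \<open>Iterating \<open>invariant_integral\<close> folds \<open>D\<close> onto the base: the
  measures of \<open>D\<close> and of \<open>D \<inter> Es k\<close> are \<open>2 ^ m\<close> times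
  the integrals of \<open>1\<close> and of \<open>F m k\<close> over \<open>D \<inter> A m\<close>,
  and there \<open>F m k\<close> lies between \<open>l m k\<close> and \<open>h m k\<close>.\<close>

lemma invariant_density:
  assumes N': "null_inv N'" "N \<subseteq> N'" and D: "D \<in> sets M" "D \<inter> N' = {}"
    and inv: "\<And>m x. x \<in> A (Suc m) - N' \<Longrightarrow> \<tau> m x \<in> D \<longleftrightarrow> x \<in> D"
  shows "l m k * prob D \<le> prob (D \<inter> Es k) \<and> prob (D \<inter> Es k) \<le> h m k * prob D"
proof -
  note main = invariant_integral[OF N' D inv]
  have Es_sets: "Es k \<in> sets M" using Es(1) by (auto intro: sigma_sets.Basic)
  have DA: "D \<inter> A m \<in> sets M" for m using D A_sets by auto
  have e1: "emeasure M (D \<inter> A m) = 2 * emeasure M (D \<inter> A (Suc m))" for m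
    using main[of "\<lambda>_. 1" m] DA by (simp add: nn_integral_cmult)
  have p2: "prob (D \<inter> A m) = 2 * prob (D \<inter> A (Suc m))" for m
  proof -
    have "ennreal (prob (D \<inter> A m)) = ennreal (2 * prob (D \<inter> A (Suc m)))"
      using e1[of m] by (simp add: emeasure_eq_measure ennreal_mult)
    then show ?thesis by (subst (asm) ennreal_inj) auto
  qed
  have pD: "2 ^ m * prob (D \<inter> A m) = prob D" for m
  proof (induction m)
    case 0
    show ?case using D(1) sets.sets_into_space by (simp add: A0 Int_absorb2)
  next
    case (Suc m)
    then show ?case using p2[of m] by simp
  qed
  define J where "J m = (\<integral>\<^sup>+x. ennreal (F m k x) * indicator (D \<inter> A m) x \<partial>M)" for m
  have nonneg: "0 \<le> F m k x" if "x \<in> A m" for m x using F_bounds[OF that] l_nonneg order_trans by blast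
  have JS: "J m = 2 * J (Suc m)" for m
  proof -
    have "J m = (\<integral>\<^sup>+x. (ennreal (F m k x) + ennreal (F m k (\<tau> m x))) * indicator (D \<inter> A (Suc m)) x \<partial>M)"
      unfolding J_def by (rule main) (use F_measurable in measurable)
    also have "\<dots> = (\<integral>\<^sup>+x. 2 * (ennreal (F (Suc m) k x) * indicator (D \<inter> A (Suc m)) x) \<partial>M)"
    proof (rule nn_integral_cong)
      fix x
      show "(ennreal (F m k x) + ennreal (F m k (\<tau> m x))) * indicator (D \<inter> A (Suc m)) x
          = 2 * (ennreal (F (Suc m) k x) * indicator (D \<inter> A (Suc m)) x)"
      proof (cases "x \<in> D \<inter> A (Suc m)")
        case True
        then have x: "x \<in> A (Suc m) - N" using D N' by auto
        then have "\<tau> m x \<in> A m" "x \<in> A m" using \<tau>_bij[of m] A_sub by (auto simp: bij_betw_def)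
        then have "ennreal (F m k x) + ennreal (F m k (\<tau> m x)) = ennreal (2 * F (Suc m) k x)"
          using F_avg[OF x, of k] nonneg by (simp add: ennreal_plus[symmetric] del: ennreal_plus)
        also have "\<dots> = 2 * ennreal (F (Suc m) k x)"
          using nonneg x by (simp add: ennreal_mult)
        finally show ?thesis using True by simp
      qed simp
    qed
    also have "\<dots> = 2 * J (Suc m)"
      unfolding J_def by (rule nn_integral_cmult) (use F_measurable DA in measurable)
    finally show ?thesis .
  qed
  have "J 0 = emeasure M (D \<inter> Es k)"
  proof -
    have "J 0 = (\<integral>\<^sup>+x. indicator (D \<inter> Es k) x \<partial>M)"
      unfolding J_def F0 A0 using D(1) sets.sets_into_space
      by (intro nn_integral_cong) (auto simp: indicator_def)
    then show ?thesis using D Es_sets by simp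
  qed
  then have J: "emeasure M (D \<inter> Es k) = 2 ^ m * J m"
  proof (induction m)
    case (Suc m)
    then show ?case using JS[of m] by (simp add: mult.assoc mult.left_commute)
  qed simp
  have "ennreal (l m k) * emeasure M (D \<inter> A m) = (\<integral>\<^sup>+x. ennreal (l m k) * indicator (D \<inter> A m) x \<partial>M)"
    using DA by (simp add: nn_integral_cmult)
  also have "\<dots> \<le> J m" unfolding J_def
    by (rule nn_integral_mono) (use F_bounds in \<open>auto simp: indicator_def ennreal_leI split: if_splits\<close>)
  finally have 1: "ennreal (l m k) * emeasure M (D \<inter> A m) \<le> J m" .
  have "J m \<le> (\<integral>\<^sup>+x. ennreal (h m k) * indicator (D \<inter> A m) x \<partial>M)" unfolding J_def
    by (rule nn_integral_mono) (use F_bounds in \<open>auto simp: indicator_def ennreal_leI split: if_splits\<close>)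
  also have "\<dots> = ennreal (h m k) * emeasure M (D \<inter> A m)" using DA by (simp add: nn_integral_cmult)
  finally have 2: "J m \<le> ennreal (h m k) * emeasure M (D \<inter> A m)" .
  have hn: "0 \<le> h m k"
  proof -
    have "A m \<noteq> {}" using A_prob[of m] by (metis measure_empty zero_neq_one divide_eq_0_iff power_not_zero zero_neq_numeral)
    then obtain x where "x \<in> A m" by blast
    then show ?thesis using F_bounds l_nonneg by (meson order_trans)
  qed
  have e: "2 ^ m * (ennreal c * emeasure M (D \<inter> A m)) = ennreal (c * prob D)" if "0 \<le> c" for c
  proof -
    have "2 ^ m * (ennreal c * emeasure M (D \<inter> A m)) = ennreal (2 ^ m * (c * prob (D \<inter> A m)))"
    proof -
      have "ennreal (2 ^ m) = 2 ^ m" by (metis ennreal_power ennreal_numeral zero_le_numeral)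
      then show ?thesis using that by (simp add: emeasure_eq_measure ennreal_mult)
    qed
    also have "2 ^ m * (c * prob (D \<inter> A m)) = c * (2 ^ m * prob (D \<inter> A m))" by simp
    finally show ?thesis by (simp add: pD)
  qed
  have "ennreal (l m k * prob D) \<le> emeasure M (D \<inter> Es k)"
    unfolding e[OF l_nonneg, symmetric] J by (rule mult_left_mono[OF 1]) simp
  moreover have "emeasure M (D \<inter> Es k) \<le> ennreal (h m k * prob D)"
    unfolding e[OF hn, symmetric] J by (rule mult_left_mono[OF 2]) simp
  ultimately show ?thesis using l_nonneg hn by (simp add: emeasure_eq_measure)
qed

text \<open>The same bounds hold for the density of \<open>Es k\<close> in \<open>D\<close> and in
  the whole space, and their gap tends to zero. So \<open>D\<close> is independent of every
  \<open>Es k\<close>, hence of every event, hence of itself.\<close>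

lemma invariant_trivial:
  assumes N': "null_inv N'" "N \<subseteq> N'" and D: "D \<in> sets M"
    and inv: "\<And>m x. x \<in> A (Suc m) - N' \<Longrightarrow> \<tau> m x \<in> D \<longleftrightarrow> x \<in> D"
  shows "prob D = 0 \<or> prob D = 1"
proof -
  have N's: "N' \<in> null_sets M" using N' by (simp add: null_inv_def)
  define D' where "D' = D - N'"
  have D': "D' \<in> sets M" "D' \<inter> N' = {}" using D N's by (auto simp: D'_def)
  have pD': "prob D' = prob D" unfolding D'_def using measure_Diff_null_set[OF D N's] by simp
  have nn: "\<tau> m x \<notin> N'" if "x \<in> A (Suc m) - N'" for m x
    using null_inv_pw[OF N'(1) \<tau>, of x m] that A_space by blast
  have d1: "l m k * prob D' \<le> prob (D' \<inter> Es k) \<and> prob (D' \<inter> Es k) \<le> h m k * prob D'" for m k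
    by (rule invariant_density[OF N' D']) (use inv nn in \<open>auto simp: D'_def\<close>)
  have sp: "space M - N' \<in> sets M" using N's by auto
  have psp: "prob (space M - N') = 1" using measure_Diff_null_set[OF sets.top N's] prob_space by simp
  have d2: "l m k \<le> prob (Es k) \<and> prob (Es k) \<le> h m k" for m k
  proof -
    have "l m k * prob (space M - N') \<le> prob ((space M - N') \<inter> Es k) \<and>
        prob ((space M - N') \<inter> Es k) \<le> h m k * prob (space M - N')"
    proof (rule invariant_density[OF N' sp])
      show "\<tau> m x \<in> space M - N' \<longleftrightarrow> x \<in> space M - N'" if "x \<in> A (Suc m) - N'" for m x
        using nn[OF that] that A_space pw_space[OF \<tau>] by blast
    qed auto
    moreover have "Es k \<in> sets M" using Es(1) by (auto intro: sigma_sets.Basic)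
    moreover have "(space M - N') \<inter> Es k = Es k - N'" using Es(3) by auto
    ultimately show ?thesis using measure_Diff_null_set[of "Es k" M N'] N's psp by simp
  qed
  have gen: "prob (D' \<inter> Es k) = prob D' * prob (Es k)" for k
  proof -
    have "\<bar>prob (D' \<inter> Es k) - prob D' * prob (Es k)\<bar> \<le> h m k - l m k" for m
    proof -
      have p: "0 \<le> prob D'" "prob D' \<le> 1" by auto
      have "prob D' * l m k \<le> prob D' * prob (Es k)" "prob D' * prob (Es k) \<le> prob D' * h m k"
        using d2[of m k] p by (auto intro: mult_left_mono)
      moreover have "prob D' * (h m k - l m k) \<le> h m k - l m k"
        using d2[of m k] p by (intro mult_left_le_one_le) auto
      ultimately show ?thesis using d1[of m k]
        unfolding abs_le_iff right_diff_distrib mult.commute[of "prob D'"] by linarith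
    qed
    then have "\<bar>prob (D' \<inter> Es k) - prob D' * prob (Es k)\<bar> \<le> 0"
      by (intro LIMSEQ_le_const[OF osc[of k]]) auto
    then show ?thesis by simp
  qed
  have "prob (D' \<inter> B) = prob D' * prob B" if "B \<in> sets M" for B
  proof -
    have "B \<in> sigma_sets (space M) (range Es)" using that Es(1) by simp
    then show ?thesis
    proof (induction rule: sigma_sets_induct_disjoint[OF Es(2,3), consumes 1, case_names basic empty compl union])
      case (basic B) then show ?case using gen by auto
    next
      case (compl B)
      then have B: "B \<in> sets M" by (simp add: Es(1))
      have "D' \<inter> (space M - B) = D' - (D' \<inter> B)" using D'(1) sets.sets_into_space by blast
      then have "prob (D' \<inter> (space M - B)) = prob D' - prob (D' \<inter> B)"
        using finite_measure_Diff[of D' "D' \<inter> B"] D' B by simp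
      also have "\<dots> = prob D' * (1 - prob B)" using compl by (simp add: right_diff_distrib)
      finally show ?case using prob_compl[OF B] by simp
    next
      case (union B)
      then have B: "range B \<subseteq> sets M" by (auto simp: Es(1))
      have "(\<lambda>i. prob (D' \<inter> B i)) sums prob (\<Union>i. D' \<inter> B i)"
      proof (rule finite_measure_UNION)
        show "range (\<lambda>i. D' \<inter> B i) \<subseteq> sets M" using B D'(1) by auto
        show "disjoint_family (\<lambda>i. D' \<inter> B i)" using union(1) unfolding disjoint_family_on_def by blast
      qed
      moreover have "(\<lambda>i. prob D' * prob (B i)) sums (prob D' * prob (\<Union>i. B i))"
        by (intro sums_mult finite_measure_UNION) (use B union(1) in auto)
      ultimately have "prob (\<Union>i. D' \<inter> B i) = prob D' * prob (\<Union>i. B i)"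
        using union(3) by (simp add: sums_unique2)
      moreover have "D' \<inter> (\<Union>i. B i) = (\<Union>i. D' \<inter> B i)" by blast
      ultimately show ?case by (simp only:)
    qed simp
  qed
  from this[OF D'(1)] have "prob D' * (prob D' - 1) = 0" by (simp add: algebra_simps)
  then show ?thesis using pD' by simp
qed

end

lemma (in ergodic_relation) ergodic_element:
  "\<exists>a N'. pw a \<and> null_inv N' \<and> N0 \<subseteq> N' \<and> bij_betw a (space M - N') (space M - N') \<and>
    (\<forall>x\<in>space M - N'. R x (a x)) \<and>
    (\<forall>D\<in>sets M. (\<forall>x\<in>space M - N'. a x \<in> D \<longleftrightarrow> x \<in> D) \<longrightarrow> prob D = 0 \<or> prob D = 1)"
proof -
  obtain A F l h \<tau> N where "odometer M act R U N0 Es A F l h \<tau> N" using odometer_exists by blast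
  then interpret odometer M act R U N0 Es A F l h \<tau> N .
  obtain N1 where n1: "null_inv N1" "N \<subseteq> N1" "bij_betw odo (space M - N1) (space M - N1)"
    "\<forall>x\<in>space M - N1. R x (odo x)"
    "\<forall>D. (\<forall>x\<in>space M - N1. odo x \<in> D \<longleftrightarrow> x \<in> D) \<longrightarrow> (\<forall>m. \<forall>x\<in>A (Suc m) - N1. \<tau> m x \<in> D \<longleftrightarrow> x \<in> D)"
    using odo_properties by (elim exE conjE)
  have N1: "null_inv N1" "N \<subseteq> N1" "bij_betw odo (space M - N1) (space M - N1)"
    "\<And>x. x \<in> space M - N1 \<Longrightarrow> R x (odo x)" using n1 by auto
  have N1D: "\<tau> m x \<in> D \<longleftrightarrow> x \<in> D" if "\<And>x. x \<in> space M - N1 \<Longrightarrow> odo x \<in> D \<longleftrightarrow> x \<in> D" "x \<in> A (Suc m) - N1" for D m x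
  proof -
    have "\<forall>x\<in>space M - N1. odo x \<in> D \<longleftrightarrow> x \<in> D" using that(1) by blast
    from n1(5)[THEN spec[of _ D], THEN mp, OF this] show ?thesis using that(2) by blast
  qed
  define N' where "N' = N1 \<union> N0"
  have N': "null_inv N'" unfolding N'_def by (rule null_inv_Un[OF N1(1) N0(1)])
  have nn: "odo x \<in> N' \<longleftrightarrow> x \<in> N'" if "x \<in> space M" for x by (rule null_inv_pw[OF N' pw_odo that])
  have "bij_betw odo (space M - N') (space M - N')"
    by (rule null_inv_bij_mono[OF N' _ pw_odo N1(3)]) (auto simp: N'_def)
  moreover have "prob D = 0 \<or> prob D = 1"
    if D: "D \<in> sets M" "\<And>x. x \<in> space M - N' \<Longrightarrow> odo x \<in> D \<longleftrightarrow> x \<in> D" for D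
  proof -
    have N's: "N' \<in> null_sets M" using N' by (simp add: null_inv_def)
    have "odo x \<in> D - N' \<longleftrightarrow> x \<in> D - N'" if "x \<in> space M - N1" for x
      using D(2)[of x] nn[of x] that by auto
    from N1D[OF this] have "prob (D - N') = 0 \<or> prob (D - N') = 1"
      by (intro invariant_trivial[OF N1(1,2)]) (use D N's in auto)
    then show ?thesis using measure_Diff_null_set[OF D(1) N's] by simp
  qed
  ultimately show ?thesis
    using pw_odo N' N1(4) by (intro exI[of _ odo] exI[of _ N']) (auto simp: N'_def)
qed

section \<open>Free actions from a relation with crossing edges\<close>

context ergodic_relation begin

lemma pw_funpow: "pw a \<Longrightarrow> pw (a ^^ k)"
  by (induction k) (simp_all add: pw_id id_def comp_def pw_comp)

text \<open>The set of points with period dividing \<open>k\<close> is invariant. Were it conull,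
  the first \<open>k\<close> iterates of a subset of measure \<open>1 / (k + 1)\<close> would form
  an invariant set of measure strictly between zero and one.\<close>

lemma ergodic_aperiodic:
  assumes a: "pw a" and N': "null_inv N'" "N0 \<subseteq> N'" and bij: "bij_betw a (space M - N') (space M - N')"
    and erg: "\<And>D. D \<in> sets M \<Longrightarrow> (\<And>x. x \<in> space M - N' \<Longrightarrow> a x \<in> D \<longleftrightarrow> x \<in> D) \<Longrightarrow> prob D = 0 \<or> prob D = 1"
    and k: "k > 0"
  shows "{x \<in> space M - N'. (a ^^ k) x = x} \<in> null_sets M"
proof -
  let ?\<Omega> = "space M - N'"
  define P where "P = {x \<in> ?\<Omega>. (a ^^ k) x = x}"
  have N's: "N' \<in> sets M" using N' by (auto simp: null_inv_def)
  have aO: "a x \<in> ?\<Omega>" if "x \<in> ?\<Omega>" for x using bij that by (auto simp: bij_betw_def)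
  have akO: "(a ^^ i) x \<in> ?\<Omega>" if "x \<in> ?\<Omega>" for x i by (induction i) (use that aO in auto)
  have ainj: "x = y" if "x \<in> ?\<Omega>" "y \<in> ?\<Omega>" "a x = a y" for x y
    using bij that by (auto simp: bij_betw_def dest: inj_onD)
  have injk: "inj_on (a ^^ i) ?\<Omega>" for i
  proof (induction i)
    case (Suc i)
    show ?case
    proof (rule inj_onI)
      fix x y assume xy: "x \<in> ?\<Omega>" "y \<in> ?\<Omega>" "(a ^^ Suc i) x = (a ^^ Suc i) y"
      then have "(a ^^ i) x = (a ^^ i) y" using ainj[OF akO akO] by simp
      then show "x = y" using Suc xy by (auto dest: inj_onD)
    qed
  qed simp
  obtain c where c: "c \<in> M \<rightarrow>\<^sub>M count_space UNIV" "\<And>x. x \<in> space M \<Longrightarrow> (a ^^ k) x = act (c x) x"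
    using pw_funpow[OF a, of k] by (auto simp: pw_def)
  \<comment> \<open>Measurability: off \<open>N0\<close> only the element \<open>0\<close> fixes a
    point, so periodicity becomes a condition on the translating element.\<close>
  have "P = (c -` {0} \<inter> space M) - N'"
  proof (rule set_eqI)
    fix x
    have "(a ^^ k) x = x \<longleftrightarrow> c x = 0" if x: "x \<in> space M - N'"
    proof
      assume "(a ^^ k) x = x"
      then have "act (c x) x = x" using c(2)[of x] x by auto
      then show "c x = 0" using N0(2)[of x "c x"] x N'(2) by blast
    next
      assume "c x = 0"
      then show "(a ^^ k) x = x" using c(2)[of x] act_0[of x] x by simp
    qed
    then show "x \<in> P \<longleftrightarrow> x \<in> (c -` {0} \<inter> space M) - N'" by (auto simp: P_def)
  qed
  then have Pm: "P \<in> sets M" using measurable_sets[OF c(1), of "{0}"] N's by auto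
  have Pinv: "a x \<in> P \<longleftrightarrow> x \<in> P" if x: "x \<in> ?\<Omega>" for x
  proof -
    have "(a ^^ k) (a x) = a ((a ^^ k) x)" by (simp add: funpow_swap1)
    then show ?thesis using x aO[OF x] ainj[OF akO[OF x] x] by (auto simp: P_def)
  qed
  have "prob P \<noteq> 1"
  proof
    assume P1: "prob P = 1"
    obtain C where C: "C \<in> sets M" "C \<subseteq> P" "prob C = 1 / (k + 1)"
      using subset_of_prob[OF Pm, of "1 / (k + 1)"] P1 by auto
    have CO: "C \<subseteq> ?\<Omega>" using C(2) by (auto simp: P_def)
    define W where "W = (\<Union>i<k. (a ^^ i) ` C)"
    have inji: "inj_on (a ^^ i) C" for i using injk CO by (rule inj_on_subset)
    have im: "(a ^^ i) ` C \<in> sets M" "prob ((a ^^ i) ` C) = 1 / (k + 1)" for i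
      using pw_image_emeasure(1)[OF pw_funpow[OF a] C(1) inji] pw_image_prob[OF pw_funpow[OF a] C(1) inji] C(3) by auto
    have Wm: "W \<in> sets M" unfolding W_def using im by auto
    have "prob W \<le> (\<Sum>i<k. prob ((a ^^ i) ` C))"
      unfolding W_def by (rule finite_measure_subadditive_finite) (use im in auto)
    also have "\<dots> = k / (k + 1)" by (simp add: im)
    also have "\<dots> < 1" by simp
    finally have W1: "prob W < 1" .
    have "C \<subseteq> W" unfolding W_def using k by force
    then have "prob C \<le> prob W" by (rule finite_measure_mono[OF _ Wm])
    moreover have "prob C > 0" using C(3) by simp
    ultimately have W0: "prob W > 0" by linarith
    have "a x \<in> W \<longleftrightarrow> x \<in> W" if x: "x \<in> ?\<Omega>" for x
    proof
      assume "x \<in> W"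
      then obtain i y where i: "i < k" "y \<in> C" "x = (a ^^ i) y" by (auto simp: W_def)
      show "a x \<in> W"
      proof (cases "Suc i < k")
        case True
        then show ?thesis using i unfolding W_def by (intro UN_I[of "Suc i"]) auto
      next
        case False
        then have "Suc i = k" using i by simp
        then have "a x = y" using i C(2) by (auto simp: P_def)
        then show ?thesis using i \<open>C \<subseteq> W\<close> by auto
      qed
    next
      assume "a x \<in> W"
      then obtain i y where i: "i < k" "y \<in> C" "a x = (a ^^ i) y" by (auto simp: W_def)
      have yO: "y \<in> ?\<Omega>" using i CO by auto
      obtain j where j: "j < k" "a x = a ((a ^^ j) y)"
      proof (cases i)
        case 0
        obtain k' where k': "k = Suc k'" using k gr0_implies_Suc by blast
        have "a x = (a ^^ k) y" using i 0 C(2) by (auto simp: P_def)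
        then show ?thesis using that[of k'] k' by simp
      next
        case (Suc j)
        then show ?thesis using that[of j] i by simp
      qed
      then have "x = (a ^^ j) y" using ainj[OF x akO[OF yO]] by simp
      then show "x \<in> W" using j i by (auto simp: W_def)
    qed
    then have "prob W = 0 \<or> prob W = 1" by (rule erg[OF Wm])
    then show False using W0 W1 by simp
  qed
  then have "prob P = 0" using erg[OF Pm Pinv] by simp
  then show ?thesis using Pm unfolding P_def by (simp add: null_sets_def emeasure_eq_measure)
qed

text \<open>Fill the space greedily: each set takes as much of the remaining room as its quota
  \<open>prob (D j)\<close> allows.\<close>

lemma partition_below:
  fixes D :: "nat \<Rightarrow> 'x set"
  assumes D: "\<And>j. D j \<in> sets M"
  shows "\<exists>X. (\<forall>j<q. X j \<in> sets M \<and> prob (X j) \<le> prob (D j)) \<and> disjoint_family_on X {..<q} \<and>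
    prob (\<Union>j<q. X j) = min 1 (\<Sum>j<q. prob (D j))"
proof (induction q)
  case 0
  show ?case by (auto simp: disjoint_family_on_def)
next
  case (Suc q)
  then obtain X where X: "\<And>j. j < q \<Longrightarrow> X j \<in> sets M \<and> prob (X j) \<le> prob (D j)" "disjoint_family_on X {..<q}"
    "prob (\<Union>j<q. X j) = min 1 (\<Sum>j<q. prob (D j))" by blast
  define V where "V = (\<Union>j<q. X j)"
  have V: "V \<in> sets M" unfolding V_def using X(1) by auto
  have pc: "prob (space M - V) = 1 - prob V" by (rule prob_compl[OF V])
  obtain Y where Y: "Y \<in> sets M" "Y \<subseteq> space M - V" "prob Y = min (1 - prob V) (prob (D q))"
    using subset_of_prob[of "space M - V" "min (1 - prob V) (prob (D q))"] V pc by auto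
  define X' where "X' j = (if j = q then Y else X j)" for j
  have U: "(\<Union>j<Suc q. X' j) = V \<union> Y" by (auto simp: X'_def V_def lessThan_Suc)
  have "V \<inter> Y = {}" using Y by auto
  then have "prob (V \<union> Y) = prob V + prob Y" by (rule finite_measure_Union[OF V Y(1)])
  moreover have "v + min (1 - v) d = min 1 (S + d)" if "v = min 1 S" "0 \<le> S" "0 \<le> d" for v S d :: real
    using that by (auto simp: min_def)
  from this[OF X(3)[folded V_def] sum_nonneg measure_nonneg, of M "D q"]
  have "prob V + min (1 - prob V) (prob (D q)) = min 1 ((\<Sum>j<q. prob (D j)) + prob (D q))" by simp
  ultimately have "prob (\<Union>j<Suc q. X' j) = min 1 (\<Sum>j<Suc q. prob (D j))"
    unfolding U Y(3) by simp
  moreover have "disjoint_family_on X' {..<Suc q}"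
  proof -
    have "X m \<inter> X n = {}" if "m < q" "n < q" "m \<noteq> n" for m n
      using X(2) that unfolding disjoint_family_on_def by blast
    moreover have "X m \<inter> Y = {}" if "m < q" for m using Y(2) that unfolding V_def by blast
    ultimately have "X' m \<inter> X' n = {}" if "m < Suc q" "n < Suc q" "m \<noteq> n" for m n
      using that unfolding X'_def less_Suc_eq by (metis Int_commute)
    then show ?thesis unfolding disjoint_family_on_def by simp
  qed
  moreover have "\<forall>j<Suc q. X' j \<in> sets M \<and> prob (X' j) \<le> prob (D j)"
    using X(1) Y by (auto simp: X'_def less_Suc_eq)
  ultimately show ?case by blast
qed

text \<open>The partial maps \<open>x \<mapsto> g j x\<close> on \<open>D j\<close> have total measure at least one, so they can be cut and
  conjugated by elements of the full groupoid of \<open>R\<close> into a single automorphism.\<close>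
lemma crossing_element:
  fixes D :: "nat \<Rightarrow> 'x set" and g :: "nat \<Rightarrow> 'g"
  assumes D: "\<And>j. D j \<in> sets M" and total: "1 \<le> (\<Sum>j<q. prob (D j))"
  shows "\<exists>b e N. pw b \<and> null_inv N \<and> bij_betw b (space M - N) (space M - N) \<and> inj_on e (space M - N) \<and>
    (\<forall>x\<in>space M - N. e x \<in> {(j, u). j < q \<and> u \<in> D j} \<and> R x (snd (e x)) \<and> R (act (g (fst (e x))) (snd (e x))) (b x))"
proof -
  obtain X where X: "\<And>j. j < q \<Longrightarrow> X j \<in> sets M" "\<And>j. j < q \<Longrightarrow> prob (X j) \<le> prob (D j)"
    "disjoint_family_on X {..<q}" "prob (\<Union>j<q. X j) = 1"
    using partition_below[where D = D and q = q, OF D] total by (auto simp: min_def)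
  have "\<exists>D'. D' \<in> sets M \<and> D' \<subseteq> D j \<and> prob D' = prob (X j)" if "j < q" for j
    using subset_of_prob[OF D[of j], of "prob (X j)"] X(2)[OF that] by auto
  then obtain D' where D': "\<And>j. j < q \<Longrightarrow> D' j \<in> sets M" "\<And>j. j < q \<Longrightarrow> D' j \<subseteq> D j"
    "\<And>j. j < q \<Longrightarrow> prob (D' j) = prob (X j)" by metis
  define E where "E j = act (g j) ` D' j" for j
  have E: "E j \<in> sets M" "prob (E j) = prob (X j)" if "j < q" for j
    using act_image[OF D'(1)[OF that], of "g j"] D'(3)[OF that] by (auto simp: E_def)
  have "\<forall>j. \<exists>f N. j < q \<longrightarrow> pw f \<and> null_inv N \<and> bij_betw f (X j - N) (D' j - N) \<and> (\<forall>x\<in>X j - N. R x (f x))"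
    using matching[OF X(1) D'(1)] D'(3) by metis
  then obtain \<alpha> N1 where \<alpha>: "\<And>j. j < q \<Longrightarrow> pw (\<alpha> j)" "\<And>j. j < q \<Longrightarrow> null_inv (N1 j)"
    "\<And>j. j < q \<Longrightarrow> bij_betw (\<alpha> j) (X j - N1 j) (D' j - N1 j)" "\<And>j x. j < q \<Longrightarrow> x \<in> X j - N1 j \<Longrightarrow> R x (\<alpha> j x)"
    by metis
  have "\<forall>j. \<exists>f N. j < q \<longrightarrow> pw f \<and> null_inv N \<and> bij_betw f (E j - N) (X j - N) \<and> (\<forall>x\<in>E j - N. R x (f x))"
    using matching[OF E(1) X(1)] E(2) by metis
  then obtain \<psi> N2 where \<psi>: "\<And>j. j < q \<Longrightarrow> pw (\<psi> j)" "\<And>j. j < q \<Longrightarrow> null_inv (N2 j)"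
    "\<And>j. j < q \<Longrightarrow> bij_betw (\<psi> j) (E j - N2 j) (X j - N2 j)" "\<And>j x. j < q \<Longrightarrow> x \<in> E j - N2 j \<Longrightarrow> R x (\<psi> j x)"
    by metis
  have UX: "(\<Union>j<q. X j) \<in> sets M" using X(1) by auto
  have "prob (space M - (\<Union>j<q. X j)) = 0" using prob_compl[OF UX] X(4) by simp
  then have "space M - (\<Union>j<q. X j) \<in> null_sets M" using UX by (simp add: null_sets_def emeasure_eq_measure)
  then obtain N3 where N3: "null_inv N3" "space M - (\<Union>j<q. X j) \<subseteq> N3" using null_inv_saturate by blast
  define N where "N = N3 \<union> (\<Union>j\<in>{..<q}. N1 j \<union> N2 j)"
  have N: "null_inv N" unfolding N_def
    by (intro null_inv_Un N3 null_inv_UN) (use \<alpha>(2) \<psi>(2) in auto)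
  have sub: "N1 j \<subseteq> N" "N2 j \<subseteq> N" if "j < q" for j using that by (auto simp: N_def)
  have sp: "X j \<subseteq> space M" "D' j \<subseteq> space M" "E j \<subseteq> space M" if "j < q" for j
    using X(1) D'(1) E(1) that sets.sets_into_space by blast+
  \<comment> \<open>Within the \<open>R\<close>-class to the source of an edge, across that edge,
    and within the class reached back into \<open>X j\<close>: a self-map of \<open>X j\<close>
    crossing exactly one edge. These maps are glued to \<open>b\<close>.\<close>
  define \<phi> where "\<phi> j x = \<psi> j (act (g j) (\<alpha> j x))" for j x
  have b\<alpha>: "bij_betw (\<alpha> j) (X j - N) (D' j - N)" if "j < q" for j
    by (rule null_inv_bij_mono[OF N sub(1) \<alpha>(1,3)]) (use that sp in auto)
  have bg: "bij_betw (act (g j)) (D' j - N) (E j - N)" if "j < q" for j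
  proof (rule null_inv_bij_mono[OF N empty_subsetI pw_act])
    have "inj_on (act (g j)) (D' j)" by (rule inj_on_inverseI[of _ "act (- g j)"]) (use sp(2)[OF that] in auto)
    then show "bij_betw (act (g j)) (D' j - {}) (E j - {})" by (simp add: bij_betw_def E_def)
  qed (use that sp in auto)
  have b\<psi>: "bij_betw (\<psi> j) (E j - N) (X j - N)" if "j < q" for j
    by (rule null_inv_bij_mono[OF N sub(2) \<psi>(1,3)]) (use that sp in auto)
  have b\<phi>: "bij_betw (\<phi> j) (X j - N) (X j - N)" if "j < q" for j
    using bij_betw_trans[OF bij_betw_trans[OF b\<alpha> bg] b\<psi>, OF that that that] by (simp add: \<phi>_def[abs_def] comp_def)
  define idx where "idx x = (if \<exists>j<q. x \<in> X j then LEAST j. j < q \<and> x \<in> X j else q)" for x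
  have idx: "idx x = j" if "j < q" "x \<in> X j" for j x
  proof -
    have "(LEAST j. j < q \<and> x \<in> X j) = j"
    proof (rule Least_equality)
      fix i assume i: "i < q \<and> x \<in> X i"
      then have "i = j" using X(3) that unfolding disjoint_family_on_def by blast
      then show "j \<le> i" by simp
    qed (use that in simp)
    then show ?thesis using that by (auto simp: idx_def)
  qed
  have idx_ex: "idx x < q \<and> x \<in> X (idx x)" if xN: "x \<in> space M - N" for x
  proof -
    have "x \<in> (\<Union>j<q. X j)" using xN N3(2) by (auto simp: N_def)
    then obtain j where "j < q" "x \<in> X j" by blast
    then show ?thesis using idx by metis
  qed
  have idx_m: "idx \<in> M \<rightarrow>\<^sub>M count_space UNIV"
  proof -
    define X' where "X' j = (if j < q then X j else {})" for j
    have [measurable]: "X' j \<in> sets M" for j using X(1) by (simp add: X'_def)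
    have "idx x = (if \<exists>j. x \<in> X' j then LEAST j. x \<in> X' j else q)" for x
    proof -
      have "(j < q \<and> x \<in> X j) = (x \<in> X' j)" for j by (simp add: X'_def)
      then show ?thesis by (simp add: idx_def)
    qed
    then have e: "idx = (\<lambda>x. if \<exists>j. x \<in> X' j then LEAST j. x \<in> X' j else q)" by blast
    show ?thesis unfolding e by measurable
  qed
  define \<phi>' where "\<phi>' j = (if j < q then \<phi> j else (\<lambda>x. x))" for j
  define b where "b x = \<phi>' (idx x) x" for x
  have "pw (\<phi>' j)" for j
  proof (cases "j < q")
    case True
    then show ?thesis unfolding \<phi>'_def \<phi>_def[abs_def]
      using pw_comp[OF \<psi>(1) pw_comp[OF pw_act \<alpha>(1)]] by simp
  qed (simp add: \<phi>'_def pw_id)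
  then have pwb: "pw b" unfolding b_def by (rule pw_countable[OF _ idx_m]) auto
  have bx: "b x = \<phi> j x" if "j < q" "x \<in> X j" for j x using idx[OF that] that by (simp add: b_def \<phi>'_def)
  have bX: "b x \<in> X (idx x) - N" if "x \<in> space M - N" for x
    using b\<phi>[of "idx x"] idx_ex[OF that] that bx[of "idx x" x] by (auto simp: bij_betw_def)
  have bij: "bij_betw b (space M - N) (space M - N)"
  proof (rule bij_betw_imageI)
    show "inj_on b (space M - N)"
    proof (rule inj_onI)
      fix x y assume xy: "x \<in> space M - N" "y \<in> space M - N" "b x = b y"
      have "idx x = idx y"
        using bX[OF xy(1)] bX[OF xy(2)] xy(3) idx idx_ex xy(1,2) by (metis DiffD1)
      then have "\<phi> (idx x) x = \<phi> (idx x) y" using bx idx_ex xy by metis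
      moreover have "x \<in> X (idx x) - N" "y \<in> X (idx x) - N" 
      using idx_ex[OF xy(1)] idx_ex[OF xy(2)] xy \<open>idx x = idx y\<close> by auto
      ultimately show "x = y" using b\<phi>[of "idx x"] idx_ex[OF xy(1)] by (meson bij_betw_def inj_onD)
    qed
    show "b ` (space M - N) = space M - N"
    proof (rule set_eqI, rule iffI)
      fix y assume "y \<in> b ` (space M - N)"
      then obtain x where x: "x \<in> space M - N" "y = b x" by blast
      then show "y \<in> space M - N" using bX[OF x(1)] idx_ex[OF x(1)] sp(1)[of "idx x"] by auto
    next
      fix y assume y: "y \<in> space M - N"
      define j where "j = idx y"
      have j: "j < q" "y \<in> X j - N" using idx_ex[OF y] y by (auto simp: j_def)
      then have "y \<in> \<phi> j ` (X j - N)" using b\<phi>[OF j(1)] by (simp add: bij_betw_def)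
      then obtain x where x: "x \<in> X j - N" "y = \<phi> j x" by blast
      then have "y = b x" "x \<in> space M - N" using bx[OF j(1)] sp(1)[OF j(1)] by auto
      then show "y \<in> b ` (space M - N)" by blast
    qed
  qed
  \<comment> \<open>The crossed edge determines \<open>x\<close>: its label gives the part, and
    \<open>\<alpha>\<close> is injective on each part.\<close>
  define e where "e x = (idx x, \<alpha> (idx x) x)" for x
  have einj: "inj_on e (space M - N)"
  proof (rule inj_onI)
    fix x y assume xy: "x \<in> space M - N" "y \<in> space M - N" "e x = e y"
    then have "idx x = idx y" "\<alpha> (idx x) x = \<alpha> (idx x) y" by (auto simp: e_def)
    moreover have "x \<in> X (idx x) - N" "y \<in> X (idx x) - N" 
      using idx_ex[OF xy(1)] idx_ex[OF xy(2)] xy \<open>idx x = idx y\<close> by auto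
    ultimately show "x = y" using b\<alpha>[of "idx x"] idx_ex[OF xy(1)] by (meson bij_betw_def inj_onD)
  qed
  have eprop: "\<forall>x\<in>space M - N. e x \<in> {(j, u). j < q \<and> u \<in> D j} \<and> R x (snd (e x)) \<and>
    R (act (g (fst (e x))) (snd (e x))) (b x)"
  proof
    fix x assume x: "x \<in> space M - N"
    define j where "j = idx x"
    have j: "j < q" "x \<in> X j - N" using idx_ex[OF x] x by (auto simp: j_def)
    have ax: "\<alpha> j x \<in> D' j - N" using b\<alpha>[OF j(1)] j(2) by (auto simp: bij_betw_def)
    have gx: "act (g j) (\<alpha> j x) \<in> E j - N" using bg[OF j(1)] ax by (auto simp: bij_betw_def)
    have "R x (\<alpha> j x)" using \<alpha>(4)[OF j(1)] j(2) sub(1)[OF j(1)] by auto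
    moreover have "R (act (g j) (\<alpha> j x)) (\<psi> j (act (g j) (\<alpha> j x)))"
      using \<psi>(4)[OF j(1)] gx sub(2)[OF j(1)] by auto
    ultimately show "e x \<in> {(j, u). j < q \<and> u \<in> D j} \<and> R x (snd (e x)) \<and> R (act (g (fst (e x))) (snd (e x))) (b x)"
      using j ax D'(2)[OF j(1)] bx[OF j(1), of x] by (auto simp: e_def j_def[symmetric] \<phi>_def)
  qed
  show ?thesis
    by (rule exI[of _ b], rule exI[of _ e], rule exI[of _ N]) (intro conjI pwb N bij einj eprop)
qed

lemma pw_bij_measure_preserving:
  assumes f: "pw f" and bij: "bij_betw f (space M) (space M)"
  shows "inv_into (space M) f \<in> M \<rightarrow>\<^sub>M M" "distr M M f = M"
proof -
  have inj: "inj_on f (space M)" using bij by (simp add: bij_betw_def)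
  obtain h where h: "pw h" "\<And>x. x \<in> space M \<Longrightarrow> h (f x) = x"
    using pw_inverse[OF f sets.top inj] by blast
  have "inv_into (space M) f y = h y" if ys: "y \<in> space M" for y
  proof -
    have "y \<in> f ` space M" using bij ys by (simp add: bij_betw_def)
    then obtain x where "x \<in> space M" "y = f x" by blast
    then show ?thesis using h inj by simp
  qed
  then show "inv_into (space M) f \<in> M \<rightarrow>\<^sub>M M"
    by (rule measurable_cong[THEN iffD2, OF _ pw_measurable[OF h(1)]])
  show "distr M M f = M"
  proof (rule measure_eqI)
    fix B assume "B \<in> sets (distr M M f)"
    then have B: "B \<in> sets M" by simp
    define C where "C = f -` B \<inter> space M"
    have C: "C \<in> sets M" unfolding C_def by (rule measurable_sets[OF pw_measurable[OF f] B])
    have "f ` C = B"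
    proof -
      have "B \<subseteq> f ` space M" using B sets.sets_into_space bij by (auto simp: bij_betw_def)
      then show ?thesis by (auto simp: C_def)
    qed
    moreover have "inj_on f C" using inj by (auto simp: C_def inj_on_def)
    ultimately have "emeasure M B = emeasure M C" using pw_image_emeasure(2)[OF f C] by simp
    then show "emeasure (distr M M f) B = emeasure M B"
      using emeasure_distr[OF pw_measurable[OF f] B] by (simp add: C_def)
  qed simp
qed

text \<open>Ergodicity comes from \<open>a\<close> alone, freeness from
  \<open>free_word_act\<close>. Edges that start in \<open>N0\<close> are left out of
  \<open>E\<close>, because chains are controlled only at points with trivial stabilizer.\<close>

lemma free_F2_action_exists:
  fixes D :: "nat \<Rightarrow> 'x set" and g :: "nat \<Rightarrow> 'g" and q :: nat
  defines "E \<equiv> {(j, u). j < q \<and> u \<in> D j - N0}" and "dst \<equiv> (\<lambda>e. act (g (fst e)) (snd e))"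
  assumes D: "\<And>j. D j \<in> sets M" and total: "1 \<le> (\<Sum>j<q. prob (D j))"
    and open_chain: "\<And>f0 f. edge_chain R snd dst E f0 f \<Longrightarrow> \<not> R (etail snd dst f0) (etail dst snd f)"
  shows "\<exists>T. mp_F2_action M T \<and> ergodic_F2_action M T \<and> ess_free_F2_action M T \<and>
    (\<forall>x\<in>space M. \<forall>w. \<exists>\<gamma>. word_act (space M) T w x = act \<gamma> x)"
proof -
  obtain a Na where a': "pw a" "null_inv Na" "N0 \<subseteq> Na" "bij_betw a (space M - Na) (space M - Na)"
    "\<forall>x\<in>space M - Na. R x (a x)"
    "\<forall>D\<in>sets M. (\<forall>x\<in>space M - Na. a x \<in> D \<longleftrightarrow> x \<in> D) \<longrightarrow> prob D = 0 \<or> prob D = 1"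
    using ergodic_element by (elim exE conjE)
  have a: "pw a" "null_inv Na" "N0 \<subseteq> Na" "bij_betw a (space M - Na) (space M - Na)"
    "\<And>x. x \<in> space M - Na \<Longrightarrow> R x (a x)"
    "\<And>D. D \<in> sets M \<Longrightarrow> (\<And>x. x \<in> space M - Na \<Longrightarrow> a x \<in> D \<longleftrightarrow> x \<in> D) \<Longrightarrow> prob D = 0 \<or> prob D = 1"
    using a'(1-5) bspec[OF a'(6)] by auto
  have "(\<Union>k\<in>{0<..}. {x \<in> space M - Na. (a ^^ k) x = x}) \<in> null_sets M"
    by (intro null_sets_UN' ergodic_aperiodic[OF a(1-4)] a(6)) auto
  then obtain Np where Np: "null_inv Np" "(\<Union>k\<in>{0<..}. {x \<in> space M - Na. (a ^^ k) x = x}) \<subseteq> Np"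
    using null_inv_saturate by blast
  obtain b e Nb where b': "pw b" "null_inv Nb" "bij_betw b (space M - Nb) (space M - Nb)" "inj_on e (space M - Nb)"
    "\<forall>x\<in>space M - Nb. e x \<in> {(j, u). j < q \<and> u \<in> D j} \<and> R x (snd (e x)) \<and> R (act (g (fst (e x))) (snd (e x))) (b x)"
    using crossing_element[OF D total, of g] by (elim exE conjE)
  have b: "pw b" "null_inv Nb" "bij_betw b (space M - Nb) (space M - Nb)" "inj_on e (space M - Nb)"
    "\<And>x. x \<in> space M - Nb \<Longrightarrow> e x \<in> {(j, u). j < q \<and> u \<in> D j}"
    "\<And>x. x \<in> space M - Nb \<Longrightarrow> R x (snd (e x))"
    "\<And>x. x \<in> space M - Nb \<Longrightarrow> R (dst (e x)) (b x)"
    using b'(1-4) bspec[OF b'(5)] unfolding dst_def by auto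
  define N where "N = Na \<union> Np \<union> Nb"
  have N: "null_inv N" unfolding N_def by (intro null_inv_Un a b Np)
  have Ns: "N \<in> sets M" "N \<in> null_sets M" using N by (auto simp: null_inv_def)
  have sub: "Na \<subseteq> N" "Np \<subseteq> N" "Nb \<subseteq> N" by (auto simp: N_def)
  have N0N: "N0 \<subseteq> N" using a(3) sub by auto
  define f where "f i = (if i then b else a)" for i
  \<comment> \<open>The identity on an invariant null set, which makes both generators bijections of
    the whole space.\<close>
  define T where "T i x = (if x \<in> N then x else f i x)" for i x
  have pwf: "pw (f i)" for i using a b by (simp add: f_def)
  have pwT: "pw (T i)" for i unfolding T_def[abs_def] by (rule pw_if[OF pw_id pwf Ns(1)])
  have bijf: "bij_betw (f i) (space M - N) (space M - N)" for i
    using null_inv_bij_mono[OF N sub(1) a(1,4)] null_inv_bij_mono[OF N sub(3) b(1,3)] by (simp add: f_def)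
  have TO: "bij_betw (T i) (space M - N) (space M - N)" for i
    using bijf[of i] by (rule bij_betw_cong[THEN iffD1, rotated]) (simp add: T_def)
  have TX: "bij_betw (T i) (space M) (space M)" for i
  proof -
    have "bij_betw (T i) N N" by (rule bij_betw_cong[THEN iffD1, OF _ bij_betw_id]) (simp add: T_def)
    then have "bij_betw (T i) ((space M - N) \<union> N) ((space M - N) \<union> N)"
      by (rule bij_betw_combine[OF TO]) auto
    moreover have "(space M - N) \<union> N = space M" using Ns(1) sets.sets_into_space by blast
    ultimately show ?thesis by simp
  qed
  have mp: "mp_F2_action M T"
    unfolding mp_F2_action_def using TX pw_measurable[OF pwT] pw_bij_measure_preserving[OF pwT TX] by blast
  have TO': "T i x \<in> space M - N" if "x \<in> space M - N" for i x
    using TO[of i] that by (auto simp: bij_betw_def)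
  have erg: "ergodic_F2_action M T" unfolding ergodic_F2_action_def
  proof (intro ballI impI)
    fix A assume A: "A \<in> sets M" and inv: "\<forall>i. T i -` A \<inter> space M = A"
    have "a x \<in> A - N \<longleftrightarrow> x \<in> A - N" if x: "x \<in> space M - Na" for x
    proof (cases "x \<in> N")
      case True
      then show ?thesis using null_inv_pw[OF N a(1), of x] x by auto
    next
      case False
      have "a x = T False x" using False by (simp add: T_def f_def)
      moreover have "T False x \<in> A \<longleftrightarrow> x \<in> A" using inv x by blast
      moreover have "a x \<notin> N" using False null_inv_pw[OF N a(1), of x] x by auto
      ultimately show ?thesis using False by auto
    qed
    from a(6)[OF _ this] have "prob (A - N) = 0 \<or> prob (A - N) = 1" using A Ns(1) by auto
    then show "prob A = 0 \<or> prob A = 1" using measure_Diff_null_set[OF A Ns(2)] by simp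
  qed
  have Ta: "(T False ^^ k) x = (a ^^ k) x \<and> (T False ^^ k) x \<in> space M - N" if x: "x \<in> space M - N" for x k
  proof (induction k)
    case (Suc k)
    have "T False y = a y" if "y \<notin> N" for y using that by (simp add: T_def f_def)
    moreover have "(a ^^ k) x \<in> space M - N" "(T False ^^ k) x = (a ^^ k) x" using Suc by auto
    ultimately show ?case using TO'[of "(a ^^ k) x" False] by auto
  qed (use x in simp)
  have free: "word_act (space M) T w x \<noteq> x" if x: "x \<in> space M - N" and w: "reduced_word w" "w \<noteq> []" for x w
  proof (rule free_word_act[where \<Omega> = "space M - N" and ed = e and E = E and src = snd and dst = dst and R = R])
    show "R x (T False x)" if "x \<in> space M - N" for x
      using a(5)[of x] that sub by (auto simp: T_def f_def)
    show "(T False ^^ k) x \<noteq> x" if "x \<in> space M - N" "k > 0" for x k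
      using Ta[OF that(1), of k] Np(2) sub that by auto
    show "e x \<in> E" if xN: "x \<in> space M - N" for x
    proof -
      have xNb: "x \<in> space M - Nb" using xN sub by auto
      \<comment> \<open>The source of the crossed edge lies in the orbit of \<open>x\<close>, and
        \<open>N0\<close> is invariant.\<close>
      have "snd (e x) \<notin> N0"
      proof
        assume n0: "snd (e x) \<in> N0"
        from R_orbit[OF R_sym[OF b(6)[OF xNb]]] obtain h where "x = act h (snd (e x))" by blast
        then have "x \<in> N0" using n0 N0(1) unfolding null_inv_def by metis
        then show False using xN N0N by auto
      qed
      then show ?thesis using b(5)[OF xNb] by (auto simp: E_def)
    qed
    show "inj_on e (space M - N)" by (rule inj_on_subset[OF b(4)]) (use sub in auto)
    show "R x (snd (e x))" if "x \<in> space M - N" for x using b(6) that sub by auto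
    show "R (dst (e x)) (T True x)" if "x \<in> space M - N" for x using b(7)[of x] that sub by (auto simp: T_def f_def)
    show "bij_betw (T i) (space M - N) (space M - N)" "bij_betw (T i) (space M) (space M)" for i
      by (rule TO, rule TX)
    show "R x z" if "R x y" "R y z" for x y z using R_trans that .
    show "R y x" if "R x y" for x y using R_sym that .
    show "\<not> R (etail snd dst f0) (etail dst snd f)" if "edge_chain R snd dst E f0 f" for f0 f
      using open_chain that .
  qed (use x w R_refl in auto)
  have "ess_free_F2_action M T" unfolding ess_free_F2_action_def
  proof (rule AE_I'[OF Ns(2)], rule subsetI, rule ccontr)
    fix x assume "x \<in> {x \<in> space M. \<not> (\<forall>w. reduced_word w \<and> w \<noteq> [] \<longrightarrow> word_act (space M) T w x \<noteq> x)}" "x \<notin> N"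
    then show False using free[of x] by auto
  qed
  moreover have "\<exists>\<gamma>. word_act (space M) T w x = act \<gamma> x" if x: "x \<in> space M" for w x
  proof (induction w)
    case Nil
    show ?case using act_0[OF x] by (intro exI[of _ 0]) (simp add: word_act_def)
  next
    case (Cons l w)
    then obtain \<gamma> where \<gamma>: "word_act (space M) T w x = act \<gamma> x" by blast
    define y where "y = act \<gamma> x"
    have y: "y \<in> space M" using x by (simp add: y_def)
    have "\<exists>h. letter_act (space M) T l y = act h y"
    proof (cases "snd l")
      case False
      then show ?thesis using pw_orbit[OF pwT y] by (simp add: letter_act_def)
    next
      case True
      have "y \<in> T (fst l) ` space M" using TX[of "fst l"] y by (simp add: bij_betw_def)
      then obtain z where z: "z \<in> space M" "y = T (fst l) z" by blast
      obtain h where h: "y = act h z" using pw_orbit[OF pwT z(1)] z(2) by metis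
      have "inv_into (space M) (T (fst l)) y = z"
        using TX[of "fst l"] z by (simp add: bij_betw_def)
      then show ?thesis using True z(1) h by (intro exI[of _ "- h"]) (simp add: letter_act_def)
    qed
    then obtain h where "letter_act (space M) T l y = act h y" by blast
    moreover have "word_act (space M) T (l # w) x = letter_act (space M) T l (word_act (space M) T w x)"
      by (simp add: word_act_def)
    ultimately show ?case using \<gamma> act_add[OF x, of h \<gamma>] by (intro exI[of _ "h + \<gamma>"]) (simp add: y_def)
  qed
  ultimately show ?thesis using mp erg by blast
qed

end

section \<open>The Bernoulli field\<close>

locale bernoulli_field =
  fixes n :: nat and p :: real and s :: "nat \<Rightarrow> 'g::group_add"
  assumes p: "0 < p" "p < 1" and n_pos: "0 < n"
    and countable_G: "countable (UNIV :: 'g set)" and infinite_G: "infinite (UNIV :: 'g set)"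
begin

abbreviation M :: "(nat \<Rightarrow> 'g \<Rightarrow> bool) measure" where
  "M \<equiv> prod_bernoulli n p"

abbreviation act :: "'g \<Rightarrow> (nat \<Rightarrow> 'g \<Rightarrow> bool) \<Rightarrow> nat \<Rightarrow> 'g \<Rightarrow> bool" where
  "act \<equiv> diag_shift n"

lemma space_M: "space M = {x. \<forall>i\<ge>n. x i = undefined}"
proof -
  have "space (bern p) = UNIV" by (simp add: bern_def)
  then have "space (bernoulli_space p (UNIV::'g set)) = UNIV"
    by (auto simp: bernoulli_space_def space_PiM PiE_def extensional_def)
  then show ?thesis unfolding prod_bernoulli_def by (auto simp: space_PiM PiE_def extensional_def)
qed

lemma measurable_component: "i < n \<Longrightarrow> (\<lambda>x. x i g) \<in> M \<rightarrow>\<^sub>M count_space UNIV"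
proof -
  assume "i < n"
  then have "(\<lambda>x. x i) \<in> M \<rightarrow>\<^sub>M bernoulli_space p UNIV"
    unfolding prod_bernoulli_def by (intro measurable_component_singleton) simp
  moreover have "(\<lambda>f. f g) \<in> bernoulli_space p UNIV \<rightarrow>\<^sub>M bern p"
    unfolding bernoulli_space_def by (intro measurable_component_singleton) simp
  ultimately have "(\<lambda>x. x i g) \<in> M \<rightarrow>\<^sub>M bern p" by (rule measurable_compose)
  also have "measurable M (bern p) = measurable M (count_space UNIV)"
    by (rule measurable_cong_sets) (auto simp: bern_def)
  finally show ?thesis .
qed

lemma sets_component [measurable]: "i < n \<Longrightarrow> {x \<in> space M. x i g = b} \<in> sets M"
  using measurable_sets[OF measurable_component, of i "{b}" g] by (simp add: vimage_def Int_def conj_commute)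

lemma measurable_into_M:
  assumes "\<And>i g. i < n \<Longrightarrow> (\<lambda>x. f x i g) \<in> N \<rightarrow>\<^sub>M count_space UNIV"
    and "\<And>x. x \<in> space N \<Longrightarrow> f x \<in> space M"
  shows "f \<in> N \<rightarrow>\<^sub>M M"
  unfolding prod_bernoulli_def
proof (rule measurable_PiM_single')
  show "(\<lambda>x. f x i) \<in> N \<rightarrow>\<^sub>M bernoulli_space p UNIV" if "i \<in> {..<n}" for i
    unfolding bernoulli_space_def
  proof (rule measurable_PiM_single')
    have "measurable N (bern p) = measurable N (count_space UNIV)"
      by (rule measurable_cong_sets) (auto simp: bern_def)
    then show "(\<lambda>x. f x i g) \<in> N \<rightarrow>\<^sub>M bern p" for g using assms(1) that by auto
  qed (auto simp: bern_def)
  show "(\<lambda>x i. f x i) \<in> space N \<rightarrow> (\<Pi>\<^sub>E i\<in>{..<n}. space (bernoulli_space p UNIV))"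
    using assms(2) by (auto simp: prod_bernoulli_def space_PiM)
qed

lemma sets_pred [measurable]: "i < n \<Longrightarrow> {x \<in> space M. x i g} \<in> sets M"
  using sets_component[of i g True] by simp

sublocale prob_space M
proof -
  interpret B: prob_space "bern p" unfolding bern_def by (rule prob_space_measure_pmf)
  interpret I: product_prob_space "\<lambda>_::'g. bern p" UNIV by standard
  have "prob_space (bernoulli_space p (UNIV :: 'g set))" unfolding bernoulli_space_def by (rule I.prob_space_axioms)
  then show "prob_space M" unfolding prod_bernoulli_def by (rule prob_space_PiM)
qed

section \<open>Cylinders, resampling and independence\<close>

definition cyl :: "((nat \<times> 'g) \<times> bool) set \<Rightarrow> (nat \<Rightarrow> 'g \<Rightarrow> bool) set" where
  "cyl G = {x \<in> space M. \<forall>((i, g), b)\<in>G. x i g = b}"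

definition cyl_ok :: "((nat \<times> 'g) \<times> bool) set \<Rightarrow> bool" where
  "cyl_ok G \<longleftrightarrow> finite G \<and> (\<forall>((i, g), b)\<in>G. i < n)"

definition bset :: "((nat \<times> 'g) \<times> bool) set \<Rightarrow> nat \<times> 'g \<Rightarrow> bool set" where
  "bset G e = {b. \<forall>b'. (e, b') \<in> G \<longrightarrow> b = b'}"

lemma cyl_iff: "x \<in> cyl G \<longleftrightarrow> x \<in> space M \<and> (\<forall>i g b. ((i, g), b) \<in> G \<longrightarrow> x i g = b)"
  unfolding cyl_def Ball_def split_paired_All by simp

lemma cyl_ok_iff: "cyl_ok G \<longleftrightarrow> finite G \<and> (\<forall>i g b. ((i, g), b) \<in> G \<longrightarrow> i < n)"
  unfolding cyl_ok_def Ball_def split_paired_All by simp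

lemma cyl_sets: "cyl_ok G \<Longrightarrow> cyl G \<in> sets M"
proof -
  assume G: "cyl_ok G"
  have "cyl G = space M \<inter> (\<Inter>((i, g), b)\<in>G. {x \<in> space M. x i g = b})"
    by (auto simp: cyl_def)
  also have "\<dots> \<in> sets M"
  proof (cases "G = {}")
    case False
    then have "(\<Inter>((i, g), b)\<in>G. {x \<in> space M. x i g = b}) \<in> sets M"
      using G by (intro sets.finite_INT) (auto simp: cyl_ok_def)
    then show ?thesis by auto
  qed auto
  finally show ?thesis .
qed

lemma cyl_Un: "cyl (G \<union> G') = cyl G \<inter> cyl G'"
  unfolding cyl_def ball_Un by blast

text \<open>The space is a finite product of infinite products; the formula merges the two levels
  into one product over the constrained coordinates.\<close>

lemma cyl_prob: assumes G: "cyl_ok G" shows "prob (cyl G) = (\<Prod>e\<in>fst ` G. measure (bern p) (bset G e))"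
proof -
  interpret B: prob_space "bern p" unfolding bern_def by (rule prob_space_measure_pmf)
  interpret I: product_prob_space "\<lambda>_::'g. bern p" UNIV by standard
  have pI: "prob_space (bernoulli_space p (UNIV :: 'g set))" unfolding bernoulli_space_def by (rule I.prob_space_axioms)
  interpret O: finite_product_prob_space "\<lambda>_::nat. bernoulli_space p (UNIV :: 'g set)" "{..<n}"
    by (intro finite_product_prob_space.intro product_prob_spaceI pI finite_product_sigma_finite.intro
      finite_product_sigma_finite_axioms.intro product_sigma_finite.intro prob_space_imp_sigma_finite) auto
  define Gi where "Gi i = {g. (i, g) \<in> fst ` G}" for i
  have fG: "finite (fst ` G)" using G by (simp add: cyl_ok_def)
  have fGi: "finite (Gi i)" for i
    by (rule finite_subset[of _ "snd ` fst ` G"]) (use fG in \<open>force simp: Gi_def\<close>)+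
  define X where "X i = {f \<in> space (Pi\<^sub>M UNIV (\<lambda>_::'g. bern p)). \<forall>g\<in>Gi i. f g \<in> bset G (i, g)}" for i
  have sU: "space (Pi\<^sub>M UNIV (\<lambda>_::'g. bern p)) = UNIV"
    by (auto simp: space_PiM PiE_def extensional_def bern_def)
  have XI: "X i = prod_emb UNIV (\<lambda>_. bern p) (Gi i) (\<Pi>\<^sub>E g\<in>Gi i. bset G (i, g))" for i
    unfolding X_def sU by (auto simp: prod_emb_def bern_def restrict_PiE_iff space_PiM)
  have Xs: "X i \<in> sets (bernoulli_space p UNIV)" for i
    unfolding XI bernoulli_space_def by (intro sets_PiM_I fGi) (auto simp: bern_def)
  have Xm: "measure (bernoulli_space p UNIV) (X i) = (\<Prod>g\<in>Gi i. measure (bern p) (bset G (i, g)))" for i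
    unfolding XI bernoulli_space_def by (rule I.measure_PiM_emb) (use fGi in \<open>auto simp: bern_def\<close>)
  have "cyl G = (\<Pi>\<^sub>E i\<in>{..<n}. X i)"
  proof (rule set_eqI)
    fix x
    have "x \<in> (\<Pi>\<^sub>E i\<in>{..<n}. X i) \<longleftrightarrow> x \<in> space M \<and> (\<forall>i<n. x i \<in> X i)"
      by (auto simp: space_M PiE_def extensional_def)
    also have "\<dots> \<longleftrightarrow> x \<in> space M \<and> (\<forall>i<n. \<forall>g b. ((i, g), b) \<in> G \<longrightarrow> x i g = b)"
    proof -
      have "(i, g) \<in> fst ` G" if "((i, g), b) \<in> G" for i g b
        using that by (rule rev_image_eqI) simp
      then have "x i \<in> X i \<longleftrightarrow> (\<forall>g b. ((i, g), b) \<in> G \<longrightarrow> x i g = b)" for i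
        unfolding X_def sU Gi_def bset_def by blast
      then show ?thesis by simp
    qed
    also have "\<dots> \<longleftrightarrow> x \<in> cyl G" using G unfolding cyl_iff cyl_ok_iff by blast
    finally show "x \<in> cyl G \<longleftrightarrow> x \<in> (\<Pi>\<^sub>E i\<in>{..<n}. X i)" by simp
  qed
  then have "prob (cyl G) = (\<Prod>i<n. \<Prod>g\<in>Gi i. measure (bern p) (bset G (i, g)))"
    using O.prob_times[of X] Xs Xm by (simp add: prod_bernoulli_def)
  also have "\<dots> = (\<Prod>e\<in>Sigma {..<n} Gi. measure (bern p) (bset G e))"
    by (subst prod.Sigma) (use fGi in \<open>auto simp: case_prod_unfold\<close>)
  also have "Sigma {..<n} Gi = fst ` G"
    using G by (force simp: Gi_def cyl_ok_def)
  finally show ?thesis .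
qed

lemma cyl_prob_Un:
  assumes "cyl_ok G" "cyl_ok G'" "fst ` G \<inter> fst ` G' = {}"
  shows "prob (cyl (G \<union> G')) = prob (cyl G) * prob (cyl G')"
proof -
  have ok: "cyl_ok (G \<union> G')" using assms by (auto simp: cyl_ok_def)
  have memfst: "e \<in> fst ` Z" if "(e, b) \<in> Z" for e b and Z :: "((nat \<times> 'g) \<times> bool) set"
    using that by (rule rev_image_eqI) simp
  have 1: "bset (G \<union> G') e = bset G e" if "e \<in> fst ` G" for e
  proof -
    have "(e, b) \<notin> G'" for b using memfst[of e b G'] that assms(3) by blast
    then show ?thesis by (simp add: bset_def)
  qed
  have 2: "bset (G \<union> G') e = bset G' e" if "e \<in> fst ` G'" for e
  proof -
    have "(e, b) \<notin> G" for b using memfst[of e b G] that assms(3) by blast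
    then show ?thesis by (simp add: bset_def)
  qed
  have "prob (cyl (G \<union> G')) = (\<Prod>e\<in>fst ` G \<union> fst ` G'. measure (bern p) (bset (G \<union> G') e))"
    by (simp add: cyl_prob[OF ok] image_Un)
  also have "\<dots> = (\<Prod>e\<in>fst ` G. measure (bern p) (bset (G \<union> G') e)) * (\<Prod>e\<in>fst ` G'. measure (bern p) (bset (G \<union> G') e))"
    using assms by (intro prod.union_disjoint) (auto simp: cyl_ok_def)
  also have "\<dots> = prob (cyl G) * prob (cyl G')"
    by (simp add: cyl_prob[OF assms(1)] cyl_prob[OF assms(2)] 1 2)
  finally show ?thesis .
qed

lemma sets_M: "sets M = sigma_sets (space M) (cyl ` Collect cyl_ok)"
proof
  let ?E = "cyl ` Collect cyl_ok"
  have sub: "?E \<subseteq> Pow (space M)" by (auto simp: cyl_def)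
  define N where "N = sigma (space M) ?E"
  have N: "space N = space M" "sets N = sigma_sets (space M) ?E" using sub by (auto simp: N_def)
  have "(\<lambda>x. x) \<in> N \<rightarrow>\<^sub>M M"
  proof (rule measurable_into_M)
    fix i g assume i: "i < n"
    show "(\<lambda>x. x i g) \<in> N \<rightarrow>\<^sub>M count_space UNIV"
    proof (rule measurable_count_space_eq2_countable[THEN iffD2], intro conjI ballI)
      fix b :: bool
      have "(\<lambda>x. x i g) -` {b} \<inter> space N = cyl {((i, g), b)}" by (auto simp: N cyl_def)
      moreover have "cyl_ok {((i, g), b)}" using i by (simp add: cyl_ok_def)
      ultimately show "(\<lambda>x. x i g) -` {b} \<inter> space N \<in> sets N"
        unfolding N(2) by (auto intro: sigma_sets.Basic)
    qed auto
  qed (simp add: N)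
  then have "A \<in> sets N" if "A \<in> sets M" for A
    using measurable_sets[of "\<lambda>x. x" N M A] that N(1) sets.sets_into_space[OF that] by (simp add: Int_absorb2 vimage_def)
  then show "sets M \<subseteq> sigma_sets (space M) ?E" using N(2) by blast
  show "sigma_sets (space M) ?E \<subseteq> sets M"
    by (rule sets.sigma_sets_subset) (use cyl_sets in auto)
qed

lemma Int_stable_cyl: "Int_stable (cyl ` Collect cyl_ok)"
proof (rule Int_stableI)
  fix A B assume "A \<in> cyl ` Collect cyl_ok" "B \<in> cyl ` Collect cyl_ok"
  then obtain G G' where "cyl_ok G" "A = cyl G" "cyl_ok G'" "B = cyl G'" by auto
  moreover then have "cyl_ok (G \<union> G')" by (auto simp: cyl_ok_def)
  ultimately show "A \<inter> B \<in> cyl ` Collect cyl_ok" using cyl_Un[of G G'] by blast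
qed

lemma measure_eq_M:
  assumes "sets N = sets M" "finite_measure N" "\<And>G. cyl_ok G \<Longrightarrow> measure N (cyl G) = prob (cyl G)"
  shows "N = M"
proof -
  interpret N: finite_measure N by fact
  show ?thesis
  proof (rule measure_eqI_generator_eq[where \<Omega> = "space M" and E = "cyl ` Collect cyl_ok" and A = "\<lambda>_. space M"])
    show "Int_stable (cyl ` Collect cyl_ok)" by (rule Int_stable_cyl)
    show "emeasure N X = emeasure M X" if "X \<in> cyl ` Collect cyl_ok" for X
      using that assms(3) by (auto simp: N.emeasure_eq_measure emeasure_eq_measure)
    have "cyl {} = space M" by (simp add: cyl_def)
    then show "range (\<lambda>_::nat. space M) \<subseteq> cyl ` Collect cyl_ok" by (auto simp: cyl_ok_def intro!: rev_image_eqI[of "{}"])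
  qed (use sets_M assms(1) in \<open>auto simp: cyl_def\<close>)
qed

lemma act_eq: "i < n \<Longrightarrow> act \<gamma> x i g = x i (- \<gamma> + g)"
  by (simp add: diag_shift_def)

lemma act_in_space: "act \<gamma> x \<in> space M"
  by (simp add: space_M diag_shift_def)

lemma act_measurable: "act \<gamma> \<in> M \<rightarrow>\<^sub>M M"
  by (rule measurable_into_M) (auto simp: act_eq act_in_space measurable_component)

lemma act_zero: "x \<in> space M \<Longrightarrow> act 0 x = x"
  by (auto simp: diag_shift_def space_M restrict_def)

lemma act_plus: "act (\<gamma> + \<delta>) x = act \<gamma> (act \<delta> x)"
  by (rule ext) (auto simp: diag_shift_def minus_add add.assoc simp del: add_uminus_conv_diff)

lemma distr_act: "distr M M (act \<gamma>) = M"
proof (rule measure_eq_M)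
  show "finite_measure (distr M M (act \<gamma>))" by (intro finite_measure_distr act_measurable)
  fix G assume G: "cyl_ok G"
  define f where "f = (\<lambda>((i::nat, g), b::bool). ((i, - \<gamma> + g), b))"
  have fG: "cyl_ok (f ` G)" using G by (auto simp: cyl_ok_def f_def)
  have pre: "act \<gamma> -` cyl G \<inter> space M = cyl (f ` G)"
    using G by (fastforce simp: cyl_def f_def act_in_space act_eq cyl_ok_def)
  define f1 where "f1 = (\<lambda>(i::nat, g). (i, - \<gamma> + g))"
  have ff: "fst ` f ` G = f1 ` fst ` G" by (force simp: f_def f1_def)
  have inj: "inj f1" by (auto simp: inj_on_def f1_def)
  have mem: "(f1 e, b) \<in> f ` G \<longleftrightarrow> (e, b) \<in> G" for e b
    by (cases e) (force simp: f_def f1_def)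
  have "prob (cyl (f ` G)) = (\<Prod>e\<in>f1 ` fst ` G. measure (bern p) (bset (f ` G) e))"
    by (simp add: cyl_prob[OF fG] ff)
  also have "\<dots> = (\<Prod>e\<in>fst ` G. measure (bern p) (bset (f ` G) (f1 e)))"
    by (subst prod.reindex) (use inj in \<open>auto intro: inj_on_subset\<close>)
  also have "\<dots> = (\<Prod>e\<in>fst ` G. measure (bern p) (bset G e))" by (simp add: bset_def mem)
  finally have "prob (cyl (f ` G)) = prob (cyl G)" by (simp add: cyl_prob[OF G])
  then show "measure (distr M M (act \<gamma>)) (cyl G) = prob (cyl G)"
    using measure_distr[OF act_measurable cyl_sets[OF G]] pre by simp
qed simp

sublocale pmp_action M act
  by standard (auto simp: countable_G act_measurable distr_act act_zero act_plus)

text \<open>By \<open>distr_mg\<close>, two independent samples merge into one of the same law, so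
  conditioning on the coordinates in \<open>S\<close> becomes Fubini.\<close>

definition mg :: "(nat \<times> 'g) set \<Rightarrow> (nat \<Rightarrow> 'g \<Rightarrow> bool) \<Rightarrow> (nat \<Rightarrow> 'g \<Rightarrow> bool) \<Rightarrow> nat \<Rightarrow> 'g \<Rightarrow> bool" where
  "mg S x y = restrict (\<lambda>i g. if (i, g) \<in> S then x i g else y i g) {..<n}"

lemma mg_eq: "i < n \<Longrightarrow> mg S x y i g = (if (i, g) \<in> S then x i g else y i g)"
  by (simp add: mg_def)

lemma mg_space: "mg S x y \<in> space M"
  by (simp add: space_M mg_def)

lemma mg_measurable [measurable]: "(\<lambda>(x, y). mg S x y) \<in> M \<Otimes>\<^sub>M M \<rightarrow>\<^sub>M M"
proof (rule measurable_into_M)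
  fix i g assume i: "i < n"
  have 1: "(\<lambda>z. fst z i g) \<in> M \<Otimes>\<^sub>M M \<rightarrow>\<^sub>M count_space UNIV" "(\<lambda>z. snd z i g) \<in> M \<Otimes>\<^sub>M M \<rightarrow>\<^sub>M count_space UNIV"
    using measurable_compose[OF measurable_fst measurable_component[OF i]]
      measurable_compose[OF measurable_snd measurable_component[OF i]] by auto
  then show "(\<lambda>z. (case z of (x, y) \<Rightarrow> mg S x y) i g) \<in> M \<Otimes>\<^sub>M M \<rightarrow>\<^sub>M count_space UNIV"
    by (cases "(i, g) \<in> S") (simp_all add: case_prod_unfold mg_eq i)
qed (auto simp: mg_space)

sublocale MM: pair_prob_space M M ..

lemma distr_mg: "distr (M \<Otimes>\<^sub>M M) M (\<lambda>(x, y). mg S x y) = M"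
proof (rule measure_eq_M)
  show "finite_measure (distr (M \<Otimes>\<^sub>M M) M (\<lambda>(x, y). mg S x y))"
    by (intro MM.P.finite_measure_distr mg_measurable)
  fix G assume G: "cyl_ok G"
  define G1 where "G1 = {z \<in> G. fst z \<in> S}"
  define G2 where "G2 = {z \<in> G. fst z \<notin> S}"
  have ok: "cyl_ok G1" "cyl_ok G2" using G by (auto simp: cyl_ok_def G1_def G2_def)
  have GU: "G = G1 \<union> G2" by (auto simp: G1_def G2_def)
  have "(\<lambda>(x, y). mg S x y) -` cyl G \<inter> space (M \<Otimes>\<^sub>M M) = cyl G1 \<times> cyl G2"
    using G by (fastforce simp: cyl_def mg_space mg_eq G1_def G2_def cyl_ok_def space_pair_measure split: if_splits)
  then have "measure (distr (M \<Otimes>\<^sub>M M) M (\<lambda>(x, y). mg S x y)) (cyl G) = measure (M \<Otimes>\<^sub>M M) (cyl G1 \<times> cyl G2)"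
    using measure_distr[OF mg_measurable cyl_sets[OF G]] by simp
  also have "\<dots> = prob (cyl G1) * prob (cyl G2)"
    using emeasure_pair_measure_Times[OF cyl_sets[OF ok(1)] cyl_sets[OF ok(2)]]
    by (simp add: measure_def enn2real_mult)
  also have "\<dots> = prob (cyl G)"
    unfolding GU by (rule cyl_prob_Un[symmetric, OF ok]) (auto simp: G1_def G2_def)
  finally show "measure (distr (M \<Otimes>\<^sub>M M) M (\<lambda>(x, y). mg S x y)) (cyl G) = prob (cyl G)" .
qed simp

text \<open>Determination by the coordinates in \<open>S\<close> is exact rather than up to null
  sets, so it passes pointwise through \<open>mg\<close>.\<close>

definition dep :: "(nat \<times> 'g) set \<Rightarrow> (nat \<Rightarrow> 'g \<Rightarrow> bool) set \<Rightarrow> bool" where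
  "dep S A \<longleftrightarrow> A \<in> sets M \<and>
     (\<forall>x\<in>space M. \<forall>y\<in>space M. (\<forall>i g. i < n \<longrightarrow> (i, g) \<in> S \<longrightarrow> x i g = y i g) \<longrightarrow> (x \<in> A \<longleftrightarrow> y \<in> A))"

lemma dep_sets: "dep S A \<Longrightarrow> A \<in> sets M"
  by (simp add: dep_def)

lemma depD:
  assumes "dep S A" "x \<in> space M" "y \<in> space M" "\<And>i g. i < n \<Longrightarrow> (i, g) \<in> S \<Longrightarrow> x i g = y i g"
  shows "x \<in> A \<longleftrightarrow> y \<in> A"
proof -
  have "(\<forall>i g. i < n \<longrightarrow> (i, g) \<in> S \<longrightarrow> x i g = y i g) \<longrightarrow> (x \<in> A \<longleftrightarrow> y \<in> A)"
    using assms(1-3) unfolding dep_def by (elim conjE) (drule (1) bspec, erule (1) bspec)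
  then show ?thesis by (rule mp) (use assms(4) in simp)
qed

lemma depI:
  assumes "A \<in> sets M" and "\<And>x y. x \<in> space M \<Longrightarrow> y \<in> space M \<Longrightarrow>
    (\<And>i g. i < n \<Longrightarrow> (i, g) \<in> S \<Longrightarrow> x i g = y i g) \<Longrightarrow> x \<in> A \<Longrightarrow> y \<in> A"
  shows "dep S A"
  unfolding dep_def
proof (intro conjI ballI impI iffI)
  fix x y assume xy: "x \<in> space M" "y \<in> space M" "\<forall>i g. i < n \<longrightarrow> (i, g) \<in> S \<longrightarrow> x i g = y i g"
  show "y \<in> A" if "x \<in> A" by (rule assms(2)[OF xy(1,2) _ that]) (use xy(3) in simp)
  show "x \<in> A" if "y \<in> A" by (rule assms(2)[OF xy(2,1) _ that]) (use xy(3) in simp)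
qed fact

lemma dep_mono:
  assumes "dep S A" "S \<subseteq> S'" shows "dep S' A"
proof (rule depI[OF dep_sets[OF assms(1)]])
  fix x y assume xy: "x \<in> space M" "y \<in> space M" "\<And>i g. i < n \<Longrightarrow> (i, g) \<in> S' \<Longrightarrow> x i g = y i g" "x \<in> A"
  have "x \<in> A \<longleftrightarrow> y \<in> A" by (rule depD[OF assms(1) xy(1,2)]) (use xy(3) assms(2) in blast)
  then show "y \<in> A" using xy(4) by simp
qed

lemma dep_mg1: "dep S A \<Longrightarrow> S \<subseteq> S' \<Longrightarrow> x \<in> space M \<Longrightarrow> mg S' x y \<in> A \<longleftrightarrow> x \<in> A"
  by (rule depD) (auto simp: mg_space mg_eq)

lemma dep_mg2: "dep S A \<Longrightarrow> S \<inter> S' = {} \<Longrightarrow> y \<in> space M \<Longrightarrow> mg S' x y \<in> A \<longleftrightarrow> y \<in> A"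
  by (rule depD) (auto simp: mg_space mg_eq)

lemma dep_Int:
  assumes "dep S A" "dep S' B" shows "dep (S \<union> S') (A \<inter> B)"
proof (rule depI)
  show "A \<inter> B \<in> sets M" using assms[THEN dep_sets] by auto
  fix x y assume xy: "x \<in> space M" "y \<in> space M" "\<And>i g. i < n \<Longrightarrow> (i, g) \<in> S \<union> S' \<Longrightarrow> x i g = y i g" "x \<in> A \<inter> B"
  have "x \<in> A \<longleftrightarrow> y \<in> A" by (rule depD[OF assms(1) xy(1,2)]) (use xy(3) in simp)
  moreover have "x \<in> B \<longleftrightarrow> y \<in> B" by (rule depD[OF assms(2) xy(1,2)]) (use xy(3) in simp)
  ultimately show "y \<in> A \<inter> B" using xy(4) by simp
qed

text \<open>In a merged pair, the first event reads only the first sample and the second event only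
  the second.\<close>

lemma indep:
  assumes A: "dep S A" and B: "dep S' B" and disj: "S \<inter> S' = {}"
  shows "prob (A \<inter> B) = prob A * prob B"
proof -
  note AB = dep_sets[OF A] dep_sets[OF B]
  have "(\<lambda>(x, y). mg S x y) -` (A \<inter> B) \<inter> space (M \<Otimes>\<^sub>M M) = A \<times> B"
    using AB[THEN sets.sets_into_space] dep_mg1[OF A order_refl] dep_mg2[OF B, of S] disj
    by (auto simp: space_pair_measure Int_commute)
  moreover have "prob (A \<inter> B) = measure (distr (M \<Otimes>\<^sub>M M) M (\<lambda>(x, y). mg S x y)) (A \<inter> B)"
    by (simp add: distr_mg)
  ultimately have "prob (A \<inter> B) = measure (M \<Otimes>\<^sub>M M) (A \<times> B)"
    using measure_distr[OF mg_measurable sets.Int[OF AB]] by simp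
  also have "\<dots> = prob A * prob B"
    using emeasure_pair_measure_Times[OF AB] by (simp add: measure_def enn2real_mult)
  finally show ?thesis .
qed

lemma measure_bern: "measure (bern p) {True} = p" "measure (bern p) {False} = 1 - p"
  using p by (simp_all add: bern_def measure_pmf_single)

lemma prob_open:
  assumes "finite F" "F \<subseteq> {..<n} \<times> UNIV"
  shows "prob {x \<in> space M. \<forall>(i, g)\<in>F. x i g} = p ^ card F"
proof -
  define G where "G = (\<lambda>e. (e, True)) ` F"
  have ok: "cyl_ok G" using assms by (auto simp: cyl_ok_def G_def)
  have "cyl G = {x \<in> space M. \<forall>(i, g)\<in>F. x i g}" by (force simp: cyl_def G_def)
  moreover have "fst ` G = F" by (force simp: G_def)
  moreover have "bset G e = {True}" if "e \<in> F" for e using that by (auto simp: bset_def G_def)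
  ultimately show ?thesis using cyl_prob[OF ok] measure_bern by simp
qed

lemma approximation:
  assumes "A \<in> sets M" "0 < \<epsilon>"
  shows "\<exists>K B. finite K \<and> dep (UNIV \<times> K) B \<and> prob ((A - B) \<union> (B - A)) < \<epsilon>"
proof -
  have "A \<in> sigma_sets (space M) (cyl ` Collect cyl_ok)" using assms(1) sets_M by simp
  then show ?thesis using assms(2)
  proof (induction arbitrary: \<epsilon>)
    case (Basic A)
    then obtain G where G: "A = cyl G" "cyl_ok G" by auto
    define K where "K = snd ` fst ` G"
    have "dep (UNIV \<times> K) A"
      unfolding dep_def G(1)
    proof (intro conjI ballI impI cyl_sets G)
      fix x y assume "x \<in> space M" "y \<in> space M" and eq: "\<forall>i g. i < n \<longrightarrow> (i, g) \<in> UNIV \<times> K \<longrightarrow> x i g = y i g"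
      have "x i g = y i g" if "((i, g), b) \<in> G" for i g b
        using eq that G(2) by (force simp: K_def cyl_ok_def)
      then show "x \<in> cyl G \<longleftrightarrow> y \<in> cyl G"
        using \<open>x \<in> space M\<close> \<open>y \<in> space M\<close> by (auto simp: cyl_def)
    qed
    moreover have "finite K" using G by (simp add: K_def cyl_ok_def)
    ultimately show ?case using Basic by (intro exI[of _ K] exI[of _ A]) simp
  next
    case Empty
    then show ?case by (intro exI[of _ "{}"]) (simp add: dep_def)
  next
    case (Compl A)
    then obtain K B where KB: "finite K" "dep (UNIV \<times> K) B" "prob ((A - B) \<union> (B - A)) < \<epsilon>"
      using Compl(2)[OF Compl(3)] by (elim exE conjE)
    have As: "A \<in> sets M" using Compl sets_M by simp
    have sub: "A \<subseteq> space M" "B \<subseteq> space M" 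
      using sets.sets_into_space[OF As] sets.sets_into_space[OF dep_sets[OF KB(2)]] by auto
    have "((space M - A) - (space M - B)) \<union> ((space M - B) - (space M - A)) = (A - B) \<union> (B - A)"
      using sub by auto
    moreover have "dep (UNIV \<times> K) (space M - B)" 
      using KB(2) unfolding dep_def by blast
    ultimately show ?case using KB(1,3) by (intro exI[of _ K] exI[of _ "space M - B"]) simp
  next
    case (Union A)
    have As: "A i \<in> sets M" for i using Union sets_M by simp
    define P where "P m = (\<Union>i<m. A i)" for m :: nat
    have Ps: "P m \<in> sets M" for m using As by (auto simp: P_def)
    have UP: "(\<Union>m. P m) = (\<Union>i. A i)" by (auto simp: P_def)
    have "incseq P" by (fastforce simp: incseq_def P_def)
    then have "(\<lambda>m. prob (P m)) \<longlonglongrightarrow> prob (\<Union>i. A i)"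
      using finite_Lim_measure_incseq[of P] Ps unfolding UP by auto
    then obtain m where m: "\<bar>prob (P m) - prob (\<Union>i. A i)\<bar> < \<epsilon> / 2"
      using LIMSEQ_D[of _ _ "\<epsilon> / 2"] Union(3) by force
    \<comment> \<open>Half of the error goes to truncating the union, the other half to the
      \<open>m\<close> approximations; the \<open>+ 1\<close> covers \<open>m = 0\<close>.\<close>
    define \<delta> where "\<delta> = (\<epsilon> / 2) / (real m + 1)"
    have \<delta>: "\<delta> > 0" using Union(3) by (simp add: \<delta>_def)
    obtain K B where KB: "\<And>i. finite (K i)" "\<And>i. dep (UNIV \<times> K i) (B i)" "\<And>i. prob ((A i - B i) \<union> (B i - A i)) < \<delta>"
      using Union(2)[OF \<delta>] by metis
    have Bs: "B i \<in> sets M" for i using KB(2) dep_sets by blast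
    define K' where "K' = (\<Union>i<m. K i)"
    define B' where "B' = (\<Union>i<m. B i)"
    have B's: "B' \<in> sets M" using Bs by (auto simp: B'_def)
    have "dep (UNIV \<times> K') B'"
    proof -
      have "dep (UNIV \<times> K') (B i)" if "i < m" for i
        by (rule dep_mono[OF KB(2)[of i]]) (use that in \<open>auto simp: K'_def\<close>)
      note dB = this
      show ?thesis
      proof (rule depI[OF B's])
        fix x y assume xy: "x \<in> space M" "y \<in> space M"
          "\<And>i g. i < n \<Longrightarrow> (i, g) \<in> UNIV \<times> K' \<Longrightarrow> x i g = y i g" "x \<in> B'"
        then obtain i where i: "i < m" "x \<in> B i" by (auto simp: B'_def)
        have "x \<in> B i \<longleftrightarrow> y \<in> B i" by (rule depD[OF dB[OF i(1)] xy(1,2)]) (rule xy(3))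
        then show "y \<in> B'" using i by (auto simp: B'_def)
      qed
    qed
    moreover have "finite K'" using KB by (simp add: K'_def)
    moreover have "prob (((\<Union>i. A i) - B') \<union> (B' - (\<Union>i. A i))) < \<epsilon>"
    proof -
      let ?D = "\<lambda>i. (A i - B i) \<union> (B i - A i)"
      have "((\<Union>i. A i) - B') \<union> (B' - (\<Union>i. A i)) \<subseteq> ((\<Union>i. A i) - P m) \<union> (\<Union>i<m. ?D i)"
        by (auto simp: B'_def P_def)
      then have "prob (((\<Union>i. A i) - B') \<union> (B' - (\<Union>i. A i))) \<le> prob (((\<Union>i. A i) - P m) \<union> (\<Union>i<m. ?D i))"
        using As Bs Ps by (intro finite_measure_mono) auto
      also have "\<dots> \<le> prob ((\<Union>i. A i) - P m) + prob (\<Union>i<m. ?D i)"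
        using As Bs Ps by (intro measure_Un_le) auto
      also have "prob ((\<Union>i. A i) - P m) = prob (\<Union>i. A i) - prob (P m)"
        using As Ps by (intro finite_measure_Diff) (auto simp: P_def)
      also have "prob (\<Union>i<m. ?D i) \<le> (\<Sum>i<m. prob (?D i))"
        using As Bs by (intro finite_measure_subadditive_finite) auto
      also have "\<dots> \<le> (\<Sum>i<m. \<delta>)" using KB(3) by (intro sum_mono) (simp add: less_imp_le)
      also have "\<dots> = m * \<delta>" by simp
      also have "m * \<delta> \<le> \<epsilon> / 2"
      proof -
        have "m * \<delta> \<le> (real m + 1) * \<delta>" using \<delta> by simp
        also have "\<dots> = \<epsilon> / 2"
        proof -
          have "real m + 1 \<noteq> 0" by simp
          then show ?thesis unfolding \<delta>_def by (rule nonzero_mult_div_cancel_left[of "real m + 1" "\<epsilon> / 2", folded times_divide_eq_right])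
        qed
        finally show ?thesis .
      qed
      finally show ?thesis using m by linarith
    qed
    ultimately show ?case by (intro exI[of _ K'] exI[of _ B'] conjI)
  qed
qed

end

text \<open>In base three with digits zero and one there are no carries: beyond the first
  difference, at \<open>k\<close>, the remaining digits change the sum by at most half of
  \<open>(1/3) ^ k\<close>.\<close>

lemma ternary_expansion_inject:
  fixes f g :: "nat \<Rightarrow> bool"
  assumes eq: "(\<Sum>k. of_bool (f k) * (1/3::real) ^ k) = (\<Sum>k. of_bool (g k) * (1/3) ^ k)"
  shows "f = g"
proof (rule ccontr)
  assume "f \<noteq> g"
  then have ex: "\<exists>k. f k \<noteq> g k" by blast
  define k where "k = (LEAST k. f k \<noteq> g k)"
  have k: "f k \<noteq> g k" "\<And>j. j < k \<Longrightarrow> f j = g j"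
    unfolding k_def using LeastI_ex[OF ex] not_less_Least by blast+
  have sg: "summable (\<lambda>k. (1/3::real) ^ k)" by (rule summable_geometric) simp
  have s1: "summable (\<lambda>k. of_bool (h k) * (1/3::real) ^ k)" for h :: "nat \<Rightarrow> bool"
    by (rule summable_comparison_test'[OF sg, of 0]) (simp add: of_bool_def)
  define d where "d j = (of_bool (f j) - of_bool (g j)) * (1/3::real) ^ j" for j
  have sd: "summable d" unfolding d_def left_diff_distrib by (rule summable_diff[OF s1 s1])
  have d0: "suminf d = 0"
    unfolding d_def left_diff_distrib using suminf_diff[OF s1 s1, of f g] eq by simp
  have dj: "\<bar>d j\<bar> \<le> (1/3) ^ j" for j by (simp add: d_def of_bool_def)
  have "suminf d = (\<Sum>j. d (j + Suc k)) + (\<Sum>j<Suc k. d j)"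
    by (rule suminf_split_initial_segment[OF sd])
  moreover have "(\<Sum>j<Suc k. d j) = d k" using k(2) by (simp add: d_def)
  ultimately have "\<bar>d k\<bar> = \<bar>\<Sum>j. d (j + Suc k)\<bar>" using d0 by simp
  also have "\<dots> \<le> (\<Sum>j. (1/3) ^ (j + Suc k))"
  proof -
    have sk: "summable (\<lambda>j. (1/3::real) ^ (j + Suc k))"
      using summable_ignore_initial_segment[OF sg] .
    have sa: "summable (\<lambda>j. \<bar>d (j + Suc k)\<bar>)"
      by (rule summable_comparison_test'[OF sk, of 0]) (simp only: real_norm_def abs_abs dj)
    have "\<bar>\<Sum>j. d (j + Suc k)\<bar> \<le> (\<Sum>j. \<bar>d (j + Suc k)\<bar>)" by (rule summable_rabs[OF sa])
    also have "\<dots> \<le> (\<Sum>j. (1/3) ^ (j + Suc k))" by (rule suminf_le[OF _ sa sk]) (rule dj)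
    finally show ?thesis .
  qed
  also have "\<dots> = (1/3) ^ Suc k * (\<Sum>j. (1/3::real) ^ j)"
    unfolding power_add by (subst suminf_mult2[symmetric]) (use sg in \<open>simp_all add: mult.commute\<close>)
  also have "\<dots> = (1/3) ^ k / 2" by (simp add: suminf_geometric)
  finally have "\<bar>d k\<bar> \<le> (1/3) ^ k / 2" .
  moreover have "\<bar>d k\<bar> = (1/3) ^ k" using k(1) by (cases "f k"; cases "g k") (auto simp: d_def)
  ultimately show False by simp
qed

context bernoulli_field begin

lemma null_of_power:
  assumes "B \<in> sets M" "0 \<le> r" "r < 1" "\<And>m::nat. prob B \<le> r ^ m"
  shows "B \<in> null_sets M"
proof -
  have "(\<lambda>m. r ^ m) \<longlonglongrightarrow> 0" using assms(2,3) by (rule LIMSEQ_realpow_zero)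
  then have "prob B \<le> 0" by (rule LIMSEQ_le_const) (use assms(4) in auto)
  then have "prob B = 0" using measure_nonneg[of M B] by linarith
  then show ?thesis using assms(1) by (simp add: null_sets_def emeasure_eq_measure)
qed

section \<open>An atomless function, essential freeness and mass transport\<close>

definition enum :: "nat \<Rightarrow> 'g" where
  "enum = from_nat_into UNIV"

lemma enum: "bij enum"
  unfolding enum_def using bij_betw_from_nat_into[OF countable_G infinite_G] .

definition U :: "(nat \<Rightarrow> 'g \<Rightarrow> bool) \<Rightarrow> real" where
  "U x = (\<Sum>k. of_bool (x 0 (enum k)) * (1/3) ^ k)"

lemma U_measurable: "U \<in> borel_measurable M"
proof -
  have [measurable]: "(\<lambda>x. x 0 (enum k)) \<in> M \<rightarrow>\<^sub>M count_space UNIV" for k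
    by (rule measurable_component[OF n_pos])
  show ?thesis unfolding U_def[abs_def] by measurable
qed

text \<open>A level set of \<open>U\<close> fixes all values in factor \<open>0\<close>, so it lies
  in cylinders of measure at most \<open>r ^ m\<close>.\<close>

lemma U_atomless: "prob {x \<in> space M. U x = u} = 0"
proof (cases "{x \<in> space M. U x = u} = {}")
  case False
  then obtain x0 where x0: "x0 \<in> space M" "U x0 = u" by auto
  define r where "r = max p (1 - p)"
  have r: "0 \<le> r" "r < 1" using p by (auto simp: r_def)
  have m: "{x \<in> space M. U x = u} \<in> sets M" using U_measurable by measurable
  have "prob {x \<in> space M. U x = u} \<le> r ^ m" for m
  proof -
    define G where "G = (\<lambda>k. ((0::nat, enum k), x0 0 (enum k))) ` {..<m}"
    have ok: "cyl_ok G" using n_pos by (auto simp: cyl_ok_iff G_def)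
    have "x \<in> cyl G" if "x \<in> {x \<in> space M. U x = u}" for x
    proof -
      have Ux: "U x = U x0" and xs: "x \<in> space M" using that x0 by auto
      have "(\<lambda>k. x 0 (enum k)) = (\<lambda>k. x0 0 (enum k))"
        using Ux unfolding U_def by (rule ternary_expansion_inject)
      then have "x 0 (enum k) = x0 0 (enum k)" for k by (rule fun_cong)
      then show ?thesis using xs by (auto simp: cyl_iff G_def)
    qed
    then have "{x \<in> space M. U x = u} \<subseteq> cyl G" by (rule subsetI)
    then have "prob {x \<in> space M. U x = u} \<le> prob (cyl G)"
      by (rule finite_measure_mono[OF _ cyl_sets[OF ok]])
    also have "\<dots> = (\<Prod>e\<in>fst ` G. measure (bern p) (bset G e))" by (rule cyl_prob[OF ok])
    also have "\<dots> \<le> (\<Prod>e\<in>fst ` G. r)"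
    proof (rule prod_mono, intro conjI measure_nonneg)
      fix e assume "e \<in> fst ` G"
      then obtain z where "z \<in> G" "e = fst z" by (rule imageE)
      then have "(e, snd z) \<in> G" by simp
      then have "bset G e \<subseteq> {snd z}" unfolding bset_def by blast
      moreover have "measure (bern p) {b} \<le> r" for b using measure_bern by (cases b) (simp_all add: r_def)
      ultimately show "measure (bern p) (bset G e) \<le> r"
        using r(1) by (cases "bset G e = {}") (auto simp: subset_singleton_iff)
    qed
    also have "\<dots> = r ^ m"
    proof -
      have "fst ` G = (\<lambda>k. (0, enum k)) ` {..<m}" by (force simp: G_def)
      moreover have "inj_on (\<lambda>k. (0::nat, enum k)) {..<m}"
        using enum by (auto simp: inj_on_def bij_def)
      ultimately show ?thesis by (simp add: card_image)
    qed
    finally show ?thesis .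
  qed
  then have "{x \<in> space M. U x = u} \<in> null_sets M" by (rule null_of_power[OF m r])
  then show ?thesis by (simp add: null_sets_def measure_def)
qed (simp only: measure_empty)

text \<open>A fixed point has equal values at \<open>g\<close> and \<open>- \<gamma> + g\<close> for
  every \<open>g\<close>. Over disjoint pairs of coordinates these are independent events of
  probability \<open>q < 1\<close>, and an infinite group supplies arbitrarily many disjoint
  pairs.\<close>

lemma stabilizer_null:
  assumes \<gamma>: "\<gamma> \<noteq> 0"
  shows "\<exists>N\<in>null_sets M. {x \<in> space M. act \<gamma> x = x} \<subseteq> N"
proof -
  define q where "q = p\<^sup>2 + (1 - p)\<^sup>2"
  have "q = 1 - 2 * (p * (1 - p))" by (simp add: q_def power2_eq_square algebra_simps)
  moreover have "p * (1 - p) > 0" using p by simp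
  ultimately have "q < 1" by linarith
  moreover have "0 \<le> q" by (simp add: q_def)
  ultimately have q: "0 \<le> q" "q < 1" by auto
  define T where "T g = {x \<in> space M. x 0 g = x 0 (- \<gamma> + g)}" for g
  have gg: "- \<gamma> + g \<noteq> g" for g
  proof
    assume "- \<gamma> + g = g"
    then have "- \<gamma> = 0" by (metis add_right_imp_eq add_0)
    then show False using \<gamma> by simp
  qed
  have T: "dep (UNIV \<times> {g, - \<gamma> + g}) (T g)" "prob (T g) = q" for g
  proof -
    define G where "G b = {((0::nat, g), b), ((0, - \<gamma> + g), b)}" for b :: bool
    have ok: "cyl_ok (G b)" for b using n_pos by (auto simp: G_def cyl_ok_iff)
    have cG: "cyl (G b) = {x \<in> space M. x 0 g = b \<and> x 0 (- \<gamma> + g) = b}" for b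
      by (auto simp: cyl_def G_def)
    have TU: "T g = cyl (G True) \<union> cyl (G False)"
      unfolding cG T_def by auto
    then have Tm: "T g \<in> sets M" using cyl_sets[OF ok] by auto
    show "dep (UNIV \<times> {g, - \<gamma> + g}) (T g)"
      by (rule depI[OF Tm]) (use n_pos in \<open>auto simp: T_def\<close>)
    have "fst ` G b = {(0, g), (0, - \<gamma> + g)}" for b by (auto simp: G_def)
    moreover have "bset (G b) (0, g) = {b}" "bset (G b) (0, - \<gamma> + g) = {b}" for b
      by (auto simp: bset_def G_def)
    ultimately have "prob (cyl (G b)) = (measure (bern p) {b})\<^sup>2" for b
      using cyl_prob[OF ok[of b]] gg[of g] by (simp add: power2_eq_square)
    moreover have "cyl (G True) \<inter> cyl (G False) = {}" unfolding cG by auto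
    then have "prob (T g) = prob (cyl (G True)) + prob (cyl (G False))"
      unfolding TU by (rule finite_measure_Union[OF cyl_sets[OF ok] cyl_sets[OF ok]])
    ultimately show "prob (T g) = q" by (simp add: measure_bern q_def)
  qed
  have ex: "\<exists>K Q. finite K \<and> dep (UNIV \<times> K) Q \<and> {x \<in> space M. act \<gamma> x = x} \<subseteq> Q \<and> prob Q = q ^ m" for m
  proof (induction m)
    case 0
    have "dep (UNIV \<times> {}) (space M)" by (rule depI) auto
    then show ?case using prob_space by (intro exI[of _ "{}"] exI[of _ "space M"]) auto
  next
    case (Suc m)
    then obtain K Q where KQ: "finite K" "dep (UNIV \<times> K) Q" "{x \<in> space M. act \<gamma> x = x} \<subseteq> Q" "prob Q = q ^ m" by blast
    have "finite (K \<union> (\<lambda>k. \<gamma> + k) ` K)" using KQ by simp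
    \<comment> \<open>Both coordinates of the new pair, \<open>g\<close> and
      \<open>- \<gamma> + g\<close>, then avoid \<open>K\<close>.\<close>
    then obtain g where g: "g \<notin> K \<union> (\<lambda>k. \<gamma> + k) ` K" using infinite_G ex_new_if_finite by metis
    have "- \<gamma> + g \<notin> K"
    proof
      assume "- \<gamma> + g \<in> K"
      then have "\<gamma> + (- \<gamma> + g) \<in> (\<lambda>k. \<gamma> + k) ` K" by (rule imageI)
      then show False using g by simp
    qed
    then have "prob (Q \<inter> T g) = prob Q * prob (T g)"
      using g by (intro indep[OF KQ(2) T(1)]) auto
    moreover have "{x \<in> space M. act \<gamma> x = x} \<subseteq> T g"
    proof
      fix x assume x: "x \<in> {x \<in> space M. act \<gamma> x = x}"
      then have "act \<gamma> x 0 g = x 0 g" by simp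
      then show "x \<in> T g" using x n_pos by (simp add: T_def act_eq)
    qed
    moreover have "dep (UNIV \<times> (K \<union> {g, - \<gamma> + g})) (Q \<inter> T g)"
      by (rule dep_mono[OF dep_Int[OF KQ(2) T(1)[of g]]]) auto
    ultimately show ?case using KQ T(2)
      by (intro exI[of _ "K \<union> {g, - \<gamma> + g}"] exI[of _ "Q \<inter> T g"]) auto
  qed
  have "\<exists>Q. Q \<in> sets M \<and> {x \<in> space M. act \<gamma> x = x} \<subseteq> Q \<and> prob Q = q ^ m" for m
  proof -
    obtain K Q where "dep (UNIV \<times> K) Q" "{x \<in> space M. act \<gamma> x = x} \<subseteq> Q" "prob Q = q ^ m"
      using ex[of m] by (elim exE conjE)
    then show ?thesis by (intro exI[of _ Q] conjI dep_sets)
  qed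
  from choice[OF allI[OF this]] obtain Q where
    "\<forall>m. Q m \<in> sets M \<and> {x \<in> space M. act \<gamma> x = x} \<subseteq> Q m \<and> prob (Q m) = q ^ m" ..
  then have Qs: "\<And>m. Q m \<in> sets M" and KQ: "\<And>m. {x \<in> space M. act \<gamma> x = x} \<subseteq> Q m" "\<And>m. prob (Q m) = q ^ m"
    by simp_all
  have "(\<Inter>m. Q m) \<in> null_sets M"
  proof (rule null_of_power[OF _ q])
    show "(\<Inter>m. Q m) \<in> sets M" using Qs by auto
    show "prob (\<Inter>m. Q m) \<le> q ^ m" for m
      unfolding KQ(2)[symmetric] by (rule finite_measure_mono) (use Qs in auto)
  qed
  moreover have "{x \<in> space M. act \<gamma> x = x} \<subseteq> (\<Inter>m. Q m)" by (rule INF_greatest) (rule KQ(1))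
  ultimately show ?thesis by (intro bexI[of _ "\<Inter>m. Q m"])
qed

lemma essentially_free: "\<exists>N0. null_inv N0 \<and> (\<forall>x\<in>space M - N0. \<forall>g. act g x = x \<longrightarrow> g = 0)"
proof -
  have "\<exists>N. \<gamma> \<noteq> 0 \<longrightarrow> N \<in> null_sets M \<and> {x \<in> space M. act \<gamma> x = x} \<subseteq> N" for \<gamma>
    using stabilizer_null[of \<gamma>] by (cases "\<gamma> = 0") auto
  from choice[OF allI[OF this]] obtain Ng where
    "\<forall>\<gamma>. \<gamma> \<noteq> 0 \<longrightarrow> Ng \<gamma> \<in> null_sets M \<and> {x \<in> space M. act \<gamma> x = x} \<subseteq> Ng \<gamma>" ..
  then have Ng: "\<And>\<gamma>. \<gamma> \<noteq> 0 \<Longrightarrow> Ng \<gamma> \<in> null_sets M" "\<And>\<gamma>. \<gamma> \<noteq> 0 \<Longrightarrow> {x \<in> space M. act \<gamma> x = x} \<subseteq> Ng \<gamma>"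
    by simp_all
  have "(\<Union>\<gamma>\<in>UNIV - {0}. Ng \<gamma>) \<in> null_sets M"
    by (rule null_sets_UN'[OF countable_subset[OF subset_UNIV countable_G]]) (simp add: Ng(1))
  from null_inv_saturate[OF this] obtain N0 where N0: "null_inv N0" "(\<Union>\<gamma>\<in>UNIV - {0}. Ng \<gamma>) \<subseteq> N0"
    by (elim exE conjE)
  have "g = 0" if x: "x \<in> space M - N0" "act g x = x" for x g
  proof (rule ccontr)
    assume g: "g \<noteq> 0"
    have "x \<in> {x \<in> space M. act g x = x}" using x by simp
    then have "x \<in> Ng g" using Ng(2)[OF g] by (rule rev_subsetD)
    then have "x \<in> N0" using N0(2) g by blast
    then show False using x by simp
  qed
  then have "\<forall>x\<in>space M - N0. \<forall>g. act g x = x \<longrightarrow> g = 0" by (intro ballI allI impI)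
  then show ?thesis using N0(1) by (intro exI[of _ N0] conjI)
qed

text \<open>Read \<open>f g x\<close> as the mass which the origin sends to \<open>g\<close>. The
  right-hand side is the mass which the origin receives: seen from the sender \<open>g\<close>, the
  configuration is \<open>act (- g) x\<close> and the origin sits at \<open>- g\<close>.\<close>

lemma mass_transport:
  assumes f: "\<And>g. f g \<in> borel_measurable M"
  shows "(\<integral>\<^sup>+x. (\<integral>\<^sup>+g. f g x \<partial>count_space UNIV) \<partial>M) =
    (\<integral>\<^sup>+x. (\<integral>\<^sup>+g. f (- g) (act (- g) x) \<partial>count_space UNIV) \<partial>M)"
proof -
  have m: "(\<lambda>x. f (- g) (act (- g) x)) \<in> borel_measurable M" for g
    by (rule measurable_compose[OF act_measurable f])
  have shift: "(\<integral>\<^sup>+x. f (- g) (act (- g) x) \<partial>M) = (\<integral>\<^sup>+x. f (- g) x \<partial>M)" for g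
    using nn_integral_distr[OF act_measurable[of "- g"], of "f (- g)"] f by (simp add: distr_act)
  have "(\<integral>\<^sup>+x. (\<integral>\<^sup>+g. f (- g) (act (- g) x) \<partial>count_space UNIV) \<partial>M)
      = (\<integral>\<^sup>+g. (\<integral>\<^sup>+x. f (- g) x \<partial>M) \<partial>count_space UNIV)"
    by (subst nn_integral_count_space_nn_integral[OF countable_G]) (use m in \<open>simp_all add: shift\<close>)
  also have "\<dots> = (\<integral>\<^sup>+g. (\<integral>\<^sup>+x. f g x \<partial>M) \<partial>count_space UNIV)"
    by (rule nn_integral_bij_count_space) (rule bij_uminus)
  also have "\<dots> = (\<integral>\<^sup>+x. (\<integral>\<^sup>+g. f g x \<partial>count_space UNIV) \<partial>M)"
    by (rule nn_integral_count_space_nn_integral[symmetric, OF countable_G f])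
  finally show ?thesis by simp
qed

text \<open>Disintegration over the coordinates in \<open>S\<close>, by Fubini for a merged
  pair.\<close>

lemma emeasure_mg:
  assumes "B \<in> sets M"
  shows "emeasure M B = (\<integral>\<^sup>+y. emeasure M {z \<in> space M. mg S y z \<in> B} \<partial>M)"
    and "y \<in> space M \<Longrightarrow> {z \<in> space M. mg S y z \<in> B} \<in> sets M"
    and "(\<lambda>y. emeasure M {z \<in> space M. mg S y z \<in> B}) \<in> borel_measurable M"
proof -
  let ?B = "(\<lambda>(x, y). mg S x y) -` B \<inter> space (M \<Otimes>\<^sub>M M)"
  have Bs: "?B \<in> sets (M \<Otimes>\<^sub>M M)" by (rule measurable_sets[OF mg_measurable assms])
  have P: "Pair y -` ?B = {z \<in> space M. mg S y z \<in> B}" if "y \<in> space M" for y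
    using that by (auto simp: space_pair_measure)
  have "emeasure M B = emeasure (distr (M \<Otimes>\<^sub>M M) M (\<lambda>(x, y). mg S x y)) B" by (simp add: distr_mg)
  also have "\<dots> = emeasure (M \<Otimes>\<^sub>M M) ?B" by (rule emeasure_distr[OF mg_measurable assms])
  also have "\<dots> = (\<integral>\<^sup>+y. emeasure M (Pair y -` ?B) \<partial>M)" by (rule emeasure_pair_measure_alt[OF Bs])
  also have "\<dots> = (\<integral>\<^sup>+y. emeasure M {z \<in> space M. mg S y z \<in> B} \<partial>M)"
    by (rule nn_integral_cong, rule arg_cong[where f = "emeasure M"], rule P)
  finally show "emeasure M B = (\<integral>\<^sup>+y. emeasure M {z \<in> space M. mg S y z \<in> B} \<partial>M)" .
  show "{z \<in> space M. mg S y z \<in> B} \<in> sets M" if "y \<in> space M"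
    using sets_Pair1[OF Bs, of y] P[OF that] by simp
  have "(\<lambda>y. emeasure M (Pair y -` ?B)) \<in> borel_measurable M" by (rule measurable_emeasure_Pair[OF Bs])
  then show "(\<lambda>y. emeasure M {z \<in> space M. mg S y z \<in> B}) \<in> borel_measurable M"
    by (rule measurable_cong[THEN iffD1, rotated]) (rule arg_cong[where f = "emeasure M"], rule P)
qed

text \<open>An equivariant measurable family of classes: \<open>C x\<close> is the class of the origin.\<close>
definition equivariant :: "((nat \<Rightarrow> 'g \<Rightarrow> bool) \<Rightarrow> 'g set) \<Rightarrow> bool" where
  "equivariant C \<longleftrightarrow> (\<forall>g. {x \<in> space M. g \<in> C x} \<in> sets M) \<and> (\<forall>x\<in>space M. 0 \<in> C x) \<and>
     (\<forall>x\<in>space M. \<forall>g. - g \<in> C (act (- g) x) \<longleftrightarrow> g \<in> C x) \<and>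
     (\<forall>x\<in>space M. \<forall>g\<in>C x. C (act (- g) x) = {h. g + h \<in> C x})"

text \<open>Infinitude through countably many finite counts, for the sake of measurability.\<close>

lemma infinite_card_iff:
  fixes A :: "'g set"
  shows "infinite A \<longleftrightarrow> (\<forall>k. \<exists>j. k < card (A \<inter> enum ` {..<j}))"
proof
  assume inf: "infinite A"
  show "\<forall>k. \<exists>j. k < card (A \<inter> enum ` {..<j})"
  proof
    fix k
    obtain B where B: "B \<subseteq> A" "finite B" "card B = Suc k" using infinite_arbitrarily_large[OF inf] by metis
    have "finite (inv enum ` B)" using B by simp
    then obtain j where j: "inv enum ` B \<subseteq> {..<j}" by (meson finite_nat_iff_bounded)
    have "B \<subseteq> enum ` {..<j}"
    proof
      fix b assume "b \<in> B"
      then have "inv enum b < j" "enum (inv enum b) = b"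
        using j enum by (auto simp: bij_is_surj surj_f_inv_f)
      then show "b \<in> enum ` {..<j}" by (metis imageI lessThan_iff)
    qed
    then have "B \<subseteq> A \<inter> enum ` {..<j}" using B by auto
    then have "Suc k \<le> card (A \<inter> enum ` {..<j})" using card_mono[of "A \<inter> enum ` {..<j}" B] B by simp
    then have "k < card (A \<inter> enum ` {..<j})" by simp
    then show "\<exists>j. k < card (A \<inter> enum ` {..<j})" by blast
  qed
next
  assume *: "\<forall>k. \<exists>j. k < card (A \<inter> enum ` {..<j})"
  show "infinite A"
  proof
    assume fin: "finite A"
    obtain j where "card A < card (A \<inter> enum ` {..<j})" using * by blast
    moreover have "card (A \<inter> enum ` {..<j}) \<le> card A" by (rule card_mono[OF fin]) auto
    ultimately show False by simp
  qed
qed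

lemma measurable_card_set:
  assumes C: "\<And>g. {x \<in> space M. g \<in> C x} \<in> sets M"
  shows "(\<lambda>x. card (C x \<inter> enum ` {..<j})) \<in> M \<rightarrow>\<^sub>M count_space UNIV"
    and "{x \<in> space M. infinite (C x)} \<in> sets M"
    and "(\<lambda>x. emeasure (count_space UNIV) (C x)) \<in> borel_measurable M"
proof -
  have [measurable]: "(\<lambda>x. g \<in> C x) \<in> M \<rightarrow>\<^sub>M count_space UNIV" for g
    using C[of g] by (simp add: pred_def)
  show m: "(\<lambda>x. card (C x \<inter> enum ` {..<j})) \<in> M \<rightarrow>\<^sub>M count_space UNIV" for j
  proof -
    have "card (C x \<inter> enum ` {..<j}) = (\<Sum>g\<in>enum ` {..<j}. if g \<in> C x then 1 else 0)" for x
      by (simp add: sum.If_cases Int_commute)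
    then show ?thesis by simp
  qed
  have [measurable]: "(\<lambda>x. card (C x \<inter> enum ` {..<j})) \<in> M \<rightarrow>\<^sub>M count_space UNIV" for j by (rule m)
  show "{x \<in> space M. infinite (C x)} \<in> sets M" unfolding infinite_card_iff by measurable
  have "emeasure (count_space UNIV) (C x) = (\<integral>\<^sup>+g. indicator (C x) g \<partial>count_space UNIV)" for x by simp
  also have "(\<integral>\<^sup>+g. indicator (C x) g \<partial>count_space UNIV) = (\<integral>\<^sup>+k. indicator (C x) (enum k) \<partial>count_space UNIV)" for x
    by (rule nn_integral_bij_count_space[symmetric]) (rule enum)
  also have "(\<integral>\<^sup>+k. indicator (C x) (enum k) \<partial>count_space UNIV) = (\<Sum>k. indicator (C x) (enum k) :: ennreal)" for x
    by (rule nn_integral_count_space_nat)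
  finally have e: "emeasure (count_space UNIV) (C x) = (\<Sum>k. indicator (C x) (enum k) :: ennreal)" for x .
  have [measurable]: "(\<lambda>x. indicator (C x) (enum k) :: ennreal) \<in> borel_measurable M" for k
    unfolding indicator_def of_bool_def by measurable
  show "(\<lambda>x. emeasure (count_space UNIV) (C x)) \<in> borel_measurable M"
    unfolding e by measurable
qed

text \<open>Poincare recurrence along infinite classes. If an infinite class met \<open>V\<close>
  only finitely often, each of its points in \<open>V\<close> could send mass
  \<open>1 / card (H x)\<close> to every point of the class: infinite mass sent, at most one
  received.\<close>

lemma recurrence:
  assumes C: "equivariant C" and V0: "V \<in> sets M"
  shows "{x \<in> V. infinite (C x) \<and> finite {g \<in> C x. act (- g) x \<in> V}} \<in> null_sets M"
proof -
  define H where "H x = {g \<in> C x. act (- g) x \<in> V}" for x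
  have Cm: "{x \<in> space M. g \<in> C x} \<in> sets M" for g using C by (simp add: equivariant_def)
  have Hm: "{x \<in> space M. g \<in> H x} \<in> sets M" for g
  proof -
    have "{x \<in> space M. g \<in> H x} = {x \<in> space M. g \<in> C x} \<inter> (act (- g) -` V \<inter> space M)" by (auto simp: H_def)
    then show ?thesis using Cm measurable_sets[OF act_measurable V0] by auto
  qed
  have Vs: "V \<subseteq> space M" using V0 sets.sets_into_space by blast
  define W where "W = {x \<in> V. infinite (C x) \<and> finite (H x)}"
  have "W = V \<inter> {x \<in> space M. infinite (C x)} - {x \<in> space M. infinite (H x)}"
    using Vs by (auto simp: W_def)
  then have Wm: "W \<in> sets M" using V0 measurable_card_set(2)[OF Cm] measurable_card_set(2)[OF Hm] by auto
  have Ws: "W \<subseteq> space M" using Wm sets.sets_into_space by blast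
  define f :: "'g \<Rightarrow> (nat \<Rightarrow> 'g \<Rightarrow> bool) \<Rightarrow> ennreal" where
    "f g x = indicator {x \<in> W. g \<in> C x} x / emeasure (count_space UNIV) (H x)" for g x
  have "f g \<in> borel_measurable M" for g
  proof -
    have "{x \<in> W. g \<in> C x} = W \<inter> {x \<in> space M. g \<in> C x}" using Ws by auto
    then have [measurable]: "{x \<in> W. g \<in> C x} \<in> sets M" using Wm Cm by auto
    have [measurable]: "(\<lambda>x. emeasure (count_space UNIV) (H x)) \<in> borel_measurable M"
      by (rule measurable_card_set(3)[OF Hm])
    show ?thesis unfolding f_def[abs_def] by measurable
  qed
  note mt = mass_transport[OF this]
  have out: "(\<integral>\<^sup>+g. f g x \<partial>count_space UNIV) = \<infinity> * indicator W x" if "x \<in> space M" for x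
  proof (cases "x \<in> W")
    case True
    then have inf: "infinite (C x)" "finite (H x)" by (auto simp: W_def)
    have "f g x = indicator (C x) g * (1 / emeasure (count_space UNIV) (H x))" for g
      using True by (auto simp: f_def indicator_def)
    then have "(\<integral>\<^sup>+g. f g x \<partial>count_space UNIV) = emeasure (count_space UNIV) (C x) * (1 / emeasure (count_space UNIV) (H x))"
      by (simp add: nn_integral_multc)
    also have "\<dots> = \<infinity>" using inf by (simp add: ennreal_top_mult divide_ennreal_def ennreal_inverse_eq_0_iff)
    finally show ?thesis using True by simp
  qed (simp add: f_def indicator_def)
  have "(\<integral>\<^sup>+g. f (- g) (act (- g) x) \<partial>count_space UNIV) \<le> 1" if x: "x \<in> space M" for x
  proof (cases "\<exists>g. act (- g) x \<in> W \<and> g \<in> C x")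
    case False
    have "f (- g) (act (- g) x) = 0" for g
      using False C x unfolding f_def equivariant_def by (auto simp: indicator_def)
    then show ?thesis by simp
  next
    case True
    have sh: "H (act (- g) x) = {h. g + h \<in> H x}" if "g \<in> C x" for g
    proof -
      have "C (act (- g) x) = {h. g + h \<in> C x}" using C x that by (simp add: equivariant_def)
      moreover have "act (- h) (act (- g) x) = act (- (g + h)) x" for h
        using act_plus[of "- h" "- g" x] by (simp add: minus_add)
      ultimately show ?thesis by (auto simp: H_def)
    qed
    have cnt: "emeasure (count_space UNIV) (H (act (- g) x)) = emeasure (count_space UNIV) (H x)" if "g \<in> C x" for g
    proof -
      have "bij_betw (\<lambda>h. g + h) {h. g + h \<in> H x} (H x)"
        by (rule bij_betw_byWitness[where f' = "\<lambda>h. - g + h"]) (auto simp: add.assoc[symmetric])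
      then have "card {h. g + h \<in> H x} = card (H x)" "finite {h. g + h \<in> H x} \<longleftrightarrow> finite (H x)"
        by (rule bij_betw_same_card, rule bij_betw_finite)
      then show ?thesis unfolding sh[OF that] by (simp add: emeasure_count_space)
    qed
    obtain g0 where g0: "act (- g0) x \<in> W" "g0 \<in> C x" using True by blast
    have g0H: "g0 \<in> H x" using g0 by (auto simp: H_def W_def)
    have finH: "finite (H x)"
    proof -
      have "finite (H (act (- g0) x))" using g0 by (simp add: W_def)
      then have "emeasure (count_space UNIV) (H (act (- g0) x)) < \<infinity>" by (simp add: of_nat_less_top)
      then have "emeasure (count_space UNIV) (H x) < \<infinity>" using cnt[OF g0(2)] by simp
      then show ?thesis by (metis emeasure_count_space_infinite less_irrefl infinity_ennreal_def subset_UNIV)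
    qed
    have "f (- g) (act (- g) x) \<le> indicator (H x) g / emeasure (count_space UNIV) (H x)" for g
    proof (cases "act (- g) x \<in> W \<and> g \<in> C x")
      case True
      then have "g \<in> H x" by (auto simp: H_def W_def)
      then show ?thesis using True cnt[of g]
        by (cases "- g \<in> C (act (- g) x)") (simp_all add: f_def)
    next
      case False
      then have "f (- g) (act (- g) x) = 0"
        using C x unfolding f_def equivariant_def by (auto simp: indicator_def)
      then show ?thesis by simp
    qed
    then have "(\<integral>\<^sup>+g. f (- g) (act (- g) x) \<partial>count_space UNIV)
        \<le> (\<integral>\<^sup>+g. indicator (H x) g / emeasure (count_space UNIV) (H x) \<partial>count_space UNIV)"
      by (intro nn_integral_mono) simp
    also have "\<dots> = emeasure (count_space UNIV) (H x) / emeasure (count_space UNIV) (H x)"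
      by (subst nn_integral_divide) simp_all
    also have "\<dots> \<le> 1"
    proof -
      have "emeasure (count_space UNIV) (H x) = of_nat (card (H x))" using finH by simp
      moreover have "card (H x) \<noteq> 0" using finH g0H by auto
      then have "(of_nat (card (H x)) :: ennreal) \<noteq> 0" by simp
      from ennreal_divide_self[OF this of_nat_less_top]
      have "(of_nat (card (H x)) / of_nat (card (H x)) :: ennreal) = 1" .
      ultimately show ?thesis by simp
    qed
    finally show ?thesis .
  qed
  then have "(\<integral>\<^sup>+x. (\<integral>\<^sup>+g. f (- g) (act (- g) x) \<partial>count_space UNIV) \<partial>M) \<le> (\<integral>\<^sup>+x. 1 \<partial>M)"
    by (intro nn_integral_mono) simp
  also have "\<dots> = 1" using emeasure_space_1 by simp
  finally have "(\<integral>\<^sup>+x. (\<integral>\<^sup>+g. f g x \<partial>count_space UNIV) \<partial>M) \<le> 1" by (simp add: mt)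
  moreover have "(\<integral>\<^sup>+x. (\<integral>\<^sup>+g. f g x \<partial>count_space UNIV) \<partial>M) = (\<integral>\<^sup>+x. \<infinity> * indicator W x \<partial>M)"
    by (rule nn_integral_cong) (rule out)
  moreover have "(\<integral>\<^sup>+x. \<infinity> * indicator W x \<partial>M) = \<infinity> * emeasure M W"
    by (rule nn_integral_cmult_indicator[OF Wm])
  ultimately have "\<infinity> * emeasure M W \<le> 1" by simp
  then have "emeasure M W = 0" by (auto simp: ennreal_top_mult top_unique split: if_splits)
  then show ?thesis using Wm by (simp add: W_def H_def null_sets_def)
qed

end

section \<open>Invariant events\<close>

context bernoulli_field begin

lemma mg_act: "act g (mg (T \<times> UNIV) y z) = mg (T \<times> UNIV) (act g y) (act g z)"
  by (rule ext)+ (simp add: diag_shift_def mg_def)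

lemma emeasure_act_vimage:
  assumes "B \<in> sets M"
  shows "emeasure M {z \<in> space M. act g z \<in> B} = emeasure M B"
proof -
  have "emeasure M B = emeasure (distr M M (act g)) B" by (simp add: distr_act)
  also have "\<dots> = emeasure M (act g -` B \<inter> space M)" by (rule emeasure_distr[OF act_measurable assms])
  also have "act g -` B \<inter> space M = {z \<in> space M. act g z \<in> B}" by auto
  finally show ?thesis by simp
qed

text \<open>If \<open>A\<close> is invariant along infinite classes which only look at the coordinates in \<open>T\<close>, then,
  conditionally on those coordinates, membership in \<open>A\<close> is approximately decided both by the other
  coordinates near the origin and by those near a far away point of its class. These are independent,
  hence membership is decided by the coordinates in \<open>T\<close>.\<close>
lemma invariant_determined:
  assumes C: "equivariant C" and Cdep: "\<And>x y. x \<in> space M \<Longrightarrow> y \<in> space M \<Longrightarrow> (\<And>i g. i < n \<Longrightarrow> i \<in> T \<Longrightarrow> x i g = y i g) \<Longrightarrow> C x = C y"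
    and A: "A \<in> sets M" and Ainf: "\<And>x. x \<in> A \<Longrightarrow> infinite (C x)"
    and Ainv: "\<And>x g. x \<in> A \<Longrightarrow> g \<in> C x \<Longrightarrow> act (- g) x \<in> A"
  shows "\<exists>A'. dep (T \<times> UNIV) A' \<and> (A - A') \<union> (A' - A) \<in> null_sets M"
proof -
  define S :: "(nat \<times> 'g) set" where "S = T \<times> UNIV"
  \<comment> \<open>The conditional probability of \<open>A\<close> given the coordinates in
    \<open>S\<close>.\<close>
  define h where "h y = prob {z \<in> space M. mg S y z \<in> A}" for y
  have Cmg: "C (mg S y z) = C y" if "y \<in> space M" for y z
    by (rule Cdep[OF mg_space that]) (simp add: mg_eq S_def)
  have hm: "h \<in> borel_measurable M"
  proof -
    have "(\<lambda>y. enn2real (emeasure M {z \<in> space M. mg S y z \<in> A})) \<in> borel_measurable M"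
      using emeasure_mg(3)[OF A] by measurable
    then show ?thesis by (simp add: h_def[abs_def] measure_def)
  qed
  have h01: "0 \<le> h y" "h y \<le> 1" for y by (auto simp: h_def)
  \<comment> \<open>The errors below add up to at most
    \<open>2 * \<delta> + 2 * \<delta> + \<delta>\<close>, hence the \<open>5\<close>; small
    \<open>\<delta>\<close> then forces \<open>h\<close> to be \<open>0\<close> or \<open>1\<close>
    almost surely on infinite classes.\<close>
  have key: "prob {y \<in> space M. infinite (C y) \<and> 5 * \<delta> < h y * (1 - h y)} = 0" if \<delta>: "0 < \<delta>" "\<delta> < 1" for \<delta>
  proof -
    let ?E = "{y \<in> space M. infinite (C y) \<and> 5 * \<delta> < h y * (1 - h y)}"
    have infm: "{x \<in> space M. infinite (C x)} \<in> sets M"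
      by (rule measurable_card_set(2)) (use C in \<open>simp add: equivariant_def\<close>)
    have "{y \<in> space M. 5 * \<delta> < h y * (1 - h y)} \<in> sets M" using hm by measurable
    moreover have "?E = {x \<in> space M. infinite (C x)} \<inter> {y \<in> space M. 5 * \<delta> < h y * (1 - h y)}" by auto
    ultimately have Em: "?E \<in> sets M" using infm by auto
    have "prob ?E \<le> \<epsilon>" if \<epsilon>: "0 < \<epsilon>" for \<epsilon>
    proof -
      obtain K B where KB: "finite K" "dep (UNIV \<times> K) B" "prob ((A - B) \<union> (B - A)) < \<delta> * \<epsilon>"
        using approximation[OF A, of "\<delta> * \<epsilon>"] \<delta> \<epsilon> by auto
      have B: "B \<in> sets M" using KB(2) by (rule dep_sets)
      define D where "D = (A - B) \<union> (B - A)"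
      have D: "D \<in> sets M" using A B by (auto simp: D_def)
      define w where "w y = prob {z \<in> space M. mg S y z \<in> D}" for y
      have wm: "(\<lambda>y. ennreal (w y)) \<in> borel_measurable M"
        using emeasure_mg(3)[OF D, of S] by (simp add: w_def emeasure_eq_measure)
      \<comment> \<open>By Markov's inequality, the conditional error of the approximation is below
        \<open>\<delta>\<close> outside a set of measure at most \<open>\<epsilon>\<close>;
        recurrence brings the class back to such good configurations infinitely often.\<close>
      define Bad where "Bad = {y \<in> space M. ennreal \<delta> \<le> ennreal (w y)}"
      have Badm: "Bad \<in> sets M" unfolding Bad_def using wm by measurable
      have "ennreal \<delta> * emeasure M Bad \<le> (\<integral>\<^sup>+y. ennreal (w y) \<partial>M)"
      proof -
        have "ennreal \<delta> * emeasure M Bad = (\<integral>\<^sup>+y. ennreal \<delta> * indicator Bad y \<partial>M)"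
          by (rule nn_integral_cmult_indicator[symmetric, OF Badm])
        also have "\<dots> \<le> (\<integral>\<^sup>+y. ennreal (w y) \<partial>M)"
          by (rule nn_integral_mono) (simp add: Bad_def indicator_def)
        finally show ?thesis .
      qed
      also have "\<dots> = emeasure M D" using emeasure_mg(1)[OF D, of S] by (simp add: w_def emeasure_eq_measure)
      also have "\<dots> \<le> ennreal (\<delta> * \<epsilon>)" using KB(3) by (simp add: D_def emeasure_eq_measure ennreal_leI)
      finally have "\<delta> * prob Bad \<le> \<delta> * \<epsilon>"
        using \<delta> \<epsilon> by (simp add: emeasure_eq_measure ennreal_mult'[symmetric])
      then have pBad: "prob Bad \<le> \<epsilon>" using \<delta> by simp
      define V where "V = {x \<in> space M. infinite (C x)} - Bad"
      have Vm: "V \<in> sets M" using infm Badm by (auto simp: V_def)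
      define Z where "Z = {x \<in> V. infinite (C x) \<and> finite {g \<in> C x. act (- g) x \<in> V}}"
      have Z: "Z \<in> null_sets M" unfolding Z_def by (rule recurrence[OF C Vm])
      have "?E \<subseteq> Bad \<union> Z"
      proof
        fix y assume "y \<in> ?E"
        then have y: "y \<in> space M" "infinite (C y)" "5 * \<delta> < h y * (1 - h y)" by auto
        show "y \<in> Bad \<union> Z"
        proof (rule ccontr)
          assume no: "y \<notin> Bad \<union> Z"
          then have yV: "y \<in> V" using y by (simp add: V_def)
          then have inf: "infinite {g \<in> C y. act (- g) y \<in> V}" using no y(2) by (simp add: Z_def)
          have "finite ((\<lambda>(a, b). a - b) ` (K \<times> K))" using KB(1) by simp
          \<comment> \<open>Infinitely many returns cannot all be differences of elements of
            \<open>K\<close>, so some \<open>g\<close> makes \<open>K\<close> and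
            \<open>g + K\<close> disjoint.\<close>
          then obtain g where g: "g \<in> C y" "act (- g) y \<in> V" "g \<notin> (\<lambda>(a, b). a - b) ` (K \<times> K)"
            using inf by (metis (mono_tags, lifting) finite_subset mem_Collect_eq subsetI)
          have disj: "K \<inter> (\<lambda>k. g + k) ` K = {}"
          proof -
            have "a \<noteq> g + b" if "a \<in> K" "b \<in> K" for a b
            proof
              assume "a = g + b"
              then have "g = a - b" by simp
              then show False using g(3) that by auto
            qed
            then show ?thesis by auto
          qed
          define y' where "y' = act (- g) y"
          have y's: "y' \<in> space M" by (simp add: y'_def act_in_space)
          have wy: "w y < \<delta>" "w y' < \<delta>"
            using yV g(2) y y's \<delta> by (auto simp: V_def Bad_def y'_def not_le ennreal_less_iff w_def)
          have mga: "act (- g) (mg S y z) = mg S y' (act (- g) z)" for z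
            by (simp add: S_def mg_act y'_def)
          have AA: "mg S y z \<in> A \<longleftrightarrow> act (- g) (mg S y z) \<in> A" for z
          proof
            have gC: "g \<in> C (mg S y z)" using g(1) Cmg[OF y(1), of z] by simp
            show "act (- g) (mg S y z) \<in> A" if "mg S y z \<in> A" by (rule Ainv[OF that gC])
            assume a: "act (- g) (mg S y z) \<in> A"
            have "- g \<in> C (act (- g) (mg S y z)) \<longleftrightarrow> g \<in> C (mg S y z)"
              using C mg_space[of S y z] unfolding equivariant_def by (elim conjE) (drule (1) bspec, erule spec)
            then have "- g \<in> C (act (- g) (mg S y z))" using gC by simp
            from Ainv[OF a this] show "mg S y z \<in> A" using mg_space by simp
          qed
          have mm: "{z \<in> space M. mg S y z \<in> X} \<in> sets M" "{z \<in> space M. mg S y' z \<in> X} \<in> sets M" if "X \<in> sets M" for X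
            using emeasure_mg(2)[OF that] y(1) y's by auto
          define B0 where "B0 = {z \<in> space M. mg S y z \<in> B}"
          define B1 where "B1 = {z \<in> space M. act (- g) (mg S y z) \<in> B}"
          define D0 where "D0 = {z \<in> space M. mg S y z \<in> D}"
          define D1 where "D1 = {z \<in> space M. act (- g) (mg S y z) \<in> D}"
          have vim: "{z \<in> space M. act (- g) (mg S y z) \<in> X} \<in> sets M \<and>
              prob {z \<in> space M. act (- g) (mg S y z) \<in> X} = prob {z \<in> space M. mg S y' z \<in> X}" if X: "X \<in> sets M" for X
          proof -
            have e: "{z \<in> space M. act (- g) (mg S y z) \<in> X} = {z \<in> space M. act (- g) z \<in> {z \<in> space M. mg S y' z \<in> X}}"
              by (auto simp: mga act_in_space)
            have e2: "{z \<in> space M. act (- g) z \<in> {z \<in> space M. mg S y' z \<in> X}} = act (- g) -` {z \<in> space M. mg S y' z \<in> X} \<inter> space M"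
              by auto
            have "{z \<in> space M. act (- g) (mg S y z) \<in> X} \<in> sets M"
              unfolding e e2 by (rule measurable_sets[OF act_measurable mm(2)[OF X]])
            moreover have "emeasure M {z \<in> space M. act (- g) (mg S y z) \<in> X} = emeasure M {z \<in> space M. mg S y' z \<in> X}"
              unfolding e by (rule emeasure_act_vimage[OF mm(2)[OF X]])
            ultimately show ?thesis by (simp only: measure_def simp_thms)
          qed
          have sets: "B0 \<in> sets M" "B1 \<in> sets M" "D0 \<in> sets M" "D1 \<in> sets M"
            using mm vim B D by (auto simp: B0_def B1_def D0_def D1_def)
          have pD: "prob D0 < \<delta>" "prob D1 < \<delta>"
            using wy vim[OF D] by (simp_all add: D0_def D1_def w_def)
          have dep0: "dep (UNIV \<times> K) B0"
          proof (rule depI[OF sets(1)])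
            fix x z assume xz: "x \<in> space M" "z \<in> space M" "\<And>i g. i < n \<Longrightarrow> (i, g) \<in> UNIV \<times> K \<Longrightarrow> x i g = z i g" "x \<in> B0"
            have "mg S y x \<in> B \<longleftrightarrow> mg S y z \<in> B"
              by (rule depD[OF KB(2) mg_space mg_space]) (simp add: mg_eq xz(3))
            then show "z \<in> B0" using xz(2,4) by (simp add: B0_def)
          qed
          have dep1: "dep (UNIV \<times> (\<lambda>k. g + k) ` K) (space M - B1)"
          proof (rule depI)
            show "space M - B1 \<in> sets M" using sets by auto
            fix x z assume xz: "x \<in> space M" "z \<in> space M"
              "\<And>i h. i < n \<Longrightarrow> (i, h) \<in> UNIV \<times> (\<lambda>k. g + k) ` K \<Longrightarrow> x i h = z i h" "x \<in> space M - B1"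
            have "act (- g) (mg S y x) \<in> B \<longleftrightarrow> act (- g) (mg S y z) \<in> B"
              by (rule depD[OF KB(2) act_in_space act_in_space]) (auto simp: act_eq mg_eq intro!: xz(3))
            then show "z \<in> space M - B1" using xz(1,2,4) by (simp add: B1_def)
          qed
          \<comment> \<open>\<open>B0\<close> and \<open>B1\<close> approximate the same event, so
            the first without the second is improbable; independence makes this probability a
            product, small only if the event is nearly certain or nearly impossible.\<close>
          have "prob (B0 \<inter> (space M - B1)) = prob B0 * prob (space M - B1)"
          proof (rule indep[OF dep0 dep1])
            show "UNIV \<times> K \<inter> UNIV \<times> (\<lambda>k. g + k) ` K = {}" using disj by blast
          qed
          moreover have "prob (B0 \<inter> (space M - B1)) \<le> prob (D0 \<union> D1)"
          proof (rule finite_measure_mono)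
            show "B0 \<inter> (space M - B1) \<subseteq> D0 \<union> D1"
            proof
              fix z assume "z \<in> B0 \<inter> (space M - B1)"
              then have z: "z \<in> space M" "mg S y z \<in> B" "act (- g) (mg S y z) \<notin> B" by (auto simp: B0_def B1_def)
              show "z \<in> D0 \<union> D1"
              proof (cases "mg S y z \<in> A")
                case True
                then have "act (- g) (mg S y z) \<in> D" using AA[of z] z unfolding D_def by blast
                then show ?thesis using z(1) by (simp add: D1_def)
              next
                case False
                then show ?thesis using z by (simp add: D0_def D_def)
              qed
            qed
          qed (use sets in auto)
          moreover have "prob (D0 \<union> D1) \<le> prob D0 + prob D1" by (rule measure_Un_le) (use sets in auto)
          ultimately have bb: "prob B0 * (1 - prob B1) \<le> 2 * \<delta>"
            using pD prob_compl[OF sets(2)] by simp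
          define A0 where "A0 = {z \<in> space M. mg S y z \<in> A}"
          have A0m: "A0 \<in> sets M" using mm(1)[OF A] by (simp add: A0_def)
          have hA0: "h y = prob A0" by (simp add: h_def A0_def)
          have "prob A0 \<le> prob (B0 \<union> D0)"
          proof (rule finite_measure_mono)
            show "A0 \<subseteq> B0 \<union> D0" unfolding A0_def B0_def D0_def D_def by blast
          qed (use sets in auto)
          also have "\<dots> \<le> prob B0 + prob D0" by (rule measure_Un_le) (use sets in auto)
          finally have u0: "h y \<le> prob B0 + \<delta>" using pD hA0 by simp
          have "prob B1 \<le> prob (A0 \<union> D1)"
          proof (rule finite_measure_mono)
            show "B1 \<subseteq> A0 \<union> D1"
            proof
              fix z assume "z \<in> B1"
              then have z: "z \<in> space M" "act (- g) (mg S y z) \<in> B" by (auto simp: B1_def)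
              show "z \<in> A0 \<union> D1"
              proof (cases "mg S y z \<in> A")
                case True
                then show ?thesis using z by (simp add: A0_def)
              next
                case False
                then have "act (- g) (mg S y z) \<in> D" using AA[of z] z unfolding D_def by blast
                then show ?thesis using z(1) by (simp add: D1_def)
              qed
            qed
          qed (use sets A0m in auto)
          also have "\<dots> \<le> prob A0 + prob D1" by (rule measure_Un_le) (use sets A0m in auto)
          finally have u1: "1 - h y \<le> (1 - prob B1) + \<delta>" using pD hA0 by simp
          have "h y * (1 - h y) \<le> (prob B0 + \<delta>) * ((1 - prob B1) + \<delta>)"
            using u0 u1 h01[of y] \<delta> by (intro mult_mono) auto
          also have "\<dots> = prob B0 * (1 - prob B1) + \<delta> * (prob B0 + (1 - prob B1)) + \<delta> * \<delta>"
            by (simp add: algebra_simps)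
          also have "\<dots> \<le> 2 * \<delta> + \<delta> * 2 + \<delta> * 1"
          proof (intro add_mono mult_left_mono bb)
            have "prob B0 \<le> 1" "0 \<le> prob B1" by auto
            then show "prob B0 + (1 - prob B1) \<le> 2" by linarith
          qed (use \<delta> in auto)
          finally show False using y(3) by simp
        qed
      qed
      then have "prob ?E \<le> prob (Bad \<union> Z)" using Badm Z by (intro finite_measure_mono) auto
      also have "\<dots> \<le> prob Bad + prob Z" by (rule measure_Un_le) (use Badm Z in auto)
      also have "prob Z = 0" using Z by (simp add: null_sets_def measure_def)
      finally show ?thesis using pBad by simp
    qed
    then have "prob ?E \<le> 0" by (rule field_le_epsilon[where y = 0, simplified])
    then show ?thesis using measure_nonneg[of M ?E] by linarith
  qed
  define A' where "A' = {y \<in> space M. h y = 1}"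
  have A'm: "A' \<in> sets M" unfolding A'_def using hm by measurable
  have A'dep: "dep S A'"
  proof (rule depI[OF A'm])
    fix x y assume xy: "x \<in> space M" "y \<in> space M" "\<And>i g. i < n \<Longrightarrow> (i, g) \<in> S \<Longrightarrow> x i g = y i g" "x \<in> A'"
    have "mg S x z = mg S y z" for z
      unfolding mg_def using xy(3) by (intro restrict_ext ext) simp
    then show "y \<in> A'" using xy by (simp add: A'_def h_def)
  qed
  define E where "E = (\<Union>m::nat. {y \<in> space M. infinite (C y) \<and> 5 * (1 / (real m + 2)) < h y * (1 - h y)})"
  have Es: "{y \<in> space M. infinite (C y) \<and> c < h y * (1 - h y)} \<in> sets M" for c
  proof -
    have "{x \<in> space M. infinite (C x)} \<in> sets M"
      by (rule measurable_card_set(2)) (use C in \<open>simp add: equivariant_def\<close>)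
    moreover have "{y \<in> space M. c < h y * (1 - h y)} \<in> sets M" using hm by measurable
    moreover have "{y \<in> space M. infinite (C y) \<and> c < h y * (1 - h y)} =
       {x \<in> space M. infinite (C x)} \<inter> {y \<in> space M. c < h y * (1 - h y)}" by auto
    ultimately show ?thesis by auto
  qed
  have "E \<in> null_sets M" unfolding E_def
  proof (rule null_sets_UN)
    fix m :: nat
    have "prob {y \<in> space M. infinite (C y) \<and> 5 * (1 / (real m + 2)) < h y * (1 - h y)} = 0"
      by (rule key) auto
    then show "{y \<in> space M. infinite (C y) \<and> 5 * (1 / (real m + 2)) < h y * (1 - h y)} \<in> null_sets M"
      using Es by (simp add: null_sets_def emeasure_eq_measure)
  qed
  have hE: "h y = 0 \<or> h y = 1" if y: "y \<in> space M" "y \<notin> E" for y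
  proof (cases "infinite (C y)")
    case True
    have "h y * (1 - h y) \<le> 0"
    proof (rule ccontr)
      assume "\<not> h y * (1 - h y) \<le> 0"
      then have pos: "0 < h y * (1 - h y) / 5" by simp
      then obtain m where "inverse (real (Suc m)) < h y * (1 - h y) / 5" using reals_Archimedean by blast
      moreover have "1 / (real m + 2) \<le> inverse (real (Suc m))" by (simp add: field_simps)
      ultimately have "5 * (1 / (real m + 2)) < h y * (1 - h y)" by linarith
      then have "y \<in> E" using y(1) True unfolding E_def by blast
      then show False using y(2) by simp
    qed
    moreover have "0 \<le> h y * (1 - h y)" using h01[of y] by simp
    ultimately have "h y * (1 - h y) = 0" by linarith
    then show ?thesis by simp
  next
    case False
    have "mg S y z \<notin> A" for z using Ainf[of "mg S y z"] Cmg[OF y(1), of z] False by auto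
    then have "{z \<in> space M. mg S y z \<in> A} = {}" by simp
    then have "h y = 0" unfolding h_def by (simp only: measure_empty)
    then show ?thesis by simp
  qed
  have mgA': "mg S y z \<in> A' \<longleftrightarrow> y \<in> A'" if "y \<in> space M" for y z by (rule dep_mg1[OF A'dep order_refl that])
  have nul: "X \<in> null_sets M"
    if X: "X \<in> sets M" and z: "\<And>y. y \<in> space M \<Longrightarrow> y \<notin> E \<Longrightarrow> prob {z \<in> space M. mg S y z \<in> X} = 0" for X
  proof -
    have "emeasure M X = (\<integral>\<^sup>+y. emeasure M {z \<in> space M. mg S y z \<in> X} \<partial>M)" by (rule emeasure_mg(1)[OF X])
    also have "\<dots> = (\<integral>\<^sup>+y. 0 \<partial>M)"
    proof (rule nn_integral_cong_AE)
      have "AE y in M. y \<notin> E" using \<open>E \<in> null_sets M\<close> by (rule AE_not_in)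
      then show "AE y in M. emeasure M {z \<in> space M. mg S y z \<in> X} = 0"
        using z by (auto simp: emeasure_eq_measure)
    qed
    finally show ?thesis using X by (simp add: null_sets_def)
  qed
  have "A - A' \<in> null_sets M"
  proof (rule nul)
    fix y assume y: "y \<in> space M" "y \<notin> E"
    show "prob {z \<in> space M. mg S y z \<in> A - A'} = 0"
    proof (cases "y \<in> A'")
      case True
      then have "{z \<in> space M. mg S y z \<in> A - A'} = {}" using mgA'[OF y(1)] by auto
      then show ?thesis by (simp only: measure_empty)
    next
      case False
      then have "{z \<in> space M. mg S y z \<in> A - A'} = {z \<in> space M. mg S y z \<in> A}" using mgA'[OF y(1)] by auto
      then show ?thesis using hE[OF y] False y(1) by (simp add: A'_def h_def)
    qed
  qed (use A A'm in auto)
  moreover have "A' - A \<in> null_sets M"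
  proof (rule nul)
    fix y assume y: "y \<in> space M" "y \<notin> E"
    show "prob {z \<in> space M. mg S y z \<in> A' - A} = 0"
    proof (cases "y \<in> A'")
      case True
      then have e: "{z \<in> space M. mg S y z \<in> A' - A} = space M - {z \<in> space M. mg S y z \<in> A}" using mgA'[OF y(1)] by auto
      show ?thesis unfolding e using prob_compl[OF emeasure_mg(2)[OF A y(1), of S]] True by (simp add: A'_def h_def)
    next
      case False
      then have "{z \<in> space M. mg S y z \<in> A' - A} = {}" using mgA'[OF y(1)] by auto
      then show ?thesis by (simp only: measure_empty)
    qed
  qed (use A A'm in auto)
  ultimately show ?thesis using A'dep unfolding S_def by (intro exI[of _ A'] conjI null_sets.Un)
qed

text \<open>\<open>invariant_determined\<close> with the whole group as class and empty
  \<open>T\<close>: the event is determined by no coordinates at all.\<close>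

lemma shift_ergodic:
  assumes A: "A \<in> sets M" and inv: "\<And>x g. x \<in> A \<Longrightarrow> act g x \<in> A"
  shows "prob A = 0 \<or> prob A = 1"
proof -
  have eq: "equivariant (\<lambda>_. UNIV)" by (simp add: equivariant_def)
  obtain A' where A': "dep ({} \<times> UNIV) A'" "(A - A') \<union> (A' - A) \<in> null_sets M"
  proof -
    have "\<exists>A'. dep ({} \<times> UNIV) A' \<and> (A - A') \<union> (A' - A) \<in> null_sets M"
      by (rule invariant_determined[OF eq _ A]) (simp_all add: infinite_G inv)
    then show ?thesis using that by (elim exE conjE)
  qed
  have triv: "A' = {} \<or> A' = space M"
  proof (rule ccontr)
    assume no: "\<not> (A' = {} \<or> A' = space M)"
    have "A' \<subseteq> space M" using dep_sets[OF A'(1)] sets.sets_into_space by blast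
    then obtain x y where "x \<in> A'" "x \<in> space M" "y \<in> space M" "y \<notin> A'" using no by blast
    then show False using depD[OF A'(1), of x y] by auto
  qed
  have pAA': "prob A = prob A'"
  proof -
    have "emeasure M A = emeasure M A'"
    proof (rule emeasure_eq_AE[OF _ A dep_sets[OF A'(1)]])
      show "AE x in M. x \<in> A \<longleftrightarrow> x \<in> A'" using AE_not_in[OF A'(2)] by (rule AE_mp) (rule AE_I2, blast)
    qed
    then show ?thesis by (simp only: measure_def)
  qed
  have "A' = {} \<Longrightarrow> prob A' = 0" by (simp only: measure_empty)
  moreover have "A' = space M \<Longrightarrow> prob A' = 1" by (simp only: prob_space)
  ultimately have "prob A' = 0 \<or> prob A' = 1" using triv by blast
  then show ?thesis by (simp only: pAA')
qed

end

section \<open>Percolation\<close>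

text \<open>\<open>p * \<Lambda> \<le> 1 / 2\<close> bounds the weighted number of walks by a
  geometric series, while \<open>p * (N * N)\<close>, between \<open>3\<close> and \<open>4\<close>,
  is the mean number of open \<open>I1\<close>-edges with a given source. The contraction lets both
  hold for the same \<open>p\<close>.\<close>

locale percolation = bernoulli_field n p s
  for n :: nat and p :: real and s :: "nat \<Rightarrow> 'g::group_add" +
  fixes I1 I2 I3 :: "nat set" and N :: nat and v :: "nat \<Rightarrow> 'g" and \<Lambda> :: real
  assumes N: "N \<ge> 2" and I: "{..<n} = I1 \<union> I2 \<union> I3" "I1 \<inter> I2 = {}" "I1 \<inter> I3 = {}" "I2 \<inter> I3 = {}"
    and card_I1: "card I1 = N * N"
    and I2_generates: "\<exists>l. fst ` set l \<subseteq> I2 \<and> word_val s l = g"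
    and I3_sum: "(\<Sum>i\<in>I3. F (s i)) = (1000::real) * (\<Sum>a<N. \<Sum>b<N. F (- v a + v b))"
    and \<Lambda>: "0 \<le> \<Lambda>" "p * \<Lambda> \<le> 1 / 2"
      "\<And>f. fsupp f \<Longrightarrow> nrm (\<lambda>h. \<Sum>i<n. lam (s i) f h + lam (- s i) f h) \<le> \<Lambda> * nrm f"
    and pN: "3 \<le> p * (real N * real N)" "p * (real N * real N) \<le> 4"
begin

lemma I_sub: "I1 \<subseteq> {..<n}" "I2 \<subseteq> {..<n}" "I3 \<subseteq> {..<n}"
  using I(1) by auto

lemma finite_I: "finite I1" "finite I2" "finite I3"
  using I_sub finite_subset by blast+

text \<open>\<open>act (- g) x\<close> is the configuration seen from \<open>g\<close>: by
  \<open>om_act\<close> its open edges are those of \<open>x\<close>, moved so that \<open>g\<close>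
  becomes the origin.\<close>

definition om :: "nat set \<Rightarrow> (nat \<Rightarrow> 'g \<Rightarrow> bool) \<Rightarrow> ('g \<times> nat) set" where
  "om T x = {(g, i). i \<in> T \<and> i < n \<and> x i g}"

lemma om_mono: "T \<subseteq> T' \<Longrightarrow> om T x \<subseteq> om T' x"
  by (auto simp: om_def)

lemma om_act: "(h, i) \<in> om T (act (- g) x) \<longleftrightarrow> (g + h, i) \<in> om T x"
  by (auto simp: om_def act_eq)

lemma conn_act: "conn s (om T (act (- g) x)) a b \<longleftrightarrow> conn s (om T x) (g + a) (g + b)"
  by (rule conn_shift) (rule om_act)

lemma conn_act_minus:
  "conn s (om T (act (- g) x) - {(h, i)}) a b \<longleftrightarrow> conn s (om T x - {(g + h, i)}) (g + a) (g + b)"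
  by (rule conn_shift) (auto simp: om_act)

text \<open>The second part underlies the bridge estimates: whether the ends of an edge are joined
  without it does not depend on the state of that edge.\<close>

lemma conn_event:
  shows "{x \<in> space M. conn s (om T x - F) a b} \<in> sets M"
    and "dep {(i, g). i \<in> T \<and> (g, i) \<notin> F} {x \<in> space M. conn s (om T x - F) a b}"
proof -
  have e: "{x \<in> space M. set es \<subseteq> om T x - F} \<in> sets M" for es
  proof (cases "set es \<subseteq> {(g, i). i \<in> T \<and> i < n} - F")
    case True
    then have "{x \<in> space M. set es \<subseteq> om T x - F} = {x \<in> space M. \<forall>e\<in>set es. x (snd e) (fst e)}"
      by (auto simp: om_def)
    also have "\<dots> \<in> sets M"
    proof -
      have "(\<lambda>x. x (snd e) (fst e)) \<in> M \<rightarrow>\<^sub>M count_space UNIV" if "e \<in> set es" for e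
        using True that by (intro measurable_component) auto
      then have "Measurable.pred M (\<lambda>x. \<forall>e\<in>set es. x (snd e) (fst e))"
        by (intro pred_intros_finite) auto
      then show ?thesis by (simp add: pred_def)
    qed
    finally show ?thesis .
  next
    case False
    then have "{x \<in> space M. set es \<subseteq> om T x - F} = {}" by (auto simp: om_def)
    then show ?thesis by (simp only: sets.empty_sets)
  qed
  have "{x \<in> space M. conn s (om T x - F) a b} =
      (\<Union>l\<in>{l. b = a + word_val s l}. {x \<in> space M. set (walk_edges s a l) \<subseteq> om T x - F})"
    unfolding conn_def by blast
  also have "\<dots> \<in> sets M" by (rule sets.countable_UN') (use e in auto)
  finally show m: "{x \<in> space M. conn s (om T x - F) a b} \<in> sets M" .
  show "dep {(i, g). i \<in> T \<and> (g, i) \<notin> F} {x \<in> space M. conn s (om T x - F) a b}"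
  proof (rule depI[OF m])
    fix x y assume xy: "x \<in> space M" "y \<in> space M"
      "\<And>i g. i < n \<Longrightarrow> (i, g) \<in> {(i, g). i \<in> T \<and> (g, i) \<notin> F} \<Longrightarrow> x i g = y i g"
      "x \<in> {x \<in> space M. conn s (om T x - F) a b}"
    have "om T x - F = om T y - F" using xy(3) by (auto simp: om_def)
    then show "y \<in> {x \<in> space M. conn s (om T x - F) a b}" using xy by simp
  qed
qed

lemma conn_event':
  shows "{x \<in> space M. conn s (om T x) a b} \<in> sets M"
    and "dep (T \<times> UNIV) {x \<in> space M. conn s (om T x) a b}"
proof -
  show "{x \<in> space M. conn s (om T x) a b} \<in> sets M" using conn_event(1)[of T "{}" a b] by simp
  have "dep {(i, g). i \<in> T \<and> (g, i) \<notin> {}} {x \<in> space M. conn s (om T x - {}) a b}" by (rule conn_event(2))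
  then have "dep {(i, g). i \<in> T} {x \<in> space M. conn s (om T x) a b}" by simp
  then show "dep (T \<times> UNIV) {x \<in> space M. conn s (om T x) a b}" by (rule dep_mono) auto
qed

section \<open>Counting walks by the norm of the walk operator\<close>

definition words :: "nat \<Rightarrow> 'g \<Rightarrow> (nat \<times> bool) list set" where
  "words k h = {l. length l = k \<and> fst ` set l \<subseteq> {..<n} \<and> word_val s l = h}"

lemma finite_words: "finite (words k h)"
proof -
  have "words k h \<subseteq> {l. set l \<subseteq> {..<n} \<times> UNIV \<and> length l = k}" by (force simp: words_def)
  then show ?thesis by (rule finite_subset) (rule finite_lists_length_eq, simp)
qed

definition cnt :: "nat \<Rightarrow> 'g \<Rightarrow> real" where
  "cnt k h = real (card (words k h))"

lemma cnt_0: "cnt 0 = (\<lambda>h. if h = 0 then 1 else 0)"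
proof
  fix h
  have "words 0 h = (if h = 0 then {[]} else {})" by (auto simp: words_def)
  then show "cnt 0 h = (if h = 0 then 1 else 0)" by (simp add: cnt_def)
qed

text \<open>Splitting off the first letter: the counts are the iterates of the walk operator on the
  point mass at \<open>0\<close>, so the norm controls them.\<close>

lemma cnt_Suc: "cnt (Suc k) = (\<lambda>h. \<Sum>i<n. lam (s i) (cnt k) h + lam (- s i) (cnt k) h)"
proof
  fix h
  define W where "W = (\<lambda>(i, d). (#) (i, d) ` words k ((if d then - s i else s i) + h))"
  have "words (Suc k) h = (\<Union>z\<in>{..<n} \<times> UNIV. W z)"
  proof (rule set_eqI)
    fix l
    show "l \<in> words (Suc k) h \<longleftrightarrow> l \<in> (\<Union>z\<in>{..<n} \<times> UNIV. W z)"
    proof (cases l)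
      case (Cons z l')
      obtain i d where z: "z = (i, d)" by force
      have "(if d then s i else - s i) + word_val s l' = h \<longleftrightarrow> word_val s l' = (if d then - s i else s i) + h"
        by (auto simp: add.assoc[symmetric])
      then show ?thesis by (auto simp: Cons z words_def W_def)
    qed (auto simp: words_def W_def)
  qed
  moreover have "card (\<Union>z\<in>{..<n} \<times> UNIV. W z) = (\<Sum>z\<in>{..<n} \<times> UNIV. card (W z))"
    by (rule card_UN_disjoint) (use finite_words in \<open>auto simp: W_def\<close>)
  moreover have "card (W (i, d)) = card (words k ((if d then - s i else s i) + h))" for i d
    unfolding W_def by (simp add: card_image)
  ultimately have "cnt (Suc k) h = (\<Sum>z\<in>{..<n} \<times> (UNIV::bool set). cnt k ((if snd z then - s (fst z) else s (fst z)) + h))"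
    by (simp add: cnt_def case_prod_unfold flip: sum.cartesian_product) (simp add: sum.cartesian_product case_prod_unfold W_def card_image)
  also have "\<dots> = (\<Sum>i<n. \<Sum>d\<in>UNIV. cnt k ((if d then - s i else s i) + h))"
    by (simp add: sum.cartesian_product case_prod_unfold)
  finally show "cnt (Suc k) h = (\<Sum>i<n. lam (s i) (cnt k) h + lam (- s i) (cnt k) h)"
    by (simp add: UNIV_bool lam_def add.commute)
qed

lemma cnt_bound: "fsupp (cnt k) \<and> nrm (cnt k) \<le> \<Lambda> ^ k"
proof (induction k)
  case 0
  have s: "{h. cnt 0 h \<noteq> 0} = {0}" by (auto simp: cnt_0)
  then show ?case by (simp add: fsupp_def nrm_def cnt_0)
next
  case (Suc k)
  then have "fsupp (cnt (Suc k))" unfolding cnt_Suc by (intro fsupp_sum fsupp_add fsupp_lam) auto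
  moreover have "nrm (cnt (Suc k)) \<le> \<Lambda> * nrm (cnt k)" unfolding cnt_Suc using \<Lambda>(3) Suc by blast
  moreover have "\<Lambda> * nrm (cnt k) \<le> \<Lambda> * \<Lambda> ^ k" using Suc \<Lambda>(1) by (intro mult_left_mono) auto
  ultimately show ?case by simp
qed

lemma cnt_le: "0 \<le> cnt k h" "cnt k h \<le> \<Lambda> ^ k"
  using abs_le_nrm[of "cnt k" h] cnt_bound[of k] by (auto simp: cnt_def)

text \<open>Prefixed by the edge \<open>i\<close> taken backwards, a walk to \<open>s i\<close>
  becomes a closed walk one step longer.\<close>

lemma cnt_loop: "(\<Sum>i<n. cnt k (s i)) \<le> cnt (Suc k) 0"
  unfolding cnt_Suc by (rule sum_mono) (simp add: lam_def cnt_le)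

lemma p_cnt: "p ^ k * cnt k h \<le> (1/2) ^ k"
proof -
  have "p ^ k * cnt k h \<le> p ^ k * \<Lambda> ^ k" using cnt_le p by (intro mult_left_mono) auto
  also have "\<dots> = (p * \<Lambda>) ^ k" by (simp add: power_mult_distrib)
  also have "\<dots> \<le> (1/2) ^ k" using \<Lambda> p by (intro power_mono) auto
  finally show ?thesis .
qed

lemma summable_half: "summable (\<lambda>k. (1/2::real) ^ k)"
  by (rule summable_geometric) simp

lemma summable_p_cnt: "summable (\<lambda>k. p ^ k * cnt k h)"
  by (rule summable_comparison_test'[OF summable_half, of 0]) (use p_cnt cnt_le(1) p in auto)

text \<open>A union bound over open walks; restricting to walks with distinct edges gives each the
  probability \<open>p ^ k\<close>.\<close>

lemma prob_conn_le: "prob {x \<in> space M. conn s (om T x - F) 0 h} \<le> (\<Sum>k. p ^ k * cnt k h)"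
proof -
  define V where "V l = {x \<in> space M. \<forall>(i, g)\<in>(\<lambda>(g, i). (i, g)) ` set (walk_edges s 0 l). x i g}" for l
  define W where "W k = {l \<in> words k h. distinct (walk_edges s 0 l)}" for k
  have fW: "finite (W k)" for k using finite_words[of k h] by (simp add: W_def)
  have sub: "(\<lambda>(g, i). (i, g)) ` set (walk_edges s 0 l) \<subseteq> {..<n} \<times> UNIV" if "l \<in> W k" for l k
  proof -
    have "snd ` set (walk_edges s 0 l) \<subseteq> {..<n}" using that by (simp add: W_def words_def snd_walk_edges)
    then show ?thesis by force
  qed
  have pV: "prob (V l) = p ^ k" if "l \<in> W k" for l k
  proof -
    have "card ((\<lambda>(g, i). (i, g)) ` set (walk_edges s 0 l)) = card (set (walk_edges s 0 l))"
      by (rule card_image) (auto simp: inj_on_def)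
    also have "\<dots> = k" using that distinct_card[of "walk_edges s 0 l"] by (simp add: W_def words_def)
    finally show ?thesis unfolding V_def using prob_open[OF _ sub[OF that]] by simp
  qed
  have Vm: "V l \<in> sets M" if "l \<in> W k" for l k
  proof -
    have "V l = {x \<in> space M. \<forall>z\<in>(\<lambda>(g, i). (i, g)) ` set (walk_edges s 0 l). x (fst z) (snd z)}"
      by (auto simp: V_def)
    moreover have "Measurable.pred M (\<lambda>x. \<forall>z\<in>(\<lambda>(g, i). (i, g)) ` set (walk_edges s 0 l). x (fst z) (snd z))"
    proof (rule pred_intros_finite(3))
      fix z assume "z \<in> (\<lambda>(g, i). (i, g)) ` set (walk_edges s 0 l)"
      then have "z \<in> {..<n} \<times> UNIV" using sub[OF that] by (rule rev_subsetD)
      then show "Measurable.pred M (\<lambda>x. x (fst z) (snd z))" by (intro measurable_component) auto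
    qed simp
    ultimately show ?thesis by (simp add: pred_def)
  qed
  define Ak where "Ak k = (\<Union>l\<in>W k. V l)" for k
  have Akm: "Ak k \<in> sets M" for k unfolding Ak_def using fW Vm by (intro sets.finite_UN) auto
  have pA: "prob (Ak k) \<le> p ^ k * cnt k h" for k
  proof -
    have "prob (Ak k) \<le> (\<Sum>l\<in>W k. prob (V l))"
      unfolding Ak_def by (rule finite_measure_subadditive_finite) (use fW Vm in auto)
    also have "\<dots> = real (card (W k)) * p ^ k" by (simp add: pV)
    also have "\<dots> \<le> cnt k h * p ^ k"
      unfolding cnt_def using finite_words p by (intro mult_right_mono) (auto simp: W_def intro!: card_mono)
    finally show ?thesis by (simp add: mult.commute)
  qed
  have sA: "summable (\<lambda>k. prob (Ak k))"
    by (rule summable_comparison_test'[OF summable_p_cnt[of h], of 0]) (use pA in auto)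
  have "{x \<in> space M. conn s (om T x - F) 0 h} \<subseteq> (\<Union>k. Ak k)"
  proof
    fix x assume "x \<in> {x \<in> space M. conn s (om T x - F) 0 h}"
    then have x: "x \<in> space M" "conn s (om T x - F) 0 h" by auto
    obtain l where l: "h = 0 + word_val s l" "set (walk_edges s 0 l) \<subseteq> om T x - F" "distinct (walk_edges s 0 l)"
      using conn_distinct[OF x(2)] by (elim exE conjE)
    have "fst ` set l = snd ` set (walk_edges s 0 l)" by (simp add: snd_walk_edges)
    also have "\<dots> \<subseteq> {..<n}" using l(2) by (auto simp: om_def)
    finally have "l \<in> W (length l)" using l by (simp add: W_def words_def)
    moreover have "x \<in> V l" using l(2) x(1) by (auto simp: V_def om_def)
    ultimately show "x \<in> (\<Union>k. Ak k)" by (auto simp: Ak_def)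
  qed
  then have "prob {x \<in> space M. conn s (om T x - F) 0 h} \<le> prob (\<Union>k. Ak k)"
    by (rule finite_measure_mono) (use Akm in auto)
  also have "\<dots> \<le> (\<Sum>k. prob (Ak k))"
    by (rule finite_measure_subadditive_countably) (use Akm sA in auto)
  also have "\<dots> \<le> (\<Sum>k. p ^ k * cnt k h)" by (rule suminf_le[OF pA sA summable_p_cnt])
  finally show ?thesis .
qed

text \<open>An open edge whose ends are otherwise joined closes a walk, and closed walks of length
  \<open>k + 1\<close> contribute at most \<open>1 / 2 ^ (k + 1)\<close>. With \<open>F i\<close>
  the edge itself and \<open>p\<close> its independent state, at most one open edge that is no
  bridge is expected to start at the origin.\<close>

lemma sum_prob_conn_le:
  assumes "J \<subseteq> {..<n}"
  shows "p * (\<Sum>i\<in>J. prob {x \<in> space M. conn s (om T x - F i) 0 (s i)}) \<le> 1"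
proof -
  have "(\<Sum>i\<in>J. prob {x \<in> space M. conn s (om T x - F i) 0 (s i)}) \<le> (\<Sum>i<n. \<Sum>k. p ^ k * cnt k (s i))"
  proof -
    have "(\<Sum>i\<in>J. prob {x \<in> space M. conn s (om T x - F i) 0 (s i)}) \<le> (\<Sum>i\<in>J. \<Sum>k. p ^ k * cnt k (s i))"
      by (rule sum_mono) (rule prob_conn_le)
    also have "\<dots> \<le> (\<Sum>i<n. \<Sum>k. p ^ k * cnt k (s i))"
      by (rule sum_mono2[OF _ assms]) (use cnt_le(1) p in \<open>auto intro!: suminf_nonneg summable_p_cnt\<close>)
    finally show ?thesis .
  qed
  also have "(\<Sum>i<n. \<Sum>k. p ^ k * cnt k (s i)) = (\<Sum>k. \<Sum>i<n. p ^ k * cnt k (s i))"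
    by (rule suminf_sum[symmetric]) (rule summable_p_cnt)
  finally have "p * (\<Sum>i\<in>J. prob {x \<in> space M. conn s (om T x - F i) 0 (s i)}) \<le> p * (\<Sum>k. \<Sum>i<n. p ^ k * cnt k (s i))"
    using p by (intro mult_left_mono) auto
  also have "\<dots> = (\<Sum>k. p * (\<Sum>i<n. p ^ k * cnt k (s i)))"
    by (rule suminf_mult[symmetric]) (intro summable_sum summable_p_cnt)
  also have "\<dots> \<le> (\<Sum>k. (1/2) ^ Suc k)"
  proof (rule suminf_le)
    show "p * (\<Sum>i<n. p ^ k * cnt k (s i)) \<le> (1/2) ^ Suc k" for k
    proof -
      have "p * (\<Sum>i<n. p ^ k * cnt k (s i)) = p ^ Suc k * (\<Sum>i<n. cnt k (s i))"
        by (simp add: sum_distrib_left mult.assoc)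
      also have "\<dots> \<le> p ^ Suc k * cnt (Suc k) 0" using p by (intro mult_left_mono cnt_loop) auto
      also have "\<dots> \<le> (1/2) ^ Suc k" by (rule p_cnt)
      finally show ?thesis .
    qed
    show "summable (\<lambda>k. p * (\<Sum>i<n. p ^ k * cnt k (s i)))"
      by (intro summable_mult summable_sum summable_p_cnt)
    show "summable (\<lambda>k. (1/2::real) ^ Suc k)" using summable_half by (subst summable_Suc_iff)
  qed
  also have "\<dots> = 1" using suminf_split_head[OF summable_half] by (simp add: suminf_geometric)
  finally show ?thesis .
qed


section \<open>The density of infinite \<open>I1\<close>-clusters\<close>

definition C1 :: "(nat \<Rightarrow> 'g \<Rightarrow> bool) \<Rightarrow> 'g set" where
  "C1 x = {g. conn s (om I1 x) 0 g}"

definition X0 :: "(nat \<Rightarrow> 'g \<Rightarrow> bool) set" where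
  "X0 = {x \<in> space M. infinite (C1 x)}"

lemma C1_act: "g \<in> C1 x \<Longrightarrow> C1 (act (- g) x) = {h. g + h \<in> C1 x}"
proof -
  assume g: "g \<in> C1 x"
  have "conn s (om I1 x) g h \<longleftrightarrow> conn s (om I1 x) 0 h" for h
    using g conn_sym conn_trans unfolding C1_def by blast
  then show ?thesis by (simp add: C1_def conn_act)
qed

lemma C1_equivariant: "equivariant C1"
  unfolding equivariant_def
proof (intro conjI allI ballI)
  show "{x \<in> space M. g \<in> C1 x} \<in> sets M" for g using conn_event'(1) by (simp add: C1_def)
  show "- g \<in> C1 (act (- g) x) \<longleftrightarrow> g \<in> C1 x" for x g
    using conn_sym[of s "om I1 x"] by (auto simp: C1_def conn_act)
  show "C1 (act (- g) x) = {h. g + h \<in> C1 x}" if "g \<in> C1 x" for x g by (rule C1_act[OF that])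
qed (simp add: C1_def)

lemma C1_measurable: "{x \<in> space M. g \<in> C1 x} \<in> sets M"
  using C1_equivariant by (simp add: equivariant_def)

lemma C1_dep: "x \<in> space M \<Longrightarrow> y \<in> space M \<Longrightarrow> (\<And>i g. i < n \<Longrightarrow> i \<in> I1 \<Longrightarrow> x i g = y i g) \<Longrightarrow> C1 x = C1 y"
proof -
  assume "\<And>i g. i < n \<Longrightarrow> i \<in> I1 \<Longrightarrow> x i g = y i g"
  then have "om I1 x = om I1 y" by (auto simp: om_def)
  then show ?thesis by (simp add: C1_def)
qed

lemma X0_sets: "X0 \<in> sets M"
  unfolding X0_def by (rule measurable_card_set(2)) (rule C1_measurable)

lemma X0_dep: "dep (I1 \<times> UNIV) X0"
proof (rule depI[OF X0_sets])
  fix x y assume xy: "x \<in> space M" "y \<in> space M" "\<And>i g. i < n \<Longrightarrow> (i, g) \<in> I1 \<times> UNIV \<Longrightarrow> x i g = y i g" "x \<in> X0"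
  have "C1 x = C1 y" by (rule C1_dep[OF xy(1,2)]) (use xy(3) in simp)
  then show "y \<in> X0" using xy by (simp add: X0_def)
qed

lemma X0_space: "X0 \<subseteq> space M"
  by (auto simp: X0_def)

lemma prob_open1: "i < n \<Longrightarrow> prob {x \<in> space M. x i 0} = p"
  using prob_open[of "{(i, 0)}"] by simp

lemma dep_open: "i < n \<Longrightarrow> dep {(i, g)} {x \<in> space M. x i g}"
  by (rule depI[OF sets_pred]) auto

definition B1 :: "nat \<Rightarrow> (nat \<Rightarrow> 'g \<Rightarrow> bool) set" where
  "B1 i = {x \<in> space M. x i 0 \<and> \<not> conn s (om I1 x - {(0, i)}) 0 (s i)}"

lemma B1_eq: "B1 i = {x \<in> space M. x i 0} \<inter> (space M - {x \<in> space M. conn s (om I1 x - {(0, i)}) 0 (s i)})"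
  by (auto simp: B1_def)

lemma B1_sets: "i \<in> I1 \<Longrightarrow> B1 i \<in> sets M"
  unfolding B1_eq using I_sub conn_event(1)[of I1 "{(0, i)}" 0 "s i"] sets_pred[of i 0] by auto

lemma dep_compl: "dep S A \<Longrightarrow> dep S (space M - A)"
proof (rule depI)
  assume A: "dep S A"
  show "space M - A \<in> sets M" using dep_sets[OF A] by auto
  fix x y assume xy: "x \<in> space M" "y \<in> space M" "\<And>i g. i < n \<Longrightarrow> (i, g) \<in> S \<Longrightarrow> x i g = y i g" "x \<in> space M - A"
  have "x \<in> A \<longleftrightarrow> y \<in> A" by (rule depD[OF A xy(1,2)]) (rule xy(3))
  then show "y \<in> space M - A" using xy by simp
qed

lemma prob_B1: "i \<in> I1 \<Longrightarrow> prob (B1 i) = p * (1 - prob {x \<in> space M. conn s (om I1 x - {(0, i)}) 0 (s i)})"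
proof -
  assume i: "i \<in> I1"
  then have n: "i < n" using I_sub by auto
  have "prob (B1 i) = prob {x \<in> space M. x i 0} * prob (space M - {x \<in> space M. conn s (om I1 x - {(0, i)}) 0 (s i)})"
    unfolding B1_eq by (rule indep[OF dep_open[OF n] dep_compl[OF conn_event(2)]]) auto
  then show ?thesis by (simp add: prob_open1[OF n] prob_compl[OF conn_event(1)])
qed

text \<open>A mean of at least \<open>3\<close> open edges, less at most \<open>1\<close> for those
  that are no bridges.\<close>

lemma sum_B1: "2 \<le> (\<Sum>i\<in>I1. prob (B1 i))"
proof -
  have "(\<Sum>i\<in>I1. prob (B1 i)) = (\<Sum>i\<in>I1. p - p * prob {x \<in> space M. conn s (om I1 x - {(0, i)}) 0 (s i)})"
    by (rule sum.cong) (simp_all add: prob_B1 right_diff_distrib)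
  also have "\<dots> = p * (real N * real N) - p * (\<Sum>i\<in>I1. prob {x \<in> space M. conn s (om I1 x - {(0, i)}) 0 (s i)})"
    by (simp add: sum_subtractf card_I1 sum_distrib_left mult.commute)
  finally show ?thesis using sum_prob_conn_le[OF I_sub(1), of I1 "\<lambda>i. {(0, i)}"] pN by linarith
qed

lemma B1_act: "i \<in> I1 \<Longrightarrow> act (- g) x \<in> B1 i \<longleftrightarrow> (g, i) \<in> om I1 x \<and> bridge s (om I1 x) (g, i)"
proof -
  assume i: "i \<in> I1"
  have "conn s (om I1 (act (- g) x) - {(0, i)}) 0 (s i) \<longleftrightarrow> conn s (om I1 x - {(g, i)}) g (g + s i)"
    using conn_act_minus[of I1 g x 0 i 0 "s i"] by simp
  moreover have "act (- g) x i 0 \<longleftrightarrow> (g, i) \<in> om I1 x" using i I_sub by (auto simp: om_def act_eq)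
  ultimately show ?thesis by (simp add: B1_def act_in_space bridge_def tgt_def)
qed

text \<open>Mass transport: inside a finite cluster every point spreads its outgoing bridges evenly.\<close>
lemma finite_clusters: "(\<Sum>i\<in>I1. prob (B1 i - X0)) \<le> 1"
proof -
  define b :: "(nat \<Rightarrow> 'g \<Rightarrow> bool) \<Rightarrow> ennreal" where "b x = (\<Sum>i\<in>I1. indicator (B1 i) x)" for x
  define f :: "'g \<Rightarrow> (nat \<Rightarrow> 'g \<Rightarrow> bool) \<Rightarrow> ennreal" where
    "f g x = indicator {x \<in> space M - X0. g \<in> C1 x} x * b x / emeasure (count_space UNIV) (C1 x)" for g x
  have bm: "b \<in> borel_measurable M"
    unfolding b_def[abs_def] using B1_sets by measurable
  have cm: "(\<lambda>x. emeasure (count_space UNIV) (C1 x)) \<in> borel_measurable M"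
    by (rule measurable_card_set(3)[OF C1_measurable])
  have "f g \<in> borel_measurable M" for g
  proof -
    have "{x \<in> space M - X0. g \<in> C1 x} = {x \<in> space M. g \<in> C1 x} - X0" by auto
    then have [measurable]: "{x \<in> space M - X0. g \<in> C1 x} \<in> sets M" using C1_measurable X0_sets by auto
    show ?thesis unfolding f_def[abs_def] using bm cm by measurable
  qed
  note mt = mass_transport[OF this]
  have cf: "emeasure (count_space UNIV) (C1 x) = of_nat (card (C1 x)) \<and> (of_nat (card (C1 x)) :: ennreal) \<noteq> 0"
    if "x \<in> space M - X0" for x
  proof -
    have fin: "finite (C1 x)" using that by (simp add: X0_def)
    have "0 \<in> C1 x" by (simp add: C1_def)
    then have "card (C1 x) \<noteq> 0" using fin by auto
    then show ?thesis using fin by simp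
  qed
  have out: "(\<integral>\<^sup>+g. f g x \<partial>count_space UNIV) = b x * indicator (space M - X0) x" for x
  proof (cases "x \<in> space M - X0")
    case True
    let ?c = "of_nat (card (C1 x)) :: ennreal"
    have "f g x = indicator (C1 x) g * (b x / ?c)" for g
      using True cf[OF True] by (auto simp: f_def indicator_def)
    then have "(\<integral>\<^sup>+g. f g x \<partial>count_space UNIV) = ?c * (b x / ?c)"
      using cf[OF True] by (simp add: nn_integral_multc)
    also have "\<dots> = b x"
      using cf[OF True] by (metis ennreal_mult_divide_eq ennreal_times_divide mult.commute of_nat_less_top less_irrefl)
    finally show ?thesis using True by simp
  next
    case False
    then have "f g x = 0" for g by (auto simp: f_def indicator_def)
    then show ?thesis using False by simp
  qed
  have inn: "(\<integral>\<^sup>+g. f (- g) (act (- g) x) \<partial>count_space UNIV) \<le> 1" if x: "x \<in> space M" for x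
  proof (cases "x \<in> X0")
    case True
    have "f (- g) (act (- g) x) = 0" for g
    proof (rule ccontr)
      assume "f (- g) (act (- g) x) \<noteq> 0"
      then have *: "act (- g) x \<in> space M - X0" "- g \<in> C1 (act (- g) x)" by (auto simp: f_def indicator_def split: if_splits)
      then have g: "g \<in> C1 x" using C1_equivariant x by (simp add: equivariant_def)
      have "C1 (act (- g) x) = (\<lambda>h. - g + h) ` C1 x"
        unfolding C1_act[OF g] by (auto simp: add.assoc[symmetric] intro!: rev_image_eqI)
      moreover have "inj_on (\<lambda>h. - g + h) (C1 x)" by (auto simp: inj_on_def)
      ultimately have "infinite (C1 (act (- g) x))" using True by (simp add: X0_def finite_image_iff)
      then show False using * by (simp add: X0_def)
    qed
    then show ?thesis by simp
  next
    case False
    then have xX: "x \<in> space M - X0" using x by simp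
    have fin: "finite (C1 x)" using False x by (simp add: X0_def)
    let ?c = "of_nat (card (C1 x)) :: ennreal"
    have fg: "f (- g) (act (- g) x) \<le> indicator (C1 x) g * (b (act (- g) x) / ?c)" for g
    proof (cases "- g \<in> C1 (act (- g) x)")
      case True
      then have g: "g \<in> C1 x" using C1_equivariant x by (simp add: equivariant_def)
      have e: "C1 (act (- g) x) = (\<lambda>h. - g + h) ` C1 x"
        unfolding C1_act[OF g] by (auto simp: add.assoc[symmetric] intro!: rev_image_eqI)
      have "card (C1 (act (- g) x)) = card (C1 x)" unfolding e by (rule card_image) (auto simp: inj_on_def)
      moreover have "finite (C1 (act (- g) x))" unfolding e using fin by simp
      ultimately show ?thesis using g by (auto simp: f_def indicator_def)
    qed (simp add: f_def)
    have "(\<integral>\<^sup>+g. f (- g) (act (- g) x) \<partial>count_space UNIV)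
        \<le> (\<integral>\<^sup>+g. b (act (- g) x) / ?c * indicator (C1 x) g \<partial>count_space UNIV)"
      by (rule nn_integral_mono) (use fg in \<open>simp add: mult.commute\<close>)
    also have "\<dots> = (\<Sum>g\<in>C1 x. b (act (- g) x) / ?c)"
      using fin by (subst nn_integral_count_space_indicator[symmetric]) (simp_all add: nn_integral_count_space_finite)
    also have "\<dots> = (\<Sum>g\<in>C1 x. b (act (- g) x)) / ?c"
      by (simp add: divide_ennreal_def sum_distrib_right)
    also have "(\<Sum>g\<in>C1 x. b (act (- g) x)) = of_nat (card {e \<in> om I1 x. bridge s (om I1 x) e \<and> conn s (om I1 x) 0 (fst e)})"
    proof -
      have "(\<Sum>g\<in>C1 x. b (act (- g) x)) = (\<Sum>g\<in>C1 x. \<Sum>i\<in>I1. indicator {e \<in> om I1 x. bridge s (om I1 x) e} (g, i))"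
        unfolding b_def by (intro sum.cong refl) (simp add: indicator_def B1_act)
      also have "\<dots> = (\<Sum>e\<in>C1 x \<times> I1. indicator {e \<in> om I1 x. bridge s (om I1 x) e} e)"
        by (simp add: sum.cartesian_product case_prod_unfold)
      also have "\<dots> = of_nat (card ((C1 x \<times> I1) \<inter> {e \<in> om I1 x. bridge s (om I1 x) e}))"
        using fin finite_I by (simp add: indicator_def sum.If_cases)
      also have "(C1 x \<times> I1) \<inter> {e \<in> om I1 x. bridge s (om I1 x) e} = {e \<in> om I1 x. bridge s (om I1 x) e \<and> conn s (om I1 x) 0 (fst e)}"
        by (auto simp: C1_def om_def)
      finally show ?thesis .
    qed
    \<comment> \<open>The origin receives the average number of bridges per vertex of its cluster,
      at most one by \<open>card_bridges_le\<close>.\<close>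
    also have "\<dots> / ?c \<le> ?c / ?c"
    proof -
      have "card {e \<in> om I1 x. bridge s (om I1 x) e \<and> conn s (om I1 x) 0 (fst e)} \<le> card (C1 x)"
        using card_bridges_le(2)[of s "om I1 x" 0] fin by (simp add: C1_def)
      then show ?thesis by (intro divide_right_mono_ennreal) simp
    qed
    also have "?c / ?c = 1" using cf[OF xX] ennreal_divide_self[OF _ of_nat_less_top] by blast
    finally show ?thesis .
  qed
  have "(\<integral>\<^sup>+x. b x * indicator (space M - X0) x \<partial>M) = (\<integral>\<^sup>+x. (\<integral>\<^sup>+g. f g x \<partial>count_space UNIV) \<partial>M)"
    by (simp add: out)
  also have "\<dots> \<le> (\<integral>\<^sup>+x. 1 \<partial>M)" unfolding mt by (rule nn_integral_mono) (rule inn)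
  also have "\<dots> = 1" using emeasure_space_1 by simp
  finally have "(\<integral>\<^sup>+x. b x * indicator (space M - X0) x \<partial>M) \<le> 1" .
  moreover have "(\<integral>\<^sup>+x. b x * indicator (space M - X0) x \<partial>M) = (\<integral>\<^sup>+x. (\<Sum>i\<in>I1. indicator (B1 i - X0) x) \<partial>M)"
  proof (rule nn_integral_cong)
    fix x assume x: "x \<in> space M"
    have "indicator (B1 i) x * indicator (space M - X0) x = (indicator (B1 i - X0) x :: ennreal)" for i
      using x by (auto simp: indicator_def)
    then show "b x * indicator (space M - X0) x = (\<Sum>i\<in>I1. indicator (B1 i - X0) x)"
      by (simp add: b_def sum_distrib_right)
  qed
  moreover have "(\<integral>\<^sup>+x. (\<Sum>i\<in>I1. indicator (B1 i - X0) x) \<partial>M) = (\<Sum>i\<in>I1. emeasure M (B1 i - X0))"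
    using B1_sets X0_sets by (subst nn_integral_sum) (auto intro!: sum.cong)
  moreover have "(\<Sum>i\<in>I1. emeasure M (B1 i - X0)) = ennreal (\<Sum>i\<in>I1. prob (B1 i - X0))"
    by (simp add: emeasure_eq_measure)
  ultimately show ?thesis by simp
qed

text \<open>At least \<open>2 - 1\<close> bridges are expected to start at the origin while its
  cluster is infinite, so the number \<open>D\<close> of open edges has expectation at least one on
  \<open>X0\<close>; a second moment bound for \<open>D\<close> turns this into a
  probability.\<close>

lemma prob_X0: "1 / 20 \<le> prob X0"
proof -
  have Om: "i \<in> I1 \<Longrightarrow> {x \<in> space M. x i 0} \<in> sets M" for i using I_sub sets_pred by auto
  have "(\<Sum>i\<in>I1. prob (B1 i)) = (\<Sum>i\<in>I1. prob (B1 i \<inter> X0)) + (\<Sum>i\<in>I1. prob (B1 i - X0))"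
    unfolding sum.distrib[symmetric]
  proof (rule sum.cong[OF refl])
    fix i assume "i \<in> I1"
    then have "prob ((B1 i \<inter> X0) \<union> (B1 i - X0)) = prob (B1 i \<inter> X0) + prob (B1 i - X0)"
      using B1_sets X0_sets by (intro finite_measure_Union) auto
    moreover have "(B1 i \<inter> X0) \<union> (B1 i - X0) = B1 i" by auto
    ultimately show "prob (B1 i) = prob (B1 i \<inter> X0) + prob (B1 i - X0)" by simp
  qed
  then have 1: "1 \<le> (\<Sum>i\<in>I1. prob (B1 i \<inter> X0))" using sum_B1 finite_clusters by linarith
  also have "\<dots> \<le> (\<Sum>i\<in>I1. prob ({x \<in> space M. x i 0} \<inter> X0))"
    by (intro sum_mono finite_measure_mono) (use Om X0_sets in \<open>auto simp: B1_def\<close>)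
  finally have 1: "1 \<le> (\<Sum>i\<in>I1. prob ({x \<in> space M. x i 0} \<inter> X0))" .
  define O1 where "O1 i = {x \<in> space M. x i 0}" for i
  have O1m: "i \<in> I1 \<Longrightarrow> O1 i \<in> sets M" for i using Om by (simp add: O1_def)
  define D :: "(nat \<Rightarrow> 'g \<Rightarrow> bool) \<Rightarrow> real" where "D x = (\<Sum>i\<in>I1. indicator (O1 i) x)" for x
  have e1: "(\<Sum>i\<in>I1. prob (O1 i \<inter> X0)) = (\<integral>x. D x * indicator X0 x \<partial>M)"
  proof -
    have "(\<integral>x. D x * indicator X0 x \<partial>M) = (\<integral>x. (\<Sum>i\<in>I1. indicator (O1 i \<inter> X0) x) \<partial>M)"
      by (simp add: D_def sum_distrib_right indicator_inter_arith)
    also have "\<dots> = (\<Sum>i\<in>I1. \<integral>x. indicator (O1 i \<inter> X0) x \<partial>M)"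
      by (rule Bochner_Integration.integral_sum) (use O1m X0_sets in \<open>auto simp: emeasure_eq_measure\<close>)
    also have "\<dots> = (\<Sum>i\<in>I1. prob (O1 i \<inter> X0))"
      using O1m X0_sets X0_space by (intro sum.cong refl) (auto simp: Int_absorb2 intro!: arg_cong[where f = prob])
    finally show ?thesis by simp
  qed
  have D2: "(D x)\<^sup>2 = (\<Sum>i\<in>I1. \<Sum>j\<in>I1. indicator (O1 i \<inter> O1 j) x)" for x
    by (simp add: D_def power2_eq_square sum_product indicator_inter_arith)
  have O2i: "integrable M (\<lambda>x. indicator (O1 i \<inter> O1 j) x :: real)" if "i \<in> I1" "j \<in> I1" for i j
    using O1m that by (auto simp: emeasure_eq_measure)
  have D2i: "integrable M (\<lambda>x. (D x)\<^sup>2)"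
    unfolding D2 by (intro Bochner_Integration.integrable_sum O2i)
  have e2: "(\<integral>x. (D x)\<^sup>2 \<partial>M) = (\<Sum>i\<in>I1. \<Sum>j\<in>I1. prob (O1 i \<inter> O1 j))"
  proof -
    have "(\<integral>x. (D x)\<^sup>2 \<partial>M) = (\<Sum>i\<in>I1. \<integral>x. (\<Sum>j\<in>I1. indicator (O1 i \<inter> O1 j) x) \<partial>M)"
      unfolding D2 by (rule Bochner_Integration.integral_sum) (intro Bochner_Integration.integrable_sum O2i)
    also have "\<dots> = (\<Sum>i\<in>I1. \<Sum>j\<in>I1. \<integral>x. indicator (O1 i \<inter> O1 j) x \<partial>M)"
      by (intro sum.cong refl Bochner_Integration.integral_sum O2i)
    also have "\<dots> = (\<Sum>i\<in>I1. \<Sum>j\<in>I1. prob (O1 i \<inter> O1 j))"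
      by (intro sum.cong refl) (auto simp: O1_def Int_absorb2 intro!: arg_cong[where f = prob])
    finally show ?thesis .
  qed
  have pij: "prob (O1 i \<inter> O1 j) = (if i = j then p else p * p)" if "i \<in> I1" "j \<in> I1" for i j
  proof (cases "i = j")
    case True
    then show ?thesis using prob_open1[of i] that I_sub by (auto simp: O1_def)
  next
    case False
    have n: "i < n" "j < n" using that I_sub by auto
    have "prob (O1 i \<inter> O1 j) = prob (O1 i) * prob (O1 j)"
      unfolding O1_def by (rule indep[OF dep_open[OF n(1)] dep_open[OF n(2)]]) (use False in auto)
    then show ?thesis using False n by (simp add: O1_def prob_open1)
  qed
  have "(\<Sum>i\<in>I1. \<Sum>j\<in>I1. prob (O1 i \<inter> O1 j)) \<le> (\<Sum>i\<in>I1. p + (p * (real N * real N)) * p)"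
  proof (rule sum_mono)
    fix i assume i: "i \<in> I1"
    have "(\<Sum>j\<in>I1. prob (O1 i \<inter> O1 j)) \<le> (\<Sum>j\<in>I1. (if i = j then p else 0) + p * p)"
      by (rule sum_mono) (use i p in \<open>simp add: pij\<close>)
    also have "\<dots> = p + real (card I1) * (p * p)"
      using i finite_I by (simp add: sum.distrib sum.delta)
    finally show "(\<Sum>j\<in>I1. prob (O1 i \<inter> O1 j)) \<le> p + (p * (real N * real N)) * p" by (simp add: card_I1 algebra_simps)
  qed
  also have "\<dots> = p * (real N * real N) + (p * (real N * real N)) * (p * (real N * real N))"
    by (simp add: card_I1 algebra_simps)
  also have "\<dots> \<le> 4 + 4 * 4" using pN p by (intro add_mono mult_mono) auto
  finally have b2: "(\<integral>x. (D x)\<^sup>2 \<partial>M) \<le> 20" using e2 by simp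
  have X0i: "integrable M (\<lambda>x. indicator X0 x :: real)" using X0_sets by (simp add: emeasure_eq_measure)
  \<comment> \<open>A tangent form of Cauchy-Schwarz, from the square of \<open>D - 20\<close>. With
    second moment at most \<open>20\<close> it gives
    \<open>1 \<le> 1 / 2 + 10 * prob X0\<close>.\<close>
  have "(\<integral>x. D x * indicator X0 x \<partial>M) \<le> (\<integral>x. (D x)\<^sup>2 / 40 + 10 * indicator X0 x \<partial>M)"
  proof (rule integral_mono)
    show "integrable M (\<lambda>x. D x * indicator X0 x)"
      unfolding D_def sum_distrib_right
      by (intro Bochner_Integration.integrable_sum integrable_real_mult_indicator)
        (use O1m X0_sets in \<open>auto simp: emeasure_eq_measure\<close>)
    show "integrable M (\<lambda>x. (D x)\<^sup>2 / 40 + 10 * indicator X0 x)"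
      using D2i X0i by simp
    fix x
    have "0 \<le> (D x - 20)\<^sup>2" by simp
    then have "D x \<le> (D x)\<^sup>2 / 40 + 10" by (simp add: power2_eq_square algebra_simps)
    then show "D x * indicator X0 x \<le> (D x)\<^sup>2 / 40 + 10 * indicator X0 x" by (simp add: indicator_def)
  qed
  also have "\<dots> = (\<integral>x. (D x)\<^sup>2 \<partial>M) / 40 + 10 * prob X0"
    using D2i X0i X0_space by (simp add: Int_absorb2)
  finally show ?thesis using 1 e1 b2 unfolding O1_def by simp
qed

section \<open>Bridges between infinite clusters\<close>

definition both :: "'g \<Rightarrow> (nat \<Rightarrow> 'g \<Rightarrow> bool) set" where
  "both g = {x \<in> X0. act (- g) x \<in> X0}"

lemma both_sets: "both g \<in> sets M"
proof -
  have "both g = X0 \<inter> (act (- g) -` X0 \<inter> space M)" using X0_space by (auto simp: both_def)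
  then show ?thesis using X0_sets measurable_sets[OF act_measurable X0_sets] by auto
qed

lemma both_dep: "dep (I1 \<times> UNIV) (both g)"
proof (rule depI[OF both_sets])
  fix x y assume xy: "x \<in> space M" "y \<in> space M" "\<And>i g. i < n \<Longrightarrow> (i, g) \<in> I1 \<times> UNIV \<Longrightarrow> x i g = y i g" "x \<in> both g"
  have "x \<in> X0 \<longleftrightarrow> y \<in> X0" by (rule depD[OF X0_dep xy(1,2)]) (rule xy(3))
  moreover have "act (- g) x \<in> X0 \<longleftrightarrow> act (- g) y \<in> X0"
    by (rule depD[OF X0_dep act_in_space act_in_space]) (use xy(3) in \<open>simp add: act_eq\<close>)
  ultimately show "y \<in> both g" using xy(4) by (simp add: both_def)
qed

text \<open>A second moment bound: \<open>Y\<close> counts the points \<open>v a\<close> lying in infinite clusters.\<close>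
lemma sum_both: "(real N * prob X0)\<^sup>2 \<le> (\<Sum>a<N. \<Sum>b<N. prob (both (- v a + v b)))"
proof -
  define V where "V a = act (- v a) -` X0 \<inter> space M" for a
  have Vm: "V a \<in> sets M" for a unfolding V_def by (rule measurable_sets[OF act_measurable X0_sets])
  have pV: "prob (V a) = prob X0" for a
    unfolding V_def using measure_distr[OF act_measurable X0_sets, of "- v a"] by (simp add: distr_act)
  have Vi: "integrable M (\<lambda>x. indicator (V a) x :: real)" for a using Vm by (simp add: emeasure_eq_measure)
  have VVi: "integrable M (\<lambda>x. indicator (V a \<inter> V b) x :: real)" for a b using Vm by (simp add: emeasure_eq_measure)
  define Y :: "(nat \<Rightarrow> 'g \<Rightarrow> bool) \<Rightarrow> real" where "Y x = (\<Sum>a<N. indicator (V a) x)" for x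
  have Yi: "integrable M Y" unfolding Y_def[abs_def] by (intro Bochner_Integration.integrable_sum Vi)
  have V_int: "(\<integral>x. indicator (V a) x \<partial>M) = prob (V a)" for a
    by (simp add: V_def Int_assoc)
  have VV_int: "(\<integral>x. indicator (V a \<inter> V b) x \<partial>M) = prob (V a \<inter> V b)" for a b
    by (simp add: V_def) (auto intro!: arg_cong[where f = prob])
  have EY: "(\<integral>x. Y x \<partial>M) = real N * prob X0"
  proof -
    have "(\<integral>x. Y x \<partial>M) = (\<Sum>a<N. \<integral>x. indicator (V a) x \<partial>M)"
      unfolding Y_def by (rule Bochner_Integration.integral_sum) (rule Vi)
    also have "\<dots> = real N * prob X0" by (simp only: V_int pV) simp
    finally show ?thesis .
  qed
  have Y2: "(Y x)\<^sup>2 = (\<Sum>a<N. \<Sum>b<N. indicator (V a \<inter> V b) x)" for x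
    by (simp add: Y_def power2_eq_square sum_product indicator_inter_arith)
  have Y2i: "integrable M (\<lambda>x. (Y x)\<^sup>2)" unfolding Y2 by (intro Bochner_Integration.integrable_sum VVi)
  have EY2: "(\<integral>x. (Y x)\<^sup>2 \<partial>M) = (\<Sum>a<N. \<Sum>b<N. prob (V a \<inter> V b))"
  proof -
    have "(\<integral>x. (Y x)\<^sup>2 \<partial>M) = (\<Sum>a<N. \<integral>x. (\<Sum>b<N. indicator (V a \<inter> V b) x) \<partial>M)"
      unfolding Y2 by (rule Bochner_Integration.integral_sum) (intro Bochner_Integration.integrable_sum VVi)
    also have "\<dots> = (\<Sum>a<N. \<Sum>b<N. \<integral>x. indicator (V a \<inter> V b) x \<partial>M)"
      by (intro sum.cong refl Bochner_Integration.integral_sum VVi)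
    finally show ?thesis by (simp only: VV_int)
  qed
  have "prob (V a \<inter> V b) = prob (both (- v a + v b))" for a b
  proof -
    have "act (- (- v a + v b)) (act (- v a) x) = act (- v b) x" for x
    proof -
      have "act (- (- v a + v b)) (act (- v a) x) = act (- (- v a + v b) + - v a) x" by (rule act_plus[symmetric])
      also have "- (- v a + v b) + - v a = - v b" by (simp add: minus_add add.assoc)
      finally show ?thesis .
    qed
    then have "V a \<inter> V b = act (- v a) -` both (- v a + v b) \<inter> space M" by (auto simp: V_def both_def)
    then show ?thesis using measure_distr[OF act_measurable both_sets, of "- v a"] by (simp add: distr_act)
  qed
  then have "(\<integral>x. (Y x)\<^sup>2 \<partial>M) = (\<Sum>a<N. \<Sum>b<N. prob (both (- v a + v b)))" by (simp add: EY2)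
  moreover have "(\<integral>x. Y x \<partial>M)\<^sup>2 \<le> (\<integral>x. (Y x)\<^sup>2 \<partial>M)"
  proof -
    have "variance Y = (\<integral>x. (Y x)\<^sup>2 \<partial>M) - (\<integral>x. Y x \<partial>M)\<^sup>2" by (rule variance_eq[OF Yi Y2i])
    moreover have "0 \<le> variance Y" by (rule variance_positive)
    ultimately show ?thesis by linarith
  qed
  ultimately show ?thesis by (simp add: EY)
qed

text \<open>The edges over which \<open>b\<close> will jump, placed at the origin. The bridge
  condition refers to all labels, so that no detour of any kind exists; labels outside
  \<open>I3\<close> get the empty set, which permits indexing by all labels.\<close>

definition Dset :: "nat \<Rightarrow> (nat \<Rightarrow> 'g \<Rightarrow> bool) set" where
  "Dset i = (if i \<in> I3 then {x \<in> both (s i). x i 0 \<and> \<not> conn s (om {..<n} x - {(0, i)}) 0 (s i)} else {})"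

lemma Dset_eq: "i \<in> I3 \<Longrightarrow> Dset i = {x \<in> space M. x i 0} \<inter>
    (both (s i) \<inter> (space M - {x \<in> space M. conn s (om {..<n} x - {(0, i)}) 0 (s i)}))"
  using X0_space by (auto simp: Dset_def both_def)

lemma Dset_sets: "Dset i \<in> sets M"
proof (cases "i \<in> I3")
  case True
  then show ?thesis
    using I_sub sets_pred[of i 0] both_sets conn_event(1)[of "{..<n}" "{(0, i)}" 0 "s i"] by (auto simp: Dset_eq)
qed (simp add: Dset_def)

text \<open>The state of an \<open>I3\<close>-edge is independent of the infinite
  \<open>I1\<close>-clusters and of detours around it, so it suffices to subtract the detour
  probabilities from those of \<open>both (s i)\<close>.\<close>

lemma sum_Dset: "1 \<le> (\<Sum>i<n. prob (Dset i))"
proof -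
  have pD: "p * prob (both (s i)) - p * prob {x \<in> space M. conn s (om {..<n} x - {(0, i)}) 0 (s i)} \<le> prob (Dset i)"
    if i: "i \<in> I3" for i
  proof -
    let ?C = "{x \<in> space M. conn s (om {..<n} x - {(0, i)}) 0 (s i)}"
    have n: "i < n" using i I_sub by auto
    have "prob (Dset i) = prob {x \<in> space M. x i 0} * prob (both (s i) \<inter> (space M - ?C))"
      unfolding Dset_eq[OF i]
    proof (rule indep[OF dep_open[OF n] dep_Int[OF both_dep dep_compl[OF conn_event(2)]]])
      have "i \<notin> I1" using i I(3) by auto
      then show "{(i, 0)} \<inter> (I1 \<times> UNIV \<union> {(j, g). j \<in> {..<n} \<and> (g, j) \<notin> {(0, i)}}) = {}" by auto
    qed
    also have "both (s i) \<inter> (space M - ?C) = both (s i) - ?C" using X0_space by (auto simp: both_def)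
    also have "prob {x \<in> space M. x i 0} = p" by (rule prob_open1[OF n])
    finally have "prob (Dset i) = p * prob (both (s i) - ?C)" .
    moreover have "prob (both (s i)) \<le> prob (both (s i) - ?C) + prob ?C"
    proof -
      have "prob (both (s i)) \<le> prob ((both (s i) - ?C) \<union> ?C)"
        by (rule finite_measure_mono) (use both_sets conn_event(1) in auto)
      also have "\<dots> \<le> prob (both (s i) - ?C) + prob ?C" by (rule measure_Un_le) (use both_sets conn_event(1) in auto)
      finally show ?thesis .
    qed
    then have "p * prob (both (s i)) \<le> p * (prob (both (s i) - ?C) + prob ?C)" using p by (intro mult_left_mono) auto
    ultimately show ?thesis by (simp add: distrib_left)
  qed
  have "(1 / 20)\<^sup>2 * (real N * real N) \<le> (real N * prob X0)\<^sup>2"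
  proof -
    have "(1 / 20)\<^sup>2 \<le> (prob X0)\<^sup>2" using prob_X0 by (intro power_mono) auto
    then have "(1 / 20)\<^sup>2 * (real N * real N) \<le> (prob X0)\<^sup>2 * (real N * real N)" by (intro mult_right_mono) auto
    then show ?thesis by (simp add: power2_eq_square mult.assoc mult.left_commute)
  qed
  also have "\<dots> \<le> (\<Sum>a<N. \<Sum>b<N. prob (both (- v a + v b)))" by (rule sum_both)
  \<comment> \<open>1000 copies with density at least 1/20 at either end: 1000 / 400 = 2.5.
    Multiplied by \<open>p\<close> this is at least \<open>7.5\<close>, and detours cost at most
    \<open>1\<close>.\<close>
  finally have "2.5 * (real N * real N) \<le> (\<Sum>i\<in>I3. prob (both (s i)))"
    using I3_sum[of "\<lambda>g. prob (both g)"] by (simp add: power2_eq_square)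
  then have "p * (2.5 * (real N * real N)) \<le> p * (\<Sum>i\<in>I3. prob (both (s i)))" using p by (intro mult_left_mono) auto
  then have 1: "7.5 \<le> p * (\<Sum>i\<in>I3. prob (both (s i)))" using pN by simp
  have "7.5 - 1 \<le> p * (\<Sum>i\<in>I3. prob (both (s i))) - p * (\<Sum>i\<in>I3. prob {x \<in> space M. conn s (om {..<n} x - {(0, i)}) 0 (s i)})"
    using 1 sum_prob_conn_le[OF I_sub(3), of "{..<n}" "\<lambda>i. {(0, i)}"] by linarith
  also have "\<dots> = (\<Sum>i\<in>I3. p * prob (both (s i)) - p * prob {x \<in> space M. conn s (om {..<n} x - {(0, i)}) 0 (s i)})"
    by (simp add: sum_subtractf sum_distrib_left)
  also have "\<dots> \<le> (\<Sum>i\<in>I3. prob (Dset i))" by (rule sum_mono) (rule pD)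
  also have "\<dots> \<le> (\<Sum>i<n. prob (Dset i))" by (rule sum_mono2) (use I_sub in auto)
  finally show ?thesis by simp
qed

end

section \<open>The cluster relation\<close>

context percolation begin

lemma act_act: "act (- h) (act (- g) x) = act (- (g + h)) x"
  by (simp only: act_plus[symmetric] minus_add)

lemma act_pred:
  assumes "A \<in> sets M"
  shows "{x \<in> space M. act g x \<in> A} \<in> sets M"
proof -
  have "{x \<in> space M. act g x \<in> A} = act g -` A \<inter> space M" by auto
  then show ?thesis using measurable_sets[OF act_measurable assms] by simp
qed

text \<open>A site in an infinite cluster assigned to every configuration, so that points in finite
  clusters can be included in a relation on the whole probability space. It is the origin whenever
  possible; on the null event that no such site exists the value is arbitrary.\<close>

definition rep :: "(nat \<Rightarrow> 'g \<Rightarrow> bool) \<Rightarrow> 'g" where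
  "rep x = (if x \<in> X0 then 0 else enum (LEAST j. act (- enum j) x \<in> X0))"

lemma rep_X0: "x \<in> X0 \<Longrightarrow> rep x = 0"
  by (simp add: rep_def)

lemma act_rep: "x \<in> space M \<Longrightarrow> act (- g) x \<in> X0 \<Longrightarrow> act (- rep x) x \<in> X0"
proof (cases "x \<in> X0")
  case True
  then show "x \<in> space M \<Longrightarrow> ?thesis" by (simp add: rep_def act_zero)
next
  case False
  assume g: "act (- g) x \<in> X0"
  obtain j where "g = enum j" using enum by (meson bij_pointE)
  then have "act (- enum j) x \<in> X0" using g by simp
  then have "act (- enum (LEAST j. act (- enum j) x \<in> X0)) x \<in> X0" by (rule LeastI)
  then show ?thesis using False by (simp add: rep_def)
qed

lemma rep_sets: "{x \<in> space M. rep x = c} \<in> sets M"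
proof -
  have P: "Measurable.pred M (\<lambda>x. act (- enum j) x \<in> X0)" for j
    using act_pred[OF X0_sets] by (simp add: pred_def)
  have "(\<lambda>x. LEAST j. act (- enum j) x \<in> X0) \<in> M \<rightarrow>\<^sub>M count_space UNIV"
    by (rule measurable_Least) (rule P)
  then have "(\<lambda>x. enum (LEAST j. act (- enum j) x \<in> X0)) \<in> M \<rightarrow>\<^sub>M count_space UNIV"
    by (rule measurable_compose) simp
  then have m: "{x \<in> space M. enum (LEAST j. act (- enum j) x \<in> X0) = c} \<in> sets M"
    using measurable_sets[of _ M "count_space UNIV" "{c}"] by (auto simp: vimage_def Int_def conj_commute)
  have "{x \<in> space M. rep x = c} =
      (if c = 0 then X0 else {}) \<union> ({x \<in> space M. enum (LEAST j. act (- enum j) x \<in> X0) = c} - X0)"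
    using X0_space by (auto simp: rep_def)
  then show ?thesis using m X0_sets by auto
qed

text \<open>Sites are identified with their representatives, and these are compared by clusters of
  \<open>I1\<close>- and \<open>I2\<close>-edges. \<open>rep y\<close> is relative to the site
  \<open>g\<close> from which \<open>y\<close> is seen, hence \<open>g + rep y\<close>.\<close>

definition R :: "(nat \<Rightarrow> 'g \<Rightarrow> bool) \<Rightarrow> (nat \<Rightarrow> 'g \<Rightarrow> bool) \<Rightarrow> bool" where
  "R x y \<longleftrightarrow> x \<in> space M \<and> (\<exists>g. y = act (- g) x \<and> conn s (om (I1 \<union> I2) x) (rep x) (g + rep y))"

lemma R_refl: "x \<in> space M \<Longrightarrow> R x x"
  unfolding R_def by (intro conjI exI[of _ 0]) (simp_all add: act_zero)

lemma R_sym: "R x y \<Longrightarrow> R y x"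
proof -
  assume "R x y"
  then obtain g where x: "x \<in> space M" and y: "y = act (- g) x"
    and c: "conn s (om (I1 \<union> I2) x) (rep x) (g + rep y)" unfolding R_def by (elim exE conjE)
  have "x = act (- (- g)) y" using x y by simp
  moreover have "conn s (om (I1 \<union> I2) y) (rep y) (- g + rep x)"
    using conn_sym[OF c] unfolding y conn_act by (simp add: add.assoc[symmetric])
  ultimately show "R y x" unfolding R_def using y act_in_space by (intro conjI exI[of _ "- g"]) simp_all
qed

lemma R_trans: "R x y \<Longrightarrow> R y z \<Longrightarrow> R x z"
proof -
  assume "R x y" "R y z"
  then obtain g h where x: "x \<in> space M" and y: "y = act (- g) x" and z: "z = act (- h) y"
    and c: "conn s (om (I1 \<union> I2) x) (rep x) (g + rep y)"
    and c': "conn s (om (I1 \<union> I2) y) (rep y) (h + rep z)" unfolding R_def by (elim exE conjE)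
  have "conn s (om (I1 \<union> I2) x) (g + rep y) (g + (h + rep z))"
    using c' conn_act[of "I1 \<union> I2" g x "rep y" "h + rep z"] y by simp
  then have "conn s (om (I1 \<union> I2) x) (rep x) ((g + h) + rep z)" using conn_trans[OF c] by (simp add: add.assoc)
  moreover have "z = act (- (g + h)) x" using y z act_act by simp
  ultimately show "R x z" unfolding R_def using x by blast
qed

text \<open>For \<open>R_measurable\<close>: the \<open>g\<close> in the definition of
  \<open>R\<close> is not unique at points with non-trivial stabilizer.\<close>

lemma act_eq_sets: "{x \<in> space M. act u x = act w x} \<in> sets M"
proof -
  have "act u x = act w x \<longleftrightarrow> (\<forall>(i, h)\<in>{..<n} \<times> UNIV. x i (- u + h) = x i (- w + h))" for x
    by (auto simp: diag_shift_def fun_eq_iff restrict_def)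
  then have "{x \<in> space M. act u x = act w x} = space M - (\<Union>z\<in>{..<n} \<times> UNIV.
      {x \<in> space M. x (fst z) (- u + snd z) \<noteq> x (fst z) (- w + snd z)})"
    by auto
  moreover have "(\<Union>z\<in>{..<n} \<times> UNIV. {x \<in> space M. x (fst z) (- u + snd z) \<noteq> x (fst z) (- w + snd z)}) \<in> sets M"
  proof (rule sets.countable_UN')
    show "countable ({..<n} \<times> (UNIV :: 'g set))" using countable_G by auto
    show "(\<lambda>z. {x \<in> space M. x (fst z) (- u + snd z) \<noteq> x (fst z) (- w + snd z)}) ` ({..<n} \<times> UNIV) \<subseteq> sets M"
    proof (rule image_subsetI)
      fix z :: "nat \<times> 'g" assume "z \<in> {..<n} \<times> UNIV"
      then have "fst z < n" by auto
      then have m: "{x \<in> space M. x (fst z) (- u + snd z)} \<in> sets M" "{x \<in> space M. x (fst z) (- w + snd z)} \<in> sets M"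
        by (auto intro: sets_pred)
      have "{x \<in> space M. x (fst z) (- u + snd z) \<noteq> x (fst z) (- w + snd z)} =
         ({x \<in> space M. x (fst z) (- u + snd z)} - {x \<in> space M. x (fst z) (- w + snd z)}) \<union>
         ({x \<in> space M. x (fst z) (- w + snd z)} - {x \<in> space M. x (fst z) (- u + snd z)})" by auto
      also have "\<dots> \<in> sets M" using m by (intro sets.Un sets.Diff)
      finally show "{x \<in> space M. x (fst z) (- u + snd z) \<noteq> x (fst z) (- w + snd z)} \<in> sets M" .
    qed
  qed
  ultimately show ?thesis by auto
qed

lemma R_measurable: "{x \<in> space M. R x (act u x)} \<in> sets M"
proof -
  have "{x \<in> space M. R x (act u x)} = (\<Union>g. \<Union>c. \<Union>d. {x \<in> space M. act u x = act (- g) x} \<inter>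
      {x \<in> space M. rep x = c} \<inter> {x \<in> space M. rep (act u x) = d} \<inter>
      {x \<in> space M. conn s (om (I1 \<union> I2) x) c (g + d)})"
    by (auto simp: R_def)
  moreover have "{x \<in> space M. rep (act u x) = d} \<in> sets M" for d
    using act_pred[OF rep_sets, of u d] act_in_space by simp
  ultimately show ?thesis
    using act_eq_sets rep_sets conn_event'(1) countable_G
    by (auto intro!: sets.countable_UN'' sets.Int)
qed

lemma R_I1: "x \<in> X0 \<Longrightarrow> g \<in> C1 x \<Longrightarrow> act (- g) x \<in> X0 \<and> R x (act (- g) x)"
proof -
  assume x: "x \<in> X0" and g: "g \<in> C1 x"
  have im: "C1 x = (\<lambda>h. g + h) ` {h. g + h \<in> C1 x}"
  proof (rule set_eqI)
    fix h
    have "h \<in> C1 x \<longleftrightarrow> g + (- g + h) \<in> C1 x" by (simp add: add.assoc[symmetric])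
    moreover have "h = g + (- g + h)" by (simp add: add.assoc[symmetric])
    ultimately show "h \<in> C1 x \<longleftrightarrow> h \<in> (\<lambda>h. g + h) ` {h. g + h \<in> C1 x}"
      by (intro iffI image_eqI[of _ _ "- g + h"]) auto
  qed
  have "infinite (C1 (act (- g) x))"
  proof
    assume "finite (C1 (act (- g) x))"
    then have "finite ((\<lambda>h. g + h) ` {h. g + h \<in> C1 x})" unfolding C1_act[OF g] by (rule finite_imageI)
    then show False using x unfolding im[symmetric] by (simp add: X0_def)
  qed
  then have y: "act (- g) x \<in> X0" by (simp add: X0_def act_in_space)
  moreover have "conn s (om (I1 \<union> I2) x) 0 g"
    using g conn_mono[OF _ om_mono[of I1 "I1 \<union> I2" x]] by (simp add: C1_def)
  ultimately show ?thesis using x X0_space unfolding R_def by (auto simp: rep_X0)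
qed

text \<open>On \<open>X0\<close> an invariant event is decided by the \<open>I1\<close>-coordinates;
  if it changed between two sites in infinite clusters, an independent open \<open>I2\<close>-path
  between them would contradict invariance. So it agrees almost surely with a shift-invariant event,
  and the shift is ergodic.\<close>

lemma R_ergodic:
  assumes D: "D \<in> sets M" and inv: "\<And>x y. x \<in> D \<Longrightarrow> R x y \<Longrightarrow> y \<in> D"
  shows "prob D = 0 \<or> prob D = 1"
proof -
  define A where "A = D \<inter> X0"
  have Am: "A \<in> sets M" using D X0_sets by (simp add: A_def)
  have "\<exists>A'. dep (I1 \<times> UNIV) A' \<and> (A - A') \<union> (A' - A) \<in> null_sets M"
  proof (rule invariant_determined[OF C1_equivariant C1_dep Am])
    show "infinite (C1 x)" if "x \<in> A" for x using that by (simp add: A_def X0_def)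
    show "act (- g) x \<in> A" if "x \<in> A" "g \<in> C1 x" for x g
      using that R_I1 inv unfolding A_def by blast
  qed
  then obtain A' where A': "dep (I1 \<times> UNIV) A'" "(A - A') \<union> (A' - A) \<in> null_sets M" by blast
  define B where "B = A' \<inter> X0"
  have Bdep: "dep (I1 \<times> UNIV) B" using dep_Int[OF A'(1) X0_dep] by (simp add: B_def)
  have Bm: "B \<in> sets M" by (rule dep_sets[OF Bdep])
  obtain N1 where N1: "null_inv N1" "(A - A') \<union> (A' - A) \<subseteq> N1" using null_inv_saturate[OF A'(2)] by blast
  have AB: "x \<in> A \<longleftrightarrow> x \<in> B" if "x \<notin> N1" for x using that N1(2) by (auto simp: A_def B_def)
  have N1_act: "act g x \<in> N1 \<longleftrightarrow> x \<in> N1" if "x \<in> space M" for x g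
    using N1(1) act_minus(1)[OF that, of g] unfolding null_inv_def by metis
  \<comment> \<open>Membership changes between the origin and \<open>g\<close>, both in infinite
    clusters; this is read off \<open>I1\<close> alone.\<close>
  define Q where "Q g = {x \<in> B. act (- g) x \<in> X0 \<and> act (- g) x \<notin> B}" for g
  have Qdep: "dep (I1 \<times> UNIV) (Q g)" for g
  proof (rule depI)
    have "Q g = B \<inter> ({x \<in> space M. act (- g) x \<in> X0} - {x \<in> space M. act (- g) x \<in> B})"
      using X0_space by (auto simp: Q_def B_def)
    then show "Q g \<in> sets M" using Bm act_pred[OF X0_sets] act_pred[OF Bm] by auto
    fix x y assume xy: "x \<in> space M" "y \<in> space M" "\<And>i g. i < n \<Longrightarrow> (i, g) \<in> I1 \<times> UNIV \<Longrightarrow> x i g = y i g" "x \<in> Q g"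
    have "x \<in> B \<longleftrightarrow> y \<in> B" by (rule depD[OF Bdep xy(1,2)]) (rule xy(3))
    moreover have "act (- g) x \<in> B \<longleftrightarrow> act (- g) y \<in> B"
      by (rule depD[OF Bdep act_in_space act_in_space]) (use xy(3) in \<open>simp add: act_eq\<close>)
    moreover have "act (- g) x \<in> X0 \<longleftrightarrow> act (- g) y \<in> X0"
      by (rule depD[OF X0_dep act_in_space act_in_space]) (use xy(3) in \<open>simp add: act_eq\<close>)
    ultimately show "y \<in> Q g" using xy(4) by (simp add: Q_def)
  qed
  have Q0: "Q g \<in> null_sets M" for g
  proof -
    obtain l where l: "fst ` set l \<subseteq> I2" "word_val s l = g" using I2_generates by blast
    define F where "F = (\<lambda>(g, i). (i, g)) ` set (walk_edges s 0 l)"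
    \<comment> \<open>All edges of one fixed \<open>I2\<close>-path from \<open>0\<close> to
      \<open>g\<close> are open: an event of positive probability, independent of
      \<open>Q g\<close>.\<close>
    define W where "W = {x \<in> space M. \<forall>(i, h)\<in>F. x i h}"
    have F2: "F \<subseteq> I2 \<times> UNIV"
    proof -
      have "snd ` set (walk_edges s 0 l) \<subseteq> I2" using l(1) by (simp add: snd_walk_edges)
      then show ?thesis unfolding F_def by force
    qed
    have Fn: "F \<subseteq> {..<n} \<times> UNIV" using F2 I_sub by auto
    have Ff: "finite F" by (simp add: F_def)
    have "W \<in> sets M"
    proof -
      have "Measurable.pred M (\<lambda>x. \<forall>z\<in>F. x (fst z) (snd z))"
      proof (rule pred_intros_finite(3)[OF Ff])
        fix z assume "z \<in> F"
        then show "Measurable.pred M (\<lambda>x. x (fst z) (snd z))" using Fn by (intro measurable_component) auto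
      qed
      moreover have "W = {x \<in> space M. \<forall>z\<in>F. x (fst z) (snd z)}" by (auto simp: W_def)
      ultimately show ?thesis by (simp add: pred_def)
    qed
    then have Wdep: "dep F W"
    proof (rule depI)
      fix x y assume xy: "x \<in> space M" "y \<in> space M" "\<And>i g. i < n \<Longrightarrow> (i, g) \<in> F \<Longrightarrow> x i g = y i g" "x \<in> W"
      have "y i h" if "(i, h) \<in> F" for i h
        using xy(3)[of i h] xy(4) that Fn by (auto simp: W_def)
      then show "y \<in> W" using xy(2) by (auto simp: W_def)
    qed
    have "Q g \<inter> W \<subseteq> N1"
    proof (rule subsetI, rule ccontr)
      fix x assume x: "x \<in> Q g \<inter> W" and xN: "x \<notin> N1"
      have xs: "x \<in> space M" using x by (simp add: W_def)
      have xA: "x \<in> A" using x AB[OF xN] by (simp add: Q_def)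
      have "set (walk_edges s 0 l) \<subseteq> om (I1 \<union> I2) x"
      proof
        fix e assume "e \<in> set (walk_edges s 0 l)"
        then have e: "(snd e, fst e) \<in> F" unfolding F_def by force
        then have "x (snd e) (fst e)" "snd e \<in> I2" using x F2 by (auto simp: W_def)
        then show "e \<in> om (I1 \<union> I2) x" using I_sub by (cases e) (auto simp: om_def)
      qed
      then have "conn s (om (I1 \<union> I2) x) 0 g" unfolding conn_def using l(2) by auto
      moreover have y: "act (- g) x \<in> X0" using x by (simp add: Q_def)
      moreover have "x \<in> X0" using xA by (simp add: A_def)
      ultimately have "R x (act (- g) x)" using xs unfolding R_def by (auto simp: rep_X0)
      then have "act (- g) x \<in> A" using xA y inv[of x] by (auto simp: A_def)
      then show False using x AB[of "act (- g) x"] N1_act[OF xs] xN by (simp add: Q_def)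
    qed
    then have "prob (Q g \<inter> W) = 0"
      using N1(1) Qdep Wdep dep_sets unfolding null_inv_def
      by (metis measure_eq_0_null_sets null_sets_subset sets.Int)
    moreover have "prob (Q g \<inter> W) = prob (Q g) * prob W"
      by (rule indep[OF Qdep Wdep]) (use F2 I(2) in auto)
    moreover have "prob W > 0" unfolding W_def using prob_open[OF Ff Fn] p by simp
    ultimately have "prob (Q g) = 0" by simp
    then show ?thesis using dep_sets[OF Qdep] by (simp add: emeasure_eq_measure null_setsI)
  qed
  define sat where "sat S = {x \<in> space M. \<exists>g. act (- g) x \<in> S}" for S :: "(nat \<Rightarrow> 'g \<Rightarrow> bool) set"
  have satm: "sat S \<in> sets M" if "S \<in> sets M" for S
  proof -
    have "sat S = (\<Union>g. {x \<in> space M. act (- g) x \<in> S})" by (auto simp: sat_def)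
    then show ?thesis using act_pred[OF that] countable_G by (auto intro!: sets.countable_UN'')
  qed
  have sat01: "prob (sat S) = 0 \<or> prob (sat S) = 1" if "S \<in> sets M" for S
  proof (rule shift_ergodic[OF satm[OF that]])
    fix x g assume "x \<in> sat S"
    then obtain h where x: "x \<in> space M" "act (- h) x \<in> S" by (auto simp: sat_def)
    moreover have "act (- (g + h)) (act g x) = act (- h) x"
      using x(1) by (simp only: minus_add act_plus act_minus)
    ultimately have "act (- (g + h)) (act g x) \<in> S" by simp
    then show "act g x \<in> sat S" unfolding sat_def using act_in_space by blast
  qed
  have "X0 \<subseteq> sat X0" using X0_space act_zero unfolding sat_def by (force intro: exI[of _ 0])
  then have "prob X0 \<le> prob (sat X0)" by (rule finite_measure_mono) (rule satm[OF X0_sets])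
  then have G1: "prob (sat X0) = 1" using sat01[OF X0_sets] prob_X0 by linarith
  have "space M - sat X0 \<in> null_sets M"
    using prob_compl[OF satm[OF X0_sets]] G1 satm[OF X0_sets] by (simp add: emeasure_eq_measure null_setsI)
  moreover have "(\<Union>g. Q g) \<in> null_sets M" using Q0 countable_G by (intro null_sets_UN') auto
  ultimately have "(space M - sat X0) \<union> (\<Union>g. Q g) \<in> null_sets M" by auto
  then obtain N2 where N2: "null_inv N2" "(space M - sat X0) \<union> (\<Union>g. Q g) \<subseteq> N2"
    using null_inv_saturate by blast
  have N2_act: "act g x \<in> N2 \<longleftrightarrow> x \<in> N2" if "x \<in> space M" for x g
    using N2(1) act_minus(1)[OF that, of g] unfolding null_inv_def by metis
  \<comment> \<open>Almost every point is related to its representative in \<open>X0\<close>; and as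
    no \<open>Q g\<close> occurs along the orbit, a single site in \<open>B\<close> puts all sites
    of infinite clusters there.\<close>
  have "AE x in M. x \<in> D \<longleftrightarrow> x \<in> sat B"
  proof (rule AE_I')
    show "N1 \<union> N2 \<in> null_sets M" using null_inv_Un[OF N1(1) N2(1)] unfolding null_inv_def by (rule conjunct1)
    show "{x \<in> space M. \<not> (x \<in> D \<longleftrightarrow> x \<in> sat B)} \<subseteq> N1 \<union> N2"
    proof (rule subsetI, rule ccontr)
      fix x assume "x \<in> {x \<in> space M. \<not> (x \<in> D \<longleftrightarrow> x \<in> sat B)}" and "x \<notin> N1 \<union> N2"
      then have x: "x \<in> space M" and ne: "\<not> (x \<in> D \<longleftrightarrow> x \<in> sat B)" and xN: "x \<notin> N1" "x \<notin> N2" by auto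
      have "x \<in> sat X0" using x xN(2) N2(2) by blast
      then obtain g where "act (- g) x \<in> X0" by (auto simp: sat_def)
      define y where "y = act (- rep x) x"
      have y: "y \<in> X0" unfolding y_def by (rule act_rep[OF x]) fact
      have ry: "rep y = 0" by (rule rep_X0[OF y])
      have Rxy: "R x y" unfolding R_def using x y_def ry by auto
      have "x \<in> D \<longleftrightarrow> y \<in> D" using inv Rxy R_sym by blast
      also have "\<dots> \<longleftrightarrow> y \<in> A" using y by (simp add: A_def)
      also have "\<dots> \<longleftrightarrow> y \<in> B" by (rule AB) (simp add: y_def N1_act[OF x] xN)
      also have "\<dots> \<longleftrightarrow> x \<in> sat B"
      proof
        show "x \<in> sat B" if yB: "y \<in> B" using x yB unfolding sat_def y_def by blast
        assume "x \<in> sat B"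
        then obtain g where g: "act (- g) x \<in> B" by (auto simp: sat_def)
        have yg: "act (- (- g + rep x)) (act (- g) x) = y" unfolding act_act y_def by (simp add: add.assoc[symmetric])
        have "act (- g) x \<notin> Q (- g + rep x)"
          using N2(2) N2_act[OF x, of "- g"] xN(2) by blast
        then show "y \<in> B" using g yg y by (auto simp: Q_def)
      qed
      finally show False using ne by simp
    qed
  qed
  then have "prob D = prob (sat B)" by (rule measure_eq_AE) (use D satm[OF Bm] in auto)
  then show ?thesis using sat01[OF Bm] by simp
qed

lemma cylinders: "\<exists>Es :: nat \<Rightarrow> (nat \<Rightarrow> 'g \<Rightarrow> bool) set.
  sets M = sigma_sets (space M) (range Es) \<and> Int_stable (range Es) \<and> range Es \<subseteq> Pow (space M)"
proof -
  have "countable (((UNIV :: nat set) \<times> (UNIV :: 'g set)) \<times> (UNIV :: bool set))" by (intro countable_SIGMA countable_G) auto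
  then have "countable (UNIV :: ((nat \<times> 'g) \<times> bool) set)" by simp
  then have "countable {G :: ((nat \<times> 'g) \<times> bool) set. finite G \<and> G \<subseteq> UNIV}" by (rule countable_Collect_finite_subset)
  then have "countable (Collect cyl_ok)" by (rule countable_subset[rotated]) (auto simp: cyl_ok_def)
  then have c: "countable (cyl ` Collect cyl_ok)" by simp
  have ne: "cyl ` Collect cyl_ok \<noteq> {}"
    using cyl_ok_def[of "{}"] by auto
  have r: "range (from_nat_into (cyl ` Collect cyl_ok)) = cyl ` Collect cyl_ok"
    by (rule range_from_nat_into[OF ne c])
  have "cyl ` Collect cyl_ok \<subseteq> Pow (space M)" by (auto simp: cyl_def)
  then show ?thesis using sets_M Int_stable_cyl r by (intro exI[of _ "from_nat_into (cyl ` Collect cyl_ok)"]) simp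
qed

section \<open>Crossing edges seen in the graph of one configuration\<close>

lemma Dset_bridge:
  assumes j: "act (- h) x \<in> Dset j"
  shows "(h, j) \<in> om {..<n} x - om (I1 \<union> I2) x" "bridge s (om {..<n} x) (h, j)"
    "act (- h) x \<in> X0" "act (- (h + s j)) x \<in> X0"
proof -
  have j3: "j \<in> I3" using j by (auto simp: Dset_def split: if_splits)
  have n: "j < n" using j3 I_sub by auto
  have d: "act (- h) x \<in> both (s j)" "act (- h) x j 0"
    "\<not> conn s (om {..<n} (act (- h) x) - {(0, j)}) 0 (s j)" using j j3 by (auto simp: Dset_def)
  have "(h, j) \<in> om {..<n} x" using d(2) n by (simp add: om_def act_eq)
  moreover have "(h, j) \<notin> om (I1 \<union> I2) x" using j3 I by (auto simp: om_def)
  ultimately show "(h, j) \<in> om {..<n} x - om (I1 \<union> I2) x" by blast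
  show "bridge s (om {..<n} x) (h, j)"
    using d(3) conn_act_minus[of "{..<n}" h x 0 j 0 "s j"] by (simp add: bridge_def tgt_def)
  show "act (- h) x \<in> X0" "act (- (h + s j)) x \<in> X0" using d(1) by (simp_all add: both_def act_act)
qed

lemma R_X0: "R (act (- a) x) y \<Longrightarrow> act (- a) x \<in> X0 \<Longrightarrow> y \<in> X0 \<Longrightarrow>
  \<exists>c. y = act (- c) x \<and> conn s (om (I1 \<union> I2) x) a c"
proof -
  assume R: "R (act (- a) x) y" and X: "act (- a) x \<in> X0" "y \<in> X0"
  obtain g where g: "y = act (- g) (act (- a) x)" "conn s (om (I1 \<union> I2) (act (- a) x)) 0 (g + 0)"
    using R unfolding R_def rep_X0[OF X(1)] rep_X0[OF X(2)] by blast
  then have "y = act (- (a + g)) x \<and> conn s (om (I1 \<union> I2) x) a (a + g)"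
    unfolding conn_act by (simp add: act_act)
  then show ?thesis by blast
qed

text \<open>An edge chain stays in the orbit of its first source \<open>x\<close>, so it can be read
  as a bridge chain in the graph of \<open>x\<close>, with positions tracked from there; then
  \<open>bridge_chain_open\<close> applies. Freeness at \<open>x\<close> ensures that a point of the
  orbit determines its position.\<close>

lemma open_chain:
  defines "dst \<equiv> (\<lambda>e. act (- s (fst e)) (snd e))"
  assumes free: "\<And>x g. x \<in> space M \<Longrightarrow> x \<notin> N0 \<Longrightarrow> act g x = x \<Longrightarrow> g = 0"
    and chain: "edge_chain R snd dst {(j, u). j < n \<and> u \<in> Dset j - N0} f0 f"
  shows "\<not> R (etail snd dst f0) (etail dst snd f)"
proof -
  let ?E = "{(j, u). j < n \<and> u \<in> Dset j - N0}"
  define x where "x = snd (fst f0)"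
  have E0: "fst f0 \<in> ?E" using chain by (induction rule: edge_chain.induct)
  have "x \<in> Dset (fst (fst f0)) - N0" using E0 by (auto simp: x_def)
  then have xs: "x \<in> space M" and xN: "x \<notin> N0" using sets.sets_into_space[OF Dset_sets] by auto
  have ends: "etail snd dst f1 = act (- dtail s ((h, fst (fst f1)), snd f1)) x"
      "etail dst snd f1 = act (- dhead s ((h, fst (fst f1)), snd f1)) x"
    if "snd (fst f1) = act (- h) x" for h and f1 :: "(nat \<times> (nat \<Rightarrow> 'g \<Rightarrow> bool)) \<times> bool"
    using that by (simp_all add: etail_def dtail_def dhead_def tgt_def dst_def act_act)
  have inX0: "etail snd dst f1 \<in> X0" "etail dst snd f1 \<in> X0" if f1: "fst f1 \<in> ?E" for f1
  proof -
    have "snd (fst f1) \<in> Dset (fst (fst f1))" using f1 by auto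
    moreover have "act (- 0) (snd (fst f1)) = snd (fst f1)"
      using calculation sets.sets_into_space[OF Dset_sets] act_zero by auto
    ultimately have "snd (fst f1) \<in> X0" "dst (fst f1) \<in> X0"
      using Dset_bridge(3,4)[of 0 "snd (fst f1)" "fst (fst f1)"] by (simp_all add: dst_def)
    then show "etail snd dst f1 \<in> X0" "etail dst snd f1 \<in> X0" by (simp_all add: etail_def)
  qed
  have "fst f \<in> ?E \<and> (\<exists>h. snd (fst f) = act (- h) x \<and>
    bridge_chain s (om {..<n} x) (om (I1 \<union> I2) x) ((0, fst (fst f0)), snd f0) ((h, fst (fst f)), snd f))"
    using chain E0 x_def
  proof (induction rule: edge_chain.induct)
    case (single f)
    have a0: "act (- 0) x = x" using xs by (simp add: act_zero)
    have "x \<in> Dset (fst (fst f))" using single by auto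
    then have "act (- 0) x \<in> Dset (fst (fst f))" by (simp only: a0)
    note br = Dset_bridge(1,2)[OF this]
    have "bridge_chain s (om {..<n} x) (om (I1 \<union> I2) x) ((0, fst (fst f)), snd f) ((0, fst (fst f)), snd f)"
      by (rule bridge_chain.single) (simp_all only: fst_conv br)
    moreover have "snd (fst f) = act (- 0) x" using single(3) a0 by (simp only:)
    ultimately show ?case using single(1) by (intro conjI exI[of _ 0])
  next
    case (extend f0 f f')
    note IH = extend.IH[OF extend.prems]
    note fE = conjunct1[OF IH]
    obtain h where h: "snd (fst f) = act (- h) x"
      and ch: "bridge_chain s (om {..<n} x) (om (I1 \<union> I2) x) ((0, fst (fst f0)), snd f0) ((h, fst (fst f)), snd f)"
      using conjunct2[OF IH] by (elim exE conjE)
    let ?a = "dhead s ((h, fst (fst f)), snd f)"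
    have "\<exists>c. etail snd dst f' = act (- c) x \<and> conn s (om (I1 \<union> I2) x) ?a c"
    proof (rule R_X0)
      show "R (act (- ?a) x) (etail snd dst f')" using extend.hyps(3) ends(2)[OF h] by simp
      show "act (- ?a) x \<in> X0" using inX0(2)[OF fE] ends(2)[OF h] by simp
      show "etail snd dst f' \<in> X0" by (rule inX0(1)[OF extend.hyps(2)])
    qed
    then obtain c where c: "etail snd dst f' = act (- c) x" "conn s (om (I1 \<union> I2) x) ?a c" by (elim exE conjE)
    let ?j = "fst (fst f')"
    \<comment> \<open>The source of the new edge: \<open>c\<close> itself if the edge is taken
      forwards, otherwise one step back from \<open>c\<close>.\<close>
    define h' where "h' = (if snd f' then c else c - s ?j)"
    have f's: "snd (fst f') \<in> space M" using extend.hyps(2) subsetD[OF sets.sets_into_space[OF Dset_sets]] by auto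
    have h': "snd (fst f') = act (- h') x"
    proof (cases "snd f'")
      case True
      then show ?thesis using c(1) by (simp add: h'_def etail_def)
    next
      case False
      then have "act (- s ?j) (snd (fst f')) = act (- c) x" using c(1) by (simp add: etail_def dst_def)
      then have "act (- (- s ?j)) (act (- s ?j) (snd (fst f'))) = act (- (- s ?j)) (act (- c) x)" by simp
      then have "snd (fst f') = act (- (c + - s ?j)) x" using f's by (simp only: act_act) (simp add: act_zero)
      then show ?thesis using False by (simp add: h'_def)
    qed
    have tl: "dtail s ((h', ?j), snd f') = c" by (simp add: dtail_def h'_def tgt_def)
    have "act (- h') x \<in> Dset ?j" using extend.hyps(2) h' by auto
    note br = Dset_bridge(1,2)[OF this]
    have ne: "((h', ?j), snd f') \<noteq> (fst ((h, fst (fst f)), snd f), \<not> snd ((h, fst (fst f)), snd f))"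
    proof
      assume e: "((h', ?j), snd f') = (fst ((h, fst (fst f)), snd f), \<not> snd ((h, fst (fst f)), snd f))"
      then have "f' = (fst f, \<not> snd f)" using h h' by (auto intro!: prod_eqI)
      then show False using extend.hyps(4) by simp
    qed
    have "bridge_chain s (om {..<n} x) (om (I1 \<union> I2) x) ((0, fst (fst f0)), snd f0) ((h', ?j), snd f')"
      by (rule bridge_chain.extend[OF ch _ _ _ ne]) (simp_all only: fst_conv br c(2) tl)
    then show ?case using h' extend.hyps(2) by (intro conjI exI[of _ h'])
  qed
  then obtain h where fE: "fst f \<in> ?E" and h: "snd (fst f) = act (- h) x"
    and ch: "bridge_chain s (om {..<n} x) (om (I1 \<union> I2) x) ((0, fst (fst f0)), snd f0) ((h, fst (fst f)), snd f)"
    by (elim exE conjE)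
  let ?a = "dtail s ((0, fst (fst f0)), snd f0)" and ?b = "dhead s ((h, fst (fst f)), snd f)"
  have e0: "etail snd dst f0 = act (- ?a) x" by (rule ends(1)) (use xs x_def in \<open>simp add: act_zero\<close>)
  have e1: "etail dst snd f = act (- ?b) x" by (rule ends(2)[OF h])
  show ?thesis
  proof
    assume "R (etail snd dst f0) (etail dst snd f)"
    then have "\<exists>c. act (- ?b) x = act (- c) x \<and> conn s (om (I1 \<union> I2) x) ?a c"
      using R_X0[of ?a x "act (- ?b) x"] inX0(1)[OF E0] inX0(2)[OF fE] e0 e1 by simp
    then obtain c where c: "act (- ?b) x = act (- c) x" "conn s (om (I1 \<union> I2) x) ?a c" by (elim exE conjE)
    \<comment> \<open>\<open>R\<close> yields only an equality of points; the trivial stabilizer of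
      \<open>x\<close> turns it into equality of the positions \<open>?b\<close> and
      \<open>c\<close>.\<close>
    have "act ?b (act (- c) x) = x" using xs unfolding c(1)[symmetric] by simp
    then have "act (?b + - c) x = x" by (simp only: act_plus)
    then have "?b + - c = 0" by (rule free[OF xs xN])
    then have "?b = c" by simp
    moreover have "\<not> conn s (om (I1 \<union> I2) x) ?a ?b"
      by (rule bridge_chain_open[OF ch om_mono]) (use I_sub in auto)
    ultimately show False using c(2) by simp
  qed
qed

lemma F2_action: "\<exists>T. mp_F2_action M T \<and> ergodic_F2_action M T \<and> ess_free_F2_action M T \<and>
    (\<forall>x\<in>space M. \<forall>w. \<exists>\<gamma>. word_act (space M) T w x = act \<gamma> x)"
proof -
  obtain N0 where N0': "null_inv N0" "\<forall>x\<in>space M - N0. \<forall>g. act g x = x \<longrightarrow> g = 0"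
    using essentially_free by (elim exE conjE)
  have N0: "g = 0" if "x \<in> space M" "x \<notin> N0" "act g x = x" for x g
    using N0'(2) that by blast
  obtain Es :: "nat \<Rightarrow> (nat \<Rightarrow> 'g \<Rightarrow> bool) set" where Es: "sets M = sigma_sets (space M) (range Es)"
    "Int_stable (range Es)" "range Es \<subseteq> Pow (space M)"
    using cylinders by (elim exE conjE)
  interpret E: ergodic_relation M act R U N0 Es
  proof
    show "R x x" if "x \<in> space M" for x using that by (rule R_refl)
    show "R y x" if "R x y" for x y using that by (rule R_sym)
    show "R x z" if "R x y" "R y z" for x y z using that by (rule R_trans)
    show "x \<in> space M \<and> (\<exists>g. y = act g x)" if "R x y" for x y using that unfolding R_def by blast
    show "{x \<in> space M. R x (act g x)} \<in> sets M" for g by (rule R_measurable)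
    show "prob D = 0 \<or> prob D = 1" if "D \<in> sets M" "\<And>x y. x \<in> D \<Longrightarrow> R x y \<Longrightarrow> y \<in> D" for D
      using that by (rule R_ergodic)
    show "U \<in> borel_measurable M" by (rule U_measurable)
    show "prob {x \<in> space M. U x = u} = 0" for u by (rule U_atomless)
    show "null_inv N0" by (rule N0'(1))
    show "g = 0" if "x \<in> space M" "x \<notin> N0" "act g x = x" for x g using that by (rule N0)
  qed (rule Es)+
  show ?thesis
  \<comment> \<open>The sign in \<open>- s j\<close>: moving along an edge with label
    \<open>j\<close> shifts the viewpoint by \<open>s j\<close>, which is the action of
    \<open>- s j\<close>.\<close>
  proof (rule E.free_F2_action_exists[where D = Dset and g = "\<lambda>j. - s j" and q = n])
    show "Dset j \<in> sets M" for j by (rule Dset_sets)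
    show "1 \<le> (\<Sum>j<n. prob (Dset j))" by (rule sum_Dset)
  qed (rule open_chain[OF N0])
qed

end

theorem theorem2:
  assumes "finitely_generated_group TYPE('g::group_add)"
    and "\<not> amenable_group TYPE('g)"
  shows "\<exists>(n::nat) (p1::real) p2. 0 \<le> p1 \<and> p1 < p2 \<and> p2 \<le> 1 \<and>
     (\<forall>p \<in> {p1<..<p2}. \<exists>T :: bool \<Rightarrow> (nat \<Rightarrow> 'g \<Rightarrow> bool) \<Rightarrow> (nat \<Rightarrow> 'g \<Rightarrow> bool).
        mp_F2_action (prod_bernoulli n p) T \<and>
        ergodic_F2_action (prod_bernoulli n p) T \<and>
        ess_free_F2_action (prod_bernoulli n p) T \<and>
        (AE x in prod_bernoulli n p. \<forall>w.
           \<exists>\<gamma>::'g. word_act (space (prod_bernoulli n p)) T w x = diag_shift n \<gamma> x))"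
proof -
  obtain n and s :: "nat \<Rightarrow> 'g" and I1 I2 I3 N and v :: "nat \<Rightarrow> 'g" and \<Lambda> where
    N: "N \<ge> 2" and I: "{..<n} = I1 \<union> I2 \<union> I3" "I1 \<inter> I2 = {}" "I1 \<inter> I3 = {}" "I2 \<inter> I3 = {}"
    and card_I1: "card I1 = N * N" and gen: "\<forall>g. \<exists>l. fst ` set l \<subseteq> I2 \<and> word_val s l = g"
    and I3: "\<forall>F :: 'g \<Rightarrow> real. (\<Sum>i\<in>I3. F (s i)) = 1000 * (\<Sum>a<N. \<Sum>b<N. F (- v a + v b))"
    and \<Lambda>: "8 * \<Lambda> \<le> real N * real N" "0 \<le> \<Lambda>"
      "\<forall>f. fsupp f \<longrightarrow> nrm (\<lambda>h. \<Sum>i<n. lam (s i) f h + lam (- s i) f h) \<le> \<Lambda> * nrm f"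
    using percolation_parameters[OF assms] by (elim exE conjE)
  have "\<forall>g. \<exists>l. word_val s l = g" using gen by blast
  then have "range (word_val s) = UNIV" by (metis surjI surj_def)
  moreover have "countable (range (word_val s))" by simp
  ultimately have cG: "countable (UNIV :: 'g set)" by simp
  \<comment> \<open>A finite group is amenable by normalized counting. Infinitude is used for the
    atomless \<open>U\<close> and for null stabilizers.\<close>
  have iG: "infinite (UNIV :: 'g set)"
  proof
    assume fin: "finite (UNIV :: 'g set)"
    have "amenable_group TYPE('g)"
      unfolding amenable_group_def
    proof (intro exI[of _ "\<lambda>A. real (card A) / real (card (UNIV :: 'g set))"] conjI allI impI)
      have "card (UNIV :: 'g set) \<noteq> 0" using fin by simp
      then show "real (card (UNIV :: 'g set)) / real (card (UNIV :: 'g set)) = 1" by simp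
      show "real (card (A \<union> B)) / real (card (UNIV :: 'g set)) =
          real (card A) / real (card (UNIV :: 'g set)) + real (card B) / real (card (UNIV :: 'g set))"
        if "A \<inter> B = {}" for A B :: "'g set"
        using that fin finite_subset[OF subset_UNIV fin] by (simp add: card_Un_disjoint add_divide_distrib)
      show "real (card ((\<lambda>x. g + x) ` A)) / real (card (UNIV :: 'g set)) = real (card A) / real (card (UNIV :: 'g set))"
        for g and A :: "'g set" by (simp add: card_image)
    qed simp
    then show False using assms(2) by simp
  qed
  have n: "0 < n"
  proof (rule ccontr)
    assume "\<not> 0 < n"
    then have "I1 = {}" using I(1) by auto
    then show False using card_I1 N by simp
  qed
  define N2 where "N2 = real N * real N"
  have N2: "4 \<le> N2" unfolding N2_def using mult_mono[of 2 "real N" 2 "real N"] N by simp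
  show ?thesis
  \<comment> \<open>The window consists of the \<open>p\<close> with mean number of open
    \<open>I1\<close>-edges between \<open>3\<close> and \<open>4\<close>; there
    \<open>8 * \<Lambda> \<le> N * N\<close> gives \<open>p * \<Lambda> \<le> 1 / 2\<close>, and
    \<open>N2 \<ge> 4\<close> keeps the upper end at most one.\<close>
  proof (rule exI[of _ n], rule exI[of _ "3 / N2"], rule exI[of _ "4 / N2"], intro conjI ballI)
    fix p assume p: "p \<in> {3 / N2<..<4 / N2}"
    have pN: "3 \<le> p * N2" "p * N2 \<le> 4" using p N2 by (simp_all add: field_simps)
    have "0 < p" using p N2 divide_pos_pos[of 3 N2] by auto
    moreover have "p < 1" using p N2 less_le_trans[of p "4 / N2" 1] by simp
    moreover have "p * \<Lambda> \<le> 1 / 2"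
    proof -
      have "p * (8 * \<Lambda>) \<le> p * N2" using \<Lambda>(1) \<open>0 < p\<close> by (simp add: N2_def)
      then show ?thesis using pN(2) by simp
    qed
    ultimately interpret percolation n p s I1 I2 I3 N v \<Lambda>
      using n cG iG N I card_I1 gen I3 \<Lambda> pN by unfold_locales (auto simp: N2_def)
    obtain T where "mp_F2_action M T" "ergodic_F2_action M T" "ess_free_F2_action M T"
      "\<forall>x\<in>space M. \<forall>w. \<exists>\<gamma>. word_act (space M) T w x = act \<gamma> x" using F2_action by blast
    then show "\<exists>T. mp_F2_action M T \<and> ergodic_F2_action M T \<and> ess_free_F2_action M T \<and>
        (AE x in M. \<forall>w. \<exists>\<gamma>::'g. word_act (space M) T w x = act \<gamma> x)"
      by (intro exI[of _ T] conjI AE_I2) auto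
  qed (use N2 in \<open>simp_all add: field_simps\<close>)
qed

end
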